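(* Let $F$ and $G$ be elements of the Selberg class. Suppose that $a_F(p)=a_G(p)$ (equivalently $b_F(p)=b_G(p)$) for all primes $p\notin E$, where $E$ is a set of primes which is thin in the sense that $$\#\{p\in E: p\le x\}\ll x^{1/2-\delta}$$ for some fixed $\delta>0$. Suppose that at least one of the following two conditions holds: (i) $\displaystyle |Z_F(T)\bigtriangleup Z_G(T)| = O\!\left(T\,\frac{\log T}{\log\log T}\right)$ (as $T\to\infty$); (ii) for every $\varepsilon>0$, $\displaystyle \sum_{p\le e^x}\frac{|a_F(p^2)-a_G(p^2)|^2}{p}\log p \ll_\varepsilon \exp\!\left(\frac{\varepsilon x}{\log x}\right)$ (for all large $x$), where the sum is over primes $p$. Then $F=G$.
   Context: Notation: for a function $f$, $\overline f(s)=\overline{f(\overline s)}$. $\Lambda$ is the von Mangoldt function; $p$ always denotes a prime. The Selberg class is the set of functions $F$ satisfying the following axioms. (1) For $\Re(s)>1$, $F(s)=\sum_{m\ge1}a_F(m)m^{-s}$, where $a_F(1)=1$ and $a_F(m)\ll_\varepsilon m^\varepsilon$ for every $\varepsilon>0$. (2) There is a natural number $m_F$ (possibly $0$) such that $(s-1)^{m_F}F(s)$ extends to an analytic function of finite order in the entire complex plane. (3) There exist $Q_F>0$, $\lambda_j(F)>0$, and $\mu_j(F),w_F\in\mathbb{C}$ with $\Re(\mu_j(F))\ge0$ and $|w_F|=1$, such that, with $\Gamma_F(s)=\prod_{j=1}^{N_F}\Gamma(\lambda_j(F)s+\mu_j(F))$, the function $\Phi_F(s)=Q_F^s\Gamma_F(s)F(s)$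 satisfies $\Phi_F(s)=w_F\overline{\Phi_F}(1-s)$. (4) $\log F(s)$ can be expressed as a Dirichlet series $\log F(s)=\sum_{m\ge2}\frac{b_F(m)\Lambda(m)}{m^s\log m}$ (in the half-plane of absolute convergence), where $b_F(m)\ll m^\theta$ for some $\theta<1/2$; by convention $b_F(m)=0$ when $m$ is not a prime power. Zeros: write the non-trivial zeros of $F$ (the zeros of $F$ that are zeros of $\Phi_F$) as $1/2+i\gamma_F$ with $\gamma_F\in\mathbb{C}$. $Z_F(T)$ denotes the multiset (counted with multiplicity) of those $\gamma_F$ that are real and satisfy $|\gamma_F|\le T$; that is, it records the zeros of $F$ on the line $\Re(s)=1/2$ with ordinate of absolute value at most $T$. For multisets $A,B$, $A\bigtriangleup B=(A\setminus B)\cup(B\setminus A)$, and $|\cdot|$ denotes cardinality counted with multiplicity. *)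

theory Defs
  imports
    "HOL-Complex_Analysis.Complex_Analysis"
    "HOL-Number_Theory.Prime_Powers"
    "HOL-Library.Landau_Symbols"
    "HOL-Library.Multiset"
begin

definition conj_fun :: "(complex \<Rightarrow> complex) \<Rightarrow> complex \<Rightarrow> complex" where
  "conj_fun f s = cnj (f (cnj s))"

definition selberg_dirichlet :: "(complex \<Rightarrow> complex) \<Rightarrow> (nat \<Rightarrow> complex) \<Rightarrow> bool" where
  "selberg_dirichlet F a \<longleftrightarrow>
     a 1 = 1 \<and>
     (\<forall>\<epsilon>>0. (\<lambda>m. norm (a m)) \<in> O(\<lambda>m. real m powr \<epsilon>)) \<and>
     (\<forall>s. Re s > 1 \<longrightarrow> ((\<lambda>m. a m * of_nat m powr (- s)) has_sum F s) {1..})"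

definition finite_order :: "(complex \<Rightarrow> complex) \<Rightarrow> bool" where
  "finite_order h \<longleftrightarrow>
     (\<exists>A::real. (\<lambda>s. norm (h s)) \<in> O[at_infinity](\<lambda>s. exp (norm s powr A)))"

text \<open>The members of the class are meromorphic functions on the plane. They are represented by
  total functions that are continuous off their poles and, as usual in the library, take the
  value 0 at a pole; this fixes the otherwise arbitrary value at 1, so that two members are equal
  as meromorphic functions iff they are equal.\<close>

definition selberg_continuation :: "(complex \<Rightarrow> complex) \<Rightarrow> bool" where
  "selberg_continuation F \<longleftrightarrow>
     F nicely_meromorphic_on UNIV \<and>
     (\<exists>(k::nat) h. h holomorphic_on UNIV \<and> finite_order h \<and>
        (\<forall>s. s \<noteq> 1 \<longrightarrow> h s = (s - 1) ^ k * F s))"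

text \<open>The product is formed as a meromorphic function: its singularities that are removable
  (poles of a Gamma factor cancelled by zeros of \<open>F\<close>) are filled in. Without this, the pointwise
  product would take the wrong value there, since \<open>Gamma\<close> is 0 at its poles.\<close>

definition selberg_Phi ::
  "(complex \<Rightarrow> complex) \<Rightarrow> real \<Rightarrow> nat \<Rightarrow> (nat \<Rightarrow> real) \<Rightarrow> (nat \<Rightarrow> complex) \<Rightarrow> complex \<Rightarrow> complex" where
  "selberg_Phi F Q N lam \<mu> =
     remove_sings (\<lambda>s. of_real Q powr s * (\<Prod>j=1..N. Gamma (of_real (lam j) * s + \<mu> j)) * F s)"

definition selberg_functional_eq ::
  "(complex \<Rightarrow> complex) \<Rightarrow> real \<Rightarrow> nat \<Rightarrow> (nat \<Rightarrow> real) \<Rightarrow> (nat \<Rightarrow> complex) \<Rightarrow> complex \<Rightarrow> bool" where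
  "selberg_functional_eq F Q N lam \<mu> w \<longleftrightarrow>
     Q > 0 \<and> (\<forall>j\<in>{1..N}. lam j > 0 \<and> Re (\<mu> j) \<ge> 0) \<and> norm w = 1 \<and>
     (\<forall>s. selberg_Phi F Q N lam \<mu> s = w * conj_fun (selberg_Phi F Q N lam \<mu>) (1 - s))"

text \<open>The function \<open>l\<close> is the logarithm of \<open>F\<close>; among the logarithms of \<open>F\<close> on the half-plane,
  the branch is determined by the requirement that it be the stated Dirichlet series.\<close>

definition selberg_log_series :: "(complex \<Rightarrow> complex) \<Rightarrow> (nat \<Rightarrow> complex) \<Rightarrow> bool" where
  "selberg_log_series F b \<longleftrightarrow>
     (\<forall>m. \<not> primepow m \<longrightarrow> b m = 0) \<and>
     (\<exists>\<theta><1/2. (\<lambda>m. norm (b m)) \<in> O(\<lambda>m. real m powr \<theta>)) \<and>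
     (\<exists>l. \<forall>s. Re s > 1 \<longrightarrow> exp (l s) = F s \<and>
        ((\<lambda>m. b m * mangoldt m / (of_nat m powr s * of_real (ln (real m)))) has_sum l s) {2..})"

definition selberg_class :: "(complex \<Rightarrow> complex) set" where
  "selberg_class = {F.
     (\<exists>a. selberg_dirichlet F a) \<and>
     selberg_continuation F \<and>
     (\<exists>Q N lam \<mu> w. selberg_functional_eq F Q N lam \<mu> w) \<and>
     (\<exists>b. selberg_log_series F b)}"

text \<open>The data of the functional equation are not unique, but they determine \<open>\<Phi>\<close> up to a
  constant factor, so it does not matter which are chosen here. The predicate
  \<open>isolated_zero\<close> is used rather than vanishing because a pole also has the value 0.\<close>

definition nontrivial_zero :: "(complex \<Rightarrow> complex) \<Rightarrow> complex \<Rightarrow> bool" where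
  "nontrivial_zero F s \<longleftrightarrow>
     isolated_zero F s \<and>
     (\<exists>Q N lam \<mu> w. selberg_functional_eq F Q N lam \<mu> w \<and> isolated_zero (selberg_Phi F Q N lam \<mu>) s)"

text \<open>On the critical line the Gamma factors have neither zeros nor poles, so the multiplicity of
  a zero of \<open>F\<close> is also its multiplicity as a zero of \<open>\<Phi>\<close>.\<close>

definition critical_zeros :: "(complex \<Rightarrow> complex) \<Rightarrow> real \<Rightarrow> real multiset" where
  "critical_zeros F T =
     (\<Sum>\<gamma> | \<bar>\<gamma>\<bar> \<le> T \<and> nontrivial_zero F (1/2 + \<i> * of_real \<gamma>).
        replicate_mset (nat (zorder F (1/2 + \<i> * of_real \<gamma>))) \<gamma>)"

text \<open>The sum above would be empty if its index set were infinite; this does not happen.\<close>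

lemma finite_critical_zeros:
  assumes "F \<in> selberg_class"
  shows "finite {\<gamma>. \<bar>\<gamma>\<bar> \<le> T \<and> nontrivial_zero F (1/2 + \<i> * of_real \<gamma>)}"
proof -
  define f where "f = (\<lambda>\<gamma>::real. 1/2 + \<i> * of_real \<gamma> :: complex)"
  have "F meromorphic_on UNIV"
    using assms by (auto simp: selberg_class_def selberg_continuation_def nicely_meromorphic_on_def)
  hence "{z. isolated_zero F z} sparse_in UNIV"
    using meromorphic_on_imp_not_zero_cosparse[of F UNIV] by (simp add: eventually_cosparse)
  moreover have "compact (f ` {-T..T})"
    unfolding f_def by (intro compact_continuous_image continuous_intros compact_Icc)
  ultimately have "finite (f ` {-T..T} \<inter> {z. isolated_zero F z})"
    by (intro sparse_in_compact_finite) (auto intro: sparse_in_subset)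
  moreover have "f ` {\<gamma>. \<bar>\<gamma>\<bar> \<le> T \<and> nontrivial_zero F (f \<gamma>)}
      \<subseteq> f ` {-T..T} \<inter> {z. isolated_zero F z}"
    by (auto simp: nontrivial_zero_def intro!: imageI)
  ultimately have "finite (f ` {\<gamma>. \<bar>\<gamma>\<bar> \<le> T \<and> nontrivial_zero F (f \<gamma>)})"
    using finite_subset by blast
  moreover have "inj f"
    by (auto simp: f_def inj_on_def)
  ultimately show ?thesis
    unfolding f_def by (meson finite_imageD inj_on_subset subset_UNIV)
qed

text \<open>Since \<open>A - B\<close> and \<open>B - A\<close> have no common element, their union is their sum.\<close>

definition mset_symdiff :: "'a multiset \<Rightarrow> 'a multiset \<Rightarrow> 'a multiset" where
  "mset_symdiff A B = (A - B) + (B - A)"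

end

theory Submission
  imports Defs "HOL-Real_Asymp.Real_Asymp"
begin

text \<open>Let \<open>e\<close> be the sequence of coefficients of the Dirichlet series of \<open>G'/G - F'/F\<close>. As the coefficients
  of \<open>F\<close> and \<open>G\<close> agree at the primes outside of a thin set, this series converges absolutely for
  \<open>Re s > 1/2\<close>, so by the functional equations the zeros of \<open>F\<close> and \<open>G\<close> above some height agree away from
  the critical line. An explicit formula with a kernel concentrated on the scale \<open>1/l\<close> expresses the real
  Dirichlet polynomial \<open>P t\<close> with coefficients \<open>e n / sqrt n\<close> by the zeros near \<open>t\<close> at which the
  multiplicities of \<open>F\<close> and \<open>G\<close> differ; a difference in \<open>t\<close> removes the Gamma factors. Hence \<open>P t\<close> is
  negligible unless such a zero is near, and then \<open>\<bar>P t\<bar> \<le> (P t)\<^sup>2 / (2 s) + s / 2\<close>. Integrate over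
  \<open>[2 T, 4 T]\<close>: the mean square of \<open>P\<close> is bounded, the prime squares being the only terms that need a mean
  value theorem, and the exceptional \<open>t\<close> have measure \<open>O(V / l)\<close>, where \<open>V\<close> is the number of zeros in
  question. By orthogonality each \<open>\<bar>e n\<bar> / sqrt n\<close> is \<open>O(1 / \<sigma> + \<sigma> V / (l T))\<close> for every \<open>\<sigma> > 0\<close>.
  With a kernel of exponent \<open>m\<close> of order \<open>ln ln T\<close>, the first hypothesis allows \<open>l = A ln T / m\<close>; the second one
  controls the prime squares up to \<open>exp (l m)\<close> even for \<open>l = A ln T\<close>, where \<open>V = O(T ln T)\<close> suffices.
  Either way \<open>V / (l T) = O(1 / A)\<close>, and with \<open>\<sigma> = sqrt A\<close> and \<open>A\<close> tending to infinity \<open>e\<close> vanishes.\<close>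

section \<open>Contour shifts and mean squares\<close>

text \<open>The obstacle is the length of the Dirichlet polynomial: its terms reach up to exp (l m),
  a power T^A or more, far beyond what a mean value over an interval of length T treats as diagonal.
  Absolute convergence disposes of everything but the prime squares; for these the off-diagonal part
  costs (1 + l m) H, where H is the sum of |e(p^2)|^2 / p, and H has to stay below a power of T with
  exponent less than 1. The exponent m cannot stay bounded either: away from its centre the kernel
  has size 2^(-m), to be summed over possibly T ln T zeros, so 2^m must beat m ln T. Hence m is of
  order ln ln T, and this can be paid for in two ways. If l gives up the factor m, the denominator
  ln ln T in the first condition repays it. If l keeps it, the logarithmic length x becomes of order
  ln T ln ln T; then x / ln x is of order ln T, and the second condition with small \<epsilon>
  bounds H by a small power of T.\<close>

lemma rectangle_shift_residues:
  fixes f :: "complex \<Rightarrow> complex"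
  assumes x: "x1 < x2" and y: "y1 < y2" and S: "open S" "convex S"
    and sub: "cbox (Complex x1 y1) (Complex x2 y2) \<subseteq> S"
    and pts: "finite pts" "pts \<inter> (cbox (Complex x1 y1) (Complex x2 y2) - box (Complex x1 y1) (Complex x2 y2)) = {}"
    and f: "f holomorphic_on S - pts"
    and M: "\<And>x y. x1 \<le> x \<Longrightarrow> x \<le> x2 \<Longrightarrow> y = y1 \<or> y = y2 \<Longrightarrow> norm (f (Complex x y)) \<le> M"
  shows "norm (integral {y1..y2} (\<lambda>y. f (Complex x2 y)) - integral {y1..y2} (\<lambda>y. f (Complex x1 y))
           - 2 * pi * (\<Sum>p\<in>pts \<inter> box (Complex x1 y1) (Complex x2 y2). residue f p)) \<le> 2 * (x2 - x1) * M"
proof -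
  define a1 a2 a3 a4 where "a1 = Complex x1 y1" and "a2 = Complex x2 y1" and "a3 = Complex x2 y2" and "a4 = Complex x1 y2"
  have rp: "rectpath a1 a3 = linepath a1 a2 +++ linepath a2 a3 +++ linepath a3 a4 +++ linepath a4 a1"
    by (simp add: rectpath_def Let_def a1_def a2_def a3_def a4_def)
  have sub': "path_image (rectpath a1 a3) \<subseteq> S - pts"
    using x y sub pts by (subst path_image_rectpath_cbox_minus_box) (auto simp: a1_def a3_def)
  have imgs: "closed_segment a1 a2 \<subseteq> S - pts" "closed_segment a2 a3 \<subseteq> S - pts"
     "closed_segment a3 a4 \<subseteq> S - pts" "closed_segment a4 a1 \<subseteq> S - pts"
    using sub' by (auto simp: rp path_image_join)
  have int: "f contour_integrable_on linepath p q" if "closed_segment p q \<subseteq> S - pts" for p q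
    by (rule contour_integrable_continuous_linepath)
       (use that f holomorphic_on_imp_continuous_on holomorphic_on_subset in blast)
  have "contour_integral (rectpath a1 a3) f = 2 * pi * \<i> * (\<Sum>p\<in>pts. winding_number (rectpath a1 a3) p * residue f p)"
  proof (rule Residue_theorem[OF S(1) convex_connected[OF S(2)] pts(1) f])
    show "\<forall>z. z \<notin> S \<longrightarrow> winding_number (rectpath a1 a3) z = 0"
      using x y sub by (auto intro!: winding_number_rectpath_outside simp: a1_def a3_def)
  qed (use sub' in auto)
  also have "(\<Sum>p\<in>pts. winding_number (rectpath a1 a3) p * residue f p) = (\<Sum>p\<in>pts \<inter> box a1 a3. residue f p)"
  proof (rule sum.mono_neutral_cong_right)
    show "\<forall>p\<in>pts - pts \<inter> box a1 a3. winding_number (rectpath a1 a3) p * residue f p = 0"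
    proof
      fix p assume p: "p \<in> pts - pts \<inter> box a1 a3"
      hence "p \<notin> cbox a1 a3" using pts(2) by (auto simp: a1_def a3_def)
      hence "winding_number (rectpath a1 a3) p = 0"
        using x y by (intro winding_number_rectpath_outside) (auto simp: a1_def a3_def)
      thus "winding_number (rectpath a1 a3) p * residue f p = 0" by simp
    qed
  qed (use pts in \<open>auto simp: winding_number_rectpath\<close>)
  finally have eq: "contour_integral (rectpath a1 a3) f = 2 * pi * \<i> * (\<Sum>p\<in>pts \<inter> box a1 a3. residue f p)" .
  have "contour_integral (rectpath a1 a3) f = contour_integral (linepath a1 a2) f + contour_integral (linepath a2 a3) f
      + contour_integral (linepath a3 a4) f + contour_integral (linepath a4 a1) f"
    unfolding rp using int imgs by (simp add: contour_integrable_join valid_path_join)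
  moreover have "contour_integral (linepath a2 a3) f = \<i> * integral {y1..y2} (\<lambda>y. f (Complex x2 y))"
    using y by (subst contour_integral_linepath_same_Re[where c = x2]) (auto simp: a2_def a3_def)
  moreover have "contour_integral (linepath a4 a1) f = - \<i> * integral {y1..y2} (\<lambda>y. f (Complex x1 y))"
    using y contour_integral_linepath_same_Re[where z = a1 and z' = a4 and c = x1 and f = f and a = y1 and b = y2] contour_integral_reversepath[of "linepath a1 a4" f]
    by (auto simp: a1_def a4_def)
  moreover have "norm (contour_integral (linepath a1 a2) f) \<le> M * norm (a2 - a1)"
  proof (rule contour_integral_bound_linepath[OF int[OF imgs(1)]])
    show "0 \<le> M" using M[of x1 y1] x norm_ge_zero[of "f (Complex x1 y1)"] by linarith
    fix z assume "z \<in> closed_segment a1 a2"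
    thus "norm (f z) \<le> M" using M[of "Re z" "Im z"] x
      by (auto simp: a1_def a2_def closed_segment_same_Im closed_segment_eq_real_ivl)
  qed
  moreover have "norm (contour_integral (linepath a3 a4) f) \<le> M * norm (a4 - a3)"
  proof (rule contour_integral_bound_linepath[OF int[OF imgs(3)]])
    show "0 \<le> M" using M[of x1 y1] x norm_ge_zero[of "f (Complex x1 y1)"] by linarith
    fix z assume "z \<in> closed_segment a3 a4"
    thus "norm (f z) \<le> M" using M[of "Re z" "Im z"] x
      by (auto simp: a3_def a4_def closed_segment_same_Im closed_segment_eq_real_ivl)
  qed
  moreover have "norm (a2 - a1) = x2 - x1" "norm (a4 - a3) = x2 - x1"
    using x by (auto simp: a1_def a2_def a3_def a4_def cmod_def)
  moreover define J where "J = integral {y1..y2} (\<lambda>y. f (Complex x2 y)) - integral {y1..y2} (\<lambda>y. f (Complex x1 y))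
           - 2 * pi * (\<Sum>p\<in>pts \<inter> box a1 a3. residue f p)"
  \<comment> \<open>The vertical sides are parametrised by the ordinate, ds = i dy, so the factor i
    of 2 pi i cancels and the residues enter with the real weight 2 pi. Only the two horizontal
    sides are left over.\<close>
  ultimately have "\<i> * J = - (contour_integral (linepath a1 a2) f + contour_integral (linepath a3 a4) f)"
    using eq unfolding J_def by (simp add: algebra_simps)
  hence "norm J = norm (contour_integral (linepath a1 a2) f + contour_integral (linepath a3 a4) f)"
    by (metis norm_ii norm_minus_cancel norm_mult mult_1)
  also have "\<dots> \<le> M * (x2 - x1) + M * (x2 - x1)"
    using \<open>norm (contour_integral (linepath a1 a2) f) \<le> _\<close> \<open>norm (contour_integral (linepath a3 a4) f) \<le> _\<close>
      \<open>norm (a2 - a1) = _\<close> \<open>norm (a4 - a3) = _\<close> by (intro norm_triangle_mono) auto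
  finally show ?thesis by (simp add: J_def a1_def a3_def algebra_simps)
qed

lemma rectangle_shift:
  fixes f :: "complex \<Rightarrow> complex"
  assumes "x1 < x2" "y1 < y2" "open S" "convex S" "cbox (Complex x1 y1) (Complex x2 y2) \<subseteq> S" "f holomorphic_on S"
    and "\<And>x y. x1 \<le> x \<Longrightarrow> x \<le> x2 \<Longrightarrow> y = y1 \<or> y = y2 \<Longrightarrow> norm (f (Complex x y)) \<le> M"
  shows "norm (integral {y1..y2} (\<lambda>y. f (Complex x2 y)) - integral {y1..y2} (\<lambda>y. f (Complex x1 y))) \<le> 2 * (x2 - x1) * M"
  using rectangle_shift_residues[of x1 x2 y1 y2 S "{}" f M] assms by auto

lemma integral_of_real_complex:
  fixes f :: "real \<Rightarrow> real" assumes "f integrable_on S"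
  shows "integral S (\<lambda>x. complex_of_real (f x)) = of_real (integral S f)"
  using integral_linear[OF assms bounded_linear_of_real] by (simp add: o_def)

section \<open>Mean squares of sums of exponentials\<close>

lemma sum_inverse_le_ln:
  "N \<ge> 1 \<Longrightarrow> (\<Sum>k=1..N. 1 / real k) \<le> 1 + ln (real N)"
proof (induction N rule: nat_induct_at_least)
  case (Suc n)
  have "ln (real n) - ln (real (Suc n)) = ln (real n / real (Suc n))"
    using Suc by (subst ln_div) auto
  also have "real n / real (Suc n) = 1 + (- 1 / real (Suc n))"
    by (simp add: field_simps)
  also have "ln \<dots> \<le> - 1 / real (Suc n)"
    using Suc by (intro ln_add_one_self_le_self2) (auto simp: field_simps)
  finally show ?case using Suc by simp
qed simp

lemma integral_exp_ii_bound:
  fixes \<theta> :: real assumes "\<theta> \<noteq> 0" "A \<le> B"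
  shows "norm (integral {A..B} (\<lambda>t. exp (\<i> * of_real (\<theta> * t)))) \<le> 2 / \<bar>\<theta>\<bar>"
proof -
  have "((\<lambda>t. exp (\<i> * of_real (\<theta> * t))) has_integral
     (exp (\<i> * of_real (\<theta> * B)) / (\<i> * of_real \<theta>) - exp (\<i> * of_real (\<theta> * A)) / (\<i> * of_real \<theta>))) {A..B}"
  proof (rule fundamental_theorem_of_calculus[OF \<open>A \<le> B\<close>])
    fix t
    have "((\<lambda>z. exp (\<i> * (of_real \<theta> * z)) / (\<i> * of_real \<theta>)) has_field_derivative
        exp (\<i> * (of_real \<theta> * of_real t))) (at (of_real t))"
      using assms by (auto intro!: derivative_eq_intros simp: field_simps)
    from has_vector_derivative_real_field[OF this]
    show "((\<lambda>t. exp (\<i> * of_real (\<theta> * t)) / (\<i> * of_real \<theta>)) has_vector_derivative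
        exp (\<i> * of_real (\<theta> * t))) (at t within {A..B})" by simp
  qed
  hence "norm (integral {A..B} (\<lambda>t. exp (\<i> * of_real (\<theta> * t))))
      = norm (exp (\<i> * of_real (\<theta> * B)) / (\<i> * of_real \<theta>) - exp (\<i> * of_real (\<theta> * A)) / (\<i> * of_real \<theta>))"
    by (simp add: integral_unique)
  also have "\<dots> \<le> norm (exp (\<i> * of_real (\<theta> * B)) / (\<i> * of_real \<theta>)) + norm (exp (\<i> * of_real (\<theta> * A)) / (\<i> * of_real \<theta>))"
    by (rule norm_triangle_ineq4)
  also have "\<dots> = 2 / \<bar>\<theta>\<bar>"
    by (simp add: norm_divide norm_mult)
  finally show ?thesis .
qed

text \<open>Opening the square leaves the length of the interval on the diagonal and, for every
  other pair, a single integral of a pure oscillation.\<close>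

lemma mean_square_exp_sum:
  fixes a :: "nat \<Rightarrow> complex" and \<theta> :: "nat \<Rightarrow> real"
  assumes fin: "finite I" and inj: "inj_on \<theta> I" and "A \<le> B"
  shows "integral {A..B} (\<lambda>t. (norm (\<Sum>p\<in>I. a p * exp (- \<i> * of_real (\<theta> p * t))))\<^sup>2)
     \<le> (B - A) * (\<Sum>p\<in>I. (norm (a p))\<^sup>2)
       + (\<Sum>p\<in>I. \<Sum>q\<in>I - {p}. norm (a p) * norm (a q) * (2 / \<bar>\<theta> p - \<theta> q\<bar>))"
proof -
  let ?S = "\<lambda>t. \<Sum>p\<in>I. a p * exp (- \<i> * of_real (\<theta> p * t))"
  have eq: "complex_of_real ((norm (?S t))\<^sup>2) =
     (\<Sum>p\<in>I. \<Sum>q\<in>I. a p * cnj (a q) * exp (\<i> * of_real ((\<theta> q - \<theta> p) * t)))" for t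
    by (subst complex_norm_square)
       (simp add: sum_product exp_cnj algebra_simps exp_diff exp_minus field_simps)
  have int: "(\<lambda>t. a p * cnj (a q) * exp (\<i> * of_real ((\<theta> q - \<theta> p) * t))) integrable_on {A..B}" for p q
    by (intro integrable_continuous_real continuous_intros)
  have "complex_of_real (integral {A..B} (\<lambda>t. (norm (?S t))\<^sup>2)) = integral {A..B} (\<lambda>t. of_real ((norm (?S t))\<^sup>2))"
    by (subst integral_linear[OF _ bounded_linear_of_real, symmetric])
       (auto simp: o_def intro!: integrable_continuous_real continuous_intros)
  also have "\<dots> = (\<Sum>p\<in>I. \<Sum>q\<in>I. integral {A..B} (\<lambda>t. a p * cnj (a q) * exp (\<i> * of_real ((\<theta> q - \<theta> p) * t))))"
    unfolding eq using fin int by (simp add: integral_sum integrable_sum)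
  finally have "integral {A..B} (\<lambda>t. (norm (?S t))\<^sup>2) =
      Re (\<Sum>p\<in>I. \<Sum>q\<in>I. integral {A..B} (\<lambda>t. a p * cnj (a q) * exp (\<i> * of_real ((\<theta> q - \<theta> p) * t))))"
    by (metis Re_complex_of_real)
  also have "\<dots> \<le> norm (\<Sum>p\<in>I. \<Sum>q\<in>I. integral {A..B} (\<lambda>t. a p * cnj (a q) * exp (\<i> * of_real ((\<theta> q - \<theta> p) * t))))"
    by (rule complex_Re_le_cmod)
  also have "\<dots> \<le> (\<Sum>p\<in>I. \<Sum>q\<in>I. norm (integral {A..B} (\<lambda>t. a p * cnj (a q) * exp (\<i> * of_real ((\<theta> q - \<theta> p) * t)))))"
    by (intro order.trans[OF norm_sum] sum_mono norm_sum)
  also have "\<dots> = (\<Sum>p\<in>I. norm (integral {A..B} (\<lambda>t. a p * cnj (a p) * exp (\<i> * of_real ((\<theta> p - \<theta> p) * t))))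
      + (\<Sum>q\<in>I-{p}. norm (integral {A..B} (\<lambda>t. a p * cnj (a q) * exp (\<i> * of_real ((\<theta> q - \<theta> p) * t))))))"
    using fin by (intro sum.cong refl) (simp add: sum.remove)
  also have "\<dots> \<le> (\<Sum>p\<in>I. (B - A) * (norm (a p))\<^sup>2
      + (\<Sum>q\<in>I-{p}. norm (a p) * norm (a q) * (2 / \<bar>\<theta> p - \<theta> q\<bar>)))"
  proof (intro sum_mono add_mono)
    fix p
    show "norm (integral {A..B} (\<lambda>t. a p * cnj (a p) * exp (\<i> * of_real ((\<theta> p - \<theta> p) * t)))) \<le> (B - A) * (norm (a p))\<^sup>2"
      using \<open>A \<le> B\<close> by (simp add: norm_mult power2_eq_square)
  next
    fix p q assume "p \<in> I" "q \<in> I - {p}"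
    hence "\<theta> q - \<theta> p \<noteq> 0" using inj by (auto simp: inj_on_def)
    hence "norm (integral {A..B} (\<lambda>t. exp (\<i> * of_real ((\<theta> q - \<theta> p) * t)))) \<le> 2 / \<bar>\<theta> p - \<theta> q\<bar>"
      using integral_exp_ii_bound[of "\<theta> q - \<theta> p" A B] \<open>A \<le> B\<close> by (simp add: abs_minus_commute)
    thus "norm (integral {A..B} (\<lambda>t. a p * cnj (a q) * exp (\<i> * of_real ((\<theta> q - \<theta> p) * t))))
        \<le> norm (a p) * norm (a q) * (2 / \<bar>\<theta> p - \<theta> q\<bar>)"
      unfolding integral_mult_right norm_mult complex_mod_cnj by (intro mult_left_mono) auto
  qed
  finally show ?thesis by (simp add: sum.distrib sum_distrib_left)
qed

text \<open>For p < q the inequality ln x <= x - 1 gives ln q - ln p >= (q - p) / q. Then q / (q -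
  p) = 1 + p / (q - p), and p <= sqrt (p q) turns the second part into 1 / (q - p).\<close>

lemma inverse_abs_ln_diff_le:
  fixes p q :: nat
  assumes "p > 0" "q > 0" "p \<noteq> q"
  shows "1 / (sqrt p * sqrt q * \<bar>ln (real p) - ln (real q)\<bar>) \<le> 1 / (sqrt p * sqrt q) + 1 / \<bar>real p - real q\<bar>"
proof -
  have *: "1 / (sqrt p * sqrt q * \<bar>ln (real p) - ln (real q)\<bar>) \<le> 1 / (sqrt p * sqrt q) + 1 / \<bar>real p - real q\<bar>"
    if "p > 0" "q > p" for p q :: nat
  proof -
    have "ln (real p) - ln (real q) \<le> real p / real q - 1"
      using that ln_le_minus_one[of "real p / real q"] by (simp add: ln_div)
    hence d: "(real q - real p) / real q \<le> \<bar>ln (real p) - ln (real q)\<bar>"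
      using that by (simp add: field_simps)
    have pos: "(real q - real p) / real q > 0" using that by simp
    have "1 / (sqrt p * sqrt q * \<bar>ln (real p) - ln (real q)\<bar>) \<le> 1 / (sqrt p * sqrt q * ((real q - real p) / real q))"
      using that d pos by (intro divide_left_mono mult_left_mono mult_pos_pos) (auto intro: order.strict_trans2)
    also have "\<dots> = real q / (sqrt p * sqrt q * (real q - real p))"
      using that by (simp add: field_simps)
    also have "\<dots> = 1 / (sqrt p * sqrt q) + real p / (sqrt p * sqrt q * (real q - real p))"
      using that by (simp add: field_simps)
    also have "real p / (sqrt p * sqrt q * (real q - real p)) \<le> 1 / (real q - real p)"
    proof -
      have "real p = sqrt p * sqrt p" by simp
      also have "\<dots> \<le> sqrt p * sqrt q" using that by (intro mult_left_mono) auto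
      finally have "real p / (sqrt p * sqrt q) \<le> 1" using that by (simp add: field_simps)
      hence "real p / (sqrt p * sqrt q) * (1 / (real q - real p)) \<le> 1 * (1 / (real q - real p))"
        using that by (intro mult_right_mono) auto
      thus ?thesis by simp
    qed
    finally show ?thesis using that by simp
  qed
  show ?thesis
    using assms *[of p q] *[of q p] by (cases "p < q") (auto simp: mult.commute abs_minus_commute)
qed

text \<open>The sum is what the squares n = p^2 contribute to a Dirichlet polynomial on the critical
  line: n^(-1/2) = 1 / p, and the frequency is ln n = 2 ln p. The bound is a Montgomery-Vaughan mean
  value estimate weakened by a logarithm, which is harmless here since the last sum only has to be
  smaller than a power of T.\<close>

lemma mean_square_dirichlet_squares:
  fixes y :: "nat \<Rightarrow> complex"
  assumes I: "I \<subseteq> {1..N}" and N: "N \<ge> 1" and "A \<le> B"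
  shows "integral {A..B} (\<lambda>t. (norm (\<Sum>p\<in>I. y p / of_nat p * exp (- \<i> * of_real (2 * ln (real p) * t))))\<^sup>2)
     \<le> (B - A) * (\<Sum>p\<in>I. (norm (y p))\<^sup>2 / (real p)\<^sup>2) + 3 * (1 + ln N) * (\<Sum>p\<in>I. (norm (y p))\<^sup>2 / real p)"
proof -
  have fin: "finite I" using I finite_subset by blast
  have pos: "p > 0" if "p \<in> I" for p using that I by auto
  define x where "x = (\<lambda>p. norm (y p) / sqrt p)"
  define H where "H = (\<Sum>p\<in>I. (norm (y p))\<^sup>2 / real p)"
  have xsq: "(x p)\<^sup>2 = (norm (y p))\<^sup>2 / real p" for p by (simp add: x_def power_divide)
  have x0: "x p \<ge> 0" for p by (simp add: x_def)
  have inj: "inj_on (\<lambda>p. 2 * ln (real p)) I" using pos by (auto simp: inj_on_def)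
  have harm: "(\<Sum>k=1..N. 1 / real k) \<le> 1 + ln N" by (rule sum_inverse_le_ln[OF N])
  \<comment> \<open>The product term will go through Cauchy-Schwarz. In the term with 1 / |p - q|
    the product x p x q is replaced by the mean of the squares, so that it suffices to sum 1 / |p -
    q| over one variable.\<close>
  have trm: "norm (y p / of_nat p) * norm (y q / of_nat q) * (2 / \<bar>2 * ln (real p) - 2 * ln (real q)\<bar>)
      \<le> (x p / sqrt p) * (x q / sqrt q) + ((x p)\<^sup>2 * (1 / \<bar>real p - real q\<bar>) + (x q)\<^sup>2 * (1 / \<bar>real p - real q\<bar>)) / 2"
    if "p \<in> I" "q \<in> I - {p}" for p q
  proof -
    have "2 * ln (real p) - 2 * ln (real q) = 2 * (ln (real p) - ln (real q))" by simp
    hence "norm (y p / of_nat p) * norm (y q / of_nat q) * (2 / \<bar>2 * ln (real p) - 2 * ln (real q)\<bar>)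
      = x p * x q * (1 / (sqrt p * sqrt q * \<bar>ln (real p) - ln (real q)\<bar>))"
    proof -
      have "real p = sqrt p * sqrt p" "real q = sqrt q * sqrt q" by simp_all
      thus ?thesis unfolding x_def norm_divide norm_of_nat \<open>2 * ln (real p) - 2 * ln (real q) = _\<close> abs_mult
        by (simp only: abs_numeral) (simp add: field_simps)
    qed
    also have "\<dots> \<le> x p * x q * (1 / (sqrt p * sqrt q) + 1 / \<bar>real p - real q\<bar>)"
      using that pos x0 by (intro mult_left_mono inverse_abs_ln_diff_le) auto
    also have "\<dots> = (x p / sqrt p) * (x q / sqrt q) + x p * x q * (1 / \<bar>real p - real q\<bar>)"
      by (simp add: ring_distribs)
    also have "x p * x q * (1 / \<bar>real p - real q\<bar>) \<le> (((x p)\<^sup>2 + (x q)\<^sup>2) / 2) * (1 / \<bar>real p - real q\<bar>)"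
      using sum_squares_bound[of "x p" "x q"] by (intro mult_right_mono) auto
    also have "(((x p)\<^sup>2 + (x q)\<^sup>2) / 2) * (1 / \<bar>real p - real q\<bar>)
        = ((x p)\<^sup>2 * (1 / \<bar>real p - real q\<bar>) + (x q)\<^sup>2 * (1 / \<bar>real p - real q\<bar>)) / 2"
      by (simp only: distrib_right times_divide_eq_left)
    finally show ?thesis by simp
  qed
  \<comment> \<open>At each distance k there are at most two q, one on either side of p.\<close>
  have near: "(\<Sum>q\<in>I-{p}. 1 / \<bar>real p - real q\<bar>) \<le> 2 * (1 + ln N)" if "p \<in> I" for p
  proof -
    have "(\<Sum>q\<in>I-{p}. 1 / \<bar>real p - real q\<bar>) \<le> (\<Sum>q\<in>{1..<p} \<union> {p<..N}. 1 / \<bar>real p - real q\<bar>)"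
      using I by (intro sum_mono2) auto
    also have "\<dots> = (\<Sum>q\<in>{1..<p}. 1 / \<bar>real p - real q\<bar>) + (\<Sum>q\<in>{p<..N}. 1 / \<bar>real p - real q\<bar>)"
      by (intro sum.union_disjoint) auto
    also have "(\<Sum>q\<in>{1..<p}. 1 / \<bar>real p - real q\<bar>) = (\<Sum>k\<in>{1..<p}. 1 / real k)"
      by (rule sum.reindex_bij_witness[of _ "\<lambda>k. p - k" "\<lambda>k. p - k"]) (auto simp: of_nat_diff)
    also have "(\<Sum>k\<in>{1..<p}. 1 / real k) \<le> (\<Sum>k=1..N. 1 / real k)"
      using that I by (intro sum_mono2) auto
    also have "(\<Sum>q\<in>{p<..N}. 1 / \<bar>real p - real q\<bar>) = (\<Sum>k\<in>{1..N-p}. 1 / real k)"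
      by (rule sum.reindex_bij_witness[of _ "\<lambda>k. p + k" "\<lambda>k. k - p"]) (auto simp: of_nat_diff)
    also have "\<dots> \<le> (\<Sum>k=1..N. 1 / real k)"
      by (intro sum_mono2) auto
    finally show ?thesis using harm by simp
  qed
  have H0: "H \<ge> 0" by (auto simp: H_def intro!: sum_nonneg)
  have "integral {A..B} (\<lambda>t. (norm (\<Sum>p\<in>I. y p / of_nat p * exp (- \<i> * of_real (2 * ln (real p) * t))))\<^sup>2)
     \<le> (B - A) * (\<Sum>p\<in>I. (norm (y p / of_nat p))\<^sup>2)
       + (\<Sum>p\<in>I. \<Sum>q\<in>I - {p}. norm (y p / of_nat p) * norm (y q / of_nat q) * (2 / \<bar>2 * ln (real p) - 2 * ln (real q)\<bar>))"
    using mean_square_exp_sum[OF fin inj \<open>A \<le> B\<close>, of "\<lambda>p. y p / of_nat p"] by simp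
  also have "(\<Sum>p\<in>I. \<Sum>q\<in>I - {p}. norm (y p / of_nat p) * norm (y q / of_nat q) * (2 / \<bar>2 * ln (real p) - 2 * ln (real q)\<bar>))
      \<le> (\<Sum>p\<in>I. \<Sum>q\<in>I - {p}. (x p / sqrt p) * (x q / sqrt q) + ((x p)\<^sup>2 * (1 / \<bar>real p - real q\<bar>) + (x q)\<^sup>2 * (1 / \<bar>real p - real q\<bar>)) / 2)"
    by (intro sum_mono trm)
  also have "\<dots> = (\<Sum>p\<in>I. \<Sum>q\<in>I - {p}. (x p / sqrt p) * (x q / sqrt q))
      + ((\<Sum>p\<in>I. \<Sum>q\<in>I - {p}. (x p)\<^sup>2 * (1 / \<bar>real p - real q\<bar>)) + (\<Sum>p\<in>I. \<Sum>q\<in>I - {p}. (x q)\<^sup>2 * (1 / \<bar>real p - real q\<bar>))) / 2"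
    by (simp add: sum.distrib sum_divide_distrib add_divide_distrib)
  also have "(\<Sum>p\<in>I. \<Sum>q\<in>I - {p}. (x q)\<^sup>2 * (1 / \<bar>real p - real q\<bar>)) = (\<Sum>p\<in>I. \<Sum>q\<in>I - {p}. (x p)\<^sup>2 * (1 / \<bar>real p - real q\<bar>))"
  proof -
    have e: "I - {p} = {q \<in> I. p \<noteq> q}" "I - {p} = {q \<in> I. q \<noteq> p}" for p by auto
    have "(\<Sum>p\<in>I. \<Sum>q\<in>I - {p}. (x q)\<^sup>2 * (1 / \<bar>real p - real q\<bar>)) = (\<Sum>p\<in>I. \<Sum>q\<in>{q\<in>I. p \<noteq> q}. (x q)\<^sup>2 * (1 / \<bar>real p - real q\<bar>))"
      by (simp add: e(1))
    also have "\<dots> = (\<Sum>q\<in>I. \<Sum>p\<in>{p\<in>I. p \<noteq> q}. (x q)\<^sup>2 * (1 / \<bar>real p - real q\<bar>))"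
      by (rule sum.swap_restrict[OF fin fin])
    finally show ?thesis by (simp add: e(2)[symmetric] abs_minus_commute)
  qed
  also have "(\<Sum>p\<in>I. \<Sum>q\<in>I - {p}. (x p)\<^sup>2 * (1 / \<bar>real p - real q\<bar>)) \<le> 2 * (1 + ln N) * H"
  proof -
    have "(\<Sum>p\<in>I. \<Sum>q\<in>I - {p}. (x p)\<^sup>2 * (1 / \<bar>real p - real q\<bar>)) \<le> (\<Sum>p\<in>I. (x p)\<^sup>2 * (2 * (1 + ln N)))"
      by (intro sum_mono) (simp only: sum_distrib_left[symmetric], intro mult_left_mono near, auto)
    also have "\<dots> = 2 * (1 + ln N) * H"
      unfolding H_def sum_distrib_left xsq by (intro sum.cong refl) (simp only: mult_ac)
    finally show ?thesis .
  qed
  also have "(\<Sum>p\<in>I. \<Sum>q\<in>I - {p}. (x p / sqrt p) * (x q / sqrt q)) \<le> (1 + ln N) * H"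
  proof -
    have "(\<Sum>p\<in>I. (1 / sqrt (real p))\<^sup>2) = (\<Sum>p\<in>I. 1 / real p)"
      by (simp add: power_divide)
    also have "\<dots> \<le> (\<Sum>k=1..N. 1 / real k)" using I by (intro sum_mono2) auto
    also note harm
    finally have inv: "(\<Sum>p\<in>I. (1 / sqrt (real p))\<^sup>2) \<le> 1 + ln N" .
    have "(\<Sum>p\<in>I. \<Sum>q\<in>I - {p}. (x p / sqrt p) * (x q / sqrt q)) \<le> (\<Sum>p\<in>I. \<Sum>q\<in>I. (x p / sqrt p) * (x q / sqrt q))"
      using fin x0 by (intro sum_mono sum_mono2) auto
    also have "\<dots> = (\<Sum>p\<in>I. x p * (1 / sqrt p))\<^sup>2"
      by (simp add: sum_product power2_eq_square)
    also have "\<dots> \<le> (\<Sum>p\<in>I. (x p)\<^sup>2) * (\<Sum>p\<in>I. (1 / sqrt p)\<^sup>2)"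
      by (rule Cauchy_Schwarz_ineq_sum)
    also have "\<dots> \<le> (\<Sum>p\<in>I. (x p)\<^sup>2) * (1 + ln N)"
      by (intro mult_left_mono inv sum_nonneg) auto
    also have "\<dots> = (1 + ln N) * H" unfolding H_def xsq by (rule mult.commute)
    finally show ?thesis .
  qed
  also have "(1 + ln (real N)) * H + (2 * (1 + ln (real N)) * H + 2 * (1 + ln (real N)) * H) / 2 = 3 * (1 + ln (real N)) * H"
    by (simp add: algebra_simps)
  finally show ?thesis by (simp add: H_def norm_divide power_divide)
qed

section \<open>The smoothing kernel\<close>

definition shc :: "complex \<Rightarrow> complex" where
  "shc z = (if z = 0 then 1 else sinh z / z)"

text \<open>\<open>shc\<close> is the difference quotient of sinh at 0, so the singularity is
  removable.\<close>

lemma shc_holomorphic [holomorphic_intros]: "shc holomorphic_on A"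
proof -
  have "sinh holomorphic_on (UNIV :: complex set)"
    by (auto simp: holomorphic_on_open intro!: exI derivative_eq_intros)
  from pole_lemma[OF this, of 0] have "(\<lambda>z. if z = 0 then deriv sinh 0 else (sinh z - sinh 0) / (z - 0)) holomorphic_on (UNIV::complex set)"
    by simp
  also have "deriv sinh (0::complex) = 1"
    using DERIV_imp_deriv[OF has_field_derivative_sinh[OF DERIV_ident], of 0] by simp
  also have "(\<lambda>z. if z = 0 then 1 else (sinh z - sinh 0) / (z - 0)) = shc"
    by (rule ext) (simp add: shc_def)
  finally have "shc holomorphic_on UNIV" .
  thus ?thesis by (rule holomorphic_on_subset) auto
qed

lemma shc_uminus [simp]: "shc (- z) = shc z"
  by (simp add: shc_def)

lemma cnj_shc: "cnj (shc z) = shc (cnj z)"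
  by (auto simp: shc_def sinh_field_def exp_cnj)

lemma norm_shc_le: assumes "z \<noteq> 0" shows "norm (shc z) \<le> exp \<bar>Re z\<bar> / norm z"
proof -
  have "norm (sinh z) \<le> (norm (exp z) + norm (exp (- z))) / 2"
    using norm_triangle_ineq4[of "exp z" "exp (-z)"] by (simp add: sinh_field_def norm_divide)
  also have "\<dots> \<le> exp \<bar>Re z\<bar>" by (auto simp: abs_if)
  finally show ?thesis using assms by (auto simp: shc_def norm_divide intro: divide_right_mono)
qed

text \<open>The unnormalised sinc function, that is, \<open>shc\<close> on the imaginary axis; there
  the kernel is real, and nonnegative for an even exponent.\<close>

definition sinq :: "real \<Rightarrow> real" where
  "sinq v = (if v = 0 then 1 else sin v / v)"

lemma shc_imaginary: "shc (\<i> * of_real v) = of_real (sinq v)"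
  by (auto simp: shc_def sinq_def sinh_field_def sin_of_real[symmetric] sin_exp_eq exp_minus field_simps)

lemma abs_sinq_le_1: "\<bar>sinq v\<bar> \<le> 1"
proof (cases "v = 0")
  case False
  thus ?thesis using abs_sin_x_le_abs_x[of v] by (simp add: sinq_def field_simps)
qed (simp add: sinq_def)

lemma sinq_ge: "1 - v\<^sup>2 / 6 \<le> sinq v"
proof -
  have *: "1 - v\<^sup>2 / 6 \<le> sinq v" if "v > 0" for v :: real
  proof -
    \<comment> \<open>The derivative cos x - 1 + x^2 / 2 is nonnegative by the half-angle formula,
      so f increases from 0; this is the cubic Taylor bound for the sine.\<close>
    define f where "f = (\<lambda>v::real. sin v - v + v ^ 3 / 6)"
    have g: "0 \<le> cos x - 1 + x\<^sup>2 / 2" for x :: real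
    proof -
      have "(sin (x / 2))\<^sup>2 \<le> (x / 2)\<^sup>2"
        using abs_sin_x_le_abs_x[of "x / 2"] by (intro abs_le_square_iff[THEN iffD1])
      thus ?thesis using cos_double_sin[of "x / 2"] by (simp add: power_divide)
    qed
    have "\<exists>y. (f has_real_derivative y) (at x) \<and> 0 \<le> y" for x
      by (rule exI[of _ "cos x - 1 + x\<^sup>2 / 2"], intro conjI g, unfold f_def)
         (auto intro!: derivative_eq_intros)
    note D = this
    have "f 0 \<le> f v"
      by (rule DERIV_nonneg_imp_nondecreasing[OF less_imp_le[OF that]]) (rule D)
    hence "v * (1 - v\<^sup>2 / 6) \<le> sin v" by (simp add: f_def field_simps power2_eq_square power3_eq_cube)
    thus ?thesis using that by (simp add: sinq_def pos_le_divide_eq mult.commute)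
  qed
  consider "v = 0" | "v > 0" | "v < 0" by linarith
  thus ?thesis
  proof cases
    case 3 thus ?thesis using *[of "- v"] by (simp add: sinq_def)
  qed (simp_all add: *, simp add: sinq_def)
qed

lemma continuous_on_sinq: "continuous_on A sinq"
proof -
  have "sinq = (\<lambda>v. Re (shc (\<i> * of_real v)))" by (rule ext) (simp add: shc_imaginary)
  moreover have "continuous_on A (\<lambda>v. Re (shc (\<i> * of_real v)))"
    by (intro continuous_intros continuous_on_compose2[OF holomorphic_on_imp_continuous_on[OF shc_holomorphic[of UNIV]]]) auto
  ultimately show ?thesis by metis
qed

text \<open>The kernel \<open>(sinh (l z) / (l z))\<^sup>m\<close> is entire, its Fourier transform along the imaginary axis is supported
  in \<open>[-l m, l m]\<close>, and on that axis it is concentrated on the scale \<open>1/l\<close>.\<close>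

definition kern :: "real \<Rightarrow> nat \<Rightarrow> complex \<Rightarrow> complex" where
  "kern l m z = shc (of_real l * z) ^ m"

definition kerr :: "real \<Rightarrow> nat \<Rightarrow> real \<Rightarrow> real" where
  "kerr l m v = sinq (l * v) ^ m"

text \<open>A Cauchy density up to normalisation. It majorises the kernel, and its mass is pi / l
  whatever the centre, so integrating it over t counts each zero with weight of order 1 / l.\<close>

definition hump :: "real \<Rightarrow> real \<Rightarrow> real" where
  "hump l v = 1 / (1 + (l * v)\<^sup>2)"

lemma kern_holomorphic [holomorphic_intros]: "kern l m holomorphic_on A"
proof -
  have "(shc \<circ> (\<lambda>z. of_real l * z)) holomorphic_on A"
    by (intro holomorphic_on_compose holomorphic_intros)
  thus ?thesis unfolding kern_def o_def by (intro holomorphic_intros)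
qed

lemma kern_uminus [simp]: "kern l m (- z) = kern l m z"
  by (simp add: kern_def)

lemma cnj_kern: "cnj (kern l m z) = kern l m (cnj z)"
  by (simp add: kern_def cnj_shc)

lemma kern_imaginary: "kern l m (\<i> * of_real v) = of_real (kerr l m v)"
proof -
  have "of_real l * (\<i> * of_real v) = \<i> * of_real (l * v)" by simp
  thus ?thesis unfolding kern_def kerr_def by (simp only: shc_imaginary of_real_power)
qed

lemma norm_kern_le:
  assumes "l > 0" "R > 0" "norm z \<ge> R"
  shows "norm (kern l m z) \<le> (exp (l * \<bar>Re z\<bar>) / (l * R)) ^ m"
proof -
  have z: "z \<noteq> 0" using assms by auto
  have "norm (shc (of_real l * z)) \<le> exp \<bar>Re (of_real l * z)\<bar> / norm (of_real l * z)"
    using z assms by (intro norm_shc_le) auto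
  also have "\<dots> \<le> exp (l * \<bar>Re z\<bar>) / (l * R)"
    using assms z by (auto simp: norm_mult abs_mult intro!: divide_left_mono mult_left_mono mult_pos_pos)
  finally show ?thesis unfolding kern_def by (simp add: norm_power power_mono)
qed

lemma kerr_bounds: assumes "even m" shows "0 \<le> kerr l m v" "kerr l m v \<le> 1"
  using assms abs_sinq_le_1[of "l * v"] power_le_one[of "\<bar>sinq (l * v)\<bar>" m]
  by (auto simp: kerr_def power_even_abs zero_le_even_power)

lemma hump_pos: "hump l v > 0" "hump l v \<le> 1"
  by (auto simp: hump_def add_pos_nonneg add_nonneg_eq_0_iff field_simps)

lemma hump_ge: assumes "\<bar>l * v\<bar> \<le> 2" shows "1/5 \<le> hump l v"
proof -
  have "(l * v)\<^sup>2 \<le> 2\<^sup>2" using assms by (intro abs_le_square_iff[THEN iffD1]) auto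
  thus ?thesis by (simp add: hump_def field_simps add_pos_nonneg)
qed

text \<open>Of the m factors 1 / x two pay for the decay of \<open>hump\<close>, by 1 / x^2 <= (5/4)
  / (1 + x^2) for x >= 2, and the other m - 2 give the power of R.\<close>

lemma kerr_le_far:
  assumes "2 \<le> m" "even m" "2 \<le> R" "R \<le> \<bar>l * v\<bar>"
  shows "kerr l m v \<le> 5 / R ^ (m - 2) * hump l v / 4"
proof -
  define x where "x = \<bar>l * v\<bar>"
  have x: "x \<ge> 2" "x \<ge> R" using assms by (auto simp: x_def)
  have "\<bar>sinq (l * v)\<bar> \<le> 1 / x"
    using x by (auto simp: sinq_def x_def field_simps abs_mult)
  hence "kerr l m v \<le> (1 / x) ^ m"
    unfolding kerr_def using assms by (metis abs_ge_zero power_even_abs power_mono)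
  also have "(1 / x) ^ m = (1 / x) ^ (m - 2) * (1 / x)\<^sup>2"
    using assms(1) by (metis le_add_diff_inverse2 power_add)
  also have "\<dots> \<le> (1 / R) ^ (m - 2) * (5/4 * hump l v)"
  proof (intro mult_mono power_mono)
    show "1 / x \<le> 1 / R" using x assms by (intro divide_left_mono) auto
    have "x\<^sup>2 \<ge> 2\<^sup>2" using x by (intro power_mono) auto
    hence "1 / x\<^sup>2 \<le> 5/4 * (1 / (1 + x\<^sup>2))" by (simp add: divide_simps)
    thus "(1 / x)\<^sup>2 \<le> 5/4 * hump l v" by (simp add: hump_def x_def power_divide)
  qed (use x assms in auto)
  finally show ?thesis by (simp add: power_divide)
qed

lemma kerr_le_hump_far:
  assumes "2 \<le> m" "even m" "2 \<le> \<bar>l * v\<bar>"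
  shows "kerr l m v \<le> 5 / 2 ^ m * hump l v"
  using kerr_le_far[OF assms(1,2) _ assms(3)] power_diff[of "2::real" 2 m] assms(1) by simp

lemma kerr_le_hump: assumes "2 \<le> m" "even m" shows "kerr l m v \<le> 5 * hump l v"
proof (cases "\<bar>l * v\<bar> \<le> 2")
  case True thus ?thesis using hump_ge[OF True] kerr_bounds[OF assms(2), of l v] by linarith
next
  case False
  have "(5::real) / 2 ^ m \<le> 5 / 1" by (intro divide_left_mono) auto
  hence "5 / 2 ^ m * hump l v \<le> 5 * hump l v" using hump_pos(1)[of l v] by (intro mult_right_mono) auto
  thus ?thesis using kerr_le_hump_far[OF assms, of l v] False by linarith
qed

lemma continuous_on_hump [continuous_intros]:
  "continuous_on A f \<Longrightarrow> continuous_on A (\<lambda>x. hump l (f x))"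
  unfolding hump_def by (intro continuous_intros) (auto simp: add_nonneg_eq_0_iff)

lemma continuous_on_kerr [continuous_intros]:
  "continuous_on A f \<Longrightarrow> continuous_on A (\<lambda>x. kerr l m (f x))"
  unfolding kerr_def by (intro continuous_intros continuous_on_compose2[OF continuous_on_sinq[of UNIV]]) auto

lemma continuous_on_kern [continuous_intros]:
  "continuous_on A f \<Longrightarrow> continuous_on A (\<lambda>x. kern l m (f x))"
  by (rule continuous_on_compose2[OF holomorphic_on_imp_continuous_on[OF kern_holomorphic[of l m UNIV]]]) auto

lemma integral_hump_le:
  assumes "l > 0" "A \<le> B" shows "integral {A..B} (\<lambda>t. hump l (t - c)) \<le> pi / l"
proof -
  have "((\<lambda>t. hump l (t - c)) has_integral (arctan (l * (B - c)) / l - arctan (l * (A - c)) / l)) {A..B}"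
  proof (rule fundamental_theorem_of_calculus[OF assms(2)])
    fix t
    have "((\<lambda>t. arctan (l * (t - c)) / l) has_field_derivative (inverse (1 + (l * (t - c))\<^sup>2) * l) / l) (at t within {A..B})"
      using assms by (auto intro!: derivative_eq_intros)
    thus "((\<lambda>t. arctan (l * (t - c)) / l) has_vector_derivative hump l (t - c)) (at t within {A..B})"
      using assms by (simp add: hump_def has_real_derivative_iff_has_vector_derivative inverse_eq_divide)
  qed
  hence "integral {A..B} (\<lambda>t. hump l (t - c)) = (arctan (l * (B - c)) - arctan (l * (A - c))) / l"
    by (simp add: integral_unique diff_divide_distrib)
  also have "\<dots> \<le> pi / l"
    using assms arctan_bounded[of "l * (B - c)"] arctan_bounded[of "l * (A - c)"] by (intro divide_right_mono) auto
  finally show ?thesis .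
qed

lemma hump_minus_commute: "hump l (a - b) = hump l (b - a)"
  by (simp add: hump_def power_mult_distrib power2_commute)

section \<open>The truncated Fourier transform of the kernel, the weight that the explicit formula
  attaches to an integer n with u = ln n\<close>

definition kphi :: "real \<Rightarrow> nat \<Rightarrow> real \<Rightarrow> real \<Rightarrow> complex" where
  "kphi l m Y u = integral {-Y..Y} (\<lambda>v. exp (- of_real u * (\<i> * of_real v)) * kern l m (\<i> * of_real v))"

text \<open>The transform at frequency 0. All later estimates are relative to this quantity.\<close>

definition kmass :: "real \<Rightarrow> nat \<Rightarrow> real \<Rightarrow> real" where
  "kmass l m Y = integral {-Y..Y} (kerr l m)"

lemma norm_kphi_le: assumes "even m" shows "norm (kphi l m Y u) \<le> kmass l m Y"
  unfolding kphi_def kmass_def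
proof (rule integral_norm_bound_integral)
  fix v
  show "norm (exp (- of_real u * (\<i> * of_real v)) * kern l m (\<i> * of_real v)) \<le> kerr l m v"
    using kerr_bounds(1)[OF assms, of l v] by (simp add: norm_mult kern_imaginary)
qed (intro integrable_continuous_real continuous_intros)+

text \<open>On |v| <= 1 / (l m) the bound sinq x >= 1 - x^2 / 6 and Bernoulli's inequality keep the
  kernel above 5/6. The true order is 1 / (l sqrt m), but a loss of powers of m does no harm where
  this is used.\<close>

lemma kmass_ge:
  assumes "even m" "m \<ge> 1" "l > 0" "1 \<le> l * Y" shows "1 / (l * m) \<le> kmass l m Y"
proof -
  define w where "w = 1 / (l * m)"
  have "w \<le> 1 / l" using assms by (simp add: w_def field_simps)
  also have "1 / l \<le> Y" using assms by (simp add: field_simps)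
  finally have w: "w > 0" "w \<le> Y" using assms by (auto simp: w_def)
  have "(5/6) * (2 * w) = integral {-w..w} (\<lambda>_. 5/6 :: real)" using w by simp
  also have "\<dots> \<le> integral {-w..w} (kerr l m)"
  proof (rule integral_le)
    fix v assume v: "v \<in> {-w..w}"
    have "\<bar>l * v\<bar> \<le> l * w" using v assms by (auto simp: abs_mult)
    also have "l * w = 1 / m" using assms by (simp add: w_def)
    finally have 1: "(l * v)\<^sup>2 \<le> (1 / m)\<^sup>2" by (intro abs_le_square_iff[THEN iffD1]) auto
    have "(1 / real m)\<^sup>2 \<le> 1 / m" using assms by (auto simp: field_simps power2_eq_square)
    with 1 have 2: "(l * v)\<^sup>2 \<le> 1 / m" by linarith
    have "(1 / real m) \<le> 1" using assms by auto
    hence 3: "- 1 \<le> - (l * v)\<^sup>2 / 6" using 2 by linarith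
    have "5 / 6 \<le> 1 + real m * (- (l * v)\<^sup>2 / 6)" using 2 assms by (simp add: field_simps)
    also have "\<dots> \<le> (1 + (- (l * v)\<^sup>2 / 6)) ^ m" using 3 by (rule Bernoulli_inequality)
    also have "\<dots> \<le> sinq (l * v) ^ m" using sinq_ge[of "l * v"] 3 by (intro power_mono) auto
    finally show "5 / 6 \<le> kerr l m v" by (simp add: kerr_def)
  qed (intro integrable_continuous_real continuous_intros)+
  also have "\<dots> \<le> kmass l m Y"
    unfolding kmass_def using w assms
    by (intro integral_subset_le integrable_continuous_real continuous_intros) (auto simp: kerr_bounds)
  finally have "5/3 * w \<le> kmass l m Y" by simp
  hence "w \<le> kmass l m Y" using w by linarith
  thus ?thesis by (simp only: w_def)
qed

text \<open>The transform hardly differs from its value at 0 while u is small against l. Where |l v|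
  <= 2 the phase differs from 1 by at most u |v| <= 2 u / l; elsewhere it is bounded trivially by 2
  and the kernel is of size 2^(-m).\<close>

lemma norm_kphi_ge:
  assumes m: "even m" "m \<ge> 2" and l: "l > 0" "1 \<le> l * Y" and u: "u \<ge> 0"
  shows "kmass l m Y * (1 - 2 * u / l - 10 * pi * m / 2 ^ m) \<le> norm (kphi l m Y u)"
proof -
  have Y: "Y > 0" using l zero_less_mult_pos[of l Y] by linarith
  have e1: "norm (1 - exp (- of_real u * (\<i> * of_real v))) \<le> u * \<bar>v\<bar>" for v
  proof -
    have "norm (1 - exp (- of_real u * (\<i> * of_real v))) = dist (exp (\<i> * of_real (- (u * v)))) 1"
      by (simp add: dist_norm norm_minus_commute mult_ac)
    also have "\<dots> = 2 * \<bar>sin (- (u * v) / 2)\<bar>" unfolding dist_norm by (rule dist_exp_i_1)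
    also have "\<dots> \<le> 2 * \<bar>- (u * v) / 2\<bar>" by (intro mult_left_mono abs_sin_x_le_abs_x) auto
    finally show ?thesis using u by (simp add: abs_mult)
  qed
  have "complex_of_real (kmass l m Y) = integral {-Y..Y} (\<lambda>v. of_real (kerr l m v))"
    unfolding kmass_def by (intro integral_of_real_complex [symmetric] integrable_continuous_real continuous_intros)
  hence eq0: "of_real (kmass l m Y) - kphi l m Y u
     = integral {-Y..Y} (\<lambda>v. of_real (kerr l m v) - exp (- of_real u * (\<i> * of_real v)) * kern l m (\<i> * of_real v))"
    unfolding kphi_def by (subst Henstock_Kurzweil_Integration.integral_diff)
       (auto intro!: integrable_continuous_real continuous_intros)
  have "norm (of_real (kmass l m Y) - kphi l m Y u) \<le> integral {-Y..Y} (\<lambda>v. 2 * u / l * kerr l m v + 10 / 2 ^ m * hump l (v - 0))"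
    unfolding eq0
  proof (rule integral_norm_bound_integral)
    fix v
    have eq: "norm (of_real (kerr l m v) - exp (- of_real u * (\<i> * of_real v)) * kern l m (\<i> * of_real v))
       = kerr l m v * norm (1 - exp (- of_real u * (\<i> * of_real v)))"
    proof -
      have "of_real (kerr l m v) - exp (- of_real u * (\<i> * of_real v)) * kern l m (\<i> * of_real v)
         = of_real (kerr l m v) * (1 - exp (- of_real u * (\<i> * of_real v)))"
        by (simp add: kern_imaginary algebra_simps)
      thus ?thesis using m by (simp only: norm_mult norm_of_real) (simp add: kerr_bounds)
    qed
    show "norm (of_real (kerr l m v) - exp (- of_real u * (\<i> * of_real v)) * kern l m (\<i> * of_real v))
      \<le> 2 * u / l * kerr l m v + 10 / 2 ^ m * hump l (v - 0)"
    proof (cases "\<bar>l * v\<bar> \<le> 2")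
      case True
      hence "u * \<bar>v\<bar> \<le> u * (2 / l)" using l u by (intro mult_left_mono) (auto simp: abs_mult field_simps)
      hence "kerr l m v * norm (1 - exp (- of_real u * (\<i> * of_real v))) \<le> kerr l m v * (2 * u / l)"
        using m by (intro mult_left_mono order.trans[OF e1]) (auto simp: kerr_bounds mult.commute)
      moreover have "10 / 2 ^ m * hump l (v - 0) \<ge> 0" using hump_pos(1)[of l v] by simp
      ultimately show ?thesis unfolding eq by (simp only: mult.commute)
    next
      case False
      have "norm (1 - exp (- of_real u * (\<i> * of_real v))) \<le> 1 + 1"
        by (rule norm_triangle_le_diff) simp
      hence "kerr l m v * norm (1 - exp (- of_real u * (\<i> * of_real v))) \<le> kerr l m v * 2"
        using m by (intro mult_left_mono) (auto simp: kerr_bounds)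
      also have "\<dots> \<le> (5 / 2 ^ m * hump l v) * 2" using False m by (intro mult_right_mono kerr_le_hump_far) auto
      finally have "kerr l m v * norm (1 - exp (- of_real u * (\<i> * of_real v))) \<le> 10 / 2 ^ m * hump l (v - 0)" by simp
      moreover have "2 * u / l * kerr l m v \<ge> 0" using u l m by (simp add: kerr_bounds)
      ultimately show ?thesis unfolding eq by linarith
    qed
  qed (intro integrable_continuous_real continuous_intros; simp add: l)+
  also have "\<dots> = 2 * u / l * kmass l m Y + 10 / 2 ^ m * integral {-Y..Y} (\<lambda>v. hump l (v - 0))"
    unfolding kmass_def
    by (subst integral_add) (use l in \<open>auto intro!: integrable_continuous_real continuous_intros\<close>)
  also have "\<dots> \<le> 2 * u / l * kmass l m Y + 10 / 2 ^ m * (pi * m * kmass l m Y)"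
  proof -
    \<comment> \<open>The far part is compared with the mass itself, at the cost of the factor m
      from \<open>kmass_ge\<close>.\<close>
    have "pi / l = pi * m * (1 / (l * m))" using m l by simp
    also have "\<dots> \<le> pi * m * kmass l m Y" using m l by (intro mult_left_mono kmass_ge) auto
    finally have "integral {-Y..Y} (\<lambda>v. hump l (v - 0)) \<le> pi * m * kmass l m Y"
      using integral_hump_le[OF l(1), of "-Y" Y 0] Y by linarith
    thus ?thesis by (intro add_left_mono mult_left_mono) auto
  qed
  finally have "norm (of_real (kmass l m Y) - kphi l m Y u) \<le> kmass l m Y * (2 * u / l + 10 * pi * m / 2 ^ m)"
    by (simp add: algebra_simps)
  moreover have "kmass l m Y \<le> norm (kphi l m Y u) + norm (of_real (kmass l m Y) - kphi l m Y u)"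
    using norm_triangle_ineq[of "kphi l m Y u" "of_real (kmass l m Y) - kphi l m Y u"] by simp
  ultimately show ?thesis by (simp add: algebra_simps)
qed

text \<open>By Cauchy's theorem the line of integration may be moved to the imaginary axis if \<open>u < l m\<close>,
  and far to the right, where the integral is negligible, if \<open>u \<ge> l m\<close>.\<close>

lemma kern_line_integral:
  assumes m: "even m" "m \<ge> 2" and l: "l > 0" "1 \<le> l * Y" and a: "0 < a" "a \<le> 1" "1 \<le> Y"
    and V: "A \<le> - Y" "Y \<le> B" and u: "u \<ge> 0"
  shows "norm (integral {A..B} (\<lambda>v. exp (- of_real u * Complex a v) * kern l m (Complex a v))
       - (if u < l * m then kphi l m Y u else 0)) \<le> 2 * (B - A) * exp ((l * m - u) * a) / (l * Y) ^ m"
proof -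
  define g where "g = (\<lambda>z. exp (- of_real u * z) * kern l m z)"
  have holo: "g holomorphic_on UNIV" unfolding g_def by (intro holomorphic_intros)
  have cont [continuous_intros]: "continuous_on S (\<lambda>v. g (Complex x v))" for S x
    by (intro continuous_on_compose2[OF holomorphic_on_imp_continuous_on[OF holo]])
       (auto simp: Complex_eq intro!: continuous_intros)
  have bound: "norm (g (Complex x v)) \<le> exp ((l * m - u) * x) / (l * Y) ^ m"
    if "x \<ge> 0" "Y \<le> norm (Complex x v)" for x v
  proof -
    have "norm (g (Complex x v)) \<le> exp (- u * x) * (exp (l * \<bar>Re (Complex x v)\<bar>) / (l * Y)) ^ m"
      unfolding g_def norm_mult using that l a by (intro mult_mono norm_kern_le) auto
    also have "\<dots> = exp ((l * m - u) * x) / (l * Y) ^ m"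
      using that by (simp add: power_divide exp_of_nat_mult[symmetric] exp_add[symmetric] algebra_simps)
    finally show ?thesis .
  qed
  have nIm: "Y \<le> norm (Complex x v)" if "v \<le> A \<or> B \<le> v" for x v
    using that V abs_Im_le_cmod[of "Complex x v"] by auto
  have Yp: "(l * Y) ^ m > 0" using l by simp
  show ?thesis
  proof (cases "u < l * m")
    case False
    \<comment> \<open>For u >= l m the bound decreases in x, so its value at x = a serves everywhere
      to the right. The abscissa a + Y is far enough, because |z| >= Y holds on that line for every
      ordinate.\<close>
    have 1: "norm (integral {A..B} (\<lambda>y. g (Complex (a + Y) y)) - integral {A..B} (\<lambda>y. g (Complex a y))) \<le> 2 * (a + Y - a) * (exp ((l * m - u) * a) / (l * Y) ^ m)"
    proof (rule rectangle_shift[where S = UNIV])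
      fix x y assume x: "a \<le> x" "y = A \<or> y = B"
      have "norm (g (Complex x y)) \<le> exp ((l * m - u) * x) / (l * Y) ^ m"
        using x a V by (intro bound nIm) auto
      also have "\<dots> \<le> exp ((l * m - u) * a) / (l * Y) ^ m"
        using x False Yp by (intro divide_right_mono) (auto intro!: mult_left_mono_neg)
      finally show "norm (g (Complex x y)) \<le> \<dots>" .
    qed (use a V holo in auto)
    have 2: "norm (integral {A..B} (\<lambda>y. g (Complex (a + Y) y))) \<le> exp ((l * m - u) * a) / (l * Y) ^ m * (B - A)"
    proof (rule integral_bound)
      fix y
      have "norm (g (Complex (a + Y) y)) \<le> exp ((l * m - u) * (a + Y)) / (l * Y) ^ m"
        using a abs_Re_le_cmod[of "Complex (a + Y) y"] by (intro bound) auto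
      also have "\<dots> \<le> exp ((l * m - u) * a) / (l * Y) ^ m"
        using False Yp a by (intro divide_right_mono) (auto intro!: mult_left_mono_neg)
      finally show "norm (g (Complex (a + Y) y)) \<le> \<dots>" .
    qed (use a V in \<open>auto intro!: continuous_intros\<close>)
    define E where "E = exp ((l * m - u) * a) / (l * Y) ^ m"
    have E0: "E \<ge> 0" using Yp by (simp add: E_def)
    have "norm (integral {A..B} (\<lambda>y. g (Complex a y))) \<le> 2 * Y * E + E * (B - A)"
      using 1 2 norm_triangle_sub[of "integral {A..B} (\<lambda>y. g (Complex a y))" "integral {A..B} (\<lambda>y. g (Complex (a + Y) y))"]
      by (simp add: E_def norm_minus_commute)
    also have "2 * Y * E \<le> (B - A) * E" using V E0 by (intro mult_right_mono) auto
    finally show ?thesis using False by (simp add: g_def E_def algebra_simps)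
  next
    case True
    define E where "E = exp ((l * m - u) * a) / (l * Y) ^ m"
    have E0: "E \<ge> 0" using Yp by (simp add: E_def)
    \<comment> \<open>For u < l m the bound increases in x. Hence E bounds g in the whole strip at
      distance at least Y from the origin, including the two tails of the imaginary axis beyond
      [-Y, Y].\<close>
    have bE: "norm (g (Complex x y)) \<le> E" if "0 \<le> x" "x \<le> a" "Y \<le> norm (Complex x y)" for x y
    proof -
      have "norm (g (Complex x y)) \<le> exp ((l * m - u) * x) / (l * Y) ^ m"
        using that by (intro bound) auto
      also have "\<dots> \<le> E" unfolding E_def
        using that True Yp by (intro divide_right_mono) (auto intro!: mult_left_mono)
      finally show ?thesis .
    qed
    have 1: "norm (integral {A..B} (\<lambda>y. g (Complex a y)) - integral {A..B} (\<lambda>y. g (Complex 0 y))) \<le> 2 * (a - 0) * E"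
    proof (rule rectangle_shift[where S = UNIV])
      fix x y assume x: "0 \<le> x" "x \<le> a" "y = A \<or> y = B"
      thus "norm (g (Complex x y)) \<le> E" using nIm by (intro bE) auto
    qed (use a V holo in auto)
    have int: "(\<lambda>y. g (Complex 0 y)) integrable_on {c..d}" for c d
      by (intro integrable_continuous_real continuous_intros)
    have "integral {A..B} (\<lambda>y. g (Complex 0 y)) = integral {A..-Y} (\<lambda>y. g (Complex 0 y)) +
      integral {-Y..Y} (\<lambda>y. g (Complex 0 y)) + integral {Y..B} (\<lambda>y. g (Complex 0 y))"
      using Henstock_Kurzweil_Integration.integral_combine[of A "-Y" B "\<lambda>y. g (Complex 0 y)"]
        Henstock_Kurzweil_Integration.integral_combine[of "-Y" Y B "\<lambda>y. g (Complex 0 y)"] V a int by (simp add: add.assoc)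
    moreover have "norm (integral {A..-Y} (\<lambda>y. g (Complex 0 y))) \<le> E * (- Y - A)"
      using V a abs_Im_le_cmod by (intro integral_bound bE continuous_intros) (auto simp: cmod_def)
    moreover have "norm (integral {Y..B} (\<lambda>y. g (Complex 0 y))) \<le> E * (B - Y)"
      using V a abs_Im_le_cmod by (intro integral_bound bE continuous_intros) (auto simp: cmod_def)
    moreover have "integral {-Y..Y} (\<lambda>y. g (Complex 0 y)) = kphi l m Y u"
      by (simp add: kphi_def g_def Complex_eq)
    ultimately have "norm (integral {A..B} (\<lambda>y. g (Complex 0 y)) - kphi l m Y u) \<le> E * (- Y - A) + E * (B - Y)"
      using norm_triangle_ineq[of "integral {A..-Y} (\<lambda>y. g (Complex 0 y))" "integral {Y..B} (\<lambda>y. g (Complex 0 y))"]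
      by simp
    hence "norm (integral {A..B} (\<lambda>y. g (Complex a y)) - kphi l m Y u) \<le> 2 * a * E + E * (- Y - A) + E * (B - Y)"
      using 1 norm_triangle_ineq[of "integral {A..B} (\<lambda>y. g (Complex a y)) - integral {A..B} (\<lambda>y. g (Complex 0 y))"
          "integral {A..B} (\<lambda>y. g (Complex 0 y)) - kphi l m Y u"] by simp
    also have "\<dots> = (2 * a - 2 * Y + (B - A)) * E" by (simp add: algebra_simps)
    also have "\<dots> \<le> (2 * (B - A)) * E" using a V E0 by (intro mult_right_mono) auto
    finally show ?thesis using True by (simp add: g_def E_def)
  qed
qed

section \<open>Zeros and logarithmic derivatives in a disc\<close>

lemma norm_bound_on_cball_from_sphere:
  fixes f :: "complex \<Rightarrow> complex"
  assumes "f holomorphic_on ball c R'" "R < R'" "\<And>z. dist c z = R \<Longrightarrow> norm (f z) \<le> B" "z \<in> cball c R" "R > 0"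
  shows "norm (f z) \<le> B"
proof (rule maximum_modulus_frontier[of f "cball c R" B z])
  show "f holomorphic_on interior (cball c R)"
    by (rule holomorphic_on_subset[OF assms(1)]) (use assms in auto)
  show "continuous_on (closure (cball c R)) f"
    by (rule continuous_on_subset[OF holomorphic_on_imp_continuous_on[OF assms(1)]]) (use assms in auto)
  show "norm (f z) \<le> B" if "z \<in> frontier (cball c R)" for z
    using that assms by (auto simp: frontier_cball dist_commute)
qed (use assms in auto)

text \<open>Induction on Z, dividing out one point at a time. The factors already removed do not
  vanish at p, so the order of f at p is that of the current quotient; a point that is no zero has
  order 0 and contributes a trivial factor. The witness w excludes the zero function.\<close>

lemma holomorphic_divide_zeros:
  fixes f :: "complex \<Rightarrow> complex"
  assumes S: "open S" "connected S" and f: "f holomorphic_on S" and nz: "w \<in> S" "f w \<noteq> 0"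
    and fin: "finite Z" and sub: "Z \<subseteq> S"
  shows "\<exists>q. q holomorphic_on S \<and> (\<forall>z\<in>S. f z = (\<Prod>p\<in>Z. (z - p) ^ nat (zorder f p)) * q z) \<and> (\<forall>p\<in>Z. q p \<noteq> 0)"
  using fin sub
proof (induction Z)
  case empty thus ?case using f by auto
next
  case (insert p Z)
  then obtain q where q: "q holomorphic_on S" "\<And>z. z \<in> S \<Longrightarrow> f z = (\<Prod>p\<in>Z. (z - p) ^ nat (zorder f p)) * q z"
    "\<And>p. p \<in> Z \<Longrightarrow> q p \<noteq> 0" by auto
  have pS: "p \<in> S" using insert by auto
  let ?P = "\<lambda>z. \<Prod>p\<in>Z. (z - p) ^ nat (zorder f p)"
  have P0: "?P p \<noteq> 0" using insert by (auto simp: prod_zero_iff)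
  have qw: "q w \<noteq> 0" using q(2)[OF nz(1)] nz by auto
  show ?case
  proof (cases "q p = 0")
    case False
    have "zorder f p = 0"
      by (rule zorder_eqI[OF S(1) pS, of "\<lambda>z. ?P z * q z"]) (use q P0 False in \<open>auto intro!: holomorphic_intros\<close>)
    thus ?thesis using q False insert by (intro exI[of _ q]) auto
  next
    case True
    have "\<not> q constant_on S" using True qw pS nz unfolding constant_on_def by metis
    then obtain g r n where g: "0 < n" "0 < r" "ball p r \<subseteq> S" "g holomorphic_on ball p r"
      "\<And>w. w \<in> ball p r \<Longrightarrow> q w = (w - p) ^ n * g w" "\<And>w. w \<in> ball p r \<Longrightarrow> g w \<noteq> 0"
      using holomorphic_factor_zero_nonconstant[OF q(1) S pS True] by metis
    define h where "h = (\<lambda>z. if z = p then g p else q z / (z - p) ^ n)"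
    have hg: "h z = g z" if "z \<in> ball p r" for z using g(5)[OF that] by (auto simp: h_def)
    have h: "h holomorphic_on S"
    proof (rule no_isolated_singularity'[of "{p}"])
      show "h holomorphic_on (S - {p})"
      proof (rule holomorphic_transform)
        show "(\<lambda>z. q z / (z - p) ^ n) holomorphic_on S - {p}"
          by (intro holomorphic_intros holomorphic_on_subset[OF q(1)]) auto
      qed (auto simp: h_def)
      fix z assume "z \<in> {p}"
      hence z: "z = p" by simp
      have "isCont g p"
        using holomorphic_on_imp_continuous_on[OF g(4)] g(2) by (auto simp: continuous_on_eq_continuous_at)
      hence "(g \<longlongrightarrow> h p) (at p within S)"
        using hg[of p] g(2) by (simp add: isCont_def tendsto_within_subset[of _ _ _ UNIV])
      moreover have "eventually (\<lambda>z. g z = h z) (at p within S)"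
        using eventually_at_ball[OF g(2), of p S] by eventually_elim (use hg in auto)
      ultimately show "(h \<longlongrightarrow> h z) (at z within S)" unfolding z by (rule Lim_transform_eventually)
    qed (use S in auto)
    have qh: "q z = (z - p) ^ n * h z" if "z \<in> S" for z
      using True g(1) by (auto simp: h_def)
    have hp: "h p \<noteq> 0" using hg[of p] g(6)[of p] g(2) by auto
    have zo: "zorder f p = int n"
    proof (rule zorder_eqI[OF S(1) pS, of "\<lambda>z. ?P z * h z"])
      show "(\<lambda>z. ?P z * h z) holomorphic_on S" by (intro holomorphic_intros h)
      show "f z = ?P z * h z * (z - p) powi int n" if "z \<in> S" "z \<noteq> p" for z
        using q(2)[OF that(1)] qh[OF that(1)] by simp
    qed (use P0 hp in auto)
    have "h p' \<noteq> 0" if "p' \<in> insert p Z" for p'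
      using that hp q(3)[of p'] qh[of p'] insert.prems by auto
    moreover have "f z = (\<Prod>p\<in>insert p Z. (z - p) ^ nat (zorder f p)) * h z" if "z \<in> S" for z
      using q(2)[OF that] qh[OF that] insert zo by simp
    ultimately show ?thesis using h by blast
  qed
qed

lemma abs_less_imp_square_less: "\<bar>x\<bar> < y \<Longrightarrow> x\<^sup>2 < (y::real)\<^sup>2"
  by (metis abs_ge_zero power2_abs power_strict_mono pos2)

text \<open>A zero-free q has a logarithm, whose real part is bounded above by the growth of q. The
  Schwarz lemma turns this one-sided bound into a bound for its modulus on a smaller disc, and
  Cauchy's estimate into one for its derivative.\<close>

lemma borel_caratheodory_log_deriv:
  fixes q :: "complex \<Rightarrow> complex"
  assumes r: "r > 0" and q: "q holomorphic_on ball c r" and nz: "\<And>z. z \<in> ball c r \<Longrightarrow> q z \<noteq> 0"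
    and B: "B > 0" and le: "\<And>z. z \<in> ball c r \<Longrightarrow> norm (q z) \<le> exp B * norm (q c)"
    and z: "z \<in> cball c (r / 2)"
  shows "norm (deriv q z / q z) \<le> 12 * (2 * B + 1) / r"
proof -
  obtain L where L: "L holomorphic_on ball c r" "\<And>z. z \<in> ball c r \<Longrightarrow> q z = exp (L z)"
    using simply_connected_eq_holomorphic_log[of "ball c r"] convex_imp_simply_connected[of "ball c r"] q nz by auto
  have cb: "c \<in> ball c r" using r by simp
  have ReL: "Re (L z) - Re (L c) \<le> B" if "z \<in> ball c r" for z
  proof -
    have "exp (Re (L z)) \<le> exp (B + Re (L c))"
      using le[OF that] L(2)[OF that] L(2)[OF cb] by (simp add: exp_add)
    thus ?thesis by simp
  qed
  define M where "M = (\<lambda>u. L (c + of_real r * u) - L c)"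
  have inb: "c + of_real r * u \<in> ball c r" if "norm u < 1" for u
    using that r by (simp add: dist_norm norm_mult)
  have Mh: "M holomorphic_on ball 0 1"
  proof -
    have "(L \<circ> (\<lambda>u. c + of_real r * u)) holomorphic_on ball 0 1"
      by (rule holomorphic_on_compose_gen[OF _ L(1)]) (use inb in \<open>auto intro!: holomorphic_intros\<close>)
    thus ?thesis unfolding M_def o_def by (intro holomorphic_intros)
  qed
  have ReM: "Re (M u) \<le> B" if "norm u < 1" for u
    using ReL[OF inb[OF that]] by (simp add: M_def)
  \<comment> \<open>The Moebius map w / (2 B + 1 - w) sends the half-plane Re w < B + 1/2 onto the
    unit disc and fixes 0; the extra 1 makes the inequalities strict.\<close>
  define \<phi> where "\<phi> = (\<lambda>u. M u / (2 * B + 1 - M u))"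
  have B': "2 * of_real B + 1 - M u \<noteq> 0" if "norm u < 1" for u
  proof
    assume "2 * of_real B + 1 - M u = 0"
    hence "Re (2 * of_real B + 1 - M u) = 0" by (simp only: zero_complex.sel)
    thus False using ReM[OF that] B by simp
  qed
  have \<phi>: "norm (\<phi> u) < 1" if "norm u < 1" for u
  proof -
    have "(Re (M u))\<^sup>2 < (2 * B + 1 - Re (M u))\<^sup>2"
      using ReM[OF that] B by (intro abs_less_imp_square_less) auto
    hence "(norm (M u))\<^sup>2 < (norm (2 * of_real B + 1 - M u))\<^sup>2"
      by (simp add: cmod_power2)
    hence "norm (M u) < norm (2 * of_real B + 1 - M u)"
      by (rule power_less_imp_less_base) auto
    thus ?thesis by (simp add: \<phi>_def norm_divide divide_simps)
  qed
  have Mle: "norm (M u) \<le> 3 * (2 * B + 1)" if "norm u \<le> 3 / 4" for u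
  proof -
    have u1: "norm u < 1" using that by simp
    have "norm (\<phi> u) \<le> norm u"
    proof (rule Schwarz_Lemma(1))
      show "\<phi> holomorphic_on ball 0 1"
        unfolding \<phi>_def using B' by (intro holomorphic_intros Mh) auto
    qed (use u1 \<phi> in \<open>auto simp: \<phi>_def M_def\<close>)
    hence p: "norm (\<phi> u) \<le> 3/4" using that by simp
    have "M u = \<phi> u * (2 * B + 1 - M u)" using B'[OF u1] by (simp add: \<phi>_def)
    hence "norm (M u) = norm (\<phi> u) * norm (2 * B + 1 - M u)" by (metis norm_mult)
    also have "\<dots> \<le> 3/4 * (2 * B + 1 + norm (M u))"
      using B norm_triangle_ineq4[of "2 * of_real B + 1" "M u"] norm_triangle_ineq[of "2 * complex_of_real B" 1]
      by (intro mult_mono p) auto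
    finally show ?thesis by simp
  qed
  \<comment> \<open>The circle of radius r / 4 about z stays within 3 r / 4 of c, where the bound 3
    (2 B + 1) is available; dividing by r / 4 gives the constant 12.\<close>
  have "norm ((deriv ^^ 1) (\<lambda>w. L w - L c) z) \<le> fact 1 * (3 * (2 * B + 1)) / (r / 4) ^ 1"
  proof (rule Cauchy_inequality)
    have sub: "cball z (r/4) \<subseteq> ball c r"
    proof
      fix w assume "w \<in> cball z (r/4)"
      thus "w \<in> ball c r" using z r dist_triangle[of c w z] by auto
    qed
    show "(\<lambda>w. L w - L c) holomorphic_on ball z (r/4)"
      using sub by (intro holomorphic_intros holomorphic_on_subset[OF L(1)]) (auto simp: subset_iff)
    show "continuous_on (cball z (r/4)) (\<lambda>w. L w - L c)"
      using sub by (intro continuous_intros continuous_on_subset[OF holomorphic_on_imp_continuous_on[OF L(1)]])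
    fix w assume w: "norm (z - w) = r / 4"
    define u where "u = (w - c) / of_real r"
    have "norm (w - c) \<le> 3/4 * r"
      using z w norm_triangle_ineq[of "w - z" "z - c"] by (auto simp: dist_norm norm_minus_commute)
    hence "norm u \<le> 3/4" using r by (simp add: u_def norm_divide field_simps)
    from Mle[OF this] show "norm (L w - L c) \<le> 3 * (2 * B + 1)" using r by (simp add: M_def u_def)
  qed (use r in auto)
  moreover have "(deriv ^^ 1) (\<lambda>w. L w - L c) z = deriv q z / q z"
  proof -
    have zb: "z \<in> ball c r" using z r by auto
    have dL: "(L has_field_derivative deriv L z) (at z)"
      using holomorphic_derivI[OF L(1) _ zb] by simp
    have "((\<lambda>z. exp (L z)) has_field_derivative exp (L z) * deriv L z) (at z)"
      using dL by (auto intro!: derivative_eq_intros)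
    hence "(q has_field_derivative exp (L z) * deriv L z) (at z)"
      by (rule has_field_derivative_transform_within_open[OF _ open_ball zb]) (use L in auto)
    hence "deriv q z = q z * deriv L z" using L(2)[OF zb] by (simp add: DERIV_imp_deriv)
    moreover have "deriv (\<lambda>w. L w - L c) z = deriv L z"
      using dL by (intro DERIV_imp_deriv) (auto intro!: derivative_eq_intros)
    ultimately show ?thesis using nz[OF zb] by simp
  qed
  ultimately show ?thesis by simp
qed

lemma has_field_derivative_prod_powers:
  fixes z :: complex
  assumes "finite Z" "z \<notin> Z"
  shows "((\<lambda>z. \<Prod>p\<in>Z. (z - p) ^ n p) has_field_derivative
     (\<Prod>p\<in>Z. (z - p) ^ n p) * (\<Sum>p\<in>Z. of_nat (n p) / (z - p))) (at z)"
  using assms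
proof (induction Z)
  case (insert p Z)
  have "((\<lambda>z. (z - p) ^ n p) has_field_derivative (z - p) ^ n p * (of_nat (n p) / (z - p))) (at z)"
  proof (cases "n p")
    case (Suc k)
    have "((\<lambda>z. (z - p) ^ n p) has_field_derivative of_nat (Suc k) * (z - p) ^ k) (at z)"
      unfolding Suc by (rule derivative_eq_intros refl | simp)+
    thus ?thesis using insert.prems Suc by (simp add: mult.commute)
  qed auto
  from DERIV_mult[OF this insert.IH] insert show ?case by (simp add: algebra_simps)
qed auto

lemma ln_2_ge_half: "ln 2 \<ge> (1/2::real)"
proof -
  have "1 - inverse 2 \<le> ln (2::real)" using ln_add_one_self_le_self2[of "-1/2::real"] ln_inverse[of "2::real"] by (simp add: inverse_eq_divide)
  thus ?thesis by simp
qed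

text \<open>Jensen's inequality by hand. Divide f by the zeros in the disc of radius r: on the
  circle of radius 3 r each factor is at least 2 r, at the centre at most r, so each zero forces a
  factor 2 of growth. This bounds their number, and the quotient, which is zero-free in the disc of
  radius r and of controlled size, is fit for Borel-Caratheodory.\<close>

theorem local_zeros:
  fixes f :: "complex \<Rightarrow> complex"
  assumes r: "r > 0" "3 * r < R'" and f: "f holomorphic_on ball c R'" and nz: "f c \<noteq> 0"
    and M: "\<And>z. z \<in> cball c (3 * r) \<Longrightarrow> norm (f z) \<le> M"
  defines "Z \<equiv> {z \<in> cball c r. f z = 0}" and "B \<equiv> ln (M / norm (f c))"
  shows "finite Z" and "B \<ge> 0" and "real (\<Sum>p\<in>Z. nat (zorder f p)) \<le> 2 * B"
    and "\<And>z d. z \<in> cball c (r / 2) \<Longrightarrow> d > 0 \<Longrightarrow> (\<And>p. p \<in> Z \<Longrightarrow> norm (z - p) \<ge> d) \<Longrightarrow>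
       norm (deriv f z / f z) \<le> 2 * B / d + 12 * (2 * B + 3) / r"
proof -
  have cR: "c \<in> ball c R'" using r by simp
  have "norm (f c) \<le> M" using M[of c] r by simp
  moreover have "norm (f c) > 0" using nz by simp
  ultimately have M0: "M > 0" "M / norm (f c) \<ge> 1" by (linarith, simp)
  show B0: "B \<ge> 0" using M0 by (simp add: B_def)
  show fin: "finite Z"
  proof (cases "\<exists>z\<in>ball c R'. f z = 0")
    case True
    then obtain z where z: "z \<in> ball c R'" "f z = 0" by auto
    have "\<not> f constant_on ball c R'" using z nz cR unfolding constant_on_def by metis
    thus ?thesis unfolding Z_def using r
      by (intro holomorphic_compact_finite_zeros[OF f]) auto
  next
    case False
    hence "Z = {}" using r by (auto simp: Z_def subset_iff)
    thus ?thesis by simp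
  qed
  have sub: "Z \<subseteq> ball c R'" using r by (auto simp: Z_def)
  let ?n = "\<lambda>p. nat (zorder f p)"
  obtain q where q: "q holomorphic_on ball c R'" "\<And>z. z \<in> ball c R' \<Longrightarrow> f z = (\<Prod>p\<in>Z. (z - p) ^ ?n p) * q z"
    "\<And>p. p \<in> Z \<Longrightarrow> q p \<noteq> 0"
    using holomorphic_divide_zeros[OF open_ball connected_ball f cR nz fin sub] by blast
  define n where "n = (\<Sum>p\<in>Z. ?n p)"
  have qc: "norm (f c) / r ^ n \<le> norm (q c)"
  proof -
    have "norm (\<Prod>p\<in>Z. (c - p) ^ ?n p) \<le> (\<Prod>p\<in>Z. r ^ ?n p)"
      unfolding prod_norm[symmetric] norm_power
      by (intro prod_mono conjI power_mono) (auto simp: Z_def dist_norm)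
    also have "\<dots> = r ^ n" by (simp add: n_def power_sum)
    finally have "norm (f c) \<le> r ^ n * norm (q c)"
      using q(2)[OF cR] by (simp add: norm_mult mult_right_mono)
    thus ?thesis using r by (simp add: field_simps)
  qed
  have qle: "norm (q z) \<le> M / (2 * r) ^ n" if "z \<in> cball c (3 * r)" for z
  proof (rule norm_bound_on_cball_from_sphere[OF q(1) r(2) _ that])
    fix z assume z: "dist c z = 3 * r"
    have "(2 * r) ^ n = (\<Prod>p\<in>Z. (2 * r) ^ ?n p)" by (simp add: n_def power_sum)
    also have "\<dots> \<le> norm (\<Prod>p\<in>Z. (z - p) ^ ?n p)"
      unfolding prod_norm[symmetric] norm_power
    proof (intro prod_mono conjI power_mono)
      fix p assume "p \<in> Z"
      thus "2 * r \<le> norm (z - p)" using z dist_triangle[of c z p] by (auto simp: Z_def dist_norm norm_minus_commute)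
    qed (use r in auto)
    finally have "(2 * r) ^ n * norm (q z) \<le> norm (f z)"
      using q(2)[of z] z r by (simp add: norm_mult mult_right_mono)
    also have "\<dots> \<le> M" using z by (intro M) auto
    finally show "norm (q z) \<le> M / (2 * r) ^ n" using r by (simp add: field_simps)
  qed (use r in auto)
  have q0: "norm (q c) > 0" using qc nz r by (intro order.strict_trans2[OF _ qc]) auto
  have ratio: "norm (q z) \<le> exp B / 2 ^ n * norm (q c)" if "z \<in> cball c (3 * r)" for z
  proof -
    have "norm (q z) \<le> M / (2 * r) ^ n" by (rule qle[OF that])
    also have "\<dots> = (M / norm (f c)) / 2 ^ n * (norm (f c) / r ^ n)"
      using nz by (simp add: power_mult_distrib)
    also have "\<dots> \<le> (M / norm (f c)) / 2 ^ n * norm (q c)"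
      using M0 by (intro mult_left_mono qc) auto
    also have "M / norm (f c) = exp B" using M0 by (simp add: B_def)
    finally show ?thesis .
  qed
  have "2 ^ n \<le> exp B" using ratio[of c] q0 r by (simp add: field_simps)
  hence "ln (2 ^ n) \<le> ln (exp B)" by (intro ln_mono) auto
  hence "ln (2 ^ n) \<le> B" by simp
  hence nB: "n * ln 2 \<le> B" by (simp add: ln_realpow)
  have "ln 2 \<ge> (1/2::real)" using ln_2_ge_half .
  hence "n * (1/2) \<le> n * ln (2::real)" by (intro mult_left_mono) auto
  with nB show nB': "real (\<Sum>p\<in>Z. ?n p) \<le> 2 * B" by (simp add: n_def)
  fix z d assume z: "z \<in> cball c (r / 2)" and d: "d > 0" "\<And>p. p \<in> Z \<Longrightarrow> norm (z - p) \<ge> d"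
  have zR: "z \<in> ball c R'" using z r by auto
  have zZ: "z \<notin> Z" using d by force
  have qnz: "q w \<noteq> 0" if "w \<in> ball c r" for w
    using that q(2)[of w] q(3)[of w] r by (cases "w \<in> Z") (auto simp: Z_def)
  \<comment> \<open>Applied with B + 1, since B itself may be 0 while a strictly positive bound is
    required.\<close>
  have "norm (deriv q z / q z) \<le> 12 * (2 * (B + 1) + 1) / r"
  proof (rule borel_caratheodory_log_deriv[OF r(1) _ qnz _ _ z])
    show "q holomorphic_on ball c r" by (rule holomorphic_on_subset[OF q(1)]) (use r in auto)
    fix w assume w: "w \<in> ball c r"
    have "exp B / 2 ^ n \<le> exp (B + 1) / 1" by (intro frac_le) auto
    hence "exp B / 2 ^ n * norm (q c) \<le> exp (B + 1) * norm (q c)" by (intro mult_right_mono) auto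
    thus "norm (q w) \<le> exp (B + 1) * norm (q c)" using ratio[of w] w r by auto
  qed (use B0 in auto)
  moreover have "deriv f z / f z = (\<Sum>p\<in>Z. of_nat (?n p) / (z - p)) + deriv q z / q z"
  proof -
    have "(q has_field_derivative deriv q z) (at z)" by (rule holomorphic_derivI[OF q(1) open_ball zR])
    from DERIV_mult[OF has_field_derivative_prod_powers[OF fin zZ] this]
    have "((\<lambda>z. (\<Prod>p\<in>Z. (z - p) ^ ?n p) * q z) has_field_derivative
       (\<Prod>p\<in>Z. (z - p) ^ ?n p) * (\<Sum>p\<in>Z. of_nat (?n p) / (z - p)) * q z + deriv q z * (\<Prod>p\<in>Z. (z - p) ^ ?n p)) (at z)" .
    hence "(f has_field_derivative
       (\<Prod>p\<in>Z. (z - p) ^ ?n p) * (\<Sum>p\<in>Z. of_nat (?n p) / (z - p)) * q z + deriv q z * (\<Prod>p\<in>Z. (z - p) ^ ?n p)) (at z)"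
      by (rule has_field_derivative_transform_within_open[OF _ open_ball zR]) (use q in auto)
    hence "deriv f z = (\<Prod>p\<in>Z. (z - p) ^ ?n p) * (\<Sum>p\<in>Z. of_nat (?n p) / (z - p)) * q z + deriv q z * (\<Prod>p\<in>Z. (z - p) ^ ?n p)"
      by (rule DERIV_imp_deriv)
    moreover have "q z \<noteq> 0" using qnz[of z] z r by auto
    moreover have "(\<Prod>p\<in>Z. (z - p) ^ ?n p) \<noteq> 0" using zZ fin by (auto simp: prod_zero_iff)
    ultimately show ?thesis using q(2)[OF zR] by (simp add: field_simps)
  qed
  moreover have "norm (\<Sum>p\<in>Z. of_nat (?n p) / (z - p)) \<le> 2 * B / d"
  proof -
    have "norm (\<Sum>p\<in>Z. of_nat (?n p) / (z - p)) \<le> (\<Sum>p\<in>Z. real (?n p) / d)"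
      using d by (intro sum_norm_le) (auto simp: norm_divide intro!: frac_le)
    also have "\<dots> = real (\<Sum>p\<in>Z. ?n p) / d" by (simp add: sum_divide_distrib)
    also have "\<dots> \<le> 2 * B / d" using nB' d by (intro divide_right_mono) auto
    finally show ?thesis .
  qed
  moreover have "12 * (2 * (B + 1) + 1) / r = 12 * (2 * B + 3) / r" by simp
  ultimately show "norm (deriv f z / f z) \<le> 2 * B / d + 12 * (2 * B + 3) / r"
    unfolding \<open>deriv f z / f z = _\<close> using norm_triangle_ineq[of "\<Sum>p\<in>Z. of_nat (?n p) / (z - p)" "deriv q z / q z"] by linarith
qed

text \<open>Pigeonhole: the centres of n + 1 equal subintervals have pairwise distance at least 2 w,
  so no point of X comes within w of two of them, and n points cannot spoil them all.\<close>

lemma exists_separated_height: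
  fixes X :: "real set"
  assumes "finite X" "card X \<le> n"
  shows "\<exists>u\<in>{T..T+1}. \<forall>x\<in>X. 1 / (2 * (real n + 1)) \<le> \<bar>x - u\<bar>"
proof (rule ccontr)
  assume neg: "\<not> ?thesis"
  define w where "w = 1 / (2 * (real n + 1))"
  have w: "w > 0" "2 * (real n + 1) * w = 1" by (simp_all add: w_def)
  define u where "u = (\<lambda>i::nat. T + (2 * real i + 1) * w)"
  have uT: "u i \<in> {T..T+1}" if "i \<in> {0..n}" for i
  proof -
    have "(2 * real i + 1) * w \<le> (2 * (real n + 1)) * w" using that w by (intro mult_right_mono) auto
    thus ?thesis using w(1) unfolding w(2) by (auto simp: u_def)
  qed
  have "\<exists>x\<in>X. \<bar>x - u i\<bar> < w" if "i \<in> {0..n}" for i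
    using neg uT[OF that] by (auto simp: w_def not_le)
  then obtain g where g: "\<And>i. i \<in> {0..n} \<Longrightarrow> g i \<in> X \<and> \<bar>g i - u i\<bar> < w" by metis
  have "inj_on g {0..n}"
  proof (rule inj_onI, rule ccontr)
    fix i j assume ij: "i \<in> {0..n}" "j \<in> {0..n}" "g i = g j" "i \<noteq> j"
    have "\<bar>u i - u j\<bar> < 2 * w" using g[OF ij(1)] g[OF ij(2)] ij(3) by linarith
    moreover have "u i - u j = 2 * (real i - real j) * w" by (simp add: u_def algebra_simps)
    ultimately have "\<bar>real i - real j\<bar> * (2 * w) < 1 * (2 * w)" using w by (simp add: abs_mult mult_ac)
    hence "\<bar>real i - real j\<bar> < 1" using w by (subst (asm) mult_less_cancel_right_pos) auto
    thus False using ij(4) by linarith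
  qed
  hence "card {0..n} \<le> card X" using g assms by (intro card_inj_on_le[of g]) auto
  thus False using assms by simp
qed

section \<open>Gamma factors\<close>

text \<open>The second assumption gives Re z + k + y >= k + y / 2 with y = Im z, which bounds |z +
  k| from below even when Re z is negative. The series of reciprocal squares is then majorised by a
  telescoping one with sum 4 / (y - 2) <= 8 / y.\<close>

lemma norm_trigamma_le:
  fixes z :: complex
  assumes y: "Im z \<ge> 4" "Im z \<ge> - 2 * Re z"
  shows "norm (Polygamma 1 z) \<le> 8 / Im z"
proof -
  define y where "y = Im z"
  have y4: "y \<ge> 4" using y by (simp add: y_def)
  define f where "f = (\<lambda>k. 2 / (real k + y / 2 - 1))"
  have "z \<noteq> 0" using y by auto
  have sums: "(\<lambda>k. inverse ((z + of_nat k) ^ Suc 1)) sums ((-1) ^ Suc 1 * Polygamma 1 z / fact 1)"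
    using \<open>z \<noteq> 0\<close> by (intro Polygamma_LIMSEQ) auto
  have f0: "f \<longlonglongrightarrow> 0" unfolding f_def by real_asymp
  have fs: "(\<lambda>k. f k - f (Suc k)) sums (f 0 - 0)" by (rule telescope_sums'[OF f0])
  have le: "norm (inverse ((z + of_nat k) ^ Suc 1)) \<le> f k - f (Suc k)" for k
  proof -
    define u where "u = real k + y / 2"
    have u: "u \<ge> 2" using y4 by (simp add: u_def)
    have "u \<le> (Re z + real k) + y" using y by (simp add: u_def y_def)
    hence "u\<^sup>2 \<le> ((Re z + real k) + y)\<^sup>2" using u by (intro power_mono) auto
    also have "\<dots> \<le> 2 * ((Re z + real k)\<^sup>2 + y\<^sup>2)"
      using sum_squares_bound[of "Re z + real k" y] by (simp add: power2_sum)
    finally have "u\<^sup>2 / 2 \<le> (norm (z + of_nat k))\<^sup>2" by (simp add: cmod_power2 y_def)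
    hence "1 / (norm (z + of_nat k))\<^sup>2 \<le> 1 / (u\<^sup>2 / 2)"
      using u by (intro frac_le) auto
    moreover have "norm (inverse ((z + of_nat k) ^ Suc 1)) = 1 / (norm (z + of_nat k))\<^sup>2"
      by (simp add: norm_inverse norm_mult norm_power inverse_eq_divide power2_eq_square norm_divide)
    ultimately have "norm (inverse ((z + of_nat k) ^ Suc 1)) \<le> 1 / (u\<^sup>2 / 2)" by simp
    also have "\<dots> \<le> 2 / (u * (u - 1))" using u by (simp add: power2_eq_square) (intro divide_left_mono mult_left_mono mult_pos_pos; simp)
    also have "\<dots> = 2 / (u - 1) - 2 / u" using u by (simp add: field_simps)
    finally show ?thesis by (simp add: f_def u_def algebra_simps)
  qed
  have sf: "summable (\<lambda>k. f k - f (Suc k))" using fs by (rule sums_summable)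
  have sn: "summable (\<lambda>k. norm (inverse ((z + of_nat k) ^ Suc 1)))"
    by (rule summable_comparison_test[OF _ sf]) (use le in auto)
  have "norm (\<Sum>k. inverse ((z + of_nat k) ^ Suc 1)) \<le> (\<Sum>k. f k - f (Suc k))"
    by (rule order.trans[OF summable_norm[OF sn] suminf_le[OF le sn sf]])
  hence "norm (Polygamma 1 z) \<le> f 0" using sums fs by (simp add: sums_iff)
  also have "f 0 \<le> 8 / y" using y4 by (simp add: f_def field_simps)
  finally show ?thesis by (simp add: y_def)
qed

lemma Im_pos_notin_nonpos_Ints: "Im z > 0 \<Longrightarrow> z \<notin> \<int>\<^sub>\<le>\<^sub>0"
  by (auto elim!: nonpos_Ints_cases)

text \<open>Integrate the bound for the derivative upwards from a fixed height, where compactness of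
  the horizontal segment bounds the function.\<close>

lemma norm_digamma_le:
  assumes X: "X \<ge> 0"
  shows "\<exists>C\<ge>0. \<forall>z. \<bar>Re z\<bar> \<le> X \<longrightarrow> Im z \<ge> max 4 (2 * X) \<longrightarrow> norm (Digamma z) \<le> C + 8 * ln (Im z)"
proof -
  define y0 where "y0 = max 4 (2 * X)"
  have y0: "y0 \<ge> 4" "y0 \<ge> 2 * X" by (auto simp: y0_def)
  have "compact ((\<lambda>x. Digamma (Complex x y0)) ` {-X..X})"
    using y0 by (intro compact_continuous_image continuous_at_imp_continuous_on ballI isCont_Polygamma Im_pos_notin_nonpos_Ints)
       (auto simp: Complex_eq intro!: continuous_intros)
  then obtain C where C: "\<And>x. x \<in> {-X..X} \<Longrightarrow> norm (Digamma (Complex x y0)) \<le> C"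
    by (meson compact_imp_bounded bounded_iff imageI)
  have "norm (Digamma z) \<le> max C 0 + 8 * ln (Im z)" if z: "\<bar>Re z\<bar> \<le> X" "Im z \<ge> y0" for z
  proof -
    have *: "norm (Digamma (Complex (Re z) (Im z)) - Digamma (Complex (Re z) y0)) \<le> 8 * ln (Im z) - 8 * ln y0"
    proof (cases "Im z = y0")
      case False
      have der: "((\<lambda>y. Digamma (Complex (Re z) y)) has_vector_derivative \<i> * Polygamma 1 (Complex (Re z) y)) (at y)" if "y \<ge> y0" for y
      proof -
        have "(Digamma has_field_derivative Polygamma (Suc 0) (Complex (Re z) y)) (at (Complex (Re z) y))"
          using that y0 by (intro has_field_derivative_Polygamma Im_pos_notin_nonpos_Ints) auto
        moreover have "((\<lambda>y. Complex (Re z) y) has_vector_derivative \<i>) (at y)"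
          unfolding Complex_eq by (auto intro!: derivative_eq_intros)
        ultimately show ?thesis using field_vector_diff_chain_at[of "\<lambda>y. Complex (Re z) y" \<i> y Digamma] by (simp add: o_def)
      qed
      show ?thesis
      proof (rule differentiable_bound_general[where f' = "\<lambda>y. \<i> * Polygamma 1 (Complex (Re z) y)" and \<phi>' = "\<lambda>y. 8 / y"])
        show "y0 < Im z" using False z by simp
        show "continuous_on {y0..Im z} (\<lambda>y. Digamma (Complex (Re z) y))"
          using der by (intro continuous_at_imp_continuous_on ballI) (auto intro: has_vector_derivative_continuous)
        show "continuous_on {y0..Im z} (\<lambda>y. 8 * ln y)" using y0 by (intro continuous_intros) auto
        show "((\<lambda>y. 8 * ln y) has_vector_derivative 8 / y) (at y)" if "y0 < y" for y
          using that y0 by (auto intro!: derivative_eq_intros simp: has_real_derivative_iff_has_vector_derivative[symmetric])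
        show "norm (\<i> * Polygamma 1 (Complex (Re z) y)) \<le> 8 / y" if "y0 < y" for y
          using that y0 z norm_trigamma_le[of "Complex (Re z) y"] by (simp add: norm_mult)
      qed (use der in auto)
    qed simp
    have "norm (Digamma z) \<le> norm (Digamma (Complex (Re z) y0)) + norm (Digamma (Complex (Re z) (Im z)) - Digamma (Complex (Re z) y0))"
      using norm_triangle_sub by (metis complex.collapse)
    also have "\<dots> \<le> C + (8 * ln (Im z) - 8 * ln y0)" using z * by (intro add_mono C) auto
    also have "\<dots> \<le> max C 0 + 8 * ln (Im z)"
    proof -
      have "ln y0 \<ge> 0" using y0 by simp
      thus ?thesis by linarith
    qed
    finally show ?thesis .
  qed
  thus ?thesis by (intro exI[of _ "max C 0"]) (auto simp: y0_def)
qed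

definition gamma_factor :: "real \<Rightarrow> nat \<Rightarrow> (nat \<Rightarrow> real) \<Rightarrow> (nat \<Rightarrow> complex) \<Rightarrow> complex \<Rightarrow> complex" where
  "gamma_factor Q N lam \<mu> s = of_real Q powr s * (\<Prod>j=1..N. Gamma (of_real (lam j) * s + \<mu> j))"

definition gamma_dlog :: "real \<Rightarrow> nat \<Rightarrow> (nat \<Rightarrow> real) \<Rightarrow> (nat \<Rightarrow> complex) \<Rightarrow> complex \<Rightarrow> complex" where
  "gamma_dlog Q N lam \<mu> s = of_real (ln Q) + (\<Sum>j=1..N. of_real (lam j) * Digamma (of_real (lam j) * s + \<mu> j))"

text \<open>For large Im s the height of the argument lies between half and twice l times Im s, so
  bounds in terms of Im z turn into bounds in terms of Im s. Since Im s >= 3 > e, additive constants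
  can be absorbed into the logarithm.\<close>

lemma digamma_affine_bounds:
  assumes l: "l > 0"
  shows "\<exists>C\<ge>0. \<exists>Y\<ge>3. \<forall>s. \<bar>Re s\<bar> \<le> 12 \<longrightarrow> Im s \<ge> Y \<longrightarrow> Im (of_real l * s + \<mu>) > 0 \<and>
     norm (Digamma (of_real l * s + \<mu>)) \<le> C * ln (Im s) \<and> norm (Polygamma 1 (of_real l * s + \<mu>)) \<le> C / Im s"
proof -
  define X where "X = 12 * l + \<bar>Re \<mu>\<bar>"
  have X0: "X \<ge> 0" using l by (simp add: X_def)
  obtain C where C: "C \<ge> 0" "\<And>z. \<bar>Re z\<bar> \<le> X \<Longrightarrow> Im z \<ge> max 4 (2 * X) \<Longrightarrow> norm (Digamma z) \<le> C + 8 * ln (Im z)"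
    using norm_digamma_le[OF X0] by blast
  define Y where "Y = max 3 (max (2 * \<bar>Im \<mu>\<bar> / l) (2 * max 4 (2 * X) / l))"
  define C' where "C' = C + 8 * (\<bar>ln (2 * l)\<bar> + 1) + 16 / l"
  have "Im (of_real l * s + \<mu>) > 0 \<and> norm (Digamma (of_real l * s + \<mu>)) \<le> C' * ln (Im s) \<and> norm (Polygamma 1 (of_real l * s + \<mu>)) \<le> C' / Im s"
    if s: "\<bar>Re s\<bar> \<le> 12" "Im s \<ge> Y" for s
  proof -
    define z where "z = of_real l * s + \<mu>"
    define t where "t = Im s"
    have t: "t \<ge> 3" "t \<ge> 2 * \<bar>Im \<mu>\<bar> / l" "t \<ge> 2 * max 4 (2 * X) / l" using s by (auto simp: Y_def t_def)
    have zr: "\<bar>Re z\<bar> \<le> X"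
    proof -
      have "\<bar>Re z\<bar> \<le> l * \<bar>Re s\<bar> + \<bar>Re \<mu>\<bar>" using l by (simp add: z_def abs_mult order.trans[OF abs_triangle_ineq])
      also have "l * \<bar>Re s\<bar> \<le> l * 12" using l s by (intro mult_left_mono) auto
      finally show ?thesis by (simp add: X_def mult.commute)
    qed
    have Imz: "Im z = l * t + Im \<mu>" by (simp add: z_def t_def)
    have lt: "2 * \<bar>Im \<mu>\<bar> \<le> l * t" "2 * max 4 (2 * X) \<le> l * t" using t l by (auto simp: field_simps)
    have z1: "l * t / 2 \<le> Im z" "Im z \<le> 2 * l * t" using lt l t unfolding Imz by (auto simp: abs_le_iff; linarith)+
    have z2: "Im z \<ge> max 4 (2 * X)" using z1 lt by linarith
    have ln1: "1 \<le> ln t" using t exp_le by (subst ln_ge_iff) auto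
    have "norm (Digamma z) \<le> C + 8 * ln (Im z)" by (rule C(2)[OF zr z2])
    also have "ln (Im z) \<le> ln (2 * l * t)" using z1 z2 by (intro ln_mono) auto
    also have "\<dots> = ln (2 * l) + ln t" using l t by (simp add: ln_mult)
    also have "\<dots> \<le> \<bar>ln (2 * l)\<bar> * ln t + ln t"
      using mult_left_mono[OF ln1, of "\<bar>ln (2*l)\<bar>"] by auto
    finally have "norm (Digamma z) \<le> C * 1 + 8 * (\<bar>ln (2 * l)\<bar> * ln t + ln t)" by simp
    also have "C * 1 \<le> C * ln t" using C ln1 by (intro mult_left_mono) auto
    also have "C * ln t + 8 * (\<bar>ln (2 * l)\<bar> * ln t + ln t) \<le> C' * ln t"
      using l ln1 by (simp add: C'_def algebra_simps)
    finally have 1: "norm (Digamma z) \<le> C' * ln t" by simp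
    have "norm (Polygamma 1 z) \<le> 8 / Im z" using z2 zr by (intro norm_trigamma_le) auto
    also have "\<dots> \<le> 8 / (l * t / 2)" using z1 z2 l t by (intro divide_left_mono mult_pos_pos) auto
    also have "\<dots> = (16 / l) / t" by simp
    also have "\<dots> \<le> C' / t" using C l t by (intro divide_right_mono) (auto simp: C'_def)
    finally show ?thesis using 1 z2 by (simp add: z_def t_def)
  qed
  moreover have "C' \<ge> 0" "Y \<ge> 3" using C l by (auto simp: C'_def Y_def)
  ultimately show ?thesis by blast
qed

text \<open>The only information of Stirling type that is used, by induction on the number of
  factors. The strip of half-width 12 is wide enough to contain the image of |Re s| < 11 under
  reflection in the critical line.\<close>

lemma gamma_factor_bounds:
  assumes Q: "Q > 0" and lam: "\<forall>j\<in>{1..N}. lam j > 0"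
  shows "\<exists>C\<ge>0. \<exists>Y\<ge>3. \<forall>s. \<bar>Re s\<bar> \<le> 12 \<longrightarrow> Im s \<ge> Y \<longrightarrow>
     gamma_factor Q N lam \<mu> s \<noteq> 0 \<and>
     (gamma_factor Q N lam \<mu> has_field_derivative gamma_dlog Q N lam \<mu> s * gamma_factor Q N lam \<mu> s) (at s) \<and>
     norm (gamma_dlog Q N lam \<mu> s) \<le> C * ln (Im s) \<and>
     (\<exists>d. (gamma_dlog Q N lam \<mu> has_field_derivative d) (at s) \<and> norm d \<le> C / Im s)"
  using lam
proof (induction N)
  case 0
  have "gamma_factor Q 0 lam \<mu> s \<noteq> 0 \<and>
     (gamma_factor Q 0 lam \<mu> has_field_derivative gamma_dlog Q 0 lam \<mu> s * gamma_factor Q 0 lam \<mu> s) (at s) \<and>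
     norm (gamma_dlog Q 0 lam \<mu> s) \<le> \<bar>ln Q\<bar> * ln (Im s) \<and>
     (\<exists>d. (gamma_dlog Q 0 lam \<mu> has_field_derivative d) (at s) \<and> norm d \<le> \<bar>ln Q\<bar> / Im s)" if "Im s \<ge> 3" for s
  proof -
    have 1: "((\<lambda>s. of_real Q powr s) has_field_derivative of_real (ln Q) * of_real Q powr s) (at s)"
      using Q has_field_derivative_powr_right[of "of_real Q" s] by (simp add: Ln_of_real)
    have ln1: "1 \<le> ln (Im s)" using that exp_le by (subst ln_ge_iff) auto
    have 2: "\<bar>ln Q\<bar> \<le> \<bar>ln Q\<bar> * ln (Im s)" using mult_left_mono[OF ln1, of "\<bar>ln Q\<bar>"] by simp
    have 3: "((\<lambda>s. of_real (ln Q)) has_field_derivative 0) (at s)" by simp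
    show ?thesis
      unfolding gamma_factor_def[abs_def] gamma_dlog_def[abs_def] using 1 2 3 Q that by (auto intro!: exI[of _ 0])
  qed
  thus ?case by (intro exI[of _ "\<bar>ln Q\<bar>"] exI[of _ "3::real"] conjI) auto
next
  case (Suc N)
  let ?G = "gamma_factor Q N lam \<mu>" and ?L = "gamma_dlog Q N lam \<mu>"
  let ?z = "\<lambda>s. of_real (lam (Suc N)) * s + \<mu> (Suc N)"
  have "\<exists>C\<ge>0. \<exists>Y\<ge>3. \<forall>s. \<bar>Re s\<bar> \<le> 12 \<longrightarrow> Im s \<ge> Y \<longrightarrow> ?G s \<noteq> 0 \<and> (?G has_field_derivative ?L s * ?G s) (at s) \<and>
     norm (?L s) \<le> C * ln (Im s) \<and> (\<exists>d. (?L has_field_derivative d) (at s) \<and> norm d \<le> C / Im s)"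
    by (rule Suc.IH) (use Suc.prems in simp)
  then obtain C Y where C: "C \<ge> 0" "Y \<ge> 3" and IH: "\<forall>s. \<bar>Re s\<bar> \<le> 12 \<longrightarrow> Im s \<ge> Y \<longrightarrow>
     ?G s \<noteq> 0 \<and> (?G has_field_derivative ?L s * ?G s) (at s) \<and>
     norm (?L s) \<le> C * ln (Im s) \<and> (\<exists>d. (?L has_field_derivative d) (at s) \<and> norm d \<le> C / Im s)"
    by blast
  define l where "l = lam (Suc N)"
  have l: "l > 0" using Suc.prems by (simp add: l_def)
  obtain C1 Y1 where C1: "C1 \<ge> 0" "Y1 \<ge> 3" and D: "\<forall>s. \<bar>Re s\<bar> \<le> 12 \<longrightarrow> Im s \<ge> Y1 \<longrightarrow> Im (?z s) > 0 \<and>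
     norm (Digamma (?z s)) \<le> C1 * ln (Im s) \<and> norm (Polygamma 1 (?z s)) \<le> C1 / Im s"
    using digamma_affine_bounds[OF l, of "\<mu> (Suc N)"] unfolding l_def by blast
  have G: "gamma_factor Q (Suc N) lam \<mu> = (\<lambda>s. ?G s * Gamma (?z s))"
    by (simp add: gamma_factor_def fun_eq_iff mult_ac)
  have L: "gamma_dlog Q (Suc N) lam \<mu> = (\<lambda>s. ?L s + of_real l * Digamma (?z s))"
    by (simp add: gamma_dlog_def fun_eq_iff l_def)
  define C2 where "C2 = C + (l + l\<^sup>2) * C1"
  have "gamma_factor Q (Suc N) lam \<mu> s \<noteq> 0 \<and>
     (gamma_factor Q (Suc N) lam \<mu> has_field_derivative gamma_dlog Q (Suc N) lam \<mu> s * gamma_factor Q (Suc N) lam \<mu> s) (at s) \<and>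
     norm (gamma_dlog Q (Suc N) lam \<mu> s) \<le> C2 * ln (Im s) \<and>
     (\<exists>d. (gamma_dlog Q (Suc N) lam \<mu> has_field_derivative d) (at s) \<and> norm d \<le> C2 / Im s)"
    if s: "\<bar>Re s\<bar> \<le> 12" "Im s \<ge> max Y Y1" for s
  proof -
    have I: "?G s \<noteq> 0" "(?G has_field_derivative ?L s * ?G s) (at s)" "norm (?L s) \<le> C * ln (Im s)"
        "\<exists>d. (?L has_field_derivative d) (at s) \<and> norm d \<le> C / Im s"
      using IH s by auto
    have D': "Im (?z s) > 0" "norm (Digamma (?z s)) \<le> C1 * ln (Im s)" "norm (Polygamma 1 (?z s)) \<le> C1 / Im s"
      using D s by auto
    have z: "?z s \<notin> \<int>\<^sub>\<le>\<^sub>0" by (rule Im_pos_notin_nonpos_Ints[OF D'(1)])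
    have t: "Im s \<ge> 3" using s C by auto
    have ln0: "ln (Im s) \<ge> 0" using t by simp
    have 1: "gamma_factor Q (Suc N) lam \<mu> s \<noteq> 0" using I(1) z by (auto simp: G Gamma_eq_zero_iff)
    have dz: "(?z has_field_derivative of_real l) (at s)"
      by (auto intro!: derivative_eq_intros simp: l_def)
    have dG: "((\<lambda>s. Gamma (?z s)) has_field_derivative (Gamma (?z s) * Digamma (?z s)) * of_real l) (at s)"
      by (rule DERIV_chain2[OF has_field_derivative_Gamma[OF z] dz])
    have "((\<lambda>s. ?G s * Gamma (?z s)) has_field_derivative ?L s * ?G s * Gamma (?z s) + (Gamma (?z s) * Digamma (?z s)) * of_real l * ?G s) (at s)"
      by (rule DERIV_mult[OF I(2) dG])
    hence 2: "(gamma_factor Q (Suc N) lam \<mu> has_field_derivative gamma_dlog Q (Suc N) lam \<mu> s * gamma_factor Q (Suc N) lam \<mu> s) (at s)"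
      unfolding G L by (simp add: algebra_simps)
    have "norm (gamma_dlog Q (Suc N) lam \<mu> s) \<le> norm (?L s) + l * norm (Digamma (?z s))"
      unfolding L using l norm_triangle_ineq[of "?L s" "of_real l * Digamma (?z s)"] by (simp add: norm_mult)
    also have "\<dots> \<le> C * ln (Im s) + l * (C1 * ln (Im s))"
      using l by (intro add_mono mult_left_mono I D') auto
    also have "\<dots> \<le> C2 * ln (Im s)" using l C1 ln0 by (simp add: C2_def algebra_simps)
    finally have 3: "norm (gamma_dlog Q (Suc N) lam \<mu> s) \<le> C2 * ln (Im s)" .
    obtain d where d: "(?L has_field_derivative d) (at s)" "norm d \<le> C / Im s" using I(4) by blast
    have "((\<lambda>s. Digamma (?z s)) has_field_derivative Polygamma (Suc 0) (?z s) * of_real l) (at s)"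
      by (rule DERIV_chain2[OF has_field_derivative_Polygamma[OF z] dz])
    from DERIV_add[OF d(1) DERIV_cmult[OF this, of "of_real l"]]
    have 4: "(gamma_dlog Q (Suc N) lam \<mu> has_field_derivative d + of_real l * (Polygamma (Suc 0) (?z s) * of_real l)) (at s)"
      unfolding L .
    have "norm (d + of_real l * (Polygamma (Suc 0) (?z s) * of_real l)) \<le> norm d + l\<^sup>2 * norm (Polygamma 1 (?z s))"
      using l norm_triangle_ineq[of d "of_real l * (Polygamma (Suc 0) (?z s) * of_real l)"] by (simp add: norm_mult power2_eq_square mult_ac)
    also have "\<dots> \<le> C / Im s + l\<^sup>2 * (C1 / Im s)"
      by (intro add_mono mult_left_mono d D') auto
    also have "\<dots> \<le> C2 / Im s" using l C1 t by (simp add: C2_def field_simps)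
    finally show ?thesis using 1 2 3 4 by blast
  qed
  moreover have "C2 \<ge> 0" "max Y Y1 \<ge> 3" using C C1 l by (auto simp: C2_def)
  ultimately show ?case by blast
qed

section \<open>Growth in a half-strip\<close>

text \<open>|F|^2 exp (-2 K x) has nonpositive derivative in x. The square is used because the
  modulus itself need not be differentiable at zeros of F. It serves to compare Gamma factors at two
  abscissas without an asymptotic formula.\<close>

lemma horizontal_gronwall:
  fixes F F' :: "complex \<Rightarrow> complex"
  assumes ab: "a \<le> b"
    and der: "\<And>x. a \<le> x \<Longrightarrow> x \<le> b \<Longrightarrow> (F has_field_derivative F' (Complex x t)) (at (Complex x t))"
    and bd: "\<And>x. a \<le> x \<Longrightarrow> x \<le> b \<Longrightarrow> norm (F' (Complex x t)) \<le> K * norm (F (Complex x t))"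
  shows "norm (F (Complex b t)) \<le> exp (K * (b - a)) * norm (F (Complex a t))"
proof -
  define u where "u = (\<lambda>x. ((Re (F (Complex x t)))\<^sup>2 + (Im (F (Complex x t)))\<^sup>2) * exp (- 2 * K * x))"
  have "u b \<le> u a"
  proof (rule DERIV_nonpos_imp_nonincreasing[OF ab])
    fix x assume x: "a \<le> x" "x \<le> b"
    define g g' where "g = F (Complex x t)" and "g' = F' (Complex x t)"
    have "((\<lambda>x. Complex x t) has_vector_derivative 1) (at x)"
      unfolding Complex_eq by (auto intro!: derivative_eq_intros)
    from field_vector_diff_chain_at[OF this der[OF x]]
    have v: "((\<lambda>x. F (Complex x t)) has_vector_derivative g') (at x)" by (simp add: o_def g'_def)
    have re: "((\<lambda>x. Re (F (Complex x t))) has_real_derivative Re g') (at x)"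
      and im: "((\<lambda>x. Im (F (Complex x t))) has_real_derivative Im g') (at x)"
      unfolding has_real_derivative_iff_has_vector_derivative
      by (rule bounded_linear.has_vector_derivative[OF bounded_linear_Re v] bounded_linear.has_vector_derivative[OF bounded_linear_Im v])+
    have "(u has_real_derivative (2 * Re g * Re g' + 2 * Im g * Im g' - 2 * K * ((Re g)\<^sup>2 + (Im g)\<^sup>2)) * exp (- 2 * K * x)) (at x)"
    proof -
      define r i where "r = (\<lambda>x. Re (F (Complex x t)))" and "i = (\<lambda>x. Im (F (Complex x t)))"
      have "(r has_real_derivative Re g') (at x)" "(i has_real_derivative Im g') (at x)"
        using re im by (simp_all add: r_def i_def)
      hence "((\<lambda>x. ((r x)\<^sup>2 + (i x)\<^sup>2) * exp (- 2 * K * x)) has_real_derivative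
         (2 * r x * Re g' + 2 * i x * Im g' - 2 * K * ((r x)\<^sup>2 + (i x)\<^sup>2)) * exp (- 2 * K * x)) (at x)"
        by (auto intro!: derivative_eq_intros simp: algebra_simps)
      thus ?thesis by (simp add: u_def r_def i_def g_def)
    qed
    moreover have "Re g * Re g' + Im g * Im g' \<le> K * ((Re g)\<^sup>2 + (Im g)\<^sup>2)"
    proof -
      have "Re g * Re g' + Im g * Im g' = Re (g' * cnj g)" by (simp add: algebra_simps)
      also have "\<dots> \<le> norm g' * norm g" using complex_Re_le_cmod[of "g' * cnj g"] by (simp add: norm_mult)
      also have "\<dots> \<le> K * norm g * norm g" using bd[OF x] by (intro mult_right_mono) (auto simp: g_def g'_def)
      also have "\<dots> = K * (norm g)\<^sup>2" by (simp add: power2_eq_square)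
      also have "\<dots> = K * ((Re g)\<^sup>2 + (Im g)\<^sup>2)" by (simp only: cmod_power2)
      finally show ?thesis .
    qed
    ultimately show "\<exists>y. (u has_real_derivative y) (at x) \<and> y \<le> 0"
      by (intro exI conjI) (assumption, rule mult_nonpos_nonneg, auto simp: algebra_simps)
  qed
  hence "(norm (F (Complex b t)))\<^sup>2 * exp (- 2 * K * b) \<le> (norm (F (Complex a t)))\<^sup>2 * exp (- 2 * K * a)"
    by (simp add: u_def cmod_power2)
  hence "(norm (F (Complex b t)))\<^sup>2 * exp (- 2 * K * b) * exp (2 * K * b) \<le> (norm (F (Complex a t)))\<^sup>2 * exp (- 2 * K * a) * exp (2 * K * b)"
    by (intro mult_right_mono) auto
  hence "(norm (F (Complex b t)))\<^sup>2 \<le> (norm (F (Complex a t)))\<^sup>2 * exp (2 * K * (b - a))"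
  proof -
    have "exp (- 2 * K * b) * exp (2 * K * b) = 1" "exp (- 2 * K * a) * exp (2 * K * b) = exp (2 * K * (b - a))"
      by (simp_all add: exp_add[symmetric] algebra_simps)
    thus ?thesis using \<open>_ * exp (2 * K * b) \<le> _\<close> by (simp only: mult.assoc mult_1_right)
  qed
  also have "\<dots> = (exp (K * (b - a)) * norm (F (Complex a t)))\<^sup>2"
    by (simp add: power_mult_distrib exp_double[symmetric] mult_ac)
  finally show ?thesis by (rule power2_le_imp_le) auto
qed

lemma exp_powr_decay:
  fixes C A c e b M :: real
  assumes "e > 0" "b > 0" "M > 0"
  shows "eventually (\<lambda>H. C * exp ((c + H) powr A - e * exp (b * H)) \<le> M) at_top"
proof -
  have 0: "((\<lambda>H. (c + H) powr (max A 1) / exp (b * H)) \<longlongrightarrow> 0) at_top"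
  proof -
    have "((\<lambda>x. x powr (max A 1) / exp (b * x)) \<longlongrightarrow> 0) at_top"
    proof (cases "A \<le> 1")
      case True thus ?thesis using assms by (simp add: max_def) real_asymp
    next
      case False thus ?thesis using assms by (simp add: max_def) real_asymp
    qed
    hence "((\<lambda>H. (c + H) powr (max A 1) / exp (b * (c + H))) \<longlongrightarrow> 0) at_top"
      by (rule filterlim_compose) real_asymp
    hence "((\<lambda>H. exp (b * c) * ((c + H) powr (max A 1) / exp (b * (c + H)))) \<longlongrightarrow> exp (b * c) * 0) at_top"
      by (intro tendsto_intros)
    thus ?thesis by (simp add: distrib_left exp_add)
  qed
  have 1: "eventually (\<lambda>H. (c + H) powr (max A 1) / exp (b * H) < e / 2) at_top"
    using order_tendstoD(2)[OF 0, of "e / 2"] assms by simp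
  have "((\<lambda>H. \<bar>C\<bar> * exp (- (e / 2) * exp (b * H))) \<longlongrightarrow> \<bar>C\<bar> * 0) at_top"
    by (rule tendsto_mult[OF tendsto_const]) (use assms in real_asymp)
  hence 2: "eventually (\<lambda>H. \<bar>C\<bar> * exp (- (e / 2) * exp (b * H)) < M) at_top"
    using order_tendstoD(2)[of _ "\<bar>C\<bar> * 0" at_top M] assms by simp
  show ?thesis
    using 1 2 eventually_ge_at_top[of "1 - c"]
  proof eventually_elim
    case (elim H)
    have "(c + H) powr A \<le> (c + H) powr (max A 1)" using elim by (intro powr_mono) auto
    also have "\<dots> \<le> e / 2 * exp (b * H)" using elim by (simp add: field_simps)
    finally have "exp ((c + H) powr A - e * exp (b * H)) \<le> exp (- (e / 2) * exp (b * H))" by simp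
    hence "\<bar>C\<bar> * exp ((c + H) powr A - e * exp (b * H)) \<le> \<bar>C\<bar> * exp (- (e / 2) * exp (b * H))"
      by (intro mult_left_mono) auto
    moreover have "C * exp ((c + H) powr A - e * exp (b * H)) \<le> \<bar>C\<bar> * exp ((c + H) powr A - e * exp (b * H))"
      by (intro mult_right_mono) auto
    ultimately show ?case using elim(2) by linarith
  qed
qed

text \<open>The auxiliary factor \<open>exp (- \<epsilon> cos (\<beta> (s - x\<^sub>m)))\<close> has modulus at most 1 in the strip and decays doubly
  exponentially there, since the real part of \<open>cos (u + i v)\<close> is \<open>cos u cosh v\<close>.\<close>

theorem phragmen_lindelof_half_strip:
  fixes f :: "complex \<Rightarrow> complex"
  assumes x: "x1 < x2" and S: "open S" "{s. x1 \<le> Re s \<and> Re s \<le> x2 \<and> y0 \<le> Im s} \<subseteq> S" and f: "f holomorphic_on S"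
    and growth: "\<And>s. x1 \<le> Re s \<Longrightarrow> Re s \<le> x2 \<Longrightarrow> y0 \<le> Im s \<Longrightarrow> norm (f s) \<le> C * exp (norm s powr A)"
    and y0: "y0 \<ge> 0" and M: "M > 0"
    and left: "\<And>y. y0 \<le> y \<Longrightarrow> norm (f (Complex x1 y)) \<le> M"
    and right: "\<And>y. y0 \<le> y \<Longrightarrow> norm (f (Complex x2 y)) \<le> M"
    and bottom: "\<And>x. x1 \<le> x \<Longrightarrow> x \<le> x2 \<Longrightarrow> norm (f (Complex x y0)) \<le> M"
    and s: "x1 \<le> Re s" "Re s \<le> x2" "y0 \<le> Im s"
  shows "norm (f s) \<le> M"
proof -
  \<comment> \<open>The frequency b = 1 / W is well below the critical value pi / W: across the
    strip the argument u of the cosine stays within [-1/2, 1/2], hence cos u >= 1/2.\<close>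
  define W xm b where "W = x2 - x1" and "xm = (x1 + x2) / 2" and "b = 1 / W"
  have W: "W > 0" "b > 0" using x by (auto simp: W_def b_def)
  have "C * exp (norm (Complex x1 y0) powr A) \<ge> 0"
    using x by (intro order.trans[OF norm_ge_zero growth]) auto
  hence C0: "C \<ge> 0" by (simp add: zero_le_mult_iff)
  define E :: "real \<Rightarrow> complex \<Rightarrow> complex" where "E = (\<lambda>e s. exp (- of_real e * cos (of_real b * (s - of_real xm))))"
  have ReE: "Re (cos (of_real b * (s - of_real xm))) \<ge> exp (b * \<bar>Im s\<bar>) / 4" if "x1 \<le> Re s" "Re s \<le> x2" for s
  proof -
    define u v where "u = b * (Re s - xm)" and "v = b * Im s"
    have eq: "of_real b * (s - of_real xm) = Complex u v" by (simp add: u_def v_def complex_eq_iff)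
    have "\<bar>Re s - xm\<bar> \<le> W / 2" using that by (auto simp: xm_def W_def abs_le_iff field_simps)
    hence "b * \<bar>Re s - xm\<bar> \<le> b * (W / 2)" using W by (intro mult_left_mono) auto
    hence "\<bar>u\<bar> \<le> 1/2" using W by (simp add: u_def abs_mult b_def)
    hence u2: "\<bar>u / 2\<bar> \<le> 1/4" by simp
    have "\<bar>sin (u / 2)\<bar> \<le> 1/4" using abs_sin_x_le_abs_x[of "u / 2"] u2 by linarith
    hence "(sin (u / 2))\<^sup>2 \<le> (1/4)\<^sup>2" by (intro abs_le_square_iff[THEN iffD1]) auto
    hence cu: "cos u \<ge> 1/2" using cos_double_sin[of "u / 2"] by (simp add: power_divide)
    have cv: "cosh v \<ge> exp \<bar>v\<bar> / 2" by (auto simp: cosh_field_def abs_if)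
    have "Re (cos (Complex u v)) = cos u * cosh v"
      by (simp add: Re_cos cosh_field_def algebra_simps)
    also have "\<dots> \<ge> (1/2) * (exp \<bar>v\<bar> / 2)" using cu cv by (intro mult_mono) auto
    finally show ?thesis using W unfolding eq by (simp add: v_def abs_mult)
  qed
  have nE: "norm (E e s) \<le> exp (- (e / 4) * exp (b * \<bar>Im s\<bar>))" if "e > 0" "x1 \<le> Re s" "Re s \<le> x2" for e s
    using mult_left_mono[OF ReE[OF that(2,3)], of e] that(1) by (simp add: E_def)
  have nE1: "norm (E e s) \<le> 1" if "e > 0" "x1 \<le> Re s" "Re s \<le> x2" for e s
  proof -
    have "exp (- (e / 4) * exp (b * \<bar>Im s\<bar>)) \<le> 1" using that(1) by simp
    thus ?thesis using nE[OF that] by linarith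
  qed
  have main: "norm (f s * E e s) \<le> M" if e: "e > 0" for e
  proof -
    define c where "c = \<bar>x1\<bar> + \<bar>x2\<bar>"
    \<comment> \<open>The top side is put so high that the doubly exponential decay of the factor
      beats the growth of f; the exponent is raised to \<open>max A 0\<close> because A may be
      negative.\<close>
    have "eventually (\<lambda>H. C * exp ((c + H) powr max A 0 - (e / 4) * exp (b * H)) \<le> M \<and> H > Im s \<and> H > y0) at_top"
      using e W M by (intro eventually_conj exp_powr_decay eventually_gt_at_top) auto
    then obtain H0 where H0: "\<And>H. H \<ge> H0 \<Longrightarrow> C * exp ((c + H) powr max A 0 - (e / 4) * exp (b * H)) \<le> M \<and> H > Im s \<and> H > y0"
      by (auto simp: eventually_at_top_linorder)
    define H where "H = max H0 1"
    have H: "C * exp ((c + H) powr max A 0 - (e / 4) * exp (b * H)) \<le> M" "H > Im s" "H > y0" "H \<ge> 1"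
      using H0[of H] by (auto simp: H_def)
    let ?R = "cbox (Complex x1 y0) (Complex x2 H)"
    have RS: "?R \<subseteq> S" using S by (auto simp: in_cbox_complex_iff)
    have hol: "(\<lambda>s. f s * E e s) holomorphic_on S" unfolding E_def by (intro holomorphic_intros f)
    show ?thesis
    proof (rule maximum_modulus_frontier[of "\<lambda>s. f s * E e s" ?R M s])
      show "(\<lambda>s. f s * E e s) holomorphic_on interior ?R"
        by (rule holomorphic_on_subset[OF hol order.trans[OF interior_subset RS]])
      show "continuous_on (closure ?R) (\<lambda>s. f s * E e s)"
        by (rule continuous_on_subset[OF holomorphic_on_imp_continuous_on[OF hol]]) (use RS in auto)
      show "s \<in> ?R" using s H by (auto simp: in_cbox_complex_iff)
      fix z assume "z \<in> frontier ?R"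
      hence z: "x1 \<le> Re z" "Re z \<le> x2" "y0 \<le> Im z" "Im z \<le> H"
        and fr: "Re z = x1 \<or> Re z = x2 \<or> Im z = y0 \<or> Im z = H"
        by (auto simp: frontier_cbox in_cbox_complex_iff in_box_complex_iff)
      show "norm (f z * E e z) \<le> M"
      proof (cases "Im z = H")
        case False
        hence "norm (f z) \<le> M" using fr z left[of "Im z"] right[of "Im z"] bottom[of "Re z"] by (metis complex.collapse)
        thus ?thesis using mult_mono[of "norm (f z)" M "norm (E e z)" 1] nE1[OF e z(1,2)] M by (simp add: norm_mult)
      next
        case True
        have "norm z \<le> c + H" using cmod_le[of z] z True y0 by (auto simp: c_def)
        hence "norm z powr A \<le> (c + H) powr max A 0"
        proof (cases "A \<ge> 0")
          case True thus ?thesis using \<open>norm z \<le> c + H\<close> by (simp add: max_def powr_mono2)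
        next
          case F: False
          have "norm z \<ge> 1" using abs_Im_le_cmod[of z] True H by auto
          hence "norm z powr A \<le> norm z powr 0" using F by (intro powr_mono) auto
          thus ?thesis using F \<open>norm z \<ge> 1\<close> \<open>norm z \<le> c + H\<close> by (simp add: max_def split: if_splits)
        qed
        hence "norm (f z) \<le> C * exp ((c + H) powr max A 0)"
          by (intro order.trans[OF growth[OF z(1,2,3)]] mult_left_mono C0) auto
        moreover have "norm (E e z) \<le> exp (- (e / 4) * exp (b * H))" using nE[OF e z(1,2)] True H by simp
        ultimately have "norm (f z * E e z) \<le> (C * exp ((c + H) powr max A 0)) * exp (- (e / 4) * exp (b * H))"
          unfolding norm_mult using C0 by (intro mult_mono) auto
        also have "\<dots> = C * exp ((c + H) powr max A 0 - (e / 4) * exp (b * H))"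
          by (simp add: mult.assoc exp_add[symmetric])
        finally show ?thesis using H by linarith
      qed
    qed auto
  qed
  \<comment> \<open>For fixed s the factor tends to 1 as its parameter tends to 0 through the values
    1 / (n + 1).\<close>
  define K where "K = norm (cos (of_real b * (s - of_real xm)))"
  have "norm (f s) \<le> M * exp (inverse (real (Suc n)) * K)" for n
  proof -
    define e where "e = inverse (real (Suc n))"
    have e: "e > 0" by (simp add: e_def)
    have "Re (cos (of_real b * (s - of_real xm))) \<le> K" unfolding K_def by (rule complex_Re_le_cmod)
    hence "exp (- e * K) \<le> norm (E e s)" using e by (simp add: E_def)
    hence "norm (f s) * exp (- e * K) \<le> norm (f s * E e s)" unfolding norm_mult by (intro mult_left_mono) auto
    also have "\<dots> \<le> M" by (rule main[OF e])
    finally show ?thesis unfolding e_def by (simp add: exp_minus field_simps)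
  qed
  moreover have "(\<lambda>n. M * exp (inverse (real (Suc n)) * K)) \<longlonglongrightarrow> M * exp (0 * K)"
    by (intro tendsto_intros LIMSEQ_inverse_real_of_nat)
  ultimately show ?thesis using LIMSEQ_le_const[of "\<lambda>n. M * exp (inverse (real (Suc n)) * K)" "M * exp (0 * K)" "norm (f s)"] by auto
qed

section \<open>Dirichlet series\<close>

text \<open>The index 0 may be included because 0 powr x = 0.\<close>

definition dser :: "(nat \<Rightarrow> complex) \<Rightarrow> complex \<Rightarrow> complex" where
  "dser a s = (\<Sum>n. a n * of_nat n powr (- s))"

definition dabs :: "(nat \<Rightarrow> complex) \<Rightarrow> real \<Rightarrow> bool" where
  "dabs a \<sigma> \<longleftrightarrow> summable (\<lambda>n. norm (a n) * real n powr (- \<sigma>))"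

text \<open>Dirichlet convolution. At 0 the set of divisors is infinite, so the value is 0 by the
  convention for sums.\<close>

definition dconv :: "(nat \<Rightarrow> complex) \<Rightarrow> (nat \<Rightarrow> complex) \<Rightarrow> nat \<Rightarrow> complex" where
  "dconv a b n = (\<Sum>d | d dvd n. a d * b (n div d))"

lemma norm_dterm: "norm (a n * of_nat n powr (- s)) = norm (a n) * real n powr (- Re s)" for a :: "nat \<Rightarrow> complex"
  by (cases "n = 0") (auto simp: norm_mult norm_powr_real_powr)

lemma powr_neg_mono: "\<sigma> \<le> \<tau> \<Longrightarrow> real n powr (- \<tau>) \<le> real n powr (- \<sigma>)"
  by (cases "n = 0") (auto intro: powr_mono)

lemma dabs_summable: "dabs a \<sigma> \<Longrightarrow> \<sigma> \<le> Re s \<Longrightarrow> summable (\<lambda>n. norm (a n * of_nat n powr (- s)))"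
  unfolding dabs_def
  by (rule summable_comparison_test[rotated]) (auto simp: norm_dterm intro!: mult_left_mono powr_neg_mono)

lemma dabs_mono: "dabs a \<sigma> \<Longrightarrow> \<sigma> \<le> \<tau> \<Longrightarrow> dabs a \<tau>"
  using dabs_summable[of a \<sigma> "of_real \<tau>"] by (simp add: norm_dterm dabs_def)

lemma dser_sums: "dabs a \<sigma> \<Longrightarrow> \<sigma> \<le> Re s \<Longrightarrow> (\<lambda>n. a n * of_nat n powr (- s)) sums dser a s"
  unfolding dser_def by (rule summable_sums[OF summable_norm_cancel[OF dabs_summable]])

lemma norm_dser_le:
  assumes "dabs a \<sigma>" "\<sigma> \<le> Re s"
  shows "norm (dser a s) \<le> (\<Sum>n. norm (a n) * real n powr (- \<sigma>))"
  unfolding dser_def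
  by (rule order.trans[OF summable_norm[OF dabs_summable[OF assms]] suminf_le[OF _ dabs_summable[OF assms]]])
     (use assms in \<open>auto simp: dabs_def norm_dterm intro!: mult_left_mono powr_neg_mono\<close>)

lemma dabs_ln:
  assumes "dabs a \<sigma>" "\<sigma> < \<tau>" shows "dabs (\<lambda>n. - of_real (ln (real n)) * a n) \<tau>"
  unfolding dabs_def
proof (rule summable_comparison_test)
  show "summable (\<lambda>n. norm (a n) * real n powr (- \<sigma>) / (\<tau> - \<sigma>))"
    using assms by (auto simp: dabs_def intro: summable_divide)
  have "norm (- of_real (ln (real n)) * a n) * real n powr (- \<tau>) \<le> norm (a n) * real n powr (- \<sigma>) / (\<tau> - \<sigma>)" for n
  proof (cases "n = 0")
    case False
    have "norm (- of_real (ln (real n)) * a n) * real n powr (- \<tau>) = ln (real n) * (norm (a n) * real n powr (- \<tau>))"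
      using False by (simp add: norm_mult)
    also have "\<dots> \<le> (real n powr (\<tau> - \<sigma>) / (\<tau> - \<sigma>)) * (norm (a n) * real n powr (- \<tau>))"
      using False assms by (intro mult_right_mono ln_powr_bound) auto
    also have "\<dots> = norm (a n) * real n powr (- \<sigma>) / (\<tau> - \<sigma>)"
      by (simp add: powr_diff powr_minus field_simps False)
    finally show ?thesis .
  qed auto
  thus "\<exists>N. \<forall>n\<ge>N. norm (norm (- of_real (ln (real n)) * a n) * real n powr (- \<tau>)) \<le> norm (a n) * real n powr (- \<sigma>) / (\<tau> - \<sigma>)"
    by simp
qed

lemma dser_has_field_derivative:
  assumes a: "dabs a \<sigma>" and s: "\<sigma> < Re s"
  shows "(dser a has_field_derivative dser (\<lambda>n. - of_real (ln (real n)) * a n) s) (at s)"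
proof -
  let ?S = "{s. \<sigma> < Re s}" and ?h = "\<lambda>n. norm (a n) * real n powr (- \<sigma>)"
  have "open ?S" by (rule open_halfspace_Re_gt)
  obtain g g' where g: "\<And>x. x \<in> ?S \<Longrightarrow> (\<lambda>n. a n * of_nat n powr (- x)) sums g x \<and>
      (\<lambda>n. (- of_real (ln (real n)) * a n) * of_nat n powr (- x)) sums g' x \<and> (g has_field_derivative g' x) (at x)"
  proof (rule series_and_derivative_comparison[of ?S ?h "\<lambda>n x. a n * of_nat n powr (- x)" "\<lambda>n x. (- of_real (ln (real n)) * a n) * of_nat n powr (- x)"])
    show "summable ?h" using a by (simp add: dabs_def)
    show "\<forall>\<^sub>F n in sequentially. \<forall>x\<in>?S. norm (a n * of_nat n powr (- x)) \<le> ?h n"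
      unfolding norm_dterm by (auto intro!: always_eventually mult_left_mono powr_neg_mono)
    show "((\<lambda>x. a n * of_nat n powr (- x)) has_field_derivative (- of_real (ln (real n)) * a n) * of_nat n powr (- x)) (at x)" for n x
    proof (cases "n = 0")
      case False
      hence "((\<lambda>x. of_nat n powr (- x)) has_field_derivative Ln (of_nat n) * of_nat n powr (- x) * (- 1)) (at x)"
        by (intro DERIV_chain2[OF has_field_derivative_powr_right]) (auto intro!: derivative_eq_intros)
      from DERIV_cmult[OF this, of "a n"] False show ?thesis by (simp add: Ln_of_nat mult_ac)
    qed auto
  qed (use \<open>open ?S\<close> in auto)
  have "g' s = dser (\<lambda>n. - of_real (ln (real n)) * a n) s"
    using g[of s] s unfolding dser_def by (auto dest: sums_unique)
  moreover have "(dser a has_field_derivative g' s) (at s)"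
  proof (rule has_field_derivative_transform_within_open[OF _ \<open>open ?S\<close>, of g])
    show "g x = dser a x" if "x \<in> ?S" for x
      using g[OF that] unfolding dser_def by (auto dest: sums_unique)
  qed (use g s in auto)
  ultimately show ?thesis by simp
qed

lemma has_sum_dser:
  assumes "dabs a \<sigma>" "\<sigma> \<le> Re s"
  shows "((\<lambda>n. a n * of_nat n powr (- s)) has_sum dser a s) {1..}"
proof -
  have "((\<lambda>n. a n * of_nat n powr (- s)) has_sum dser a s) UNIV"
    by (rule norm_summable_imp_has_sum[OF dabs_summable[OF assms] dser_sums[OF assms]])
  also have "?this \<longleftrightarrow> ?thesis"
    by (rule has_sum_cong_neutral) auto
  finally show ?thesis .
qed

lemma dabs_iff_abs_summable_on: "dabs a \<sigma> \<longleftrightarrow> (\<lambda>n. norm (a n) * real n powr (- \<sigma>)) summable_on {1..}"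
proof -
  have "dabs a \<sigma> \<longleftrightarrow> (\<lambda>n. norm (a n) * real n powr (- \<sigma>)) summable_on UNIV"
    unfolding dabs_def by (rule summable_on_UNIV_nonneg_real_iff[symmetric]) simp
  also have "\<dots> \<longleftrightarrow> (\<lambda>n. norm (a n) * real n powr (- \<sigma>)) summable_on {1..}"
    by (rule summable_on_cong_neutral) auto
  finally show ?thesis .
qed

lemma dser_eqI:
  assumes "((\<lambda>n. a n * of_nat n powr (- s)) has_sum S) {1..}" "dabs a \<sigma>" "\<sigma> \<le> Re s"
  shows "dser a s = S"
  using has_sum_dser[OF assms(2,3)] assms(1) by (rule has_sum_unique)

text \<open>Absolute convergence permits regrouping the double sum over pairs (d, e) by the product
  n = d e; the pairs correspond to (n, d) with d dividing n.\<close>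

lemma dser_dconv:
  assumes a: "dabs a \<sigma>" and b: "dabs b \<sigma>"
  shows "dabs (dconv a b) \<sigma>" and "\<sigma> \<le> Re s \<Longrightarrow> dser (dconv a b) s = dser a s * dser b s"
proof -
  have main: "((\<lambda>n. dconv a b n * of_nat n powr (- s)) has_sum (dser a s * dser b s)) {1..}
     \<and> (\<lambda>n. norm (dconv a b n * of_nat n powr (- s))) summable_on {1..}" if s: "\<sigma> \<le> Re s" for s
  proof -
    define f where "f = (\<lambda>n. a n * of_nat n powr (- s))"
    define g where "g = (\<lambda>n. b n * of_nat n powr (- s))"
    let ?S = "SIGMA n:{1..}. {d. d dvd (n::nat)}"
    have fa: "(\<lambda>n. norm (f n)) summable_on {1..}" and ga: "(\<lambda>n. norm (g n)) summable_on {1..}"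
      using dabs_mono[OF a s] dabs_mono[OF b s] by (simp_all add: f_def g_def norm_dterm dabs_iff_abs_summable_on)
    have fs: "(f has_sum dser a s) {1..}" and gs: "(g has_sum dser b s) {1..}"
      unfolding f_def g_def by (rule has_sum_dser[OF a s] has_sum_dser[OF b s])+
    have abs: "(\<lambda>x. norm (case x of (d,e) \<Rightarrow> f d * g e)) summable_on {1..} \<times> {1..}"
    proof (subst Infinite_Sum.abs_summable_on_Sigma_iff, intro conjI ballI)
      show "(\<lambda>e. norm (case (d, e) of (d, e) \<Rightarrow> f d * g e)) summable_on {1..}" for d
        unfolding prod.case norm_mult by (rule summable_on_cmult_right[OF ga])
      have "(\<lambda>d. norm (f d) * infsum (\<lambda>e. norm (g e)) {1..}) summable_on {1..}"
        by (rule summable_on_cmult_left[OF fa])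
      thus "(\<lambda>d. norm (\<Sum>\<^sub>\<infinity>e\<in>{1..}. norm (case (d, e) of (d, e) \<Rightarrow> f d * g e))) summable_on {1..}"
        unfolding prod.case norm_mult infsum_cmult_right' real_norm_def
        by (subst abs_of_nonneg) (auto intro!: mult_nonneg_nonneg infsum_nonneg)
    qed
    have sum1: "((\<lambda>(d,e). f d * g e) has_sum (dser a s * dser b s)) ({1..} \<times> {1..})"
    proof -
      have "((\<lambda>(d,e). f d * g e) has_sum (infsum (\<lambda>(d,e). f d * g e) ({1..} \<times> {1..}))) ({1..} \<times> {1..})"
        by (rule has_sum_infsum[OF Infinite_Sum.abs_summable_summable[OF abs]])
      moreover have "infsum (\<lambda>(d,e). f d * g e) ({1..} \<times> {1..}) = infsum (\<lambda>d. infsum (\<lambda>e. f d * g e) {1..}) {1..}"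
        using infsum_Sigma'_banach[of "\<lambda>d e. f d * g e" "{1..}" "\<lambda>_. {1..}"] Infinite_Sum.abs_summable_summable[OF abs] by simp
      moreover have "\<dots> = dser a s * dser b s"
        unfolding infsum_cmult_right' infsum_cmult_left' infsumI[OF fs] infsumI[OF gs] ..
      ultimately show ?thesis by simp
    qed
    have bij: "bij_betw (\<lambda>(n,d). (d, n div d)) ?S ({1..} \<times> {1..})"
    proof (rule bij_betwI[of _ _ _ "\<lambda>(d,e). (d * e, d)"])
      show "(\<lambda>(n,d). (d, n div d)) \<in> ?S \<rightarrow> {1..} \<times> {1..}"
      proof
        fix nd assume "nd \<in> ?S"
        then obtain n d where nd: "nd = (n, d)" "n \<ge> 1" "d dvd n" by auto
        then obtain e where "n = d * e" by auto
        with nd show "(case nd of (n, d) \<Rightarrow> (d, n div d)) \<in> {1..} \<times> {1..}" by (cases "d = 0"; cases "e = 0") auto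
      qed
    qed auto
    have eq: "(case (case nd of (n,d) \<Rightarrow> (d, n div d)) of (d, e) \<Rightarrow> f d * g e) = (case nd of (n,d) \<Rightarrow> a d * b (n div d) * of_nat n powr (- s))"
      if "nd \<in> ?S" for nd
    proof -
      obtain n d where nd: "nd = (n, d)" by force
      have "n = d * (n div d)" using that nd by auto
      hence "of_nat n powr (- s) = of_nat d powr (- s) * (of_nat (n div d) powr (- s) :: complex)"
        using powr_times_real[of "of_nat d" "of_nat (n div d)" "- s"] by (metis complex_Re_of_nat of_nat_0_le_iff Reals_of_nat of_nat_mult)
      thus ?thesis by (simp add: nd f_def g_def)
    qed
    have sum2: "((\<lambda>(n,d). a d * b (n div d) * of_nat n powr (- s)) has_sum (dser a s * dser b s)) ?S"
      using sum1
        has_sum_reindex_bij_betw[OF bij, of "\<lambda>(d,e). f d * g e" "dser a s * dser b s"]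
      by (intro iffD1[OF has_sum_cong[OF eq]]) simp_all
    have fin: "finite {d. d dvd n}" if "n \<in> {1..}" for n :: nat using that by simp
    have "((\<lambda>n. dconv a b n * of_nat n powr (- s)) has_sum (dser a s * dser b s)) {1..}"
    proof (rule has_sum_SigmaD[OF sum2])
      fix n :: nat assume "n \<in> {1..}"
      thus "((\<lambda>d. case (n, d) of (n, d) \<Rightarrow> a d * b (n div d) * of_nat n powr (- s)) has_sum dconv a b n * of_nat n powr (- s)) {d. d dvd n}"
        using fin[of n] by (auto simp: dconv_def sum_distrib_right intro!: has_sum_finiteI)
    qed
    moreover from this have "(\<lambda>n. dconv a b n * of_nat n powr (- s)) summable_on {1..}"
      by (auto simp: summable_on_def)
    ultimately show ?thesis by (intro conjI summable_on_iff_abs_summable_on_complex[THEN iffD1])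
  qed
  show *: "dabs (dconv a b) \<sigma>"
    using main[of "of_real \<sigma>"] by (simp add: norm_dterm dabs_iff_abs_summable_on)
  show "dser (dconv a b) s = dser a s * dser b s" if "\<sigma> \<le> Re s"
    using main[OF that] by (intro dser_eqI[OF _ * that]) auto
qed

text \<open>If all earlier coefficients vanish, the n-th term equals minus the tail. Multiplied by
  n^x at x = \<sigma> + k, the tail is at most a constant times (n / (n + 1))^k, which tends to 0
  with growing k.\<close>

lemma dser_eq_0_imp:
  assumes a: "dabs a \<sigma>" and z: "\<And>x. \<sigma> \<le> x \<Longrightarrow> dser a (of_real x) = 0" and "n \<ge> 1"
  shows "a n = 0"
  using \<open>n \<ge> 1\<close>
proof (induction n rule: less_induct)
  case (less n)
  define b where "b = (\<lambda>j. if j \<le> n then 0 else a j)"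
  define C where "C = (\<Sum>j. norm (b j) * real j powr (- \<sigma>))"
  have b: "dabs b \<sigma>" unfolding dabs_def
    by (rule summable_comparison_test[OF _ a[unfolded dabs_def]]) (auto simp: b_def)
  have "norm (a n) \<le> C * real n powr \<sigma> * (real n / (real n + 1)) ^ k" for k
  proof -
    let ?x = "\<sigma> + real k"
    have "(\<lambda>j. (if j = n then a n * of_nat n powr (- of_real ?x) else 0) + b j * of_nat j powr (- of_real ?x)) sums
        (a n * of_nat n powr (- of_real ?x) + dser b (of_real ?x))"
      by (intro sums_add sums_single dser_sums[OF b]) auto
    moreover have "(if j = n then a n * of_nat n powr (- of_real ?x) else 0) + b j * of_nat j powr (- of_real ?x) = a j * of_nat j powr (- of_real ?x)" for j
      using less.IH[of j] by (cases "j = 0"; cases j n rule: linorder_cases) (auto simp: b_def)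
    ultimately have "a n * of_nat n powr (- of_real ?x) + dser b (of_real ?x) = dser a (of_real ?x)"
      unfolding dser_def[of a] by (simp add: sums_unique)
    hence "a n * of_nat n powr (- of_real ?x) = - dser b (of_real ?x)" using z[of ?x] by (simp add: add_eq_0_iff)
    hence "norm (a n) * real n powr (- ?x) = norm (dser b (of_real ?x))"
      by (metis norm_dterm norm_minus_cancel Re_complex_of_real)
    also have "\<dots> \<le> (\<Sum>j. norm (b j * of_nat j powr (- of_real ?x)))"
      unfolding dser_def by (intro summable_norm dabs_summable[OF b]) auto
    also have "\<dots> \<le> (\<Sum>j. norm (b j) * real j powr (- \<sigma>) * (real n + 1) powr (- real k))"
    proof (rule suminf_le)
      fix j
      show "norm (b j * of_nat j powr (- of_real ?x)) \<le> norm (b j) * real j powr (- \<sigma>) * (real n + 1) powr (- real k)"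
      proof (cases "j \<le> n")
        case False
        have "norm (b j * of_nat j powr (- of_real ?x)) = norm (b j) * real j powr (- \<sigma>) * real j powr (- real k)"
          unfolding norm_dterm by (simp add: powr_diff powr_minus field_simps)
        also have "\<dots> \<le> norm (b j) * real j powr (- \<sigma>) * (real n + 1) powr (- real k)"
          using False by (intro mult_left_mono powr_mono2') auto
        finally show ?thesis .
      qed (auto simp: b_def)
      show "summable (\<lambda>j. norm (b j * of_nat j powr (- of_real ?x)))"
        by (rule dabs_summable[OF b]) simp
    qed (use b in \<open>auto intro!: summable_mult2 simp: dabs_def\<close>)
    also have "\<dots> = C * (real n + 1) powr (- real k)"
      unfolding C_def using b by (intro suminf_mult2[symmetric]) (simp add: dabs_def)
    finally have "norm (a n) * real n powr (- ?x) * real n powr ?x \<le> C * (real n + 1) powr (- real k) * real n powr ?x"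
      by (intro mult_right_mono) auto
    moreover have "norm (a n) * real n powr (- ?x) * real n powr ?x = norm (a n)"
      using less.prems by (simp add: mult.assoc powr_add[symmetric])
    moreover have "(real n + 1) powr (- real k) * real n powr ?x = real n powr \<sigma> * (real n / (real n + 1)) ^ k"
      using less.prems by (simp add: powr_add powr_minus powr_realpow power_divide field_simps)
    ultimately show ?thesis by (simp only: mult.assoc)
  qed
  moreover have "(\<lambda>k. C * real n powr \<sigma> * (real n / (real n + 1)) ^ k) \<longlonglongrightarrow> C * real n powr \<sigma> * 0"
    by (intro tendsto_mult tendsto_const LIMSEQ_realpow_zero) auto
  ultimately have "norm (a n) \<le> 0"
    using LIMSEQ_le_const[of "\<lambda>k. C * real n powr \<sigma> * (real n / (real n + 1)) ^ k" "C * real n powr \<sigma> * 0" "norm (a n)"] by simp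
  thus ?case by simp
qed

section \<open>Members of the Selberg class\<close>

lemma dabs_add: "dabs a \<sigma> \<Longrightarrow> dabs b \<sigma> \<Longrightarrow> dabs (\<lambda>n. a n + b n) \<sigma>"
  unfolding dabs_def
  by (rule summable_comparison_test[OF _ summable_add[of "\<lambda>n. norm (a n) * real n powr (- \<sigma>)" "\<lambda>n. norm (b n) * real n powr (- \<sigma>)"]])
     (auto simp: distrib_right[symmetric] intro!: exI[of _ 0] mult_right_mono norm_triangle_ineq)

lemma dser_add:
  assumes "dabs a \<sigma>" "dabs b \<sigma>" "\<sigma> \<le> Re s"
  shows "dser (\<lambda>n. a n + b n) s = dser a s + dser b s"
  using sums_unique[OF sums_add[OF dser_sums[OF assms(1,3)] dser_sums[OF assms(2,3)]]]
  by (simp add: dser_def distrib_right)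

lemma dabs_uminus [simp]: "dabs (\<lambda>n. - a n) \<sigma> \<longleftrightarrow> dabs a \<sigma>"
  by (simp add: dabs_def)

lemma dser_uminus:
  assumes "dabs a \<sigma>" "\<sigma> \<le> Re s"
  shows "dser (\<lambda>n. - a n) s = - dser a s"
  using sums_unique[OF sums_minus[OF dser_sums[OF assms]]] by (simp add: dser_def)

lemma bigo_nat_bound:
  fixes f :: "nat \<Rightarrow> complex"
  assumes "(\<lambda>n. norm (f n)) \<in> O(\<lambda>n. real n powr e)"
  shows "\<exists>C\<ge>0. \<forall>n\<ge>1. norm (f n) \<le> C * real n powr e"
proof -
  obtain c where c: "eventually (\<lambda>n. norm (norm (f n)) \<le> c * norm (real n powr e)) sequentially"
    using landau_o.bigE[OF assms] by blast
  then obtain n0 where n0: "\<And>n. n \<ge> n0 \<Longrightarrow> norm (f n) \<le> c * real n powr e"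
    by (auto simp: eventually_sequentially)
  define C where "C = \<bar>c\<bar> + (\<Sum>n<n0. norm (f n) / real n powr e)"
  have s0: "(\<Sum>n<n0. norm (f n) / real n powr e) \<ge> 0" by (intro sum_nonneg) auto
  have "norm (f n) \<le> C * real n powr e" if "n \<ge> 1" for n
  proof (cases "n < n0")
    case True
    have "norm (f n) / real n powr e \<le> (\<Sum>n<n0. norm (f n) / real n powr e)"
      using True by (intro member_le_sum) auto
    hence "norm (f n) / real n powr e \<le> C" by (simp add: C_def)
    thus ?thesis using that by (simp add: field_simps)
  next
    case False
    have "norm (f n) \<le> c * real n powr e" using n0 False by simp
    also have "\<dots> \<le> C * real n powr e" using s0 by (intro mult_right_mono) (auto simp: C_def)
    finally show ?thesis .
  qed
  moreover have "C \<ge> 0" using s0 by (simp add: C_def)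
  ultimately show ?thesis by blast
qed

text \<open>One choice of the coefficients and of the data of the functional equation, which
  membership in the class only asserts to exist.\<close>

locale selberg =
  fixes F :: "complex \<Rightarrow> complex" and a b :: "nat \<Rightarrow> complex"
    and Q :: real and N :: nat and lam :: "nat \<Rightarrow> real" and \<mu> :: "nat \<Rightarrow> complex" and w :: complex
  assumes dirichlet: "selberg_dirichlet F a" and continuation: "selberg_continuation F"
    and functional_eq: "selberg_functional_eq F Q N lam \<mu> w" and log_series: "selberg_log_series F b"
begin

lemma a_1: "a 1 = 1"
  using dirichlet by (simp add: selberg_dirichlet_def)

lemma a_bound: "\<epsilon> > 0 \<Longrightarrow> \<exists>C\<ge>0. \<forall>n\<ge>1. norm (a n) \<le> C * real n powr \<epsilon>"
  using dirichlet by (intro bigo_nat_bound) (auto simp: selberg_dirichlet_def)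

lemma has_sum_F: "Re s > 1 \<Longrightarrow> ((\<lambda>n. a n * of_nat n powr (- s)) has_sum F s) {1..}"
  using dirichlet by (simp add: selberg_dirichlet_def)

lemma dabs_a: assumes "\<sigma> > 1" shows "dabs a \<sigma>"
proof -
  have "(\<lambda>n. a n * of_nat n powr (- of_real \<sigma>)) summable_on {1..}"
    using has_sum_F[of "of_real \<sigma>"] assms has_sum_imp_summable by auto
  hence "(\<lambda>n. norm (a n * of_nat n powr (- of_real \<sigma>))) summable_on {1..}"
    by (rule summable_on_iff_abs_summable_on_complex[THEN iffD1])
  thus ?thesis by (simp add: norm_dterm dabs_iff_abs_summable_on)
qed

lemma F_eq_dser: assumes "Re s > 1" shows "F s = dser a s"
  by (rule dser_eqI[OF has_sum_F[OF assms] dabs_a[OF assms] order.refl, symmetric])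

text \<open>The coefficients of log F; those of -F'/F are \<open>bL\<close>.\<close>

definition bl :: "nat \<Rightarrow> complex" where "bl n = b n * mangoldt n / of_real (ln (real n))"
definition bL :: "nat \<Rightarrow> complex" where "bL n = b n * mangoldt n"

lemma has_sum_log:
  obtains l where "\<And>s. Re s > 1 \<Longrightarrow> exp (l s) = F s"
    "\<And>s. Re s > 1 \<Longrightarrow> ((\<lambda>n. bl n * of_nat n powr (- s)) has_sum l s) {1..}"
proof -
  obtain l where l: "\<And>s. Re s > 1 \<Longrightarrow> exp (l s) = F s"
    "\<And>s. Re s > 1 \<Longrightarrow> ((\<lambda>m. b m * mangoldt m / (of_nat m powr s * of_real (ln (real m)))) has_sum l s) {2..}"
    using log_series by (auto simp: selberg_log_series_def)
  have "((\<lambda>n. bl n * of_nat n powr (- s)) has_sum l s) {1..}" if s: "Re s > 1" for s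
  proof -
    have "((\<lambda>m. b m * mangoldt m / (of_nat m powr s * of_real (ln (real m)))) has_sum l s) {2..}
      \<longleftrightarrow> ((\<lambda>n. bl n * of_nat n powr (- s)) has_sum l s) {1..}"
    proof (rule has_sum_cong_neutral)
      fix n :: nat assume "n \<in> {1..} - {2..}"
      hence "n = 1" by auto
      thus "bl n * of_nat n powr (- s) = 0" by (simp add: bl_def)
    qed (auto simp: bl_def powr_minus field_simps)
    thus ?thesis using l(2)[OF s] by blast
  qed
  thus ?thesis using l(1) that by blast
qed

lemma dabs_bl: assumes "\<sigma> > 1" shows "dabs bl \<sigma>"
proof -
  obtain l where l: "\<And>s. Re s > 1 \<Longrightarrow> ((\<lambda>n. bl n * of_nat n powr (- s)) has_sum l s) {1..}"
    by (rule has_sum_log) blast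
  have "((\<lambda>n. bl n * of_nat n powr (- of_real \<sigma>)) has_sum l (of_real \<sigma>)) {1..}"
    by (rule l) (use assms in simp)
  hence "(\<lambda>n. bl n * of_nat n powr (- of_real \<sigma>)) summable_on {1..}"
    by (rule has_sum_imp_summable)
  hence "(\<lambda>n. norm (bl n * of_nat n powr (- of_real \<sigma>))) summable_on {1..}"
    by (rule summable_on_iff_abs_summable_on_complex[THEN iffD1])
  thus ?thesis by (simp add: norm_dterm dabs_iff_abs_summable_on)
qed

lemma F_eq_exp: assumes "Re s > 1" shows "F s = exp (dser bl s)"
proof -
  obtain l where l: "\<And>s. Re s > 1 \<Longrightarrow> exp (l s) = F s"
    "\<And>s. Re s > 1 \<Longrightarrow> ((\<lambda>n. bl n * of_nat n powr (- s)) has_sum l s) {1..}" by (rule has_sum_log) blast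
  show ?thesis using dser_eqI[OF l(2)[OF assms] dabs_bl[OF assms] order.refl] l(1)[OF assms] by simp
qed

lemma F_nonzero: "Re s > 1 \<Longrightarrow> F s \<noteq> 0"
  by (simp add: F_eq_exp)

lemma bl_ln: "- of_real (ln (real n)) * bl n = - bL n"
proof -
  consider "n = 0" | "n = 1" | "n \<ge> 2" by linarith
  thus ?thesis by cases (auto simp: bl_def bL_def)
qed

lemma dabs_bL: assumes "\<sigma> > 1" shows "dabs bL \<sigma>"
proof -
  have "dabs (\<lambda>n. - of_real (ln (real n)) * bl n) \<sigma>"
    using assms by (intro dabs_ln[OF dabs_bl[of "(1 + \<sigma>) / 2"]]) auto
  thus ?thesis unfolding bl_ln dabs_uminus .
qed

lemma F_has_field_derivative_exp:
  assumes "Re s > 1" shows "(F has_field_derivative - dser bL s * F s) (at s)"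
proof -
  define \<sigma> where "\<sigma> = (1 + Re s) / 2"
  have \<sigma>: "1 < \<sigma>" "\<sigma> < Re s" using assms by (auto simp: \<sigma>_def)
  have "(dser bl has_field_derivative dser (\<lambda>n. - of_real (ln (real n)) * bl n) s) (at s)"
    by (rule dser_has_field_derivative[OF dabs_bl[OF \<sigma>(1)] \<sigma>(2)])
  also have "dser (\<lambda>n. - of_real (ln (real n)) * bl n) s = - dser bL s"
    unfolding bl_ln using \<sigma> by (intro dser_uminus[OF dabs_bL[OF \<sigma>(1)]]) auto
  finally have "((\<lambda>s. exp (dser bl s)) has_field_derivative exp (dser bl s) * (- dser bL s)) (at s)"
    by (rule DERIV_chain2[OF DERIV_exp])
  hence "((\<lambda>s. exp (dser bl s)) has_field_derivative - dser bL s * F s) (at s)"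
    by (simp add: F_eq_exp[OF assms] mult.commute)
  thus ?thesis
    by (rule has_field_derivative_transform_within_open[OF _ open_halfspace_Re_gt[of 1]]) (use assms F_eq_exp in auto)
qed

lemma logderiv_F: "Re s > 1 \<Longrightarrow> deriv F s / F s = - dser bL s"
  using DERIV_imp_deriv[OF F_has_field_derivative_exp] F_nonzero by simp

text \<open>Comparison of coefficients in -F' = (-F'/F) F, all series being absolutely convergent
  for Re s >= 2.\<close>

lemma a_conv: assumes "n \<ge> 1" shows "of_real (ln (real n)) * a n = dconv bL a n"
proof -
  let ?c = "\<lambda>n. - of_real (ln (real n)) * a n"
  have c: "dabs ?c 2" by (rule dabs_ln[OF dabs_a[of "3/2"]]) auto
  have d: "dabs (dconv bL a) 2" by (rule dser_dconv(1)[OF dabs_bL dabs_a]) auto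
  have "dser (\<lambda>n. ?c n + dconv bL a n) (of_real x) = 0" if x: "2 \<le> x" for x
  proof -
    define s where "s = complex_of_real x"
    have s: "Re s \<ge> 2" "Re s > 1" using x by (auto simp: s_def)
    have "(dser a has_field_derivative dser ?c s) (at s)"
      by (rule dser_has_field_derivative[OF dabs_a[of "3/2"]]) (use s in auto)
    moreover have "(dser a has_field_derivative - dser bL s * F s) (at s)"
      by (rule has_field_derivative_transform_within_open[OF F_has_field_derivative_exp[OF s(2)] open_halfspace_Re_gt[of 1]])
         (use s F_eq_dser in auto)
    ultimately have "dser ?c s = - dser bL s * F s" by (rule DERIV_unique)
    moreover have "dser (dconv bL a) s = dser bL s * dser a s"
      by (rule dser_dconv(2)[OF dabs_bL dabs_a]) (use s in auto)
    moreover have "dser (\<lambda>n. ?c n + dconv bL a n) s = dser ?c s + dser (dconv bL a) s"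
      by (rule dser_add[OF c d s(1)])
    ultimately show ?thesis using F_eq_dser[OF s(2)] by (simp add: s_def)
  qed
  from dser_eq_0_imp[OF dabs_add[OF c d] this assms] show ?thesis by (simp add: algebra_simps)
qed

text \<open>The divisors of p^k are the p^j, and the common value ln p of the von Mangoldt function
  cancels. This is the recursion linking a power series to its logarithm, as in Newton's
  identities.\<close>

lemma a_prime_power:
  assumes p: "prime p" shows "of_nat k * a (p ^ k) = (\<Sum>j=1..k. b (p ^ j) * a (p ^ (k - j)))"
proof -
  have p2: "p \<ge> 2" using p by (rule prime_ge_2_nat)
  have lnp: "ln (real p) > 0" using p2 by simp
  have "{d. d dvd p ^ k} = (\<lambda>j. p ^ j) ` {..k}" using divides_primepow_nat[OF p] by auto
  moreover have "inj_on (\<lambda>j. p ^ j) {..k}" using p2 by (auto simp: inj_on_def)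
  ultimately have "dconv bL a (p ^ k) = (\<Sum>j\<le>k. bL (p ^ j) * a (p ^ k div p ^ j))"
    unfolding dconv_def by (simp add: sum.reindex)
  also have "\<dots> = (\<Sum>j\<le>k. (if j = 0 then 0 else of_real (ln (real p)) * (b (p ^ j) * a (p ^ (k - j)))))"
    using p p2 by (intro sum.cong refl) (auto simp: bL_def mangoldt_primepow power_diff[symmetric])
  also have "\<dots> = (\<Sum>j=1..k. of_real (ln (real p)) * (b (p ^ j) * a (p ^ (k - j))))"
    by (intro sum.mono_neutral_cong_right) auto
  also have "\<dots> = of_real (ln (real p)) * (\<Sum>j=1..k. b (p ^ j) * a (p ^ (k - j)))"
    by (simp add: sum_distrib_left)
  finally have "of_real (ln (real (p ^ k))) * a (p ^ k) = of_real (ln (real p)) * (\<Sum>j=1..k. b (p ^ j) * a (p ^ (k - j)))"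
    using a_conv[of "p ^ k"] p2 by simp
  moreover have "ln (real (p ^ k)) = real k * ln (real p)" using p2 by (simp add: ln_realpow)
  ultimately have "of_real (ln (real p)) * (of_nat k * a (p ^ k)) = of_real (ln (real p)) * (\<Sum>j=1..k. b (p ^ j) * a (p ^ (k - j)))"
    by (simp add: mult_ac)
  thus ?thesis using lnp by simp
qed

lemma b_prime: "prime p \<Longrightarrow> b p = a p"
  using a_prime_power[of p 1] a_1 by simp

lemma b_prime_square: assumes "prime p" shows "b (p\<^sup>2) = 2 * a (p\<^sup>2) - (a p)\<^sup>2"
proof -
  have "{1..2} = {1, 2::nat}" by auto
  thus ?thesis using a_prime_power[OF assms, of 2] a_1 b_prime[OF assms] by (simp add: power2_eq_square[of "a p"])
qed

text \<open>For fixed k the recursion passes the bound a(n) << n^\<epsilon> on to b. The axiom on b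
  only provides an exponent \<theta> < 1/2, too weak for summability at small k.\<close>

lemma b_prime_power_bound:
  "k \<ge> 1 \<Longrightarrow> \<epsilon> > 0 \<Longrightarrow> \<exists>C\<ge>0. \<forall>p. prime p \<longrightarrow> norm (b (p ^ k)) \<le> C * real p powr \<epsilon>"
proof (induction k arbitrary: \<epsilon> rule: less_induct)
  case (less k)
  \<comment> \<open>Then each a (p^i) with i <= k costs at most p^(\<epsilon>/2), and a product of
    two such bounds costs p^\<epsilon>.\<close>
  define \<delta> where "\<delta> = \<epsilon> / (2 * real k)"
  have \<delta>: "\<delta> > 0" using less.prems by (simp add: \<delta>_def)
  obtain A where A: "A \<ge> 0" "\<And>n. n \<ge> 1 \<Longrightarrow> norm (a n) \<le> A * real n powr \<delta>" using a_bound[OF \<delta>] by blast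
  have apk: "norm (a (p ^ i)) \<le> A * real p powr (\<epsilon> / 2)" if "prime p" "i \<le> k" for p i
  proof -
    have p2: "p \<ge> 2" using that(1) by (rule prime_ge_2_nat)
    have "norm (a (p ^ i)) \<le> A * real (p ^ i) powr \<delta>" using p2 by (intro A) auto
    also have "real (p ^ i) powr \<delta> = real p powr (real i * \<delta>)"
      using p2 by (simp add: powr_powr[symmetric] powr_realpow)
    also have "\<dots> \<le> real p powr (real k * \<delta>)" using p2 that \<delta> by (intro powr_mono mult_right_mono) auto
    also have "real k * \<delta> = \<epsilon> / 2" using less.prems by (simp add: \<delta>_def)
    finally show ?thesis using A by (simp add: mult_left_mono)
  qed
  have "\<forall>j\<in>{1..<k}. \<exists>C\<ge>0. \<forall>p. prime p \<longrightarrow> norm (b (p ^ j)) \<le> C * real p powr (\<epsilon> / 2)"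
    using less by auto
  then obtain B where B: "\<And>j. j \<in> {1..<k} \<Longrightarrow> B j \<ge> 0 \<and> (\<forall>p. prime p \<longrightarrow> norm (b (p ^ j)) \<le> B j * real p powr (\<epsilon> / 2))"
    by metis
  define C where "C = real k * A + (\<Sum>j\<in>{1..<k}. B j * A)"
  have "norm (b (p ^ k)) \<le> C * real p powr \<epsilon>" if p: "prime p" for p
  proof -
    have p2: "p \<ge> 2" using p by (rule prime_ge_2_nat)
    have "{1..k} = insert k {1..<k}" using less.prems by auto
    hence "b (p ^ k) = of_nat k * a (p ^ k) - (\<Sum>j\<in>{1..<k}. b (p ^ j) * a (p ^ (k - j)))"
      using a_prime_power[OF p, of k] a_1 by (simp add: algebra_simps)
    also have "norm \<dots> \<le> norm (of_nat k * a (p ^ k)) + norm (\<Sum>j\<in>{1..<k}. b (p ^ j) * a (p ^ (k - j)))"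
      by (rule norm_triangle_ineq4)
    also have "\<dots> \<le> real k * (A * real p powr (\<epsilon> / 2)) + (\<Sum>j\<in>{1..<k}. (B j * real p powr (\<epsilon> / 2)) * (A * real p powr (\<epsilon> / 2)))"
      unfolding norm_mult using p B A
      by (intro add_mono sum_norm_le mult_mono order.trans[OF eq_refl[OF norm_mult]]) (auto intro!: apk mult_left_mono mult_mono simp: norm_mult)
    also have "\<dots> \<le> real k * (A * real p powr \<epsilon>) + (\<Sum>j\<in>{1..<k}. B j * A * real p powr \<epsilon>)"
    proof (intro add_mono sum_mono mult_left_mono)
      have "real p powr (\<epsilon> / 2) * real p powr (\<epsilon> / 2) = real p powr \<epsilon>" by (simp add: powr_add[symmetric])
      thus "B j * real p powr (\<epsilon> / 2) * (A * real p powr (\<epsilon> / 2)) \<le> B j * A * real p powr \<epsilon>" for j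
        by (simp add: mult_ac)
    qed (use p2 less.prems A in \<open>auto intro!: powr_mono\<close>)
    also have "\<dots> = C * real p powr \<epsilon>" by (simp add: C_def distrib_right sum_distrib_right)
    finally show ?thesis .
  qed
  moreover have "C \<ge> 0" unfolding C_def using A B by (intro add_nonneg_nonneg sum_nonneg mult_nonneg_nonneg) auto
  ultimately show ?case by blast
qed

lemma F_bounded_right: "\<exists>C>0. \<forall>s. Re s \<ge> 2 \<longrightarrow> norm (F s) \<le> C"
proof (intro exI conjI allI impI)
  let ?C = "(\<Sum>n. norm (a n) * real n powr (- 2)) + 1"
  have "(\<Sum>n. norm (a n) * real n powr (- 2)) \<ge> 0"
    using dabs_a[of 2] by (intro suminf_nonneg) (auto simp: dabs_def)
  thus "?C > 0" by linarith
  fix s assume "Re s \<ge> 2"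
  thus "norm (F s) \<le> ?C" using norm_dser_le[OF dabs_a[of 2], of s] F_eq_dser[of s] by auto
qed

text \<open>F is the exponential of an absolutely bounded series there. The lower bound is needed at
  the centres of the discs to which \<open>local_zeros\<close> is applied.\<close>

lemma F_lower_right: "\<exists>c>0. \<forall>s. Re s \<ge> 2 \<longrightarrow> c \<le> norm (F s)"
proof (intro exI conjI allI impI)
  let ?C = "\<Sum>n. norm (bl n) * real n powr (- 2)"
  show "exp (- ?C) > 0" by simp
  fix s assume s: "Re s \<ge> 2"
  have "norm (dser bl s) \<le> ?C" using s by (intro norm_dser_le dabs_bl) auto
  hence "- ?C \<le> Re (dser bl s)" using abs_Re_le_cmod[of "dser bl s"] by linarith
  thus "exp (- ?C) \<le> norm (F s)" using s F_eq_exp[of s] by simp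
qed

end

section \<open>Functional equation and polynomial growth\<close>

context selberg
begin

lemma F_continuation:
  obtains k h where "h holomorphic_on UNIV" "finite_order h" "\<And>s. s \<noteq> 1 \<Longrightarrow> h s = (s - 1) ^ k * F s"
  using continuation by (auto simp: selberg_continuation_def)

lemma F_holomorphic: "1 \<notin> A \<Longrightarrow> F holomorphic_on A"
proof -
  assume A: "1 \<notin> A"
  obtain k h where h: "h holomorphic_on UNIV" "\<And>s. s \<noteq> 1 \<Longrightarrow> h s = (s - 1) ^ k * F s"
    by (rule F_continuation) blast
  have "(\<lambda>s. h s / (s - 1) ^ k) holomorphic_on A"
    using A by (intro holomorphic_intros holomorphic_on_subset[OF h(1)]) auto
  thus ?thesis
  proof (rule holomorphic_transform)
    fix s assume "s \<in> A"
    hence "s \<noteq> 1" using A by blast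
    thus "h s / (s - 1) ^ k = F s" using h(2)[of s] by simp
  qed
qed

abbreviation "gam \<equiv> gamma_factor Q N lam \<mu>"
abbreviation "dlog \<equiv> gamma_dlog Q N lam \<mu>"

text \<open>Packages the conclusion of \<open>gamma_factor_bounds\<close> for given constants, so
  that two functions can later share one pair of constants.\<close>

definition gamma_region :: "real \<Rightarrow> real \<Rightarrow> bool" where
  "gamma_region C Y \<longleftrightarrow> C \<ge> 0 \<and> Y \<ge> 3 \<and> (\<forall>s. \<bar>Re s\<bar> \<le> 12 \<longrightarrow> Im s \<ge> Y \<longrightarrow>
     gam s \<noteq> 0 \<and> (gam has_field_derivative dlog s * gam s) (at s) \<and> norm (dlog s) \<le> C * ln (Im s) \<and>
     (\<exists>d. (dlog has_field_derivative d) (at s) \<and> norm d \<le> C / Im s))"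

lemma gamma_region_exists: "\<exists>C Y. gamma_region C Y"
proof -
  have pos: "Q > 0" "\<forall>j\<in>{1..N}. lam j > 0"
    using functional_eq by (auto simp: selberg_functional_eq_def)
  show ?thesis using gamma_factor_bounds[of Q N lam \<mu>, OF pos(1) pos(2)]
    unfolding gamma_region_def by (elim exE conjE) (intro exI conjI; assumption)
qed

lemma gamma_regionD:
  assumes "gamma_region C Y" "\<bar>Re s\<bar> \<le> 12" "Im s \<ge> Y"
  shows "gam s \<noteq> 0" "(gam has_field_derivative dlog s * gam s) (at s)" "norm (dlog s) \<le> C * ln (Im s)"
    "\<exists>d. (dlog has_field_derivative d) (at s) \<and> norm d \<le> C / Im s"
proof -
  have *: "gam s \<noteq> 0 \<and> (gam has_field_derivative dlog s * gam s) (at s) \<and> norm (dlog s) \<le> C * ln (Im s) \<and>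
     (\<exists>d. (dlog has_field_derivative d) (at s) \<and> norm d \<le> C / Im s)"
    using assms(1)[unfolded gamma_region_def, THEN conjunct2, THEN conjunct2, THEN spec, THEN mp, THEN mp, OF assms(2,3)] .
  show "gam s \<noteq> 0" by (rule conjunct1[OF *])
  show "(gam has_field_derivative dlog s * gam s) (at s)" by (rule conjunct1[OF conjunct2[OF *]])
  show "norm (dlog s) \<le> C * ln (Im s)" by (rule conjunct1[OF conjunct2[OF conjunct2[OF *]]])
  show "\<exists>d. (dlog has_field_derivative d) (at s) \<and> norm d \<le> C / Im s" by (rule conjunct2[OF conjunct2[OF conjunct2[OF *]]])
qed

lemma open_strip: "open {s. - 12 < Re s \<and> Re s < 12 \<and> Y < Im s}"
  by (intro open_Collect_conj open_halfspace_Re_gt open_halfspace_Re_lt open_halfspace_Im_gt)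

text \<open>High up in the strip both the Gamma factor and F are holomorphic, so filling in
  removable singularities changes nothing.\<close>

lemma Phi_eq:
  assumes g: "gamma_region C Y" and s: "\<bar>Re s\<bar> < 12" "Im s > Y"
  shows "selberg_Phi F Q N lam \<mu> s = gam s * F s"
    and "(\<lambda>s. gam s * F s) analytic_on {s}"
proof -
  let ?S = "{s. - 12 < Re s \<and> Re s < 12 \<and> Y < Im s}"
  have Y: "Y \<ge> 3" using g by (simp add: gamma_region_def)
  have gh: "gam holomorphic_on ?S"
    unfolding holomorphic_on_open[OF open_strip]
  proof
    fix x assume "x \<in> ?S"
    hence "(gam has_field_derivative dlog x * gam x) (at x)" by (intro gamma_regionD(2)[OF g]) auto
    thus "\<exists>f'. (gam has_field_derivative f') (at x)" by blast
  qed
  have "F holomorphic_on ?S" by (rule F_holomorphic) (use Y in auto)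
  hence "(\<lambda>s. gam s * F s) holomorphic_on ?S" by (intro holomorphic_intros gh)
  hence "(\<lambda>s. gam s * F s) analytic_on ?S" by (simp add: analytic_on_open open_strip)
  thus an: "(\<lambda>s. gam s * F s) analytic_on {s}" by (rule analytic_on_subset) (use s in auto)
  have "selberg_Phi F Q N lam \<mu> = remove_sings (\<lambda>s. gam s * F s)"
    by (simp add: selberg_Phi_def gamma_factor_def)
  thus "selberg_Phi F Q N lam \<mu> s = gam s * F s"
    using remove_sings_at_analytic[OF an] by simp
qed

text \<open>The half-width drops from 12 to 11 because the reflected point 1 - cnj s must lie in the
  strip as well.\<close>

lemma functional_eq_pointwise:
  assumes g: "gamma_region C Y" and s: "\<bar>Re s\<bar> < 11" "Im s > Y"
  shows "gam s * F s = w * cnj (gam (1 - cnj s) * F (1 - cnj s))"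
proof -
  have "\<bar>Re (1 - cnj s)\<bar> < 12" "Im (1 - cnj s) > Y" using s by auto
  note * = Phi_eq(1)[OF g this]
  have "selberg_Phi F Q N lam \<mu> s = w * conj_fun (selberg_Phi F Q N lam \<mu>) (1 - s)"
    using functional_eq by (auto simp: selberg_functional_eq_def)
  thus ?thesis using * Phi_eq(1)[OF g, of s] s by (simp add: conj_fun_def)
qed

lemma w_nonzero: "w \<noteq> 0"
  using functional_eq by (auto simp: selberg_functional_eq_def)

lemma F_zero_reflect:
  assumes g: "gamma_region C Y" and s: "\<bar>Re s\<bar> < 11" "Im s > Y"
  shows "F (1 - cnj s) = 0 \<longleftrightarrow> F s = 0"
proof -
  have "gam s \<noteq> 0" by (rule gamma_regionD(1)[OF g]) (use s in auto)
  moreover have "gam (1 - cnj s) \<noteq> 0" by (rule gamma_regionD(1)[OF g]) (use s in auto)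
  ultimately show ?thesis using functional_eq_pointwise[OF g s] w_nonzero
    by (metis complex_cnj_zero_iff mult_eq_0_iff)
qed

text \<open>The logarithmic derivative of the functional equation; the minus sign comes from the
  inner map s -> 1 - s.\<close>

lemma logderiv_reflect:
  assumes g: "gamma_region C Y" and s: "\<bar>Re s\<bar> < 11" "Im s > Y" and nz: "F s \<noteq> 0"
  shows "deriv F s / F s + dlog s = - cnj (deriv F (1 - cnj s) / F (1 - cnj s) + dlog (1 - cnj s))"
proof -
  define s' where "s' = 1 - cnj s"
  define P where "P = (\<lambda>s. gam s * F s)"
  define D where "D = (\<lambda>s. (deriv F s / F s + dlog s) * P s)"
  have Y: "Y \<ge> 3" using g by (simp add: gamma_region_def)
  have nz': "F s' \<noteq> 0" using F_zero_reflect[OF g s] nz by (simp add: s'_def)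
  have der: "(P has_field_derivative D z) (at z)" if z: "\<bar>Re z\<bar> \<le> 12" "Im z > Y" "F z \<noteq> 0" for z
  proof -
    have "F holomorphic_on (- {1})" by (rule F_holomorphic) auto
    hence Fd: "(F has_field_derivative deriv F z) (at z)"
      by (rule holomorphic_derivI) (use z Y in auto)
    have "(gam has_field_derivative dlog z * gam z) (at z)"
      by (rule gamma_regionD(2)[OF g]) (use z in auto)
    hence "(P has_field_derivative dlog z * gam z * F z + deriv F z * gam z) (at z)"
      unfolding P_def by (rule DERIV_mult[OF _ Fd])
    thus ?thesis using z by (simp add: D_def P_def field_simps)
  qed
  have 1: "(P has_field_derivative D s) (at s)" by (rule der) (use s nz in auto)
  have 2: "(P has_field_derivative D s') (at (cnj (1 - s)))"
    using der[of s'] s nz' by (simp add: s'_def)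
  have "((cnj \<circ> P \<circ> cnj) has_field_derivative cnj (D s')) (at (1 - s))"
    using has_field_derivative_cnj_cnj[OF 2] by simp
  hence "((\<lambda>z. (cnj \<circ> P \<circ> cnj) (1 - z)) has_field_derivative cnj (D s') * (- 1)) (at s)"
    by (rule DERIV_chain2) (auto intro!: derivative_eq_intros)
  hence "((\<lambda>z. w * (cnj \<circ> P \<circ> cnj) (1 - z)) has_field_derivative w * (cnj (D s') * (- 1))) (at s)"
    by (rule DERIV_cmult)
  hence "(P has_field_derivative w * (cnj (D s') * (- 1))) (at s)"
  proof (rule has_field_derivative_transform_within_open)
    show "open {s. - 11 < Re s \<and> Re s < 11 \<and> Y < Im s}"
      by (intro open_Collect_conj open_halfspace_Re_gt open_halfspace_Re_lt open_halfspace_Im_gt)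
    show "w * (cnj \<circ> P \<circ> cnj) (1 - z) = P z" if "z \<in> {s. - 11 < Re s \<and> Re s < 11 \<and> Y < Im s}" for z
      using functional_eq_pointwise[OF g, of z] that by (auto simp: P_def abs_less_iff)
  qed (use s in auto)
  hence "D s = - (w * cnj (D s'))" using DERIV_unique[OF 1] by force
  moreover have "P s = w * cnj (P s')" using functional_eq_pointwise[OF g s] by (simp add: P_def s'_def)
  moreover have "P s \<noteq> 0" using nz gamma_regionD(1)[OF g, of s] s by (simp add: P_def)
  moreover have "X * p = - (w * cnj (X' * p')) \<Longrightarrow> p = w * cnj p' \<Longrightarrow> X * p = - cnj X' * p" for X X' p p'
    by (simp add: mult_ac)
  ultimately have "(deriv F s / F s + dlog s) * P s = - cnj (deriv F s' / F s' + dlog s') * P s"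
    unfolding D_def by blast
  thus ?thesis using \<open>P s \<noteq> 0\<close> by (simp add: s'_def)
qed

text \<open>The functional equation carries abscissa -10 to 11, where F is bounded. The quotient of
  the Gamma factors is estimated along the horizontal segment of length 21 between the two, where
  their logarithmic derivative is at most C ln t.\<close>

lemma F_left_edge_bound:
  assumes g: "gamma_region C Y" and K: "\<And>s. Re s \<ge> 2 \<Longrightarrow> norm (F s) \<le> K" and t: "t > Y"
  shows "norm (F (Complex (- 10) t)) \<le> K * t powr (21 * C)"
proof -
  have Y: "Y \<ge> 3" "C \<ge> 0" using g by (auto simp: gamma_region_def)
  have "norm (gam (Complex 11 t)) \<le> exp (C * ln t * (11 - (- 10))) * norm (gam (Complex (- 10) t))"
  proof (rule horizontal_gronwall[where F' = "\<lambda>s. dlog s * gam s"])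
    fix x :: real assume x: "- 10 \<le> x" "x \<le> 11"
    show "(gam has_field_derivative dlog (Complex x t) * gam (Complex x t)) (at (Complex x t))"
      by (rule gamma_regionD(2)[OF g]) (use x t in auto)
    show "norm (dlog (Complex x t) * gam (Complex x t)) \<le> C * ln t * norm (gam (Complex x t))"
      unfolding norm_mult by (rule mult_right_mono) (use gamma_regionD(3)[OF g, of "Complex x t"] x t in auto)
  qed auto
  also have "exp (C * ln t * (11 - (- 10))) = t powr (21 * C)" using t Y by (simp add: powr_def mult_ac)
  finally have A: "norm (gam (Complex 11 t)) \<le> t powr (21 * C) * norm (gam (Complex (- 10) t))" .
  have eq: "1 - cnj (Complex (- 10) t) = Complex 11 t" by (simp add: complex_eq_iff)
  have "gam (Complex (- 10) t) * F (Complex (- 10) t) = w * cnj (gam (Complex 11 t) * F (Complex 11 t))"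
    using functional_eq_pointwise[OF g, of "Complex (- 10) t"] t unfolding eq by simp
  hence "norm (gam (Complex (- 10) t) * F (Complex (- 10) t)) = norm (w * cnj (gam (Complex 11 t) * F (Complex 11 t)))"
    by (rule arg_cong)
  hence "norm (gam (Complex (- 10) t)) * norm (F (Complex (- 10) t)) = norm (gam (Complex 11 t)) * norm (F (Complex 11 t))"
    using functional_eq by (simp only: norm_mult complex_mod_cnj selberg_functional_eq_def mult_1)
  also have "\<dots> \<le> (t powr (21 * C) * norm (gam (Complex (- 10) t))) * K"
    by (intro mult_mono A K) auto
  finally have "norm (gam (Complex (- 10) t)) * norm (F (Complex (- 10) t)) \<le> norm (gam (Complex (- 10) t)) * (K * t powr (21 * C))"
    by (simp add: mult_ac)
  moreover have "norm (gam (Complex (- 10) t)) > 0" using gamma_regionD(1)[OF g, of "Complex (- 10) t"] t by simp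
  ultimately show ?thesis by simp
qed

lemma F_growth: "\<exists>A C R. \<forall>s. Im s \<ge> 1 \<longrightarrow> norm s \<ge> R \<longrightarrow> norm (F s) \<le> C * exp (norm s powr A)"
proof -
  obtain k h where h: "h holomorphic_on UNIV" "finite_order h" "\<And>s. s \<noteq> 1 \<Longrightarrow> h s = (s - 1) ^ k * F s"
    by (rule F_continuation) blast
  obtain A where "(\<lambda>s. norm (h s)) \<in> O[at_infinity](\<lambda>s. exp (norm s powr A))"
    using h(2) by (auto simp: finite_order_def)
  then obtain c where "eventually (\<lambda>s. norm (norm (h s)) \<le> c * norm (exp (norm s powr A))) at_infinity"
    using landau_o.bigE by blast
  then obtain R where R: "\<And>s. norm s \<ge> R \<Longrightarrow> norm (h s) \<le> c * exp (norm s powr A)"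
    by (auto simp: eventually_at_infinity)
  have "norm (F s) \<le> c * exp (norm s powr A)" if "Im s \<ge> 1" "norm s \<ge> R" for s
  proof -
    have "1 \<le> norm (s - 1)" using abs_Im_le_cmod[of "s - 1"] that by auto
    hence "1 \<le> norm (s - 1) ^ k" by (rule one_le_power)
    hence "norm (F s) \<le> norm (s - 1) ^ k * norm (F s)" using mult_right_mono[of 1 "norm (s - 1) ^ k" "norm (F s)"] by simp
    also have "\<dots> = norm (h s)"
    proof -
      have "s \<noteq> 1" using that by auto
      thus ?thesis using h(3)[of s] by (simp add: norm_mult norm_power)
    qed
    also have "\<dots> \<le> c * exp (norm s powr A)" by (rule R[OF that(2)])
    finally show ?thesis .
  qed
  thus ?thesis by blast
qed

text \<open>F / (s + 20)^n with n >= 21 C is bounded on both vertical edges, so Phragmen-Lindelof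
  applies; the finite order in the axioms provides the required growth condition. The bound is
  written as an exponential because \<open>local_zeros\<close> needs the logarithm of a
  maximum.\<close>

theorem F_poly_bound: "\<exists>B\<ge>0. \<exists>Y\<ge>3. \<forall>s. Re s \<ge> - 10 \<longrightarrow> Im s \<ge> Y \<longrightarrow> norm (F s) \<le> exp (B * ln (Im s))"
proof -
  obtain C Y where g: "gamma_region C Y" using gamma_region_exists by blast
  have Y: "Y \<ge> 3" "C \<ge> 0" using g by (auto simp: gamma_region_def)
  obtain K where K: "K > 0" "\<And>s. Re s \<ge> 2 \<Longrightarrow> norm (F s) \<le> K" using F_bounded_right by blast
  obtain A C1 R where gr: "\<And>s. Im s \<ge> 1 \<Longrightarrow> norm s \<ge> R \<Longrightarrow> norm (F s) \<le> C1 * exp (norm s powr A)"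
    using F_growth by blast
  define y0 where "y0 = max (Y + 1) R"
  have y0: "y0 > Y" "y0 \<ge> R" "y0 \<ge> 3" using Y by (auto simp: y0_def)
  define n where "n = nat \<lceil>21 * C\<rceil>"
  have n: "21 * C \<le> real n" by (simp add: n_def real_nat_ceiling_ge)
  define f where "f = (\<lambda>s. F s / (s + 20) ^ n)"
  let ?S = "{s. 0 < Im s}"
  have fh: "f holomorphic_on ?S"
  proof -
    have "s + 20 \<noteq> 0" if "0 < Im s" for s using that by (auto simp: complex_eq_iff)
    thus ?thesis unfolding f_def by (intro holomorphic_intros F_holomorphic) auto
  qed
  have big: "Im s \<le> norm (s + 20)" for s using abs_Im_le_cmod[of "s + 20"] by simp
  have dv: "norm (f s) = norm (F s) / norm (s + 20) ^ n" for s by (simp add: f_def norm_divide norm_power)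
  have le1: "norm (f s) \<le> norm (F s)" if "Im s \<ge> 3" for s
  proof -
    have "1 \<le> norm (s + 20) ^ n" using big[of s] that by (intro one_le_power) linarith
    hence "norm (F s) / norm (s + 20) ^ n \<le> norm (F s) / 1" by (intro divide_left_mono) auto
    thus ?thesis by (simp add: dv)
  qed
  have "compact ((\<lambda>x. f (Complex x y0)) ` {-10..11})"
    by (intro compact_continuous_image continuous_on_compose2[OF holomorphic_on_imp_continuous_on[OF fh]])
       (use y0 in \<open>auto simp: Complex_eq intro!: continuous_intros\<close>)
  then obtain M1 where M1: "\<And>x. x \<in> {-10..11} \<Longrightarrow> norm (f (Complex x y0)) \<le> M1"
    by (meson compact_imp_bounded bounded_iff imageI)
  define M where "M = max K M1"
  have M: "M > 0" "M \<ge> K" "M \<ge> M1" using K by (auto simp: M_def)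
  have strip: "norm (f s) \<le> M" if s: "- 10 \<le> Re s" "Re s \<le> 11" "y0 \<le> Im s" for s
  proof (rule phragmen_lindelof_half_strip[of "- 10" 11 ?S y0 f C1 A M])
    show "open ?S" by (rule open_halfspace_Im_gt)
    show "norm (f s) \<le> C1 * exp (norm s powr A)" if "y0 \<le> Im s" for s
      using le1[of s] gr[of s] that y0 abs_Im_le_cmod[of s] by auto
    show "norm (f (Complex (- 10) y)) \<le> M" if "y0 \<le> y" for y
    proof -
      have "norm (F (Complex (- 10) y)) \<le> K * y powr (21 * C)"
        using that y0 by (intro F_left_edge_bound[OF g K(2)]) auto
      also have "\<dots> \<le> K * y powr (real n)" using K n that y0 by (intro mult_left_mono powr_mono) auto
      also have "\<dots> = K * y ^ n" using that y0 by (simp add: powr_realpow)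
      also have "\<dots> \<le> K * norm (Complex (- 10) y + 20) ^ n"
        using K big[of "Complex (- 10) y"] that y0 by (intro mult_left_mono power_mono) auto
      finally have "norm (f (Complex (- 10) y)) \<le> K"
        using that y0 big[of "Complex (- 10) y"] unfolding dv by (subst pos_divide_le_eq) (auto intro!: zero_less_power simp: complex_eq_iff)
      thus ?thesis using M by linarith
    qed
    show "norm (f (Complex 11 y)) \<le> M" if "y0 \<le> y" for y
      using le1[of "Complex 11 y"] K(2)[of "Complex 11 y"] that y0 M by auto
    show "norm (f (Complex x y0)) \<le> M" if "- 10 \<le> x" "x \<le> 11" for x
      using M1[of x] that M by auto
  qed (use s y0 M fh in auto)
  define B where "B = \<bar>ln (M * 40 ^ n)\<bar> + real n"
  have "norm (F s) \<le> exp (B * ln (Im s))" if s: "Re s \<ge> - 10" "Im s \<ge> y0" for s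
  proof -
    define t where "t = Im s"
    have t: "t \<ge> 3" using s y0 by (simp add: t_def)
    have ln1: "1 \<le> ln t" using t exp_le by (subst ln_ge_iff) auto
    have pos: "M * 40 ^ n > 0" using M by simp
    have "norm (F s) \<le> M * (40 * t) ^ n"
    proof (cases "Re s \<le> 11")
      case True
      have p: "norm (s + 20) ^ n > 0" using big[of s] s y0 by (intro zero_less_power) linarith
      have le: "norm (s + 20) \<le> 40 * t"
      proof -
        have "norm (s + 20) \<le> \<bar>Re (s + 20)\<bar> + \<bar>Im (s + 20)\<bar>" by (rule cmod_le)
        thus ?thesis using s True t by (simp add: t_def)
      qed
      have "norm (F s) \<le> M * norm (s + 20) ^ n" using strip[of s] s True p by (simp add: dv field_simps)
      also have "\<dots> \<le> M * (40 * t) ^ n" using M by (intro mult_left_mono power_mono le) auto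
      finally show ?thesis .
    next
      case False
      have "1 \<le> (40 * t) ^ n" using t by (intro one_le_power) auto
      hence "M * 1 \<le> M * (40 * t) ^ n" using M by (intro mult_left_mono) auto
      moreover have "norm (F s) \<le> K" by (rule K(2)) (use False in auto)
      ultimately show ?thesis using M by linarith
    qed
    also have "\<dots> = exp (ln (M * 40 ^ n) + real n * ln t)"
      using pos t by (simp add: exp_add power_mult_distrib exp_of_nat_mult)
    also have "\<dots> \<le> exp (B * ln t)"
      using mult_left_mono[OF ln1, of "\<bar>ln (M * 40 ^ n)\<bar>"] unfolding B_def distrib_right exp_le_cancel_iff by linarith
    finally show ?thesis by (simp add: t_def)
  qed
  moreover have "B \<ge> 0" by (simp add: B_def)
  ultimately show ?thesis using y0 by blast
qed

end

context selberg
begin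

text \<open>\<open>local_zeros\<close> with r = 4 about 2 + i (T + 1/2). The large disc of radius 12
  reaches the abscissa -10, which is why the growth bound had to go that far to the left. The disc
  of radius 2 contains the segments near the critical line with ordinate in [T, T + 1].\<close>

theorem local_logderiv:
  "\<exists>K\<ge>1. \<exists>T0\<ge>3. \<forall>T\<ge>T0. finite {z \<in> cball (Complex 2 (T + 1/2)) 4. F z = 0} \<and>
     real (\<Sum>p\<in>{z \<in> cball (Complex 2 (T + 1/2)) 4. F z = 0}. nat (zorder F p)) \<le> K * ln T \<and>
     (\<forall>z\<in>cball (Complex 2 (T + 1/2)) 2. \<forall>d>0. (\<forall>p\<in>{z \<in> cball (Complex 2 (T + 1/2)) 4. F z = 0}. d \<le> norm (z - p)) \<longrightarrow>
        norm (deriv F z / F z) \<le> K * ln T / d + K * ln T)"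
proof -
  obtain P Y where P: "P \<ge> 0" "Y \<ge> 3" and bd: "\<And>s. Re s \<ge> - 10 \<Longrightarrow> Im s \<ge> Y \<Longrightarrow> norm (F s) \<le> exp (P * ln (Im s))"
    using F_poly_bound by blast
  obtain c where c: "c > 0" "\<And>s. Re s \<ge> 2 \<Longrightarrow> c \<le> norm (F s)" using F_lower_right by blast
  define T0 where "T0 = Y + 15"
  define K1 where "K1 = 2 * P + \<bar>ln c\<bar>"
  define K where "K = 6 * K1 + 10"
  have K1: "K1 \<ge> 0" using P by (simp add: K1_def)
  have main: "finite {z \<in> cball (Complex 2 (T + 1/2)) 4. F z = 0} \<and>
     real (\<Sum>p\<in>{z \<in> cball (Complex 2 (T + 1/2)) 4. F z = 0}. nat (zorder F p)) \<le> K * ln T \<and>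
     (\<forall>z\<in>cball (Complex 2 (T + 1/2)) 2. \<forall>d>0. (\<forall>p\<in>{z \<in> cball (Complex 2 (T + 1/2)) 4. F z = 0}. d \<le> norm (z - p)) \<longrightarrow>
        norm (deriv F z / F z) \<le> K * ln T / d + K * ln T)" if T: "T \<ge> T0" for T
  proof -
    define z0 where "z0 = Complex 2 (T + 1/2)"
    have T3: "T \<ge> 18" using T P by (simp add: T0_def)
    have ln1: "1 \<le> ln T" using T3 exp_le by (subst ln_ge_iff) auto
    define M where "M = exp (2 * P * ln T)"
    have re: "\<bar>Re z - 2\<bar> \<le> norm (z - z0)" and im: "\<bar>Im z - (T + 1/2)\<bar> \<le> norm (z - z0)" for z
      using abs_Re_le_cmod[of "z - z0"] abs_Im_le_cmod[of "z - z0"] by (simp_all add: z0_def)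
    have r: "(4::real) > 0" "3 * 4 < (13::real)" by simp_all
    have f: "F holomorphic_on ball z0 13"
    proof (rule F_holomorphic)
      show "1 \<notin> ball z0 13" using im[of 1] T3 by (auto simp: dist_norm norm_minus_commute)
    qed
    have nz: "F z0 \<noteq> 0" by (rule F_nonzero) (simp add: z0_def)
    have cz: "c \<le> norm (F z0)" by (rule c(2)) (simp add: z0_def)
    have M: "norm (F z) \<le> M" if z: "z \<in> cball z0 (3 * 4)" for z
    proof -
      have n: "norm (z - z0) \<le> 12" using z by (simp add: dist_norm norm_minus_commute)
      have 1: "norm (F z) \<le> exp (P * ln (Im z))"
        using re[of z] im[of z] n T P by (intro bd) (auto simp: T0_def)
      have "ln (Im z) \<le> ln (T\<^sup>2)"
      proof -
        have "Im z \<le> T + 13" "Im z > 0" using im[of z] n T3 by auto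
        moreover have "2 * T \<le> T * T" using T3 by (intro mult_right_mono) auto
        hence "T + 13 \<le> T\<^sup>2" using T3 unfolding power2_eq_square by linarith
        ultimately show ?thesis by (intro ln_mono) auto
      qed
      also have "ln (T\<^sup>2) = 2 * ln T" using T3 by (simp add: ln_realpow)
      finally have "P * ln (Im z) \<le> P * (2 * ln T)" using P by (intro mult_left_mono) auto
      hence "exp (P * ln (Im z)) \<le> M" unfolding M_def by (simp add: mult_ac)
      thus ?thesis using 1 by linarith
    qed
    note lz = local_zeros[OF r f nz M]
    define Bd where "Bd = ln (M / norm (F z0))"
    have Bd: "Bd \<le> K1 * ln T"
    proof -
      have "Bd = 2 * P * ln T - ln (norm (F z0))" using nz by (simp add: Bd_def ln_div M_def)
      also have "\<dots> \<le> 2 * P * ln T - ln c" using c(1) cz by (intro diff_left_mono ln_mono) auto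
      also have "\<dots> \<le> K1 * ln T"
      proof -
        have "- ln c \<le> \<bar>ln c\<bar> * 1" by simp
        also have "\<dots> \<le> \<bar>ln c\<bar> * ln T" using ln1 by (intro mult_left_mono) auto
        finally show ?thesis by (simp add: K1_def distrib_right)
      qed
      finally show ?thesis .
    qed
    have Bd0: "0 \<le> Bd" using lz(2) by (simp add: Bd_def)
    have K1l: "K1 * ln T \<ge> 0" using K1 ln1 by simp
    have "real (\<Sum>p\<in>{z \<in> cball z0 4. F z = 0}. nat (zorder F p)) \<le> 2 * Bd" using lz(3) by (simp add: Bd_def)
    also have "\<dots> \<le> K * ln T" using Bd K1l ln1 by (simp add: K_def distrib_right)
    finally have 2: "real (\<Sum>p\<in>{z \<in> cball z0 4. F z = 0}. nat (zorder F p)) \<le> K * ln T" .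
    have 3: "norm (deriv F z / F z) \<le> K * ln T / d + K * ln T"
      if "z \<in> cball z0 2" "d > 0" "\<forall>p\<in>{z \<in> cball z0 4. F z = 0}. d \<le> norm (z - p)" for z d
    proof -
      have "norm (deriv F z / F z) \<le> 2 * Bd / d + 12 * (2 * Bd + 3) / 4"
        using lz(4)[of z d] that by (simp add: Bd_def)
      also have "\<dots> \<le> K * ln T / d + K * ln T"
      proof (rule add_mono)
        have "2 * Bd \<le> K * ln T" using Bd K1l ln1 by (simp add: K_def distrib_right)
        thus "2 * Bd / d \<le> K * ln T / d" using that by (intro divide_right_mono) auto
        show "12 * (2 * Bd + 3) / 4 \<le> K * ln T" using Bd ln1 by (simp add: K_def distrib_right)
      qed
      finally show ?thesis .
    qed
    show ?thesis using lz(1) 2 3 unfolding z0_def by blast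
  qed
  have "K \<ge> 1" "T0 \<ge> 3" using K1 P by (auto simp: K_def T0_def)
  thus ?thesis using main by blast
qed

end

section \<open>Two functions that almost agree at the primes\<close>

lemma summable_on_times:
  fixes f g :: "nat \<Rightarrow> real"
  assumes f: "f summable_on A" "\<And>x. f x \<ge> 0" and g: "g summable_on B" "\<And>y. g y \<ge> 0"
  shows "(\<lambda>(x,y). f x * g y) summable_on (A \<times> B)"
proof -
  have "(\<lambda>z. norm (case z of (x,y) \<Rightarrow> f x * g y)) summable_on A \<times> B"
  proof (subst Infinite_Sum.abs_summable_on_Sigma_iff, intro conjI ballI)
    show "(\<lambda>y. norm (case (x, y) of (x, y) \<Rightarrow> f x * g y)) summable_on B" for x
      using f(2) g(2) by (simp add: summable_on_cmult_right[OF g(1)])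
    have "(\<lambda>x. f x * infsum g B) summable_on A"
      by (rule summable_on_cmult_left[OF f(1)])
    thus "(\<lambda>x. norm (\<Sum>\<^sub>\<infinity>y\<in>B. norm (case (x, y) of (x, y) \<Rightarrow> f x * g y))) summable_on A"
      using f(2) g(2) by (simp add: infsum_cmult_right' infsum_nonneg)
  qed
  thus ?thesis by (rule Infinite_Sum.abs_summable_summable)
qed

lemma summable_on_union:
  fixes f :: "nat \<Rightarrow> real"
  assumes "f summable_on A" "f summable_on B"
  shows "f summable_on (A \<union> B)"
proof -
  have "f summable_on (B - A)" by (rule summable_on_subset_banach[OF assms(2)]) auto
  from summable_on_Un_disjoint[OF assms(1) this] show ?thesis by simp
qed

lemma summable_on_comparison_real:
  fixes f g :: "'a \<Rightarrow> real"
  assumes "g summable_on A" "\<And>x. x \<in> A \<Longrightarrow> 0 \<le> f x" "\<And>x. x \<in> A \<Longrightarrow> f x \<le> g x"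
  shows "f summable_on A"
  by (rule summable_on_comparison_test[OF assms(1) assms(3) assms(2)])

lemma summable_on_powr:
  assumes "\<kappa> > 1" shows "(\<lambda>n. real n powr (- \<kappa>)) summable_on A"
proof -
  have "summable (\<lambda>n. real n powr (- \<kappa>))" using assms by (simp add: summable_real_powr_iff)
  hence "(\<lambda>n. real n powr (- \<kappa>)) summable_on UNIV" by (subst summable_on_UNIV_nonneg_real_iff) auto
  thus ?thesis by (rule summable_on_subset_banach) auto
qed

text \<open>The \<open>i\<close>-th element of a set whose counting function is \<open>O(x\<^sup>\<alpha>)\<close> is at least a constant times \<open>i\<close>
  to the power \<open>1/\<alpha>\<close>.\<close>

lemma summable_on_thin_set:
  fixes E :: "nat set"
  assumes cnt: "\<And>p. p \<in> E \<Longrightarrow> real (card {q \<in> E. q \<le> p}) \<le> C * real p powr \<alpha>"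
    and C: "C > 0" and \<alpha>: "0 < \<alpha>" "\<alpha> < \<beta>" and E: "0 \<notin> E"
  shows "(\<lambda>p. real p powr (- \<beta>)) summable_on E"
proof -
  define r where "r = (\<lambda>p. card {q \<in> E. q \<le> p})"
  have mono: "r p < r q" if "p \<in> E" "q \<in> E" "p < q" for p q
  proof -
    have "q \<in> {x \<in> E. x \<le> q}" "q \<notin> {x \<in> E. x \<le> p}" "{x \<in> E. x \<le> p} \<subseteq> {x \<in> E. x \<le> q}"
      using that by auto
    hence "{x \<in> E. x \<le> p} \<subset> {x \<in> E. x \<le> q}" by blast
    thus ?thesis unfolding r_def by (intro psubset_card_mono) auto
  qed
  have inj: "inj_on r E"
    by (rule inj_onI) (metis mono linorder_neqE_nat less_irrefl)
  have "(\<lambda>i. real i powr (- (\<beta> / \<alpha>))) summable_on r ` E" using \<alpha> by (intro summable_on_powr) auto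
  hence s: "(\<lambda>p. real (r p) powr (- (\<beta> / \<alpha>))) summable_on E"
    by (subst (asm) summable_on_reindex[OF inj]) (simp add: o_def)
  show ?thesis
  proof (rule summable_on_comparison_real[OF summable_on_cmult_right[OF s, of "C powr (\<beta> / \<alpha>)"]])
    fix p assume p: "p \<in> E"
    have p0: "p > 0" using p E by (cases p) auto
    have rpos: "r p > 0" unfolding r_def using p by (subst card_gt_0_iff) auto
    have "real p powr (- \<beta>) = (real p powr \<alpha>) powr (- (\<beta> / \<alpha>))"
      using \<alpha> by (simp add: powr_powr)
    also have "\<dots> \<le> (real (r p) / C) powr (- (\<beta> / \<alpha>))"
      using cnt[OF p] C rpos \<alpha> by (intro powr_mono2') (auto simp: r_def field_simps)
    also have "\<dots> = C powr (\<beta> / \<alpha>) * real (r p) powr (- (\<beta> / \<alpha>))"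
      using C rpos by (simp add: powr_divide powr_minus field_simps)
    finally show "real p powr (- \<beta>) \<le> C powr (\<beta> / \<alpha>) * real (r p) powr (- (\<beta> / \<alpha>))" .
  qed simp
qed

lemma prime_power_inject:
  fixes p q :: nat
  assumes "prime p" "prime q" "k > 0" "p ^ k = q ^ l" shows "p = q \<and> k = l"
proof -
  have "p dvd q ^ l" using assms by (metis dvd_power)
  hence "p = q" using assms prime_dvd_power primes_dvd_imp_eq by blast
  thus ?thesis using assms prime_gt_1_nat[of p] by (simp add: power_inject_exp)
qed

locale selberg_pair =
  A: selberg F aF bF QF NF lamF \<mu>F wF + B: selberg G aG bG QG NG lamG \<mu>G wG
  for F aF bF QF NF lamF \<mu>F wF G aG bG QG NG lamG \<mu>G wG +
  fixes E :: "nat set" and \<delta> :: real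
  assumes E_prime: "\<And>p. p \<in> E \<Longrightarrow> prime p" and \<delta>_pos: "\<delta> > 0"
    and E_thin: "(\<lambda>x::real. real (card {p \<in> E. real p \<le> x})) \<in> O(\<lambda>x. x powr (1/2 - \<delta>))"
    and agree: "\<And>p. prime p \<Longrightarrow> p \<notin> E \<Longrightarrow> aF p = aG p"
begin

definition e :: "nat \<Rightarrow> complex" where "e n = A.bL n - B.bL n"

text \<open>At \<open>\<sigma> = 1/2\<close> the terms of the Dirichlet series of \<open>e\<close> are absolutely summable except for those at
  the squares of primes.\<close>

definition psquares :: "nat set" where "psquares = {p\<^sup>2 | p. prime p}"

definition e1 :: "nat \<Rightarrow> complex" where "e1 n = (if n \<in> psquares then 0 else e n)"
definition e2 :: "nat \<Rightarrow> complex" where "e2 n = (if n \<in> psquares then e n else 0)"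

lemma e_split: "e n = e1 n + e2 n"
  by (simp add: e1_def e2_def)

lemma e_prime_power: "prime p \<Longrightarrow> k > 0 \<Longrightarrow> e (p ^ k) = (bF (p ^ k) - bG (p ^ k)) * of_real (ln (real p))"
  by (simp add: e_def A.bL_def B.bL_def left_diff_distrib)

lemma e_eq_0: "\<not> primepow n \<Longrightarrow> e n = 0"
  by (simp add: e_def A.bL_def B.bL_def mangoldt_def)

lemma e_prime: "prime p \<Longrightarrow> p \<notin> E \<Longrightarrow> e p = 0"
  using e_prime_power[of p 1] agree[of p] by (simp add: A.b_prime B.b_prime)

lemma e_prime_square:
  assumes "prime p" "p \<notin> E" shows "e (p\<^sup>2) = 2 * (aF (p\<^sup>2) - aG (p\<^sup>2)) * of_real (ln (real p))"
  using e_prime_power[of p 2] agree[of p] assms by (simp add: A.b_prime_square B.b_prime_square algebra_simps)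

lemma ln_le_powr: fixes x \<epsilon> :: real assumes "x \<ge> 1" "\<epsilon> > 0" shows "\<bar>ln x\<bar> \<le> x powr \<epsilon> / \<epsilon>"
  using ln_powr_bound[of x \<epsilon>] assms by simp

lemma e_prime_power_bound:
  assumes "k \<ge> 1" "\<epsilon> > 0"
  shows "\<exists>C\<ge>0. \<forall>p. prime p \<longrightarrow> norm (e (p ^ k)) \<le> C * real p powr \<epsilon>"
proof -
  obtain C1 where C1: "C1 \<ge> 0" "\<And>p. prime p \<Longrightarrow> norm (bF (p ^ k)) \<le> C1 * real p powr (\<epsilon> / 2)"
    using A.b_prime_power_bound[OF assms(1), of "\<epsilon> / 2"] assms by auto
  obtain C2 where C2: "C2 \<ge> 0" "\<And>p. prime p \<Longrightarrow> norm (bG (p ^ k)) \<le> C2 * real p powr (\<epsilon> / 2)"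
    using B.b_prime_power_bound[OF assms(1), of "\<epsilon> / 2"] assms by auto
  have "norm (e (p ^ k)) \<le> ((C1 + C2) * (2 / \<epsilon>)) * real p powr \<epsilon>" if p: "prime p" for p
  proof -
    have p1: "real p \<ge> 1" using prime_ge_1_nat[OF p] by simp
    have "norm (e (p ^ k)) = norm (bF (p ^ k) - bG (p ^ k)) * \<bar>ln (real p)\<bar>"
      using e_prime_power[OF p, of k] assms by (simp add: norm_mult)
    also have "\<dots> \<le> (C1 * real p powr (\<epsilon> / 2) + C2 * real p powr (\<epsilon> / 2)) * (real p powr (\<epsilon> / 2) / (\<epsilon> / 2))"
      using C1(1) C2(1) assms p1 p
      by (intro mult_mono ln_le_powr order.trans[OF norm_triangle_ineq4] add_mono C1(2) C2(2)) auto
    also have "\<dots> = ((C1 + C2) * (2 / \<epsilon>)) * (real p powr (\<epsilon> / 2) * real p powr (\<epsilon> / 2))"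
      using assms by (simp add: field_simps)
    also have "real p powr (\<epsilon> / 2) * real p powr (\<epsilon> / 2) = real p powr \<epsilon>" by (simp add: powr_add[symmetric])
    finally show ?thesis .
  qed
  moreover have "(C1 + C2) * (2 / \<epsilon>) \<ge> 0" using C1 C2 assms by simp
  ultimately show ?thesis by blast
qed

lemma e_power_bound: "\<exists>\<theta> C. 0 \<le> \<theta> \<and> \<theta> < 1/2 \<and> 0 \<le> C \<and> (\<forall>n\<ge>1. norm (bF n - bG n) \<le> C * real n powr \<theta>)"
proof -
  obtain \<theta>1 where 1: "\<theta>1 < 1/2" "(\<lambda>m. norm (bF m)) \<in> O(\<lambda>m. real m powr \<theta>1)"
    using A.log_series by (auto simp: selberg_log_series_def)
  obtain \<theta>2 where 2: "\<theta>2 < 1/2" "(\<lambda>m. norm (bG m)) \<in> O(\<lambda>m. real m powr \<theta>2)"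
    using B.log_series by (auto simp: selberg_log_series_def)
  obtain C1 where C1: "C1 \<ge> 0" "\<And>n. n \<ge> 1 \<Longrightarrow> norm (bF n) \<le> C1 * real n powr \<theta>1" using bigo_nat_bound[OF 1(2)] by auto
  obtain C2 where C2: "C2 \<ge> 0" "\<And>n. n \<ge> 1 \<Longrightarrow> norm (bG n) \<le> C2 * real n powr \<theta>2" using bigo_nat_bound[OF 2(2)] by auto
  define \<theta> where "\<theta> = max 0 (max \<theta>1 \<theta>2)"
  have "norm (bF n - bG n) \<le> (C1 + C2) * real n powr \<theta>" if n: "n \<ge> 1" for n
  proof -
    have "norm (bF n - bG n) \<le> C1 * real n powr \<theta>1 + C2 * real n powr \<theta>2"
      using C1(2)[OF n] C2(2)[OF n] norm_triangle_ineq4[of "bF n" "bG n"] by linarith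
    also have "\<dots> \<le> C1 * real n powr \<theta> + C2 * real n powr \<theta>"
      using C1 C2 n by (intro add_mono mult_left_mono powr_mono) (auto simp: \<theta>_def)
    finally show ?thesis by (simp add: distrib_right)
  qed
  thus ?thesis using 1 2 C1 C2 by (intro exI[of _ \<theta>] exI[of _ "C1 + C2"]) (auto simp: \<theta>_def)
qed

text \<open>For bounded k the estimate p^(1/4) suffices, as 1/4 - k/2 <= -5/4 for k >= 3. For large
  k the exponent \<theta> < 1/2 saves (p^k)^(2 \<eta>): one factor p^(\<eta> k) >= p^(3/2) turns
  p^(1/4) into p^(-5/4), the other gives geometric decay in k.\<close>

lemma e_high_power_bound:
  "\<exists>C \<eta>. C \<ge> 0 \<and> \<eta> > 0 \<and> (\<forall>p k. prime p \<longrightarrow> k \<ge> 3 \<longrightarrow>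
     norm (e (p ^ k)) * real (p ^ k) powr (- (1/2)) \<le> C * (real p powr (- (5/4)) * 2 powr (- \<eta> * real k)))"
proof -
  obtain \<theta> C where \<theta>: "0 \<le> \<theta>" "\<theta> < 1/2" and C: "0 \<le> C" "\<And>n. n \<ge> 1 \<Longrightarrow> norm (bF n - bG n) \<le> C * real n powr \<theta>"
    using e_power_bound by blast
  define \<eta> where "\<eta> = (1/2 - \<theta>) / 2"
  have \<eta>: "\<eta> > 0" using \<theta> by (simp add: \<eta>_def)
  define K where "K = nat \<lceil>(3/2) / \<eta>\<rceil>"
  have K: "3/2 \<le> \<eta> * real k" if "k \<ge> K" for k
  proof -
    have "(3/2) / \<eta> \<le> real K" by (simp add: K_def real_nat_ceiling_ge)
    also have "real K \<le> real k" using that by simp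
    finally show ?thesis using \<eta> by (simp add: field_simps)
  qed
  have "\<forall>k\<in>{1..K}. \<exists>C\<ge>0. \<forall>p. prime p \<longrightarrow> norm (e (p ^ k)) \<le> C * real p powr (1/4)"
    using e_prime_power_bound[of _ "1/4"] by simp
  then obtain B where B: "\<And>k. k \<in> {1..K} \<Longrightarrow> B k \<ge> 0 \<and> (\<forall>p. prime p \<longrightarrow> norm (e (p ^ k)) \<le> B k * real p powr (1/4))"
    by metis
  define C' where "C' = 4 * C + (\<Sum>k\<in>{1..K}. B k * 2 powr (\<eta> * real k))"
  have sB: "(\<Sum>k\<in>{1..K}. B k * 2 powr (\<eta> * real k)) \<ge> 0" using B by (intro sum_nonneg) auto
  have "norm (e (p ^ k)) * real (p ^ k) powr (- (1/2)) \<le> C' * (real p powr (- (5/4)) * 2 powr (- \<eta> * real k))"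
    if p: "prime p" and k: "k \<ge> 3" for p k
  proof -
    have p2: "real p \<ge> 2" using prime_ge_2_nat[OF p] by simp
    have pk: "real (p ^ k) powr x = real p powr (real k * x)" for x
      using p2 by (simp add: powr_powr[symmetric] powr_realpow)
    show ?thesis
    proof (cases "k \<le> K")
      case True
      have "norm (e (p ^ k)) * real (p ^ k) powr (- (1/2)) \<le> (B k * real p powr (1/4)) * real p powr (- (3/2))"
      proof (intro mult_mono)
        show "norm (e (p ^ k)) \<le> B k * real p powr (1/4)" using B[of k] True k p by auto
        show "real (p ^ k) powr (- (1/2)) \<le> real p powr (- (3/2))" unfolding pk using p2 k by (intro powr_mono) auto
      qed (use B[of k] True k in auto)
      also have "\<dots> = (B k * 2 powr (\<eta> * real k)) * ((real p powr (1/4) * real p powr (- (3/2))) * 2 powr (- \<eta> * real k))"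
        by (simp add: powr_minus)
      also have "real p powr (1/4) * real p powr (- (3/2)) = real p powr (- (5/4))" by (simp add: powr_add[symmetric])
      also have "(B k * 2 powr (\<eta> * real k)) * (real p powr (- (5/4)) * 2 powr (- \<eta> * real k)) \<le> C' * (real p powr (- (5/4)) * 2 powr (- \<eta> * real k))"
      proof (rule mult_right_mono)
        have "B k * 2 powr (\<eta> * real k) \<le> (\<Sum>k\<in>{1..K}. B k * 2 powr (\<eta> * real k))"
          using True k B by (intro member_le_sum) auto
        thus "B k * 2 powr (\<eta> * real k) \<le> C'" using C by (simp add: C'_def)
      qed simp
      finally show ?thesis .
    next
      case False
      have "norm (e (p ^ k)) = norm (bF (p ^ k) - bG (p ^ k)) * \<bar>ln (real p)\<bar>"
        using e_prime_power[OF p, of k] k by (simp add: norm_mult)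
      also have "\<dots> \<le> (C * real (p ^ k) powr \<theta>) * (real p powr (1/4) / (1/4))"
        using C p2 p by (intro mult_mono C ln_le_powr) auto
      finally have "norm (e (p ^ k)) * real (p ^ k) powr (- (1/2)) \<le> (C * real (p ^ k) powr \<theta>) * (real p powr (1/4) / (1/4)) * real (p ^ k) powr (- (1/2))"
        by (rule mult_right_mono) simp
      also have "\<dots> = 4 * C * (real p powr (1/4) * real p powr (- \<eta> * real k)) * real p powr (- \<eta> * real k)"
      proof -
        have "real (p ^ k) powr \<theta> * real (p ^ k) powr (- (1/2)) = real p powr (- \<eta> * real k) * real p powr (- \<eta> * real k)"
        proof -
          have "real k * \<theta> + real k * (- (1/2)) = - \<eta> * real k + - \<eta> * real k"
            by (simp add: \<eta>_def algebra_simps)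
          thus ?thesis unfolding pk powr_add[symmetric] by (rule arg_cong)
        qed
        thus ?thesis by (simp add: mult_ac)
      qed
      also have "\<dots> \<le> 4 * C * (real p powr (- (5/4))) * 2 powr (- \<eta> * real k)"
      proof (intro mult_mono)
        have "real p powr (1/4) * real p powr (- \<eta> * real k) = real p powr (1/4 - \<eta> * real k)" by (simp add: powr_add[symmetric])
        also have "\<dots> \<le> real p powr (- (5/4))" using K[of k] False p2 by (intro powr_mono) auto
        finally show "real p powr (1/4) * real p powr (- \<eta> * real k) \<le> real p powr (- (5/4))" .
        show "real p powr (- \<eta> * real k) \<le> 2 powr (- \<eta> * real k)" using p2 \<eta> by (intro powr_mono2') auto
      qed (use C in auto)
      also have "\<dots> \<le> C' * (real p powr (- (5/4)) * 2 powr (- \<eta> * real k))"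
        using sB unfolding mult.assoc[symmetric] by (intro mult_right_mono) (auto simp: C'_def)
      finally show ?thesis .
    qed
  qed
  moreover have "C' \<ge> 0" using C sB by (simp add: C'_def)
  ultimately show ?thesis using \<eta> by blast
qed

lemma summable_high_powers:
  "(\<lambda>n. norm (e n) * real n powr (- (1/2))) summable_on {p ^ k | p k. prime p \<and> k \<ge> 3}"
proof -
  obtain C \<eta> where C: "C \<ge> 0" "\<eta> > 0" and bd: "\<And>p k. prime p \<Longrightarrow> k \<ge> 3 \<Longrightarrow>
     norm (e (p ^ k)) * real (p ^ k) powr (- (1/2)) \<le> C * (real p powr (- (5/4)) * 2 powr (- \<eta> * real k))"
    using e_high_power_bound by blast
  let ?P = "{p::nat. prime p} \<times> {3::nat..}"
  have img: "{p ^ k | p k. prime (p::nat) \<and> k \<ge> 3} = (\<lambda>(p,k). p ^ k) ` ?P" by auto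
  have inj: "inj_on (\<lambda>(p,k). p ^ k) ?P"
  proof (rule inj_onI)
    fix x y assume xy: "x \<in> ?P" "y \<in> ?P" "(case x of (p,k) \<Rightarrow> p ^ k) = (case y of (p,k) \<Rightarrow> p ^ k)"
    obtain p k q l where *: "x = (p, k)" "y = (q, l)" by (metis surj_pair)
    thus "x = y" using xy prime_power_inject[of p q k l] by simp
  qed
  have "(\<lambda>k. 2 powr (- \<eta> * real k)) summable_on ({3..} :: nat set)"
  proof -
    have "summable (\<lambda>k. (2 powr (- \<eta>)) ^ k)"
      using C by (intro summable_geometric) (simp add: powr_less_one)
    hence "summable (\<lambda>k. 2 powr (- \<eta> * real k))"
      by (simp add: powr_realpow[symmetric] powr_powr)
    hence "(\<lambda>k. 2 powr (- \<eta> * real k)) summable_on (UNIV :: nat set)"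
      by (subst summable_on_UNIV_nonneg_real_iff) auto
    thus ?thesis by (rule summable_on_subset_banach) auto
  qed
  hence "(\<lambda>(p,k). real p powr (- (5/4)) * 2 powr (- \<eta> * real k)) summable_on ?P"
    by (intro summable_on_times summable_on_powr) auto
  hence "(\<lambda>x. C * (case x of (p,k) \<Rightarrow> real p powr (- (5/4)) * 2 powr (- \<eta> * real k))) summable_on ?P"
    by (rule summable_on_cmult_right)
  hence "(\<lambda>x. norm (e (case x of (p,k) \<Rightarrow> p ^ k)) * real (case x of (p,k) \<Rightarrow> p ^ k) powr (- (1/2))) summable_on ?P"
    by (rule summable_on_comparison_real) (use bd in auto)
  thus ?thesis unfolding img by (subst summable_on_reindex[OF inj]) (simp add: o_def)
qed

lemma E_count: "\<exists>C>0. \<exists>\<alpha>. 0 < \<alpha> \<and> \<alpha> < 1/2 \<and> (\<forall>p\<in>E. real (card {q \<in> E. q \<le> p}) \<le> C * real p powr \<alpha>)"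
proof -
  \<comment> \<open>For \<delta> >= 1/2 the exponent 1/2 - \<delta> would not be positive, but
    \<open>summable_on_thin_set\<close> divides by it.\<close>
  define \<alpha> where "\<alpha> = 1/2 - min \<delta> (1/4)"
  have \<alpha>: "0 < \<alpha>" "\<alpha> < 1/2" "1/2 - \<delta> \<le> \<alpha>" using \<delta>_pos by (auto simp: \<alpha>_def)
  obtain c where "eventually (\<lambda>x. norm (real (card {p \<in> E. real p \<le> x})) \<le> c * norm (x powr (1/2 - \<delta>))) at_top"
    using landau_o.bigE[OF E_thin] by blast
  then obtain x0 where x0: "\<And>x. x \<ge> x0 \<Longrightarrow> real (card {p \<in> E. real p \<le> x}) \<le> c * x powr (1/2 - \<delta>)"
    by (auto simp: eventually_at_top_linorder)
  define C where "C = \<bar>c\<bar> + \<bar>x0\<bar> + 1"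
  have "real (card {q \<in> E. q \<le> p}) \<le> C * real p powr \<alpha>" if p: "p \<in> E" for p
  proof -
    have p1: "real p \<ge> 1" using prime_ge_1_nat[OF E_prime[OF p]] by simp
    show ?thesis
    proof (cases "real p \<ge> x0")
      case True
      have "real (card {q \<in> E. q \<le> p}) \<le> c * real p powr (1/2 - \<delta>)" using x0[OF True] by simp
      also have "\<dots> \<le> C * real p powr \<alpha>" using p1 \<alpha> by (intro mult_mono powr_mono) (auto simp: C_def)
      finally show ?thesis .
    next
      case False
      have "card {q \<in> E. q \<le> p} \<le> card {1..p}"
        using prime_ge_1_nat[OF E_prime] by (intro card_mono) auto
      hence "real (card {q \<in> E. q \<le> p}) \<le> real p" by simp
      also have "\<dots> \<le> C * 1" using False by (simp add: C_def)
      also have "\<dots> \<le> C * real p powr \<alpha>" using p1 \<alpha> by (intro mult_left_mono) (auto simp: C_def intro: ge_one_powr_ge_zero)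
      finally show ?thesis .
    qed
  qed
  moreover have "C > 0" by (simp add: C_def)
  ultimately show ?thesis using \<alpha> by blast
qed

lemma summable_E: "\<exists>\<beta><1/2. (\<lambda>p. real p powr (- \<beta>)) summable_on E"
proof -
  obtain C \<alpha> where C: "C > 0" "0 < \<alpha>" "\<alpha> < 1/2" "\<And>p. p \<in> E \<Longrightarrow> real (card {q \<in> E. q \<le> p}) \<le> C * real p powr \<alpha>"
    using E_count by blast
  have "(\<lambda>p. real p powr (- ((\<alpha> + 1/2) / 2))) summable_on E"
    using C E_prime by (intro summable_on_thin_set[OF C(4) C(1,2)]) (auto dest: prime_gt_0_nat)
  thus ?thesis using C by (intro exI[of _ "(\<alpha> + 1/2) / 2"]) auto
qed

text \<open>Convergence at some exponent \<beta> < 1/2 leaves room for the factor p^(1/2 - \<beta>)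
  by which e (p) is bounded.\<close>

lemma summable_E_primes: "(\<lambda>n. norm (e n) * real n powr (- (1/2))) summable_on E"
proof -
  obtain \<beta> where \<beta>: "\<beta> < 1/2" "(\<lambda>p. real p powr (- \<beta>)) summable_on E" using summable_E by blast
  obtain C where C: "C \<ge> 0" "\<And>p. prime p \<Longrightarrow> norm (e (p ^ 1)) \<le> C * real p powr (1/2 - \<beta>)"
    using e_prime_power_bound[of 1 "1/2 - \<beta>"] \<beta> by auto
  show ?thesis
  proof (rule summable_on_comparison_real[OF summable_on_cmult_right[OF \<beta>(2), of C]])
    fix p assume p: "p \<in> E"
    have "norm (e p) * real p powr (- (1/2)) \<le> (C * real p powr (1/2 - \<beta>)) * real p powr (- (1/2))"
      using C(2)[OF E_prime[OF p]] by (intro mult_right_mono) auto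
    also have "\<dots> = C * real p powr (- \<beta>)" by (simp add: mult.assoc powr_add[symmetric])
    finally show "norm (e p) * real p powr (- (1/2)) \<le> C * real p powr (- \<beta>)" .
  qed simp
qed

lemma e1_support: "e1 n \<noteq> 0 \<Longrightarrow> n \<in> E \<union> {p ^ k | p k. prime p \<and> k \<ge> 3}"
proof -
  assume n: "e1 n \<noteq> 0"
  hence "e n \<noteq> 0" "n \<notin> psquares" by (auto simp: e1_def split: if_splits)
  hence "primepow n" using e_eq_0 by blast
  then obtain p k where pk: "prime p" "k > 0" "n = p ^ k" by (auto simp: primepow_def)
  have "k \<noteq> 2" using pk \<open>n \<notin> psquares\<close> by (auto simp: psquares_def)
  show ?thesis
  proof (cases "k = 1")
    case True thus ?thesis using pk e_prime[of p] \<open>e n \<noteq> 0\<close> by auto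
  next
    case False
    hence "k \<ge> 3" using pk \<open>k \<noteq> 2\<close> by linarith
    thus ?thesis using pk by blast
  qed
qed

lemma dabs_e1: "dabs e1 (1/2)"
proof -
  have "(\<lambda>n. norm (e n) * real n powr (- (1/2))) summable_on (E \<union> {p ^ k | p k. prime p \<and> k \<ge> 3})"
    by (rule summable_on_union[OF summable_E_primes summable_high_powers])
  hence "(\<lambda>n. norm (e1 n) * real n powr (- (1/2))) summable_on (E \<union> {p ^ k | p k. prime p \<and> k \<ge> 3})"
    by (rule summable_on_comparison_real) (auto simp: e1_def)
  also have "?this \<longleftrightarrow> (\<lambda>n. norm (e1 n) * real n powr (- (1/2))) summable_on {1..}"
    by (rule summable_on_cong_neutral) (use e1_support in auto)
  finally show ?thesis by (simp add: dabs_iff_abs_summable_on)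
qed

lemma e_square_bound: "\<epsilon> > 0 \<Longrightarrow> \<exists>C\<ge>0. \<forall>p. prime p \<longrightarrow> norm (e (p\<^sup>2)) \<le> C * real p powr \<epsilon>"
  using e_prime_power_bound[of 2 \<epsilon>] by simp

lemma psquares_img: "psquares = (\<lambda>p. p\<^sup>2) ` {p. prime p}" "inj_on (\<lambda>p::nat. p\<^sup>2) A"
  by (auto simp: psquares_def inj_on_def)

text \<open>For absolute convergence of the series over squares m = 1 is used, for the diagonal of
  the mean square m = 2. Half of \<epsilon> absorbs the size of e (p^2).\<close>

lemma summable_squares:
  assumes "\<epsilon> > 0" shows "(\<lambda>p. (norm (e (p\<^sup>2))) ^ m * real p powr (- (1 + \<epsilon>))) summable_on {p. prime p}"
proof (cases "m = 0")
  case True thus ?thesis using summable_on_powr[of "1 + \<epsilon>"] assms by simp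
next
  case False
  obtain C where C: "C \<ge> 0" "\<And>p. prime p \<Longrightarrow> norm (e (p\<^sup>2)) \<le> C * real p powr (\<epsilon> / (2 * real m))"
    using e_square_bound[of "\<epsilon> / (2 * real m)"] assms False by auto
  have s: "(\<lambda>p. C ^ m * real p powr (- (1 + \<epsilon> / 2))) summable_on {p. prime p}"
    using assms by (intro summable_on_cmult_right summable_on_powr) auto
  show ?thesis
  proof (rule summable_on_comparison_real[OF s])
    fix p :: nat assume "p \<in> {p. prime p}"
    hence p: "prime p" by simp
    have p0: "real p > 0" using prime_gt_0_nat[OF p] by simp
    have "(norm (e (p\<^sup>2))) ^ m * real p powr (- (1 + \<epsilon>)) \<le> (C * real p powr (\<epsilon> / (2 * real m))) ^ m * real p powr (- (1 + \<epsilon>))"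
      using C(2)[OF p] by (intro mult_right_mono power_mono) auto
    also have "\<dots> = C ^ m * ((real p powr (\<epsilon> / (2 * real m))) ^ m * real p powr (- (1 + \<epsilon>)))"
      by (simp add: power_mult_distrib)
    also have "(real p powr (\<epsilon> / (2 * real m))) ^ m = real p powr (\<epsilon> / 2)"
      using p0 False by (simp add: powr_realpow[symmetric] powr_powr)
    also have "real p powr (\<epsilon> / 2) * real p powr (- (1 + \<epsilon>)) = real p powr (- (1 + \<epsilon> / 2))"
      unfolding powr_add[symmetric] by (rule arg_cong[where f = "(powr) (real p)"]) simp
    finally show "(norm (e (p\<^sup>2))) ^ m * real p powr (- (1 + \<epsilon>)) \<le> C ^ m * real p powr (- (1 + \<epsilon> / 2))" .
  qed auto
qed

lemma dabs_e2: assumes "\<sigma> > 1/2" shows "dabs e2 \<sigma>"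
proof -
  have "(\<lambda>p. norm (e (p\<^sup>2)) ^ 1 * real p powr (- (1 + (2 * \<sigma> - 1)))) summable_on {p. prime p}"
    using assms by (intro summable_squares) auto
  moreover have "norm (e (p\<^sup>2)) ^ 1 * real p powr (- (1 + (2 * \<sigma> - 1))) = norm (e (p\<^sup>2)) * real (p\<^sup>2) powr (- \<sigma>)"
    if "p \<in> {p. prime p}" for p
  proof -
    have p0: "real p > 0" using that by (simp add: prime_gt_0_nat)
    have "real (p\<^sup>2) = real p powr 2" using p0 by simp
    hence "real (p\<^sup>2) powr (- \<sigma>) = real p powr (2 * (- \<sigma>))" by (simp only: powr_powr)
    thus ?thesis by simp
  qed
  ultimately have "(\<lambda>p. norm (e (p\<^sup>2)) * real (p\<^sup>2) powr (- \<sigma>)) summable_on {p. prime p}"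
    by (rule iffD1[OF summable_on_cong, rotated])
  hence "(\<lambda>n. norm (e n) * real n powr (- \<sigma>)) summable_on psquares"
    unfolding psquares_img(1) by (subst summable_on_reindex[OF psquares_img(2)]) (simp add: o_def)
  also have "?this \<longleftrightarrow> (\<lambda>n. norm (e2 n) * real n powr (- \<sigma>)) summable_on {1..}"
    by (rule summable_on_cong_neutral) (auto simp: e2_def psquares_def Suc_le_eq dest: prime_gt_0_nat)
  finally show ?thesis by (simp add: dabs_iff_abs_summable_on)
qed

lemma dabs_e: assumes "\<sigma> > 1/2" shows "dabs e \<sigma>"
proof -
  have "dabs (\<lambda>n. e1 n + e2 n) \<sigma>"
    using assms by (intro dabs_add dabs_e2 dabs_mono[OF dabs_e1]) auto
  thus ?thesis by (simp add: e_split[symmetric])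
qed

end

section \<open>The explicit formula\<close>

lemma reflected_has_field_derivative:
  assumes "(f has_field_derivative D) (at (1 - cnj s))"
  shows "((\<lambda>s. cnj (f (1 - cnj s))) has_field_derivative - cnj D) (at s)"
proof -
  have "(f has_field_derivative D) (at (cnj (1 - s)))" using assms by simp
  from has_field_derivative_cnj_cnj[OF this]
  have 1: "((cnj \<circ> f \<circ> cnj) has_field_derivative cnj D) (at (1 - s))" .
  have 2: "((\<lambda>s. 1 - s) has_field_derivative - 1) (at s)" by (auto intro!: derivative_eq_intros)
  have "((\<lambda>s. (cnj \<circ> f \<circ> cnj) (1 - s)) has_field_derivative cnj D * (- 1)) (at s)"
    by (rule DERIV_chain2[OF 1 2])
  thus ?thesis by (simp add: o_def)
qed

text \<open>Stated at every point, zero or not: with order 0 it says that the logarithmic derivative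
  is holomorphic nearby. Residues can thus be computed without distinguishing which of two functions
  vanishes.\<close>

lemma zero_factor:
  fixes f :: "complex \<Rightarrow> complex"
  assumes f: "f holomorphic_on S" "open S" "connected S" "p \<in> S" and nz: "w \<in> S" "f w \<noteq> 0"
  shows "\<exists>r>0. \<exists>q. ball p r \<subseteq> S \<and> q holomorphic_on ball p r \<and> (\<forall>z\<in>ball p r - {p}. f z \<noteq> 0 \<and>
     deriv f z / f z = of_int (zorder f p) / (z - p) + q z)"
    and "zorder f p \<ge> 0" "f p = 0 \<Longrightarrow> zorder f p > 0" "f p \<noteq> 0 \<Longrightarrow> zorder f p = 0"
proof -
  define n g where "n = zorder f p" and "g = zor_poly f p"
  have "(if f p = 0 then n > 0 else n = 0) \<and> (\<exists>r. r > 0 \<and> cball p r \<subseteq> S \<and> g holomorphic_on cball p r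
    \<and> (\<forall>w\<in>cball p r. f w = g w * (w - p) ^ nat n \<and> g w \<noteq> 0))"
    unfolding n_def g_def by (rule zorder_exist_zero[OF f]) (use nz in blast)
  then obtain r where n: "if f p = 0 then n > 0 else n = 0" and r: "r > 0" "cball p r \<subseteq> S" "g holomorphic_on cball p r"
    "\<And>w. w \<in> cball p r \<Longrightarrow> f w = g w * (w - p) ^ nat n \<and> g w \<noteq> 0" by blast
  show n0: "zorder f p \<ge> 0" and "f p = 0 \<Longrightarrow> zorder f p > 0" "f p \<noteq> 0 \<Longrightarrow> zorder f p = 0"
    using n by (auto simp: n_def split: if_splits)
  have gb: "g holomorphic_on ball p r" by (rule holomorphic_on_subset[OF r(3)]) auto
  have "f z \<noteq> 0 \<and> deriv f z / f z = of_int (zorder f p) / (z - p) + deriv g z / g z" if z: "z \<in> ball p r - {p}" for z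
  proof -
    have zb: "z \<in> ball p r" "z \<noteq> p" using z by auto
    have fz: "f z = g z * (z - p) ^ nat n" "g z \<noteq> 0" using r(4)[of z] zb by auto
    have 1: "((\<lambda>z. (z - p) ^ nat n) has_field_derivative of_nat (nat n) * (z - p) ^ (nat n - 1)) (at z)"
      by (auto intro!: derivative_eq_intros)
    have 2: "(g has_field_derivative deriv g z) (at z)" by (rule holomorphic_derivI[OF gb open_ball zb(1)])
    from DERIV_mult[OF 2 1]
    have "((\<lambda>z. g z * (z - p) ^ nat n) has_field_derivative
       deriv g z * (z - p) ^ nat n + of_nat (nat n) * (z - p) ^ (nat n - 1) * g z) (at z)" .
    hence "(f has_field_derivative deriv g z * (z - p) ^ nat n + of_nat (nat n) * (z - p) ^ (nat n - 1) * g z) (at z)"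
      by (rule has_field_derivative_transform_within_open[OF _ open_ball zb(1)]) (use r(4) in auto)
    hence d: "deriv f z = deriv g z * (z - p) ^ nat n + of_nat (nat n) * (z - p) ^ (nat n - 1) * g z"
      by (rule DERIV_imp_deriv)
    have "of_nat (nat n) * (z - p) ^ (nat n - 1) = of_nat (nat n) * (z - p) ^ nat n / (z - p)"
      using zb by (cases "nat n") auto
    note pw = this
    have "deriv f z / f z = of_nat (nat n) / (z - p) + deriv g z / g z"
      unfolding d fz(1) pw using fz(2) zb by (simp add: add_divide_distrib)
    moreover have "of_nat (nat n) = (of_int (zorder f p) :: complex)" using n0 by (simp add: n_def)
    ultimately show ?thesis using fz zb by simp
  qed
  moreover have "(\<lambda>z. deriv g z / g z) holomorphic_on ball p r"
    using r(4) by (intro holomorphic_intros gb holomorphic_deriv) auto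
  moreover have "ball p r \<subseteq> S" using r(2) ball_subset_cball by blast
  ultimately show "\<exists>r>0. \<exists>q. ball p r \<subseteq> S \<and> q holomorphic_on ball p r \<and> (\<forall>z\<in>ball p r - {p}. f z \<noteq> 0 \<and>
     deriv f z / f z = of_int (zorder f p) / (z - p) + q z)"
    using r(1) by blast
qed

context selberg
begin

lemma gamma_region_mono:
  assumes "gamma_region C Y" "C \<le> C'" "Y \<le> Y'" shows "gamma_region C' Y'"
  unfolding gamma_region_def
proof (intro conjI allI impI)
  have 0: "C \<ge> 0" "Y \<ge> 3" using assms by (auto simp: gamma_region_def)
  thus "C' \<ge> 0" "Y' \<ge> 3" using assms by auto
  fix s assume s: "\<bar>Re s\<bar> \<le> 12" "Y' \<le> Im s"
  have s': "Y \<le> Im s" using s assms by simp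
  note D = gamma_regionD[OF assms(1) s(1) s']
  show "gam s \<noteq> 0" "(gam has_field_derivative dlog s * gam s) (at s)" by (rule D)+
  have "C * ln (Im s) \<le> C' * ln (Im s)" using assms 0 s' by (intro mult_right_mono) auto
  thus "norm (dlog s) \<le> C' * ln (Im s)" using D(3) by linarith
  have "C / Im s \<le> C' / Im s" using assms 0 s' by (intro divide_right_mono) auto
  thus "\<exists>d. (dlog has_field_derivative d) (at s) \<and> norm d \<le> C' / Im s" using D(4) by (blast intro: order.trans)
qed

lemma F_holo_upper: "F holomorphic_on {s. 0 < Im s}"
  by (rule F_holomorphic) auto

lemma F_nonzero_upper: "\<exists>w\<in>{s. 0 < Im s}. F w \<noteq> 0"
  using F_nonzero[of "Complex 2 1"] by (intro bexI[of _ "Complex 2 1"]) auto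

lemma connected_upper: "connected {s. 0 < Im s}"
  by (intro convex_connected convex_halfspace_Im_gt)

lemma open_upper: "open {s. 0 < Im s}"
  by (rule open_halfspace_Im_gt)

lemma zorder_F:
  assumes "Im p > 0"
  shows "zorder F p \<ge> 0" "F p = 0 \<Longrightarrow> zorder F p > 0" "F p \<noteq> 0 \<Longrightarrow> zorder F p = 0"
proof -
  obtain w where w: "w \<in> {s. 0 < Im s}" "F w \<noteq> 0" using F_nonzero_upper by blast
  have p: "p \<in> {s. 0 < Im s}" using assms by simp
  note z = zero_factor(2,3,4)[OF F_holo_upper open_upper connected_upper p w]
  show "zorder F p \<ge> 0" "F p = 0 \<Longrightarrow> zorder F p > 0" "F p \<noteq> 0 \<Longrightarrow> zorder F p = 0" by (rule z; assumption?)+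
qed

lemma F_factor:
  assumes "Im p > 0"
  shows "\<exists>r>0. \<exists>q. ball p r \<subseteq> {s. 0 < Im s} \<and> q holomorphic_on ball p r \<and> (\<forall>z\<in>ball p r - {p}. F z \<noteq> 0 \<and>
     deriv F z / F z = of_int (zorder F p) / (z - p) + q z)"
proof -
  obtain w where w: "w \<in> {s. 0 < Im s}" "F w \<noteq> 0" using F_nonzero_upper by blast
  have p: "p \<in> {s. 0 < Im s}" using assms by simp
  show ?thesis by (rule zero_factor(1)[OF F_holo_upper open_upper connected_upper p w])
qed

lemma finite_zeros_F:
  assumes "compact K" "K \<subseteq> {s. 0 < Im s}" shows "finite {z \<in> K. F z = 0}"
proof (cases "\<exists>z\<in>K. F z = 0")
  case True
  then obtain z where z: "z \<in> K" "F z = 0" by blast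
  obtain w where w: "w \<in> {s. 0 < Im s}" "F w \<noteq> 0" using F_nonzero_upper by blast
  have "\<not> F constant_on {s. 0 < Im s}"
  proof
    assume "F constant_on {s. 0 < Im s}"
    then obtain c where "\<And>x. x \<in> {s. 0 < Im s} \<Longrightarrow> F x = c" unfolding constant_on_def by blast
    from this[OF w(1)] this[of z] z w assms show False by auto
  qed
  thus ?thesis by (rule holomorphic_compact_finite_zeros[OF F_holo_upper open_upper connected_upper assms])
next
  case False
  hence "{z \<in> K. F z = 0} = {}" by blast
  thus ?thesis by (metis finite.emptyI)
qed

end

section \<open>The difference of the logarithmic derivatives on both sides of the critical line,
  with constants common to both functions\<close>

locale selberg_strip = selberg_pair +
  fixes C Y :: real
  assumes regF: "A.gamma_region C Y" and regG: "B.gamma_region C Y"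
begin

lemma C_nonneg: "C \<ge> 0" and Y_ge: "Y \<ge> 3"
  using regF by (auto simp: A.gamma_region_def)

definition al :: "complex \<Rightarrow> complex" where "al s = A.dlog s - B.dlog s"
text \<open>What the Gamma factors leave behind when the difference of the logarithmic derivatives
  is reflected in the critical line. It may grow like ln t, but its derivative is O(1/t).\<close>

definition xi :: "complex \<Rightarrow> complex" where "xi s = al s + cnj (al (1 - cnj s))"

lemma al_bounds:
  assumes "\<bar>Re s\<bar> \<le> 12" "Im s \<ge> Y"
  shows "norm (al s) \<le> 2 * C * ln (Im s)" "\<exists>d. (al has_field_derivative d) (at s) \<and> norm d \<le> 2 * C / Im s"
proof -
  note a = A.gamma_regionD[OF regF assms] and b = B.gamma_regionD[OF regG assms]
  show "norm (al s) \<le> 2 * C * ln (Im s)"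
    using a(3) b(3) norm_triangle_ineq4[of "A.dlog s" "B.dlog s"] by (simp add: al_def)
  obtain d1 where d1: "(A.dlog has_field_derivative d1) (at s)" "norm d1 \<le> C / Im s" using a(4) by blast
  obtain d2 where d2: "(B.dlog has_field_derivative d2) (at s)" "norm d2 \<le> C / Im s" using b(4) by blast
  have "(al has_field_derivative d1 - d2) (at s)"
    unfolding al_def[abs_def] by (rule DERIV_diff[OF d1(1) d2(1)])
  moreover have "norm (d1 - d2) \<le> 2 * C / Im s" using d1 d2 norm_triangle_ineq4[of d1 d2] by simp
  ultimately show "\<exists>d. (al has_field_derivative d) (at s) \<and> norm d \<le> 2 * C / Im s" by blast
qed

lemma xi_bounds:
  assumes s: "\<bar>Re s\<bar> \<le> 11" "Im s \<ge> Y"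
  shows "norm (xi s) \<le> 4 * C * ln (Im s)" "\<exists>d. (xi has_field_derivative d) (at s) \<and> norm d \<le> 4 * C / Im s"
proof -
  have 1: "\<bar>Re s\<bar> \<le> 12" and 2: "\<bar>Re (1 - cnj s)\<bar> \<le> 12" "Im (1 - cnj s) \<ge> Y" using s by auto
  show "norm (xi s) \<le> 4 * C * ln (Im s)"
    using al_bounds(1)[OF 1 s(2)] al_bounds(1)[OF 2] norm_triangle_ineq[of "al s" "cnj (al (1 - cnj s))"]
    by (simp add: xi_def)
  obtain d1 where d1: "(al has_field_derivative d1) (at s)" "norm d1 \<le> 2 * C / Im s" using al_bounds(2)[OF 1 s(2)] by blast
  obtain d2 where d2: "(al has_field_derivative d2) (at (1 - cnj s))" "norm d2 \<le> 2 * C / Im s"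
    using al_bounds(2)[OF 2] by auto
  have "(xi has_field_derivative d1 + - cnj d2) (at s)"
    unfolding xi_def[abs_def] by (rule DERIV_add[OF d1(1) reflected_has_field_derivative[OF d2(1)]])
  moreover have "norm (d1 + - cnj d2) \<le> 4 * C / Im s"
    using d1 d2 norm_triangle_ineq[of d1 "- cnj d2"] by simp
  ultimately show "\<exists>d. (xi has_field_derivative d) (at s) \<and> norm d \<le> 4 * C / Im s" by blast
qed

definition LD :: "complex \<Rightarrow> complex" where "LD s = deriv F s / F s - deriv G s / G s"

lemma logderiv_diff_right_of_1:
  assumes "Re s > 1" shows "LD s = - dser e s"
proof -
  have "dser e s = dser (\<lambda>n. A.bL n + - B.bL n) s" by (simp add: e_def[abs_def])
  also have "\<dots> = dser A.bL s + dser (\<lambda>n. - B.bL n) s"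
    by (rule dser_add[of _ "Re s"]) (use A.dabs_bL[OF assms] B.dabs_bL[OF assms] in auto)
  also have "dser (\<lambda>n. - B.bL n) s = - dser B.bL s"
    by (rule dser_uminus[OF B.dabs_bL[OF assms]]) simp
  finally show ?thesis using A.logderiv_F[OF assms] B.logderiv_F[OF assms] by (simp add: LD_def)
qed

lemma dser_e_holomorphic: "dser e holomorphic_on {s. 1/2 < Re s}"
proof -
  have "dser e field_differentiable at s" if "1/2 < Re s" for s
  proof -
    define \<sigma> where "\<sigma> = (1/2 + Re s) / 2"
    have "\<sigma> > 1/2" "\<sigma> < Re s" using that by (auto simp: \<sigma>_def)
    thus ?thesis using dser_has_field_derivative[OF dabs_e] unfolding field_differentiable_def by blast
  qed
  thus ?thesis unfolding holomorphic_on_def by (auto intro: field_differentiable_at_within)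
qed

text \<open>Multiplied by F G the identity becomes one between holomorphic functions, so it
  continues from Re s > 1 to Re s > 1/2 without regard to zeros.\<close>

lemma logderiv_diff_right:
  assumes s: "Re s > 1/2" "Im s > 0" "F s \<noteq> 0" "G s \<noteq> 0" shows "LD s = - dser e s"
proof -
  let ?S = "{s. 1/2 < Re s} \<inter> {s. 0 < Im s}"
  define D where "D = (\<lambda>s. deriv F s * G s - F s * deriv G s + dser e s * F s * G s)"
  have S: "open ?S" "connected ?S"
    by (intro open_Int open_halfspace_Re_gt open_halfspace_Im_gt)
       (intro convex_connected convex_Int convex_halfspace_Re_gt convex_halfspace_Im_gt)
  have FG: "F holomorphic_on ?S" "G holomorphic_on ?S"
    by (auto intro!: A.F_holomorphic B.F_holomorphic)
  have hol: "D holomorphic_on ?S"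
    unfolding D_def using S(1)
    by (intro holomorphic_intros holomorphic_deriv FG holomorphic_on_subset[OF dser_e_holomorphic]) auto
  have "D s = 0"
  proof (rule analytic_continuation[OF hol S, of "{s. 1 < Re s} \<inter> {s. 0 < Im s}" "Complex 2 1"])
    have "open ({s. 1 < Re s} \<inter> {s. 0 < Im s})" by (intro open_Int open_halfspace_Re_gt open_halfspace_Im_gt)
    thus "Complex 2 1 islimpt ({s. 1 < Re s} \<inter> {s. 0 < Im s})"
      by (intro interior_limit_point) (simp only: interior_open, simp)
    fix z assume z: "z \<in> {s. 1 < Re s} \<inter> {s. 0 < Im s}"
    have "F z \<noteq> 0" "G z \<noteq> 0" using z A.F_nonzero[of z] B.F_nonzero[of z] by auto
    thus "D z = 0" using logderiv_diff_right_of_1[of z] z by (simp add: D_def LD_def field_simps)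
  qed (use s in auto)
  thus ?thesis using s by (simp add: D_def LD_def field_simps)
qed

text \<open>The functional equations express the left-hand side at s by its value at 1 - cnj s,
  which lies to the right of the critical line.\<close>

lemma logderiv_diff_left:
  assumes s: "- 10 < Re s" "Re s < 1/2" "Im s > Y" "F s \<noteq> 0" "G s \<noteq> 0"
  shows "LD s = cnj (dser e (1 - cnj s)) - xi s"
proof -
  define s' where "s' = 1 - cnj s"
  have r: "\<bar>Re s\<bar> < 11" using s by auto
  have nz: "F s' \<noteq> 0" "G s' \<noteq> 0"
    using A.F_zero_reflect[OF regF r s(3)] B.F_zero_reflect[OF regG r s(3)] s by (auto simp: s'_def)
  have "LD s + al s = (deriv F s / F s + A.dlog s) - (deriv G s / G s + B.dlog s)"
    by (simp add: LD_def al_def)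
  also have "\<dots> = - cnj (LD s' + al s')"
    unfolding A.logderiv_reflect[OF regF r s(3,4)] B.logderiv_reflect[OF regG r s(3,5)]
    by (simp add: LD_def al_def s'_def)
  finally have "LD s + al s = - cnj (LD s' + al s')" .
  moreover have "LD s' = - dser e s'"
    using s nz Y_ge by (intro logderiv_diff_right) (auto simp: s'_def)
  ultimately show ?thesis by (simp add: xi_def s'_def algebra_simps add_eq_0_iff eq_diff_eq)
qed

text \<open>\<open>W\<close> is the continuation of the difference of the logarithmic derivatives. Outside of the critical line
  it has no singularities: the zeros of \<open>F\<close> and \<open>G\<close> there cancel.\<close>

definition W :: "complex \<Rightarrow> complex" where
  "W s = (if Re s > 1/2 then - dser e s else if Re s < 1/2 then cnj (dser e (1 - cnj s)) - xi s else LD s)"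

text \<open>The three cases in the definition of \<open>W\<close> are restrictions of one function;
  this glues them across the critical line.\<close>

lemma W_eq_LD:
  assumes "- 10 < Re s" "Im s > Y" "F s \<noteq> 0" "G s \<noteq> 0" shows "W s = LD s"
proof -
  have "Im s > 0" using assms Y_ge by simp
  thus ?thesis using assms logderiv_diff_left[of s] logderiv_diff_right[of s] unfolding W_def
    by (metis linorder_neqE_linordered_idom)
qed

definition sing :: "complex set" where "sing = {s. Re s = 1/2 \<and> (F s = 0 \<or> G s = 0)}"

lemma W_field_differentiable:
  assumes s: "- 10 < Re s" "Re s < 11" "Im s > Y" "s \<notin> sing"
  shows "W field_differentiable at s"
proof -
  consider "Re s > 1/2" | "Re s < 1/2" | "Re s = 1/2" by linarith
  thus ?thesis
  proof cases
    case 1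
    have "dser e field_differentiable at s"
      by (rule holomorphic_on_imp_differentiable_at[OF dser_e_holomorphic open_halfspace_Re_gt]) (use 1 in simp)
    then obtain d where "(dser e has_field_derivative d) (at s)" unfolding field_differentiable_def by blast
    from DERIV_minus[OF this] have "((\<lambda>s. - dser e s) has_field_derivative - d) (at s)" .
    hence "(W has_field_derivative - d) (at s)"
      by (rule has_field_derivative_transform_within_open[OF _ open_halfspace_Re_gt[of "1/2"]]) (use 1 in \<open>auto simp: W_def\<close>)
    thus ?thesis unfolding field_differentiable_def by blast
  next
    case 2
    have "1 - cnj s \<in> {s. 1/2 < Re s}" using 2 by simp
    hence "dser e field_differentiable at (1 - cnj s)"
      by (rule holomorphic_on_imp_differentiable_at[OF dser_e_holomorphic open_halfspace_Re_gt])
    then obtain d where "(dser e has_field_derivative d) (at (1 - cnj s))" unfolding field_differentiable_def by blast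
    note d = reflected_has_field_derivative[OF this]
    have "\<bar>Re s\<bar> \<le> 11" "Im s \<ge> Y" using s by auto
    then obtain d' where "(xi has_field_derivative d') (at s)" using xi_bounds(2) by blast
    from DERIV_diff[OF d this]
    have "((\<lambda>s. cnj (dser e (1 - cnj s)) - xi s) has_field_derivative - cnj d - d') (at s)" .
    hence "(W has_field_derivative - cnj d - d') (at s)"
      by (rule has_field_derivative_transform_within_open[OF _ open_halfspace_Re_lt[of "1/2"]]) (use 2 in \<open>auto simp: W_def\<close>)
    thus ?thesis unfolding field_differentiable_def by blast
  next
    case 3
    have nz: "F s \<noteq> 0" "G s \<noteq> 0" using s 3 by (auto simp: sing_def)
    let ?S = "{s. - 10 < Re s} \<inter> {s. Y < Im s}"
    have S: "open ?S" by (intro open_Int open_halfspace_Re_gt open_halfspace_Im_gt)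
    have FG: "F holomorphic_on ?S" "G holomorphic_on ?S"
      using Y_ge by (auto intro!: A.F_holomorphic B.F_holomorphic)
    have "continuous_on ?S (\<lambda>s. F s * G s)" by (intro continuous_intros holomorphic_on_imp_continuous_on FG)
    hence "open ((\<lambda>s. F s * G s) -` (- {0}) \<inter> ?S)"
      using continuous_on_open_vimage[OF S] open_Compl[OF closed_singleton] by blast
    hence "open (?S \<inter> (\<lambda>s. F s * G s) -` (- {0}))" by (simp only: Int_commute)
    hence O: "open (?S \<inter> {s. F s * G s \<noteq> 0})" (is "open ?O") by (simp add: vimage_def)
    have sO: "s \<in> ?O" using s nz by auto
    have "LD holomorphic_on ?O"
      unfolding LD_def[abs_def]
      by (intro holomorphic_intros holomorphic_on_subset[OF FG(1)] holomorphic_on_subset[OF FG(2)]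
          holomorphic_on_subset[OF holomorphic_deriv[OF FG(1) S]] holomorphic_on_subset[OF holomorphic_deriv[OF FG(2) S]]) auto
    hence "LD field_differentiable at s" by (rule holomorphic_on_imp_differentiable_at[OF _ O sO])
    then obtain d where "(LD has_field_derivative d) (at s)" unfolding field_differentiable_def by blast
    hence "(W has_field_derivative d) (at s)"
      by (rule has_field_derivative_transform_within_open[OF _ O sO]) (use W_eq_LD in auto)
    thus ?thesis unfolding field_differentiable_def by blast
  qed
qed

definition mz :: "complex \<Rightarrow> int" where "mz p = zorder F p - zorder G p"

text \<open>F and G contribute simple poles to their logarithmic derivatives, with their orders at p
  as residues; the entire factor k is evaluated at p.\<close>

lemma residue_W:
  assumes p: "- 10 < Re p" "Im p > Y" and k: "k holomorphic_on UNIV"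
  shows "residue (\<lambda>s. W s * k s) p = of_int (mz p) * k p"
proof -
  have p0: "Im p > 0" using p Y_ge by simp
  obtain r1 q1 where r1: "r1 > 0" "q1 holomorphic_on ball p r1" "\<And>z. z \<in> ball p r1 - {p} \<Longrightarrow> F z \<noteq> 0 \<and> deriv F z / F z = of_int (zorder F p) / (z - p) + q1 z"
    using A.F_factor[OF p0] by blast
  obtain r2 q2 where r2: "r2 > 0" "q2 holomorphic_on ball p r2" "\<And>z. z \<in> ball p r2 - {p} \<Longrightarrow> G z \<noteq> 0 \<and> deriv G z / G z = of_int (zorder G p) / (z - p) + q2 z"
    using B.F_factor[OF p0] by blast
  let ?O = "ball p (min r1 r2) \<inter> ({s. - 10 < Re s} \<inter> {s. Y < Im s})"
  have O: "open ?O" "p \<in> ?O" using r1 r2 p by (auto intro!: open_Int open_halfspace_Re_gt open_halfspace_Im_gt)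
  define f where "f = (\<lambda>z. of_int (mz p) * k z + (q1 z - q2 z) * k z * (z - p))"
  have f: "f holomorphic_on ?O"
    unfolding f_def by (intro holomorphic_intros holomorphic_on_subset[OF k] holomorphic_on_subset[OF r1(2)] holomorphic_on_subset[OF r2(2)]) auto
  have "W z * k z = f z / (z - p)" if z: "z \<in> ?O - {p}" for z
  proof -
    have 1: "F z \<noteq> 0 \<and> deriv F z / F z = of_int (zorder F p) / (z - p) + q1 z" using z by (intro r1(3)) auto
    have 2: "G z \<noteq> 0 \<and> deriv G z / G z = of_int (zorder G p) / (z - p) + q2 z" using z by (intro r2(3)) auto
    have "W z = LD z" using 1 2 z by (intro W_eq_LD) auto
    also have "\<dots> = of_int (mz p) / (z - p) + (q1 z - q2 z)"
      using 1 2 by (simp add: LD_def mz_def diff_divide_distrib)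
    finally have Wz: "W z = of_int (mz p) / (z - p) + (q1 z - q2 z)" .
    show ?thesis unfolding Wz f_def using z by (simp add: add_divide_distrib distrib_right)
  qed
  hence "residue (\<lambda>z. W z * k z) p = residue (\<lambda>z. f z / (z - p)) p"
    using O by (intro residue_cong) (auto simp: eventually_at_topological)
  also have "\<dots> = f p" by (rule residue_simple[OF O f])
  finally show ?thesis by (simp add: f_def)
qed

lemma finite_sing:
  assumes "compact K" "K \<subseteq> {s. 0 < Im s}" shows "finite (sing \<inter> K)"
proof (rule finite_subset)
  show "sing \<inter> K \<subseteq> {z \<in> K. F z = 0} \<union> {z \<in> K. G z = 0}" by (auto simp: sing_def)
qed (use A.finite_zeros_F[OF assms] B.finite_zeros_F[OF assms] in auto)

text \<open>A unit interval of heights meets O(ln T) zeros of F and G, so some height keeps a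
  distance of order 1 / ln T from all of them. There the logarithmic derivatives are O((ln T)^2),
  for which T is a convenient bound.\<close>

theorem good_height:
  "\<exists>T0\<ge>3. \<forall>T\<ge>T0. \<exists>U\<in>{T..T+1}. Complex (1/2) U \<notin> sing \<and> (\<forall>x\<in>{1/4..3/4}. norm (W (Complex x U)) \<le> T)"
proof -
  obtain K1 T1 where K1: "K1 \<ge> 1" "T1 \<ge> 3" and F: "\<And>T. T \<ge> T1 \<Longrightarrow> finite {z \<in> cball (Complex 2 (T + 1/2)) 4. F z = 0} \<and>
     real (\<Sum>p\<in>{z \<in> cball (Complex 2 (T + 1/2)) 4. F z = 0}. nat (zorder F p)) \<le> K1 * ln T \<and>
     (\<forall>z\<in>cball (Complex 2 (T + 1/2)) 2. \<forall>d>0. (\<forall>p\<in>{z \<in> cball (Complex 2 (T + 1/2)) 4. F z = 0}. d \<le> norm (z - p)) \<longrightarrow>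
        norm (deriv F z / F z) \<le> K1 * ln T / d + K1 * ln T)"
    using A.local_logderiv by blast
  obtain K2 T2 where K2: "K2 \<ge> 1" "T2 \<ge> 3" and G: "\<And>T. T \<ge> T2 \<Longrightarrow> finite {z \<in> cball (Complex 2 (T + 1/2)) 4. G z = 0} \<and>
     real (\<Sum>p\<in>{z \<in> cball (Complex 2 (T + 1/2)) 4. G z = 0}. nat (zorder G p)) \<le> K2 * ln T \<and>
     (\<forall>z\<in>cball (Complex 2 (T + 1/2)) 2. \<forall>d>0. (\<forall>p\<in>{z \<in> cball (Complex 2 (T + 1/2)) 4. G z = 0}. d \<le> norm (z - p)) \<longrightarrow>
        norm (deriv G z / G z) \<le> K2 * ln T / d + K2 * ln T)"
    using B.local_logderiv by blast
  define K where "K = max K1 K2"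
  have K: "K \<ge> 1" "K1 \<le> K" "K2 \<le> K" using K1 by (auto simp: K_def)
  have "eventually (\<lambda>T. 2 * (K * ln T * (2 * (2 * K * ln T + 2)) + K * ln T) \<le> T) at_top"
    using K(1) by real_asymp
  then obtain T3 where T3: "\<And>T. T \<ge> T3 \<Longrightarrow> 2 * (K * ln T * (2 * (2 * K * ln T + 2)) + K * ln T) \<le> T"
    by (auto simp: eventually_at_top_linorder)
  define T0 where "T0 = max (max T1 T2) (max T3 (Y + 10))"
  have main: "\<exists>U\<in>{T..T+1}. Complex (1/2) U \<notin> sing \<and> (\<forall>x\<in>{1/4..3/4}. norm (W (Complex x U)) \<le> T)" if T: "T \<ge> T0" for T
  proof -
    define z0 where "z0 = Complex 2 (T + 1/2)"
    have T': "T \<ge> T1" "T \<ge> T2" "T \<ge> T3" "T \<ge> Y + 10" using T by (auto simp: T0_def)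
    have ln1: "1 \<le> ln T" using T' Y_ge exp_le by (subst ln_ge_iff) auto
    define ZF ZG where "ZF = {z \<in> cball z0 4. F z = 0}" and "ZG = {z \<in> cball z0 4. G z = 0}"
    note F' = F[OF T'(1), folded z0_def, folded ZF_def] and G' = G[OF T'(2), folded z0_def, folded ZG_def]
    have im: "Im z > 0" if "z \<in> cball z0 4" for z
    proof -
      have "\<bar>Im z - (T + 1/2)\<bar> \<le> norm (z - z0)" using abs_Im_le_cmod[of "z - z0"] by (simp add: z0_def)
      thus ?thesis using that T' Y_ge by (auto simp: dist_norm norm_minus_commute)
    qed
    have cF: "real (card ZF) \<le> K1 * ln T"
    proof -
      have "(\<Sum>p\<in>ZF. 1) \<le> (\<Sum>p\<in>ZF. nat (zorder F p))"
        using A.zorder_F(2) im by (intro sum_mono) (fastforce simp: ZF_def)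
      hence "real (card ZF) \<le> real (\<Sum>p\<in>ZF. nat (zorder F p))" unfolding of_nat_le_iff by simp
      thus ?thesis using F' by linarith
    qed
    have cG: "real (card ZG) \<le> K2 * ln T"
    proof -
      have "(\<Sum>p\<in>ZG. 1) \<le> (\<Sum>p\<in>ZG. nat (zorder G p))"
        using B.zorder_F(2) im by (intro sum_mono) (fastforce simp: ZG_def)
      hence "real (card ZG) \<le> real (\<Sum>p\<in>ZG. nat (zorder G p))" unfolding of_nat_le_iff by simp
      thus ?thesis using G' by linarith
    qed
    define X where "X = Im ` (ZF \<union> ZG)"
    define n where "n = card X"
    have fX: "finite X" using F' G' by (simp add: X_def)
    have "n \<le> card (ZF \<union> ZG)" unfolding n_def X_def using F' G' by (intro card_image_le) auto
    also have "\<dots> \<le> card ZF + card ZG" by (rule card_Un_le)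
    finally have "real n \<le> K1 * ln T + K2 * ln T" using cF cG by linarith
    also have "\<dots> \<le> K * ln T + K * ln T" using K ln1 by (intro add_mono mult_right_mono) auto
    finally have n: "real n \<le> 2 * K * ln T" by simp
    obtain U where U: "U \<in> {T..T+1}" "\<And>x. x \<in> X \<Longrightarrow> 1 / (2 * (real n + 1)) \<le> \<bar>x - U\<bar>"
      using exists_separated_height[OF fX, of n T] by (auto simp: n_def)
    define d where "d = 1 / (2 * (real n + 1))"
    have d: "d > 0" by (simp add: d_def)
    have sep: "d \<le> norm (Complex x U - p)" if "p \<in> ZF \<union> ZG" for x p
    proof -
      have "d \<le> \<bar>Im p - U\<bar>" unfolding d_def using that by (intro U(2)) (auto simp: X_def)
      also have "\<dots> = \<bar>Im (Complex x U - p)\<bar>" by simp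
      also have "\<dots> \<le> norm (Complex x U - p)" by (rule abs_Im_le_cmod)
      finally show ?thesis .
    qed
    have inb: "Complex x U \<in> cball z0 2" if "x \<in> {1/4..3/4}" for x
    proof -
      have "\<bar>x - 2\<bar> \<le> 7/4" using that by (intro abs_leI) auto
      moreover have "\<bar>U - (T + 1/2)\<bar> \<le> 1/2" using U(1) by (intro abs_leI) auto
 ultimately have "(x - 2)\<^sup>2 \<le> (7/4)\<^sup>2" "(U - (T + 1/2))\<^sup>2 \<le> (1/2)\<^sup>2" by (auto intro!: abs_le_square_iff[THEN iffD1])
      moreover have "(norm (Complex x U - z0))\<^sup>2 = (x - 2)\<^sup>2 + (U - (T + 1/2))\<^sup>2" by (simp add: z0_def cmod_power2)
      \<comment> \<open>The segment fits into the disc of radius 2, for 49/16 + 4/16 < 4; this fixes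
        the range [1/4, 3/4] of abscissas.\<close>
      moreover have "(7/4::real)\<^sup>2 + (1/2)\<^sup>2 \<le> 2\<^sup>2" by (simp add: power2_eq_square)
      ultimately have "(norm (Complex x U - z0))\<^sup>2 \<le> 2\<^sup>2" by linarith
      hence "norm (Complex x U - z0) \<le> 2" by (rule power2_le_imp_le) simp
      thus ?thesis by (simp add: dist_norm norm_minus_commute)
    qed
    have nz: "F (Complex x U) \<noteq> 0" "G (Complex x U) \<noteq> 0" if "x \<in> {1/4..3/4}" for x
    proof -
      have "Complex x U \<in> cball z0 4" using inb[OF that] by simp
      thus "F (Complex x U) \<noteq> 0" "G (Complex x U) \<noteq> 0"
        using sep[of "Complex x U" x] d by (auto simp: ZF_def ZG_def)
    qed
    have "norm (W (Complex x U)) \<le> T" if x: "x \<in> {1/4..3/4}" for x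
    proof -
      have "W (Complex x U) = LD (Complex x U)" using x nz[OF x] U T' by (intro W_eq_LD) auto
      hence "norm (W (Complex x U)) \<le> norm (deriv F (Complex x U) / F (Complex x U)) + norm (deriv G (Complex x U) / G (Complex x U))"
        by (simp add: LD_def norm_triangle_ineq4)
      also have "\<dots> \<le> (K1 * ln T / d + K1 * ln T) + (K2 * ln T / d + K2 * ln T)"
        using F' G' inb[OF x] d sep by (intro add_mono) auto
      also have "\<dots> \<le> (K * ln T / d + K * ln T) + (K * ln T / d + K * ln T)"
        using K ln1 d by (intro add_mono divide_right_mono mult_right_mono) auto
      also have "\<dots> = 2 * (K * ln T * (2 * (real n + 1)) + K * ln T)" by (simp add: d_def)
      also have "\<dots> \<le> 2 * (K * ln T * (2 * (2 * K * ln T + 2)) + K * ln T)"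
        using n K ln1 by (intro mult_left_mono add_mono) auto
      also have "\<dots> \<le> T" by (rule T3[OF T'(3)])
      finally show ?thesis .
    qed
    moreover have "Complex (1/2) U \<notin> sing" using nz[of "1/2"] by (auto simp: sing_def)
    ultimately show ?thesis using U(1) by blast
  qed
  have "T0 \<ge> 3" using K1 by (auto simp: T0_def)
  thus ?thesis using main by blast
qed

end

lemma integral_cnj_Icc:
  fixes f :: "real \<Rightarrow> complex" assumes "f integrable_on {a..b}"
  shows "integral {a..b} (\<lambda>x. cnj (f x)) = cnj (integral {a..b} f)"
  using integral_linear[OF assms bounded_linear_cnj] by (simp add: o_def)

lemma integral_Re_Icc:
  fixes f :: "real \<Rightarrow> complex" assumes "f integrable_on {a..b}"
  shows "integral {a..b} (\<lambda>x. Re (f x)) = Re (integral {a..b} f)"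
  using integral_linear[OF assms bounded_linear_Re] by (simp add: o_def)

lemma integral_sums_uniform:
  fixes f :: "nat \<Rightarrow> real \<Rightarrow> complex"
  assumes sums: "\<And>y. y \<in> {c..d} \<Longrightarrow> (\<lambda>n. f n y) sums g y"
    and cont: "\<And>n. continuous_on {c..d} (f n)"
    and le: "\<And>n y. y \<in> {c..d} \<Longrightarrow> norm (f n y) \<le> M n" and M: "summable M"
  shows "(\<lambda>n. integral {c..d} (f n)) sums integral {c..d} g"
proof -
  have "uniform_limit (cbox c d) (\<lambda>n y. \<Sum>i<n. f i y) (\<lambda>y. suminf (\<lambda>i. f i y)) sequentially"
    by (rule Weierstrass_m_test[OF _ M]) (use le in auto)
  also have "?this \<longleftrightarrow> uniform_limit (cbox c d) (\<lambda>n y. \<Sum>i<n. f i y) g sequentially"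
    using sums by (intro uniform_limit_cong' refl) (auto simp: sums_iff)
  finally obtain I J where IJ: "\<And>n. ((\<lambda>y. \<Sum>i<n. f i y) has_integral I n) (cbox c d)"
    "(g has_integral J) (cbox c d)" "I \<longlonglongrightarrow> J"
    by (rule uniform_limit_integral_cbox) (use cont in \<open>auto intro!: continuous_on_sum\<close>)
  have "I n = (\<Sum>i<n. integral {c..d} (f i))" for n
  proof -
    have "I n = integral {c..d} (\<lambda>y. \<Sum>i<n. f i y)" using integral_unique[OF IJ(1)[of n]] by simp
    also have "\<dots> = (\<Sum>i<n. integral {c..d} (f i))"
      by (intro integral_sum integrable_continuous_real cont) auto
    finally show ?thesis .
  qed
  hence "I = (\<lambda>n. \<Sum>i<n. integral {c..d} (f i))" by (rule ext)
  moreover have "J = integral {c..d} g" using IJ(2) by (simp add: integral_unique)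
  ultimately show ?thesis using IJ(3) unfolding sums_def by simp
qed

text \<open>With abscissa 1 / (4 A) and l <= A ln T the exponential is at most T^(1/4), while l T /
  2 >= T. The base is thus at most T^(-3/4), and the fourth power already gives T^(-3).\<close>

lemma kern_decay:
  fixes A T l :: real and m :: nat
  assumes A: "A \<ge> 1" and T: "T \<ge> 3" and l: "2 \<le> l" "l \<le> A * ln T" and m: "4 \<le> m"
  shows "(exp (l * (1 / (4 * A))) / (l * (T / 2))) ^ m \<le> 1 / T ^ 3"
proof -
  have "exp (l * (1 / (4 * A))) \<le> exp (ln T / 4)"
    using A l mult_right_mono[of l "A * ln T" "1 / (4 * A)"] by simp
  also have "\<dots> = T powr (1/4)" using T by (simp add: powr_def)
  finally have 1: "exp (l * (1 / (4 * A))) \<le> T powr (1/4)" .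
  have 2: "l * (T / 2) \<ge> T" using l T mult_right_mono[of 2 l "T / 2"] by simp
  have "exp (l * (1 / (4 * A))) / (l * (T / 2)) \<le> T powr (1/4) / T"
    using 1 2 T by (intro frac_le) auto
  also have "\<dots> = T powr (1/4) * T powr (- 1)" using T by (simp add: powr_minus field_simps)
  also have "\<dots> = T powr (- (3/4))" unfolding powr_add[symmetric] by simp
  finally have "(exp (l * (1 / (4 * A))) / (l * (T / 2))) ^ m \<le> (T powr (- (3/4))) ^ m"
    using l T by (intro power_mono) auto
  also have "\<dots> = T powr (- (3/4) * real m)" using T by (simp add: powr_realpow[symmetric] powr_powr)
  also have "\<dots> \<le> T powr (- 3)" using T m by (intro powr_mono) auto
  also have "\<dots> = 1 / T ^ 3" using T by (simp add: powr_minus powr_numeral field_simps)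
  finally show ?thesis .
qed

context selberg_strip
begin

text \<open>The integers whose logarithm lies in the support [-L, L] of the transform of the kernel;
  the others contribute only to the error.\<close>

definition freqs :: "real \<Rightarrow> nat set" where "freqs L = {n. 1 \<le> n \<and> ln (real n) < L}"

lemma finite_freqs: "finite (freqs L)"
proof (rule finite_subset)
  show "freqs L \<subseteq> {..nat \<lfloor>exp L\<rfloor>}"
  proof
    fix n assume n: "n \<in> freqs L"
    hence "real n \<le> exp L" using ln_less_cancel_iff[of "real n" "exp L"] by (auto simp: freqs_def)
    thus "n \<in> {..nat \<lfloor>exp L\<rfloor>}" by (simp add: le_nat_floor)
  qed
qed simp

definition osc :: "nat \<Rightarrow> real \<Rightarrow> complex" where "osc n t = exp (- \<i> * of_real (t * ln (real n)))"

text \<open>The Dirichlet polynomial at 1/2 + i t, smoothed by the transform of the kernel. It is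
  not real; only its real part enters the explicit formula.\<close>

definition dpoly :: "real \<Rightarrow> nat \<Rightarrow> real \<Rightarrow> real \<Rightarrow> complex" where
  "dpoly l m Y' t = (\<Sum>n\<in>freqs (l * m). e n * of_real (real n powr (- (1/2))) * osc n t * kphi l m Y' (ln (real n)))"

definition zset :: "real \<Rightarrow> real \<Rightarrow> complex set" where "zset U1 U2 = sing \<inter> {s. U1 < Im s \<and> Im s < U2}"

lemma finite_zset: assumes "U1 \<ge> Y" shows "finite (zset U1 U2)"
proof (rule finite_subset)
  show "zset U1 U2 \<subseteq> sing \<inter> cbox (Complex 0 U1) (Complex 1 U2)"
    by (auto simp: zset_def sing_def in_cbox_complex_iff)
  show "finite (sing \<inter> cbox (Complex 0 U1) (Complex 1 U2))"
    by (rule finite_sing) (use assms Y_ge in \<open>auto simp: in_cbox_complex_iff\<close>)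
qed

lemma dirichlet_integral:
  fixes T l t a U1 U2 :: real and m :: nat
  defines "X \<equiv> (exp (l * a) / (l * (T / 2))) ^ m"
  assumes a: "0 < a" "a \<le> 1" and T: "T \<ge> 3" and l: "l \<ge> 2" and m: "even m" "m \<ge> 2"
    and U: "U1 - t \<le> - (T / 2)" "T / 2 \<le> U2 - t"
  shows "norm (integral {U1..U2} (\<lambda>y. dser e (Complex (1/2 + a) y) * kern l m (Complex a (y - t))) - dpoly l m (T / 2) t)
     \<le> (\<Sum>n. norm (e n) * real n powr (- (1/2 + a))) * (2 * (U2 - U1) * X)"
proof -
  define De where "De = (\<Sum>n. norm (e n) * real n powr (- (1/2 + a)))"
  have dabs: "dabs e (1/2 + a)" using a by (intro dabs_e) auto
  let ?k = "\<lambda>y. kern l m (Complex a (y - t))"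
  define h where "h = (\<lambda>n. e n * of_real (real n powr (- (1/2))) * osc n t)"
  define J where "J = (\<lambda>n. integral {U1..U2} (\<lambda>y. exp (- of_real (ln (real n)) * Complex a (y - t)) * ?k y))"
  have ck: "continuous_on {U1..U2} ?k"
    by (intro continuous_intros)
  obtain Mk where Mk: "\<And>y. y \<in> {U1..U2} \<Longrightarrow> norm (?k y) \<le> Mk" "Mk \<ge> 0"
  proof -
    have "compact (?k ` {U1..U2})" by (intro compact_continuous_image ck) auto
    then obtain M where "\<And>y. y \<in> {U1..U2} \<Longrightarrow> norm (?k y) \<le> M" by (meson compact_imp_bounded bounded_iff imageI)
    thus ?thesis using that[of "max M 0"] by fastforce
  qed
  \<comment> \<open>Splits n^(-s) at the centre 1/2 + i t of the kernel: the part n^(-1/2 - i t)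
    comes out of the integral.\<close>
  have term_eq: "e n * of_nat n powr (- Complex (1/2 + a) y) = h n * exp (- of_real (ln (real n)) * Complex a (y - t))" for n y
  proof (cases "n = 0")
    case False
    have e1: "of_real (real n powr (- (1/2))) = exp (of_real (- (1/2) * ln (real n)) :: complex)"
      unfolding exp_of_real using False by (simp add: powr_def)
    have e2: "of_nat n powr (- Complex (1/2 + a) y) = exp (- Complex (1/2 + a) y * of_real (ln (real n)))"
      using False by (simp add: powr_def Ln_of_nat)
    have e3: "- Complex (1/2 + a) y * of_real (ln (real n)) = of_real (- (1/2) * ln (real n)) + - \<i> * of_real (t * ln (real n)) + - of_real (ln (real n)) * Complex a (y - t)"
      by (simp add: complex_eq_iff algebra_simps)
    show ?thesis unfolding h_def osc_def e1 e2 e3 exp_add by (simp only: mult.assoc)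
  qed (simp add: h_def)
  have sums1: "(\<lambda>n. h n * J n) sums integral {U1..U2} (\<lambda>y. dser e (Complex (1/2 + a) y) * ?k y)"
  proof -
    have "(\<lambda>n. integral {U1..U2} (\<lambda>y. (e n * of_nat n powr (- Complex (1/2 + a) y)) * ?k y)) sums integral {U1..U2} (\<lambda>y. dser e (Complex (1/2 + a) y) * ?k y)"
    proof (rule integral_sums_uniform)
      show "(\<lambda>n. (e n * of_nat n powr (- Complex (1/2 + a) y)) * ?k y) sums (dser e (Complex (1/2 + a) y) * ?k y)" for y
        by (intro sums_mult2 dser_sums[OF dabs]) simp
      show "continuous_on {U1..U2} (\<lambda>y. (e n * of_nat n powr (- Complex (1/2 + a) y)) * ?k y)" for n
        unfolding term_eq by (intro continuous_intros ck)
      show "norm ((e n * of_nat n powr (- Complex (1/2 + a) y)) * ?k y) \<le> norm (e n) * real n powr (- (1/2 + a)) * Mk" if "y \<in> {U1..U2}" for n y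
        unfolding norm_mult[of "e n * of_nat n powr (- Complex (1/2 + a) y)"] norm_dterm
        using Mk that by (intro mult_mono) auto
      show "summable (\<lambda>n. norm (e n) * real n powr (- (1/2 + a)) * Mk)"
        using dabs by (intro summable_mult2) (simp add: dabs_def)
    qed
    thus ?thesis unfolding term_eq J_def mult.assoc integral_mult_right .
  qed
  have Jb: "norm (J n - (if ln (real n) < l * m then kphi l m (T / 2) (ln (real n)) else 0)) \<le> real n powr (- a) * (2 * (U2 - U1) * X)"
    if n: "n \<ge> 1" for n
  proof -
    have J: "J n = integral {U1 - t..U2 - t} (\<lambda>v. exp (- of_real (ln (real n)) * Complex a v) * kern l m (Complex a v))"
      using integral_shift_Icc_real[of "U1" "U2" "\<lambda>v. exp (- of_real (ln (real n)) * Complex a v) * kern l m (Complex a v)" "- t"]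
      by (simp add: J_def o_def add.commute[of "- t"])
    have N: "norm (integral {U1 - t..U2 - t} (\<lambda>v. exp (- of_real (ln (real n)) * Complex a v) * kern l m (Complex a v))
       - (if ln (real n) < l * m then kphi l m (T / 2) (ln (real n)) else 0))
       \<le> 2 * ((U2 - t) - (U1 - t)) * exp ((l * m - ln (real n)) * a) / (l * (T / 2)) ^ m"
    proof (rule kern_line_integral)
      have "2 * 1 \<le> l * (T / 2)" using l T by (intro mult_mono) auto
      thus "1 \<le> l * (T / 2)" by simp
    qed (use m l a U T n in auto)
    have E: "exp ((l * m - ln (real n)) * a) / (l * (T / 2)) ^ m = real n powr (- a) * X"
    proof -
      have "exp ((l * m - ln (real n)) * a) = exp (l * a) ^ m * exp (- a * ln (real n))"
        by (simp add: exp_of_nat_mult[symmetric] exp_add[symmetric] algebra_simps)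
      moreover have "exp (- a * ln (real n)) = real n powr (- a)" using n by (simp add: powr_def)
      ultimately show ?thesis unfolding X_def power_divide by simp
    qed
    have "2 * ((U2 - t) - (U1 - t)) * exp ((l * m - ln (real n)) * a) / (l * (T / 2)) ^ m = 2 * ((U2 - t) - (U1 - t)) * (real n powr (- a) * X)"
      unfolding E[symmetric] by simp
    also have "\<dots> = real n powr (- a) * (2 * (U2 - U1) * X)" by simp
    finally show ?thesis using N unfolding J by simp
  qed
  have sums2: "(\<lambda>n. if n \<in> freqs (l * m) then h n * kphi l m (T / 2) (ln (real n)) else 0) sums dpoly l m (T / 2) t"
    using sums_If_finite_set[OF finite_freqs, of "l * m" "\<lambda>n. h n * kphi l m (T / 2) (ln (real n))"]
    by (simp add: dpoly_def h_def)
  note sd = sums_diff[OF sums1 sums2]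
  have "norm (h n * J n - (if n \<in> freqs (l * m) then h n * kphi l m (T / 2) (ln (real n)) else 0))
     \<le> norm (e n) * real n powr (- (1/2 + a)) * (2 * (U2 - U1) * X)" for n
  proof (cases "n = 0")
    case False
    have "h n * J n - (if n \<in> freqs (l * m) then h n * kphi l m (T / 2) (ln (real n)) else 0)
       = h n * (J n - (if ln (real n) < l * m then kphi l m (T / 2) (ln (real n)) else 0))"
      using False by (auto simp: freqs_def algebra_simps)
    also have "norm \<dots> \<le> (norm (e n) * real n powr (- (1/2))) * (real n powr (- a) * (2 * (U2 - U1) * X))"
      unfolding norm_mult using False
      by (intro mult_mono Jb) (auto simp: h_def norm_mult osc_def)
    also have "\<dots> = norm (e n) * (real n powr (- (1/2)) * real n powr (- a)) * (2 * (U2 - U1) * X)" by simp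
    also have "real n powr (- (1/2)) * real n powr (- a) = real n powr (- (1/2 + a))"
      unfolding powr_add[symmetric] by simp
    finally show ?thesis .
  qed (simp add: h_def freqs_def)
  moreover have s: "summable (\<lambda>n. norm (e n) * real n powr (- (1/2 + a)) * (2 * (U2 - U1) * X))"
    using dabs by (intro summable_mult2) (simp add: dabs_def)
  ultimately have "norm (\<Sum>n. h n * J n - (if n \<in> freqs (l * m) then h n * kphi l m (T / 2) (ln (real n)) else 0))
      \<le> (\<Sum>n. norm (e n) * real n powr (- (1/2 + a)) * (2 * (U2 - U1) * X))"
    by (rule norm_suminf_le)
  also have "\<dots> = De * (2 * (U2 - U1) * X)"
    unfolding De_def using dabs by (intro suminf_mult2[symmetric]) (simp add: dabs_def)
  finally show ?thesis using sums_unique[OF sd] by (simp add: De_def)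
qed

text \<open>Integrate \<open>W\<close> times the kernel over a rectangle with sides 1/2 - a and 1/2
  + a. The residues give the sum over zeros. On the right side \<open>W\<close> is minus the
  Dirichlet series, on the left side its conjugate reflection minus \<open>xi\<close>; since the
  kernel is even and real on the real axis, the two sides combine to a real part.\<close>

theorem explicit_formula:
  assumes A: "A \<ge> 1"
  shows "\<exists>C1\<ge>0. \<exists>T0\<ge>3. \<forall>T\<ge>T0. \<exists>U1\<in>{T..T+1}. \<exists>U2\<in>{5*T..5*T+1}. \<forall>l m t.
     2 \<le> l \<longrightarrow> l \<le> A * ln T \<longrightarrow> 4 \<le> m \<longrightarrow> even m \<longrightarrow> 2 * T \<le> t \<longrightarrow> t \<le> 17/4 * T \<longrightarrow>
     \<bar>2 * pi * (\<Sum>p\<in>zset U1 U2. real_of_int (mz p) * kerr l m (Im p - t)) + 2 * Re (dpoly l m (T / 2) t)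
       - integral {U1..U2} (\<lambda>y. Re (xi (Complex (1/2) y)) * kerr l m (y - t))\<bar> \<le> C1 / T"
proof -
  \<comment> \<open>The abscissa for which \<open>kern_decay\<close> gives kernel values of size
    T^(-3) on the horizontal sides.\<close>
  define a where "a = 1 / (4 * A)"
  have a: "0 < a" "a \<le> 1/4" using A by (auto simp: a_def)
  define De where "De = (\<Sum>n. norm (e n) * real n powr (- (1/2 + a)))"
  have dabs: "dabs e (1/2 + a)" using a by (intro dabs_e) auto
  have De0: "De \<ge> 0" unfolding De_def using dabs by (intro suminf_nonneg) (auto simp: dabs_def)
  define C1 where "C1 = 5 + 12 * C + 20 * De"
  obtain T1 where T1: "T1 \<ge> 3" "\<And>T. T \<ge> T1 \<Longrightarrow> \<exists>U\<in>{T..T+1}. Complex (1/2) U \<notin> sing \<and> (\<forall>x\<in>{1/4..3/4}. norm (W (Complex x U)) \<le> T)"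
    using good_height by blast
  define T0 where "T0 = max T1 (Y + 4)"
  have main: "\<exists>U1\<in>{T..T+1}. \<exists>U2\<in>{5*T..5*T+1}. \<forall>l m t.
     2 \<le> l \<longrightarrow> l \<le> A * ln T \<longrightarrow> 4 \<le> m \<longrightarrow> even m \<longrightarrow> 2 * T \<le> t \<longrightarrow> t \<le> 17/4 * T \<longrightarrow>
     \<bar>2 * pi * (\<Sum>p\<in>zset U1 U2. real_of_int (mz p) * kerr l m (Im p - t)) + 2 * Re (dpoly l m (T / 2) t)
       - integral {U1..U2} (\<lambda>y. Re (xi (Complex (1/2) y)) * kerr l m (y - t))\<bar> \<le> C1 / T"
    if T: "T \<ge> T0" for T
  proof -
    have T': "T \<ge> T1" "T \<ge> Y + 4" "T \<ge> 7" "5 * T \<ge> T1" using T Y_ge T1 by (auto simp: T0_def)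
    obtain U1 where U1: "U1 \<in> {T..T+1}" "Complex (1/2) U1 \<notin> sing" "\<And>x. x \<in> {1/4..3/4} \<Longrightarrow> norm (W (Complex x U1)) \<le> T"
      using T1(2)[OF T'(1)] by blast
    obtain U2 where U2: "U2 \<in> {5*T..5*T+1}" "Complex (1/2) U2 \<notin> sing" "\<And>x. x \<in> {1/4..3/4} \<Longrightarrow> norm (W (Complex x U2)) \<le> 5 * T"
      using T1(2)[OF T'(4)] by blast
    have U12: "U1 < U2" "U1 - 1 > Y" "U2 - U1 \<le> 5 * T" using U1(1) U2(1) T' Y_ge by auto
    \<comment> \<open>A convex neighbourhood of the contour inside the region where \<open>W\<close>
      is known to be differentiable off the critical zeros.\<close>
    let ?S = "box (Complex (-10) (U1 - 1)) (Complex 11 (U2 + 1))"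
    have S: "open ?S" "convex ?S" by (auto intro: open_box convex_box)
    have final: "\<bar>2 * pi * (\<Sum>p\<in>zset U1 U2. real_of_int (mz p) * kerr l m (Im p - t)) + 2 * Re (dpoly l m (T / 2) t)
       - integral {U1..U2} (\<lambda>y. Re (xi (Complex (1/2) y)) * kerr l m (y - t))\<bar> \<le> C1 / T"
      if l: "2 \<le> l" "l \<le> A * ln T" and m: "4 \<le> m" "even m" and t: "2 * T \<le> t" "t \<le> 17/4 * T" for l m t
    proof -
      define X where "X = (exp (l * a) / (l * (T / 2))) ^ m"
      have X: "X \<le> 1 / T ^ 3" unfolding X_def a_def using A T' l m by (intro kern_decay) auto
      have X0: "X \<ge> 0" using l T' by (simp add: X_def)
      have TX: "T * X \<le> 1 / T"
      proof -
        have "T * X \<le> T * (1 / T ^ 3)" using X T' by (intro mult_left_mono) auto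
        also have "\<dots> = 1 / T\<^sup>2" using T' by (simp add: power2_eq_square power3_eq_cube)
        also have "\<dots> \<le> 1 / T" using T' by (intro divide_left_mono) (auto simp: power2_eq_square)
        finally show ?thesis .
      qed
      define c where "c = Complex (1/2) t"
      define ks where "ks = (\<lambda>s. kern l m (s - c))"
      have ks_holo: "ks holomorphic_on B" for B
      proof -
        have "(kern l m \<circ> (\<lambda>s. s - c)) holomorphic_on B"
          by (intro holomorphic_on_compose holomorphic_intros)
        thus ?thesis by (simp add: ks_def o_def)
      qed
      have ksc: "ks (Complex (1/2 + x) y) = kern l m (Complex x (y - t))" for x y
        unfolding ks_def c_def by (rule arg_cong[of _ _ "kern l m"]) (simp add: complex_eq_iff)
      have ksl: "kern l m (Complex 0 v) = of_real (kerr l m v)" for v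
        using kern_imaginary[of l m v] by (simp add: Complex_eq)
      have kX: "norm (ks (Complex (1/2 + x) y)) \<le> X" if "\<bar>x\<bar> \<le> a" "y = U1 \<or> y = U2" for x y
      proof -
        \<comment> \<open>The ordinate t is between 2 T and 17/4 T, while U1 <= T + 1 and U2 >= 5 T.
          The limit 17/4 instead of 4 leaves room for a later shift of t by at most T / 4.\<close>
        have "T / 2 \<le> \<bar>Im (Complex x (y - t))\<bar>" using that t U1(1) U2(1) T' by auto
        also have "\<dots> \<le> norm (Complex x (y - t))" by (rule abs_Im_le_cmod)
        finally have "norm (kern l m (Complex x (y - t))) \<le> (exp (l * \<bar>Re (Complex x (y - t))\<bar>) / (l * (T / 2))) ^ m"
          using l T' by (intro norm_kern_le) auto
        also have "\<dots> \<le> X" unfolding X_def using l T' that by (intro power_mono divide_right_mono) auto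
        finally show ?thesis unfolding ksc .
      qed
      have Wd: "(\<lambda>s. W s * ks s) holomorphic_on ?S - (sing \<inter> cbox (Complex (-10) (U1 - 1)) (Complex 11 (U2 + 1)))"
      proof (intro holomorphic_on_mult ks_holo)
        show "W holomorphic_on ?S - (sing \<inter> cbox (Complex (-10) (U1 - 1)) (Complex 11 (U2 + 1)))"
          unfolding holomorphic_on_def
        proof
          fix s assume s: "s \<in> ?S - (sing \<inter> cbox (Complex (-10) (U1 - 1)) (Complex 11 (U2 + 1)))"
          hence "s \<notin> sing" using box_subset_cbox by blast
          moreover have "- 10 < Re s" "Re s < 11" "Im s > Y" using s U12 by (auto simp: in_box_complex_iff)
          ultimately show "W field_differentiable at s within ?S - (sing \<inter> cbox (Complex (-10) (U1 - 1)) (Complex 11 (U2 + 1)))"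
            by (intro field_differentiable_at_within[OF W_field_differentiable])
        qed
      qed
      define IR IL where "IR = integral {U1..U2} (\<lambda>y. W (Complex (1/2 + a) y) * ks (Complex (1/2 + a) y))"
        and "IL = integral {U1..U2} (\<lambda>y. W (Complex (1/2 + - a) y) * ks (Complex (1/2 + - a) y))"
      define P where "P = sing \<inter> cbox (Complex (-10) (U1 - 1)) (Complex 11 (U2 + 1))"
      have fP: "finite P" unfolding P_def
        by (rule finite_sing) (use U12 Y_ge in \<open>auto simp: in_cbox_complex_iff\<close>)
      have "norm (IR - IL - 2 * pi * (\<Sum>p\<in>P \<inter> box (Complex (1/2 + - a) U1) (Complex (1/2 + a) U2). residue (\<lambda>s. W s * ks s) p))
          \<le> 2 * ((1/2 + a) - (1/2 + - a)) * (5 * T * X)"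
        unfolding IR_def IL_def
      proof (rule rectangle_shift_residues[OF _ U12(1) S])
        show "cbox (Complex (1/2 + - a) U1) (Complex (1/2 + a) U2) \<subseteq> ?S"
          using a by (auto simp: in_box_complex_iff in_cbox_complex_iff)
        show "P \<inter> (cbox (Complex (1/2 + - a) U1) (Complex (1/2 + a) U2) - box (Complex (1/2 + - a) U1) (Complex (1/2 + a) U2)) = {}"
        proof -
          have False if p: "p \<in> P" "p \<in> cbox (Complex (1/2 + - a) U1) (Complex (1/2 + a) U2)" "p \<notin> box (Complex (1/2 + - a) U1) (Complex (1/2 + a) U2)" for p
          proof -
            have "Re p = 1/2" "p \<in> sing" using p(1) by (auto simp: P_def sing_def)
            hence "Im p = U1 \<or> Im p = U2" using p(2,3) a by (auto simp: in_box_complex_iff in_cbox_complex_iff)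
            hence "p = Complex (1/2) U1 \<or> p = Complex (1/2) U2" using \<open>Re p = 1/2\<close> by (auto simp: complex_eq_iff)
            thus False using U1(2) U2(2) \<open>p \<in> sing\<close> by auto
          qed
          thus ?thesis by blast
        qed
        fix x y assume xy: "1/2 + - a \<le> x" "x \<le> 1/2 + a" "y = U1 \<or> y = U2"
        have "norm (W (Complex x y)) \<le> 5 * T" using xy a U1(3)[of x] U2(3)[of x] T' by auto
        moreover have "norm (ks (Complex (1/2 + (x - 1/2)) y)) \<le> X" using xy by (intro kX) auto
        ultimately show "norm (W (Complex x y) * ks (Complex x y)) \<le> 5 * T * X"
          unfolding norm_mult using T' by (intro mult_mono) auto
      qed (use a fP Wd in \<open>auto simp: P_def\<close>)
      also have "(\<Sum>p\<in>P \<inter> box (Complex (1/2 + - a) U1) (Complex (1/2 + a) U2). residue (\<lambda>s. W s * ks s) p)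
          = (\<Sum>p\<in>zset U1 U2. of_real (real_of_int (mz p) * kerr l m (Im p - t)))"
      proof (rule sum.cong)
        show "P \<inter> box (Complex (1/2 + - a) U1) (Complex (1/2 + a) U2) = zset U1 U2"
          using a by (auto simp: P_def zset_def sing_def in_box_complex_iff in_cbox_complex_iff)
        fix p assume p: "p \<in> zset U1 U2"
        hence "Re p = 1/2" "Im p > U1" by (auto simp: zset_def sing_def)
        hence "residue (\<lambda>s. W s * ks s) p = of_int (mz p) * ks p" using U12 by (intro residue_W ks_holo) auto
        also have "ks p = of_real (kerr l m (Im p - t))"
        proof -
          have "p = Complex (1/2 + 0) (Im p)" using \<open>Re p = 1/2\<close> by (simp add: complex_eq_iff)
          hence "ks p = ks (Complex (1/2 + 0) (Im p))" by (rule arg_cong)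
          thus ?thesis unfolding ksc ksl .
        qed
        finally show "residue (\<lambda>s. W s * ks s) p = of_real (real_of_int (mz p) * kerr l m (Im p - t))" by simp
      qed
      finally have R1: "norm (IR - IL - of_real (2 * pi * (\<Sum>p\<in>zset U1 U2. real_of_int (mz p) * kerr l m (Im p - t)))) \<le> 4 * a * (5 * T * X)"
        by simp
      have Sint: "Complex x y \<in> ?S" if "\<bar>x\<bar> \<le> 1" "y \<in> {U1..U2}" for x y
        using that by (auto simp: in_box_complex_iff)
      have xi_holo: "xi holomorphic_on ?S"
      proof -
        have "xi field_differentiable at s" if "s \<in> ?S" for s
        proof -
          have "\<bar>Re s\<bar> \<le> 11" "Im s \<ge> Y" using that U12 by (auto simp: in_box_complex_iff)
          thus ?thesis using xi_bounds(2) unfolding field_differentiable_def by blast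
        qed
        thus ?thesis unfolding holomorphic_on_def by (blast intro: field_differentiable_at_within)
      qed
      have cxi: "continuous_on {U1..U2} (\<lambda>y. xi (Complex x y))" if "\<bar>x\<bar> \<le> 1" for x
        by (rule continuous_on_compose2[OF holomorphic_on_imp_continuous_on[OF xi_holo]])
           (use Sint that in \<open>auto simp: Complex_eq intro!: continuous_intros\<close>)
      have cks: "continuous_on {U1..U2} (\<lambda>y. ks (Complex x y))" for x
        by (rule continuous_on_compose2[OF holomorphic_on_imp_continuous_on[OF ks_holo[of UNIV]]])
           (auto simp: Complex_eq intro!: continuous_intros)
      \<comment> \<open>The integral of \<open>xi\<close> is moved from 1/2 - a to the critical
        line, where the kernel is real and nonnegative.\<close>
      define Xi0 Xi1 where "Xi0 = integral {U1..U2} (\<lambda>y. xi (Complex (1/2) y) * ks (Complex (1/2) y))"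
        and "Xi1 = integral {U1..U2} (\<lambda>y. xi (Complex (1/2 + - a) y) * ks (Complex (1/2 + - a) y))"
      have "norm (Xi0 - Xi1) \<le> 2 * (1/2 - (1/2 + - a)) * (24 * C * T * X)"
        unfolding Xi0_def Xi1_def
      proof (rule rectangle_shift[OF _ U12(1) S])
        show "cbox (Complex (1/2 + - a) U1) (Complex (1/2) U2) \<subseteq> ?S"
          using a by (auto simp: in_box_complex_iff in_cbox_complex_iff)
        show "(\<lambda>s. xi s * ks s) holomorphic_on ?S" by (intro holomorphic_intros xi_holo ks_holo)
        fix x y assume xy: "1/2 + - a \<le> x" "x \<le> 1/2" "y = U1 \<or> y = U2"
        have y: "y \<ge> Y" "y > 0" "y \<le> 6 * T" using xy U12 U1(1) U2(1) T' Y_ge by auto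
        have "norm (xi (Complex x y)) \<le> 4 * C * ln y" using xi_bounds(1)[of "Complex x y"] xy a y by auto
        also have "\<dots> \<le> 4 * C * (6 * T)"
          using ln_le_minus_one[of y] y C_nonneg by (intro mult_left_mono) auto
        finally have "norm (xi (Complex x y)) \<le> 24 * C * T" by simp
        moreover have "norm (ks (Complex (1/2 + (x - 1/2)) y)) \<le> X" using xy a by (intro kX) auto
        ultimately show "norm (xi (Complex x y) * ks (Complex x y)) \<le> 24 * C * T * X"
          unfolding norm_mult using T' C_nonneg by (intro mult_mono) auto
      qed (use a in auto)
      hence R2: "norm (Xi0 - Xi1) \<le> 2 * a * (24 * C * T * X)" by simp
      define J where "J = integral {U1..U2} (\<lambda>y. dser e (Complex (1/2 + a) y) * kern l m (Complex a (y - t)))"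
      have cJ: "continuous_on {U1..U2} (\<lambda>y. dser e (Complex (1/2 + a) y) * kern l m (Complex a (y - t)))"
      proof (intro continuous_intros)
        show "continuous_on {U1..U2} (\<lambda>y. dser e (Complex (1/2 + a) y))"
          by (rule continuous_on_compose2[OF holomorphic_on_imp_continuous_on[OF dser_e_holomorphic]])
             (use a in \<open>auto simp: Complex_eq intro!: continuous_intros\<close>)
      qed
      have R3: "norm (J - dpoly l m (T / 2) t) \<le> De * (2 * (U2 - U1) * X)"
        unfolding J_def De_def X_def
        by (rule dirichlet_integral) (use a T' l m t U1(1) U2(1) in auto)
      have IR: "IR = - J"
        unfolding IR_def J_def ksc using a by (simp add: W_def)
      have IL: "IL = cnj J - Xi1"
      proof -
        have "IL = integral {U1..U2} (\<lambda>y. cnj (dser e (Complex (1/2 + a) y) * kern l m (Complex a (y - t))) - xi (Complex (1/2 + - a) y) * ks (Complex (1/2 + - a) y))"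
          unfolding IL_def
        proof (rule integral_cong)
          fix y
          have 1: "1 - cnj (Complex (1/2 + - a) y) = Complex (1/2 + a) y" by (simp add: complex_eq_iff)
          have 2: "kern l m (Complex (- a) (y - t)) = cnj (kern l m (Complex a (y - t)))"
          proof -
            have "Complex (- a) (y - t) = - cnj (Complex a (y - t))" by (simp add: complex_eq_iff)
            thus ?thesis by (simp add: cnj_kern)
          qed
          have Wl: "W (Complex (1/2 + - a) y) = cnj (dser e (Complex (1/2 + a) y)) - xi (Complex (1/2 + - a) y)"
            using a unfolding W_def 1 by simp
          show "W (Complex (1/2 + - a) y) * ks (Complex (1/2 + - a) y) = cnj (dser e (Complex (1/2 + a) y) * kern l m (Complex a (y - t))) - xi (Complex (1/2 + - a) y) * ks (Complex (1/2 + - a) y)"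
            unfolding Wl ksc 2 by (simp add: left_diff_distrib)
        qed
        also have "\<dots> = integral {U1..U2} (\<lambda>y. cnj (dser e (Complex (1/2 + a) y) * kern l m (Complex a (y - t)))) - Xi1"
          unfolding Xi1_def using a
          by (intro Henstock_Kurzweil_Integration.integral_diff integrable_continuous_real continuous_on_mult cxi cks continuous_on_cnj cJ) auto
        also have "integral {U1..U2} (\<lambda>y. cnj (dser e (Complex (1/2 + a) y) * kern l m (Complex a (y - t)))) = cnj J"
          unfolding J_def by (intro integral_cnj_Icc integrable_continuous_real cJ)
        finally show ?thesis .
      qed
      define Zs where "Zs = (\<Sum>p\<in>zset U1 U2. real_of_int (mz p) * kerr l m (Im p - t))"
      have Xi0r: "Re Xi0 = integral {U1..U2} (\<lambda>y. Re (xi (Complex (1/2) y)) * kerr l m (y - t))"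
      proof -
        have k0: "ks (Complex (1/2) y) = of_real (kerr l m (y - t))" for y using ksc[of 0 y] by (simp add: ksl)
        have "Re Xi0 = integral {U1..U2} (\<lambda>y. Re (xi (Complex (1/2) y) * ks (Complex (1/2) y)))"
          unfolding Xi0_def by (intro integral_Re_Icc[symmetric] integrable_continuous_real continuous_on_mult cxi cks) auto
        thus ?thesis unfolding k0 by simp
      qed
      \<comment> \<open>Here IR - IL = -(J + cnj J) + Xi1, which is the source of the factor 2
        before the real part of the polynomial.\<close>
      have "Re (IR - IL - of_real (2 * pi * Zs)) = - 2 * Re J + Re Xi1 - 2 * pi * Zs" by (simp add: IR IL)
      hence 1: "\<bar>- 2 * Re J + Re Xi1 - 2 * pi * Zs\<bar> \<le> 4 * a * (5 * T * X)"
        using abs_Re_le_cmod[of "IR - IL - of_real (2 * pi * Zs)"] R1 by (simp add: Zs_def)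
      have 2: "\<bar>Re Xi0 - Re Xi1\<bar> \<le> 2 * a * (24 * C * T * X)"
        using abs_Re_le_cmod[of "Xi0 - Xi1"] R2 by simp
      have 3: "\<bar>Re J - Re (dpoly l m (T / 2) t)\<bar> \<le> De * (2 * (U2 - U1) * X)"
        using abs_Re_le_cmod[of "J - dpoly l m (T / 2) t"] R3 by simp
      have "\<bar>2 * pi * Zs + 2 * Re (dpoly l m (T / 2) t) - Re Xi0\<bar>
         \<le> 4 * a * (5 * T * X) + 2 * a * (24 * C * T * X) + 2 * (De * (2 * (U2 - U1) * X))"
        using 1 2 3 by (simp only: abs_le_iff) linarith
      also have "\<dots> \<le> C1 * (T * X)"
      proof -
        have "4 * a * (5 * T * X) \<le> 1 * (5 * T * X)" using a T' X0 by (intro mult_right_mono) auto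
        moreover have "2 * a * (24 * C * T * X) \<le> (1/2) * (24 * C * T * X)" using a T' X0 C_nonneg by (intro mult_right_mono) auto
        moreover have "De * (2 * (U2 - U1) * X) \<le> De * (2 * (5 * T) * X)"
          using De0 U12 X0 by (intro mult_left_mono mult_right_mono) auto
        ultimately show ?thesis by (simp add: C1_def algebra_simps)
      qed
      also have "\<dots> \<le> C1 * (1 / T)" using TX C_nonneg De0 by (intro mult_left_mono) (auto simp: C1_def)
      finally show ?thesis by (simp add: Zs_def Xi0r)
    qed
    show ?thesis
      by (rule bexI[OF _ U1(1)], rule bexI[OF _ U2(1)]) (use final in blast)
  qed
  have "C1 \<ge> 0" "T0 \<ge> 3" using C_nonneg De0 T1 by (auto simp: C1_def T0_def)
  thus ?thesis using main by blast
qed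

end

section \<open>Averaging over the shift\<close>

context selberg_strip
begin

text \<open>The mean value inequality along the critical line, where the derivative of
  \<open>xi\<close> is at most 4 C / T above height T.\<close>

lemma Re_xi_lipschitz:
  assumes "T > 0" "T \<ge> Y" "T \<le> y" "h \<ge> 0"
  shows "\<bar>Re (xi (Complex (1/2) y)) - Re (xi (Complex (1/2) (y + h)))\<bar> \<le> 4 * C * h / T"
proof -
  let ?S = "{s. Re s = 1/2} \<inter> {s. y \<le> Im s}"
  have "convex ?S" by (intro convex_Int convex_halfspace_Im_ge) (auto simp: convex_alt algebra_simps)
  have "norm (xi (Complex (1/2) y) - xi (Complex (1/2) (y + h))) \<le> (4 * C / T) * norm (Complex (1/2) y - Complex (1/2) (y + h))"
  proof (rule field_differentiable_bound[OF \<open>convex ?S\<close>])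
    define f' where "f' = (\<lambda>s. SOME d. (xi has_field_derivative d) (at s) \<and> norm d \<le> 4 * C / Im s)"
    fix z assume z: "z \<in> ?S"
    hence "\<bar>Re z\<bar> \<le> 11" "Im z \<ge> Y" using assms by auto
    from xi_bounds(2)[OF this] have f': "(xi has_field_derivative f' z) (at z) \<and> norm (f' z) \<le> 4 * C / Im z"
      unfolding f'_def by (rule someI_ex)
    thus "(xi has_field_derivative f' z) (at z within ?S)" by (blast intro: has_field_derivative_at_within)
    have "4 * C / Im z \<le> 4 * C / T" using z assms C_nonneg by (intro divide_left_mono) auto
    thus "norm (f' z) \<le> 4 * C / T" using f' by linarith
  qed (use assms in auto)
  also have "norm (Complex (1/2) y - Complex (1/2) (y + h)) = h" using assms by (simp add: cmod_def)
  finally show ?thesis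
    using abs_Re_le_cmod[of "xi (Complex (1/2) y) - xi (Complex (1/2) (y + h))"] by simp
qed

text \<open>Substituting y + h for y moves the shift from the kernel to \<open>xi\<close>. On the
  common interval the Lipschitz bound meets a kernel of bounded mass; the two end pieces of length h
  are far from t, where the kernel is at most 16 / T^4. The constant covers 40 + 2 * 384.\<close>

lemma xi_difference:
  assumes h: "0 < h" "h \<le> T / 4" and T: "T \<ge> 2 * Y" "T \<ge> 8" and l: "l \<ge> 2" and m: "m \<ge> 4" "even m"
    and U: "U1 \<in> {T..T+1}" "U2 \<in> {5*T..5*T+1}" and t: "2 * T \<le> t" "t \<le> 4 * T"
  shows "\<bar>integral {U1..U2} (\<lambda>y. Re (xi (Complex (1/2) y)) * kerr l m (y - t))
        - integral {U1..U2} (\<lambda>y. Re (xi (Complex (1/2) y)) * kerr l m (y - (t + h)))\<bar> \<le> 1000 * C * h / T"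
proof -
  define r where "r = (\<lambda>y. Re (xi (Complex (1/2) y)))"
  define k where "k = (\<lambda>y. kerr l m (y - t))"
  have xic: "continuous_on {Y..} (\<lambda>y. xi (Complex (1/2) y))"
  proof (rule continuous_at_imp_continuous_on, rule ballI)
    fix y assume "y \<in> {Y..}"
    hence "\<bar>Re (Complex (1/2) y)\<bar> \<le> 11" "Im (Complex (1/2) y) \<ge> Y" by auto
    from xi_bounds(2)[OF this] have "isCont xi (Complex (1/2) y)" by (blast intro: DERIV_isCont)
    moreover have "isCont (\<lambda>y. Complex (1/2) y) y" by (simp add: Complex_eq)
    ultimately show "isCont (\<lambda>y. xi (Complex (1/2) y)) y" by (intro isCont_o2[of y "\<lambda>y. Complex (1/2) y" xi])
  qed
  have rc: "continuous_on S (\<lambda>y. r (y + c))" if "\<And>y. y \<in> S \<Longrightarrow> y + c \<ge> Y" for S c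
    unfolding r_def by (intro continuous_intros continuous_on_compose2[OF xic]) (use that in auto)
  have rc0: "continuous_on S r" if "\<And>y. y \<in> S \<Longrightarrow> y \<ge> Y" for S using rc[of S 0] that by simp
  have kc: "continuous_on S k" for S unfolding k_def by (intro continuous_intros)
  have UU: "U1 - h \<ge> Y" "U1 \<ge> Y" "U1 \<ge> T" "U1 \<le> U2 - h" "U2 \<le> 6 * T" using U h T Y_ge by auto
  have rb: "\<bar>r y\<bar> \<le> 24 * C * T" if "Y \<le> y" "y \<le> 6 * T" for y
  proof -
    have "\<bar>r y\<bar> \<le> norm (xi (Complex (1/2) y))" unfolding r_def by (rule abs_Re_le_cmod)
    also have "\<dots> \<le> 4 * C * ln y" using xi_bounds(1)[of "Complex (1/2) y"] that by simp
    also have "\<dots> \<le> 4 * C * (6 * T)" using that Y_ge C_nonneg ln_le_minus_one[of y] by (intro mult_left_mono) auto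
    finally show ?thesis by simp
  qed
  have k0: "0 \<le> k y" for y unfolding k_def using m by (simp add: kerr_bounds)
  have kfar: "k y \<le> 16 / T ^ 4" if "\<bar>y - t\<bar> \<ge> T / 4" for y
  proof -
    have "norm (kern l m (\<i> * of_real (y - t))) \<le> (exp (l * \<bar>Re (\<i> * of_real (y - t))\<bar>) / (l * (T / 4))) ^ m"
    proof (rule norm_kern_le)
      have "norm (\<i> * complex_of_real (y - t)) = \<bar>y - t\<bar>" by (simp only: norm_mult norm_ii norm_of_real mult_1)
      thus "T / 4 \<le> norm (\<i> * complex_of_real (y - t))" using that by simp
    qed (use l T in auto)
    hence "k y \<le> (1 / (l * (T / 4))) ^ m"
      unfolding kern_imaginary norm_of_real using k0[of y] by (simp add: k_def)
    also have "\<dots> \<le> (2 / T) ^ m" using l T by (intro power_mono) (auto simp: field_simps)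
    also have "\<dots> \<le> (2 / T) ^ 4" using T m by (intro power_decreasing) auto
    finally show ?thesis by (simp add: power_divide)
  qed
  have shift: "integral {U1..U2} (\<lambda>y. r y * kerr l m (y - (t + h))) = integral {U1 - h..U2 - h} (\<lambda>y. r (y + h) * k y)"
    using integral_shift_Icc_real[of "U1 - h" "U2 - h" "\<lambda>y. r y * kerr l m (y - (t + h))" h]
    by (simp add: o_def k_def add.commute)
  have i1: "(\<lambda>y. r y * k y) integrable_on {a..b}" if "Y \<le> a" for a b
    using that by (intro integrable_continuous_real continuous_on_mult rc0 kc) auto
  have i2: "(\<lambda>y. r (y + h) * k y) integrable_on {a..b}" if "Y \<le> a" for a b
    using that h by (intro integrable_continuous_real continuous_on_mult rc kc) auto
  have s1: "integral {U1..U2} (\<lambda>y. r y * k y) = integral {U1..U2 - h} (\<lambda>y. r y * k y) + integral {U2 - h..U2} (\<lambda>y. r y * k y)"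
    by (rule Henstock_Kurzweil_Integration.integral_combine[symmetric]) (use UU h i1 in auto)
  have s2: "integral {U1 - h..U2 - h} (\<lambda>y. r (y + h) * k y) = integral {U1 - h..U1} (\<lambda>y. r (y + h) * k y) + integral {U1..U2 - h} (\<lambda>y. r (y + h) * k y)"
    by (rule Henstock_Kurzweil_Integration.integral_combine[symmetric]) (use UU h i2 in auto)
  have m1: "\<bar>integral {U1..U2 - h} (\<lambda>y. r y * k y) - integral {U1..U2 - h} (\<lambda>y. r (y + h) * k y)\<bar> \<le> (4 * C * h / T) * (5 * (pi / l))"
  proof -
    have "integral {U1..U2 - h} (\<lambda>y. r y * k y) - integral {U1..U2 - h} (\<lambda>y. r (y + h) * k y) = integral {U1..U2 - h} (\<lambda>y. (r y - r (y + h)) * k y)"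
      using UU i1 i2 by (simp add: Henstock_Kurzweil_Integration.integral_diff left_diff_distrib)
    also have "norm \<dots> \<le> integral {U1..U2 - h} (\<lambda>y. (4 * C * h / T) * (5 * hump l (y - t)))"
    proof (rule integral_norm_bound_integral)
      show "(\<lambda>y. (r y - r (y + h)) * k y) integrable_on {U1..U2 - h}"
        unfolding left_diff_distrib using UU i1 i2 by (intro integrable_diff) auto
      show "(\<lambda>y. (4 * C * h / T) * (5 * hump l (y - t))) integrable_on {U1..U2 - h}"
        by (intro integrable_continuous_real continuous_intros)
      fix y assume y: "y \<in> {U1..U2 - h}"
      have "\<bar>r y - r (y + h)\<bar> \<le> 4 * C * h / T"
        unfolding r_def using y UU T h Y_ge by (intro Re_xi_lipschitz) auto
      moreover have "k y \<le> 5 * hump l (y - t)" unfolding k_def using m by (intro kerr_le_hump) auto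
      ultimately show "norm ((r y - r (y + h)) * k y) \<le> (4 * C * h / T) * (5 * hump l (y - t))"
        unfolding real_norm_def abs_mult using k0[of y] by (intro mult_mono) auto
    qed
    also have "\<dots> = (4 * C * h / T) * (5 * integral {U1..U2 - h} (\<lambda>y. hump l (y - t)))" by simp
    also have "\<dots> \<le> (4 * C * h / T) * (5 * (pi / l))"
      using l UU C_nonneg h T by (intro mult_left_mono integral_hump_le) auto
    finally show ?thesis by simp
  qed
  have e1: "\<bar>integral {U2 - h..U2} (\<lambda>y. r y * k y)\<bar> \<le> (24 * C * T) * (16 / T ^ 4) * h"
  proof -
    have "norm (integral {U2 - h..U2} (\<lambda>y. r y * k y)) \<le> (24 * C * T) * (16 / T ^ 4) * (U2 - (U2 - h))"
    proof (rule integral_bound)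
      show "continuous_on {U2 - h..U2} (\<lambda>y. r y * k y)" using UU h by (intro continuous_on_mult rc0 kc) auto
      fix y assume "y \<in> {U2 - h..U2}"
      thus "norm (r y * k y) \<le> (24 * C * T) * (16 / T ^ 4)"
        unfolding real_norm_def abs_mult using k0[of y] UU U h T t C_nonneg Y_ge
        by (intro mult_mono rb) (auto intro!: kfar)
    qed (use h in auto)
    thus ?thesis by simp
  qed
  have e2: "\<bar>integral {U1 - h..U1} (\<lambda>y. r (y + h) * k y)\<bar> \<le> (24 * C * T) * (16 / T ^ 4) * h"
  proof -
    have "norm (integral {U1 - h..U1} (\<lambda>y. r (y + h) * k y)) \<le> (24 * C * T) * (16 / T ^ 4) * (U1 - (U1 - h))"
    proof (rule integral_bound)
      show "continuous_on {U1 - h..U1} (\<lambda>y. r (y + h) * k y)" using UU h by (intro continuous_on_mult rc kc) auto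
      fix y assume "y \<in> {U1 - h..U1}"
      thus "norm (r (y + h) * k y) \<le> (24 * C * T) * (16 / T ^ 4)"
        unfolding real_norm_def abs_mult using k0[of y] UU U h T t C_nonneg Y_ge
        by (intro mult_mono rb) (auto intro!: kfar)
    qed (use h in auto)
    thus ?thesis by simp
  qed
  have "(4 * C * h / T) * (5 * (pi / l)) \<le> (4 * C * h / T) * 10"
  proof (rule mult_left_mono)
    have "pi / l \<le> 4 / 2" using l pi_less_4 pi_gt_zero by (intro frac_le) auto
    thus "5 * (pi / l) \<le> 10" by simp
  qed (use C_nonneg h T in auto)
  moreover have "(24 * C * T) * (16 / T ^ 4) * h \<le> 384 * C * h / T"
  proof -
    have "T * (1 / T ^ 4) \<le> 1 / T"
    proof -
      have "T * (1 / T ^ 4) = 1 / T ^ 3" using T by (simp add: power_def numeral_eq_Suc)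
      also have "\<dots> \<le> 1 / T ^ 1" using T by (intro divide_left_mono power_increasing) auto
      finally show ?thesis by simp
    qed
    hence "(384 * C * h) * (T * (1 / T ^ 4)) \<le> (384 * C * h) * (1 / T)" using C_nonneg h by (intro mult_left_mono) auto
    thus ?thesis by (simp add: mult_ac)
  qed
  ultimately have "\<bar>integral {U1..U2} (\<lambda>y. r y * k y) - integral {U1 - h..U2 - h} (\<lambda>y. r (y + h) * k y)\<bar>
      \<le> (4 * C * h / T) * 10 + 384 * C * h / T + 384 * C * h / T"
    using m1 e1 e2 unfolding s1 s2 by linarith
  also have "\<dots> \<le> 1000 * C * h / T" using C_nonneg h T by (simp add: field_simps)
  finally show ?thesis unfolding shift[symmetric] by (simp add: r_def k_def)
qed

text \<open>If some zero is close to \<open>t\<close> or \<open>t + h\<close> then \<open>s/2\<close> is dominated by the sum over zeros;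
  otherwise \<open>P\<close> itself is, by the explicit formula.\<close>

lemma pointwise_bound:
  assumes fin: "finite Z" and m: "m \<ge> 2" "even m" and s: "s > 0"
    and P: "\<bar>P\<bar> \<le> 2 * pi * (\<Sum>p\<in>Z. real_of_int \<bar>mz p\<bar> * (kerr l m (Im p - t) + kerr l m (Im p - (t + h)))) + \<epsilon>" and \<epsilon>: "\<epsilon> \<ge> 0"
  shows "\<bar>P\<bar> \<le> P\<^sup>2 / (2 * s) + (5 * s / 2 + 10 * pi / 2 ^ m) *
     (\<Sum>p\<in>Z. real_of_int \<bar>mz p\<bar> * (hump l (Im p - t) + hump l (Im p - (t + h)))) + \<epsilon>"
proof -
  define R where "R = (\<Sum>p\<in>Z. real_of_int \<bar>mz p\<bar> * (hump l (Im p - t) + hump l (Im p - (t + h))))"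
  have hp: "hump l v \<ge> 0" for v using hump_pos(1)[of l v] by simp
  have R0: "R \<ge> 0" unfolding R_def by (intro sum_nonneg mult_nonneg_nonneg add_nonneg_nonneg hp) auto
  show ?thesis
  proof (cases "\<exists>p\<in>Z. mz p \<noteq> 0 \<and> (\<bar>l * (Im p - t)\<bar> \<le> 2 \<or> \<bar>l * (Im p - (t + h))\<bar> \<le> 2)")
    case True
    then obtain p where p: "p \<in> Z" "mz p \<noteq> 0" "\<bar>l * (Im p - t)\<bar> \<le> 2 \<or> \<bar>l * (Im p - (t + h))\<bar> \<le> 2" by blast
    \<comment> \<open>A single nearby zero with \<open>mz p\<close> different from 0 contributes at
      least 1/5 to R, so the coefficient 5 s / 2 makes it worth s / 2.\<close>
    have "1 * (1/5) \<le> real_of_int \<bar>mz p\<bar> * (hump l (Im p - t) + hump l (Im p - (t + h)))"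
    proof (rule mult_mono)
      show "1 / 5 \<le> hump l (Im p - t) + hump l (Im p - (t + h))"
        using p(3) hump_ge[of l "Im p - t"] hump_ge[of l "Im p - (t + h)"] hp[of "Im p - t"] hp[of "Im p - (t + h)"] by auto
    qed (use p in auto)
    also have "\<dots> \<le> R" unfolding R_def
      by (rule member_le_sum[OF p(1) _ fin]) (intro mult_nonneg_nonneg add_nonneg_nonneg hp, auto)
    finally have "1/5 \<le> R" by simp
    hence "(5 * s / 2) * (1/5) \<le> (5 * s / 2) * R" using s by (intro mult_left_mono) auto
    moreover have "0 \<le> (10 * pi / 2 ^ m) * R" using R0 by simp
    moreover have "\<bar>P\<bar> \<le> P\<^sup>2 / (2 * s) + s / 2"
    proof -
      have "2 * s * \<bar>P\<bar> \<le> P\<^sup>2 + s\<^sup>2" using sum_squares_bound[of "\<bar>P\<bar>" s] by (simp add: mult_ac)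
      thus ?thesis using s by (simp add: field_simps power2_eq_square)
    qed
    moreover have "(5 * s / 2 + 10 * pi / 2 ^ m) * R = (5 * s / 2) * R + (10 * pi / 2 ^ m) * R" by (simp add: distrib_right)
    ultimately show ?thesis using \<epsilon> unfolding R_def[symmetric] by linarith
  next
    case False
    have "(\<Sum>p\<in>Z. real_of_int \<bar>mz p\<bar> * (kerr l m (Im p - t) + kerr l m (Im p - (t + h)))) \<le>
       (\<Sum>p\<in>Z. (5 / 2 ^ m) * (real_of_int \<bar>mz p\<bar> * (hump l (Im p - t) + hump l (Im p - (t + h)))))"
    proof (rule sum_mono)
      fix p assume p: "p \<in> Z"
      show "real_of_int \<bar>mz p\<bar> * (kerr l m (Im p - t) + kerr l m (Im p - (t + h))) \<le> (5 / 2 ^ m) * (real_of_int \<bar>mz p\<bar> * (hump l (Im p - t) + hump l (Im p - (t + h))))"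
      proof (cases "mz p = 0")
        case nz: False
        hence "2 \<le> \<bar>l * (Im p - t)\<bar>" "2 \<le> \<bar>l * (Im p - (t + h))\<bar>" using p False by auto
        hence "kerr l m (Im p - t) + kerr l m (Im p - (t + h)) \<le> 5 / 2 ^ m * hump l (Im p - t) + 5 / 2 ^ m * hump l (Im p - (t + h))"
          using m by (intro add_mono kerr_le_hump_far) auto
        hence "real_of_int \<bar>mz p\<bar> * (kerr l m (Im p - t) + kerr l m (Im p - (t + h))) \<le> real_of_int \<bar>mz p\<bar> * (5 / 2 ^ m * hump l (Im p - t) + 5 / 2 ^ m * hump l (Im p - (t + h)))"
          by (intro mult_left_mono) auto
        thus ?thesis by (simp add: algebra_simps)
      qed simp
    qed
    also have "\<dots> = (5 / 2 ^ m) * R" by (simp add: R_def sum_distrib_left)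
    finally have "2 * pi * (\<Sum>p\<in>Z. real_of_int \<bar>mz p\<bar> * (kerr l m (Im p - t) + kerr l m (Im p - (t + h)))) \<le> 2 * pi * ((5 / 2 ^ m) * R)"
      by (intro mult_left_mono) auto
    hence "\<bar>P\<bar> \<le> (10 * pi / 2 ^ m) * R + \<epsilon>" using P by (simp add: mult_ac)
    moreover have "0 \<le> P\<^sup>2 / (2 * s)" "0 \<le> 5 * s / 2 * R" using s R0 by auto
    moreover have "(5 * s / 2 + 10 * pi / 2 ^ m) * R = (5 * s / 2) * R + (10 * pi / 2 ^ m) * R" by (simp add: distrib_right)
    ultimately show ?thesis unfolding R_def[symmetric] by linarith
  qed
qed

end

section \<open>Extraction of a single coefficient by orthogonality\<close>

lemma osc_integral_bound:
  fixes c x :: real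
  assumes "c > 0" "c \<le> \<bar>x\<bar>" "A \<le> B"
  shows "norm (integral {A..B} (\<lambda>t. exp (\<i> * of_real (x * t)))) \<le> 2 / c"
proof -
  have "norm (integral {A..B} (\<lambda>t. exp (\<i> * of_real (x * t)))) \<le> 2 / \<bar>x\<bar>"
    using assms by (intro integral_exp_ii_bound) auto
  also have "\<dots> \<le> 2 / c" using assms by (intro frac_le) auto
  finally show ?thesis .
qed

text \<open>The nearest logarithm to ln n0 is that of n0 + 1, not of n0 - 1, since the logarithm is
  concave.\<close>

lemma log_separation:
  fixes n0 n :: nat
  assumes n0: "n0 \<ge> 2" and n: "n \<ge> 1" "n \<noteq> n0"
  shows "ln (real (n0 + 1) / real n0) \<le> \<bar>ln (real n0) - ln (real n)\<bar>"
proof (cases "n < n0")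
  case True
  have "real (n0 + 1) / real n0 \<le> real n0 / real n"
  proof -
    have "n * (n0 + 1) \<le> (n0 - 1) * (n0 + 1)" using True by (intro mult_right_mono) auto
    also have "\<dots> \<le> n0 * n0" using n0 by (cases n0) (auto simp: algebra_simps)
    finally have "real (n * (n0 + 1)) \<le> real (n0 * n0)" by (simp only: of_nat_le_iff)
    thus ?thesis using n0 n by (simp add: field_simps)
  qed
  hence "ln (real (n0 + 1) / real n0) \<le> ln (real n0 / real n)" using n0 n by (subst ln_le_cancel_iff) auto
  also have "\<dots> = ln (real n0) - ln (real n)" using n0 n by (simp add: ln_div)
  finally show ?thesis by simp
next
  case False
  hence "real (n0 + 1) / real n0 \<le> real n / real n0" using n0 n by (intro divide_right_mono) auto
  hence "ln (real (n0 + 1) / real n0) \<le> ln (real n / real n0)" using n0 n by (subst ln_le_cancel_iff) auto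
  also have "\<dots> = ln (real n) - ln (real n0)" using n0 n by (simp add: ln_div)
  finally show ?thesis by simp
qed

text \<open>Taking the real part introduces the conjugate frequencies, hence sums of logarithms; for
  n0 >= 2 they are separated from 0 by the same gap because n0 + 1 <= n0^2.\<close>

lemma log_separation_sum:
  fixes n0 n :: nat
  assumes n0: "n0 \<ge> 2" and n: "n \<ge> 1"
  shows "ln (real (n0 + 1) / real n0) \<le> \<bar>ln (real n0) + ln (real n)\<bar>"
proof -
  have "2 * n0 \<le> n0 * n0" using n0 by simp
  hence "n0 + 1 \<le> n0 * n0" using n0 by linarith
  hence "real (n0 + 1) \<le> real (n0 * n0)" by (simp only: of_nat_le_iff)
  hence "real (n0 + 1) / real n0 \<le> real n0" using n0 by (simp add: field_simps)
  hence "ln (real (n0 + 1) / real n0) \<le> ln (real n0)" using n0 by (subst ln_le_cancel_iff) auto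
  moreover have "0 \<le> ln (real n)" using n by simp
  ultimately show ?thesis by linarith
qed

context selberg_strip
begin

text \<open>The weight of the prime squares in the off-diagonal part of the mean square, p^2 running
  up to exp L. It is the only quantity in the final inequality, apart from the zeros, that grows
  appreciably with the length; the two hypotheses call for two different estimates of it.\<close>

definition psq_sum :: "real \<Rightarrow> real" where
  "psq_sum L = (\<Sum>p | prime p \<and> 2 * ln (real p) < L. (norm (e (p\<^sup>2)))\<^sup>2 / real p)"

definition nonsquare_mass :: real where "nonsquare_mass = (\<Sum>n. norm (e1 n) * real n powr (- (1/2)))"

definition square_mass :: real where "square_mass = (\<Sum>\<^sub>\<infinity>p\<in>{p. prime p}. (norm (e (p\<^sup>2)))\<^sup>2 / (real p)\<^sup>2)"

lemma sum_e1_le: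
  assumes "finite X" shows "(\<Sum>n\<in>X. norm (e1 n) * real n powr (- (1/2))) \<le> nonsquare_mass"
  unfolding nonsquare_mass_def using dabs_e1 assms by (intro sum_le_suminf) (auto simp: dabs_def)

lemma sum_squares_le:
  assumes "finite X" "X \<subseteq> {p. prime p}"
  shows "(\<Sum>p\<in>X. (norm (e (p\<^sup>2)))\<^sup>2 / (real p)\<^sup>2) \<le> square_mass"
  unfolding square_mass_def
proof (rule finite_sum_le_infsum)
  have "(\<lambda>p. (norm (e (p\<^sup>2))) ^ 2 * real p powr (- (1 + 1))) summable_on {p. prime p}"
    by (rule summable_squares) simp
  also have "?this \<longleftrightarrow> (\<lambda>p. (norm (e (p\<^sup>2)))\<^sup>2 / (real p)\<^sup>2) summable_on {p. prime p}"
    by (rule summable_on_cong) (auto simp: powr_minus field_simps prime_gt_0_nat)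
  finally show "(\<lambda>p. (norm (e (p\<^sup>2)))\<^sup>2 / (real p)\<^sup>2) summable_on {p. prime p}" .
qed (use assms in auto)

lemma nonsquare_mass_nonneg: "0 \<le> nonsquare_mass" using sum_e1_le[of "{}"] by simp
lemma psq_sum_nonneg: "0 \<le> psq_sum L" unfolding psq_sum_def by (intro sum_nonneg) auto

lemma psq_index:
  assumes L: "L \<ge> 0"
  defines "N \<equiv> nat \<lfloor>exp (L / 2)\<rfloor>"
  shows "{p. prime p \<and> 2 * ln (real p) < L} \<subseteq> {1..N}" "N \<ge> 1" "ln (real N) \<le> L"
    "finite {p. prime p \<and> 2 * ln (real p) < L}"
proof -
  show sub: "{p. prime p \<and> 2 * ln (real p) < L} \<subseteq> {1..N}"
  proof
    fix p assume p: "p \<in> {p. prime p \<and> 2 * ln (real p) < L}"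
    hence p0: "p > 0" by (auto simp: prime_gt_0_nat)
    have "ln (real p) < L / 2" using p by simp
    hence "real p \<le> exp (L / 2)" using p0 by (metis less_eq_real_def exp_less_cancel_iff exp_ln of_nat_0_less_iff)
    thus "p \<in> {1..N}" using p0 by (simp add: le_nat_floor N_def)
  qed
  show N1: "N \<ge> 1" unfolding N_def using L by (simp add: le_nat_floor)
  have "real N \<le> exp (L / 2)" unfolding N_def by (simp add: of_nat_floor)
  hence "ln (real N) \<le> L / 2" using N1 by (metis ln_exp ln_mono of_nat_0_less_iff zero_less_one order_less_le_trans)
  thus "ln (real N) \<le> L" using L by simp
  show "finite {p. prime p \<and> 2 * ln (real p) < L}" using sub finite_subset by blast
qed

lemma freqs_psquares: "freqs L \<inter> psquares = (\<lambda>p. p\<^sup>2) ` {p. prime p \<and> 2 * ln (real p) < L}"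
proof -
  have "ln (real (p\<^sup>2)) = 2 * ln (real p)" if "prime p" for p :: nat
    using that by (simp add: ln_realpow prime_gt_0_nat)
  moreover have "1 \<le> p\<^sup>2" if "prime p" for p :: nat using prime_ge_1_nat[OF that] by (simp add: Suc_leI)
  ultimately show ?thesis unfolding psquares_def freqs_def by auto
qed

lemma powr_half_square: "prime p \<Longrightarrow> real (p\<^sup>2) powr (- (1/2)) = 1 / real p" for p :: nat
proof -
  assume p: "prime p"
  have "real (p\<^sup>2) = real p powr 2" using prime_gt_0_nat[OF p] by simp
  hence "real (p\<^sup>2) powr (- (1/2)) = real p powr (- 1)" by (simp only: powr_powr) simp
  thus ?thesis using prime_gt_0_nat[OF p] by (simp add: powr_minus_divide)
qed

text \<open>Apart from the absolutely convergent part this is Cauchy-Schwarz over the prime squares,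
  with the sum of 1 / p bounded by a harmonic sum.\<close>

lemma sum_coefficients_le:
  assumes L: "L \<ge> 0"
  shows "(\<Sum>n\<in>freqs L. norm (e n) * real n powr (- (1/2))) \<le> nonsquare_mass + sqrt (psq_sum L * (1 + L))"
proof -
  let ?I = "{p. prime p \<and> 2 * ln (real p) < L}"
  note I = psq_index[OF L]
  have "(\<Sum>n\<in>freqs L. norm (e n) * real n powr (- (1/2)))
     = (\<Sum>n\<in>freqs L - psquares. norm (e n) * real n powr (- (1/2))) + (\<Sum>n\<in>freqs L \<inter> psquares. norm (e n) * real n powr (- (1/2)))"
    by (subst sum.union_disjoint[symmetric]) (auto simp: finite_freqs intro!: sum.cong)
  also have "(\<Sum>n\<in>freqs L - psquares. norm (e n) * real n powr (- (1/2))) = (\<Sum>n\<in>freqs L - psquares. norm (e1 n) * real n powr (- (1/2)))"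
    by (intro sum.cong) (auto simp: e1_def)
  also have "(\<Sum>n\<in>freqs L \<inter> psquares. norm (e n) * real n powr (- (1/2))) = (\<Sum>p\<in>?I. norm (e (p\<^sup>2)) * (1 / real p))"
    unfolding freqs_psquares by (subst sum.reindex[OF psquares_img(2)], simp only: o_def, intro sum.cong refl) (simp only: powr_half_square mem_Collect_eq)
  finally have eq: "(\<Sum>n\<in>freqs L. norm (e n) * real n powr (- (1/2))) =
     (\<Sum>n\<in>freqs L - psquares. norm (e1 n) * real n powr (- (1/2))) + (\<Sum>p\<in>?I. norm (e (p\<^sup>2)) * (1 / real p))" .
  have "(\<Sum>p\<in>?I. norm (e (p\<^sup>2)) * (1 / real p)) = (\<Sum>p\<in>?I. (norm (e (p\<^sup>2)) / sqrt (real p)) * (1 / sqrt (real p)))"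
    by (intro sum.cong) auto
  hence "(\<Sum>p\<in>?I. norm (e (p\<^sup>2)) * (1 / real p))\<^sup>2 \<le> (\<Sum>p\<in>?I. (norm (e (p\<^sup>2)) / sqrt (real p))\<^sup>2) * (\<Sum>p\<in>?I. (1 / sqrt (real p))\<^sup>2)"
    by (simp only: Cauchy_Schwarz_ineq_sum)
  also have "(\<Sum>p\<in>?I. (norm (e (p\<^sup>2)) / sqrt (real p))\<^sup>2) = psq_sum L"
    unfolding psq_sum_def by (simp add: power_divide)
  also have "(\<Sum>p\<in>?I. (1 / sqrt (real p))\<^sup>2) = (\<Sum>p\<in>?I. 1 / real p)" by (simp add: power_divide)
  finally have 1: "(\<Sum>p\<in>?I. norm (e (p\<^sup>2)) * (1 / real p))\<^sup>2 \<le> psq_sum L * (\<Sum>p\<in>?I. 1 / real p)" .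
  have "(\<Sum>p\<in>?I. 1 / real p) \<le> (\<Sum>p\<in>{1..nat \<lfloor>exp (L / 2)\<rfloor>}. 1 / real p)"
    using I by (intro sum_mono2) auto
  also have "\<dots> \<le> 1 + L" using sum_inverse_le_ln[OF I(2)] I(3) by linarith
  finally have "psq_sum L * (\<Sum>p\<in>?I. 1 / real p) \<le> psq_sum L * (1 + L)"
    using psq_sum_nonneg by (intro mult_left_mono) auto
  hence "(\<Sum>p\<in>?I. norm (e (p\<^sup>2)) * (1 / real p)) \<le> sqrt (psq_sum L * (1 + L))"
    using 1 by (intro real_le_rsqrt) linarith
  thus ?thesis unfolding eq using sum_e1_le[of "freqs L - psquares"] finite_freqs by (intro add_mono) auto
qed

lemma continuous_on_osc [continuous_intros]: "continuous_on A (osc n)"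
  unfolding osc_def by (intro continuous_intros)

lemma norm_osc [simp]: "norm (osc n t) = 1" by (simp add: osc_def)

lemma osc_add: "osc n (t + h) = osc n t * osc n h"
  by (simp add: osc_def exp_add[symmetric] algebra_simps)

text \<open>The part \<open>e1\<close> is bounded pointwise, and the part over squares in mean
  square, with (x + y)^2 <= 2 x^2 + 2 y^2 joining them. The factor g leaves room for the transform
  of the kernel and for the shift in t.\<close>

lemma mean_square_bound:
  fixes g :: "nat \<Rightarrow> complex"
  assumes g: "\<And>n. norm (g n) \<le> M" and L: "L \<ge> 0" and AB: "A \<le> B"
  shows "integral {A..B} (\<lambda>t. (norm (\<Sum>n\<in>freqs L. e n * of_real (real n powr (- (1/2))) * g n * osc n t))\<^sup>2)
     \<le> M\<^sup>2 * (2 * (B - A) * (nonsquare_mass\<^sup>2 + square_mass) + 6 * (1 + L) * psq_sum L)"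
proof -
  let ?I = "{p. prime p \<and> 2 * ln (real p) < L}"
  note I = psq_index[OF L]
  define c where "c = (\<lambda>n. e n * of_real (real n powr (- (1/2))) * g n)"
  define S1 where "S1 = (\<lambda>t. \<Sum>n\<in>freqs L - psquares. c n * osc n t)"
  define S2 where "S2 = (\<lambda>t. \<Sum>n\<in>freqs L \<inter> psquares. c n * osc n t)"
  have M: "M \<ge> 0" using norm_ge_zero[of "g 0"] g[of 0] by linarith
  have S: "(\<Sum>n\<in>freqs L. c n * osc n t) = S1 t + S2 t" for t
    unfolding S1_def S2_def by (subst sum.union_disjoint[symmetric]) (auto simp: finite_freqs intro!: sum.cong)
  have S1: "norm (S1 t) \<le> M * nonsquare_mass" for t
  proof -
    have "norm (S1 t) \<le> (\<Sum>n\<in>freqs L - psquares. M * (norm (e1 n) * real n powr (- (1/2))))"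
      unfolding S1_def
    proof (rule sum_norm_le)
      fix n assume n: "n \<in> freqs L - psquares"
      have "norm (c n * osc n t) = norm (g n) * (norm (e1 n) * real n powr (- (1/2)))"
        using n by (simp add: c_def norm_mult e1_def)
      also have "\<dots> \<le> M * (norm (e1 n) * real n powr (- (1/2)))" by (intro mult_right_mono g) auto
      finally show "norm (c n * osc n t) \<le> M * (norm (e1 n) * real n powr (- (1/2)))" .
    qed
    also have "\<dots> = M * (\<Sum>n\<in>freqs L - psquares. norm (e1 n) * real n powr (- (1/2)))" by (simp only: sum_distrib_left)
    also have "\<dots> \<le> M * nonsquare_mass" using M finite_freqs by (intro mult_left_mono sum_e1_le) auto
    finally show ?thesis .
  qed
  define y where "y = (\<lambda>p. e (p\<^sup>2) * g (p\<^sup>2))"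
  have S2: "S2 t = (\<Sum>p\<in>?I. y p / of_nat p * exp (- \<i> * of_real (2 * ln (real p) * t)))" for t
  proof -
    have "S2 t = (\<Sum>p\<in>?I. c (p\<^sup>2) * osc (p\<^sup>2) t)"
      unfolding S2_def freqs_psquares by (subst sum.reindex[OF psquares_img(2)]) (simp only: o_def)
    also have "\<dots> = (\<Sum>p\<in>?I. y p / of_nat p * exp (- \<i> * of_real (2 * ln (real p) * t)))"
    proof (rule sum.cong[OF refl])
      fix p assume "p \<in> ?I"
      hence p: "prime p" by simp
      have "osc (p\<^sup>2) t = exp (- \<i> * of_real (2 * ln (real p) * t))"
        using prime_gt_0_nat[OF p] by (simp add: osc_def ln_realpow mult_ac)
      moreover have "c (p\<^sup>2) = y p / of_nat p"
        unfolding c_def y_def powr_half_square[OF p] by simp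
      ultimately show "c (p\<^sup>2) * osc (p\<^sup>2) t = y p / of_nat p * exp (- \<i> * of_real (2 * ln (real p) * t))" by simp
    qed
    finally show ?thesis .
  qed
  have ny: "(norm (y p))\<^sup>2 \<le> M\<^sup>2 * (norm (e (p\<^sup>2)))\<^sup>2" for p
  proof -
    have "norm (y p) \<le> M * norm (e (p\<^sup>2))"
      unfolding y_def norm_mult mult.commute[of "norm (e (p\<^sup>2))"] by (intro mult_right_mono g) auto
    hence "(norm (y p))\<^sup>2 \<le> (M * norm (e (p\<^sup>2)))\<^sup>2" by (intro power_mono) auto
    thus ?thesis by (simp add: power_mult_distrib)
  qed
  have i2: "integral {A..B} (\<lambda>t. (norm (S2 t))\<^sup>2) \<le> (B - A) * (M\<^sup>2 * square_mass) + 3 * (1 + L) * (M\<^sup>2 * psq_sum L)"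
  proof -
    have "integral {A..B} (\<lambda>t. (norm (S2 t))\<^sup>2) \<le> (B - A) * (\<Sum>p\<in>?I. (norm (y p))\<^sup>2 / (real p)\<^sup>2)
       + 3 * (1 + ln (real (nat \<lfloor>exp (L / 2)\<rfloor>))) * (\<Sum>p\<in>?I. (norm (y p))\<^sup>2 / real p)"
      unfolding S2 by (rule mean_square_dirichlet_squares[OF I(1,2) AB])
    moreover have "(B - A) * (\<Sum>p\<in>?I. (norm (y p))\<^sup>2 / (real p)\<^sup>2) \<le> (B - A) * (M\<^sup>2 * square_mass)"
    proof (rule mult_left_mono)
      have "(\<Sum>p\<in>?I. (norm (y p))\<^sup>2 / (real p)\<^sup>2) \<le> (\<Sum>p\<in>?I. M\<^sup>2 * ((norm (e (p\<^sup>2)))\<^sup>2 / (real p)\<^sup>2))"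
        unfolding times_divide_eq_right by (intro sum_mono divide_right_mono ny) auto
      also have "\<dots> \<le> M\<^sup>2 * square_mass"
        unfolding sum_distrib_left[symmetric] using I(4) by (intro mult_left_mono sum_squares_le) auto
      finally show "(\<Sum>p\<in>?I. (norm (y p))\<^sup>2 / (real p)\<^sup>2) \<le> M\<^sup>2 * square_mass" .
    qed (use AB in auto)
    moreover have "3 * (1 + ln (real (nat \<lfloor>exp (L / 2)\<rfloor>))) * (\<Sum>p\<in>?I. (norm (y p))\<^sup>2 / real p) \<le> 3 * (1 + L) * (M\<^sup>2 * psq_sum L)"
    proof (rule mult_mono)
      show "(\<Sum>p\<in>?I. (norm (y p))\<^sup>2 / real p) \<le> M\<^sup>2 * psq_sum L"
        unfolding psq_sum_def sum_distrib_left times_divide_eq_right by (intro sum_mono divide_right_mono ny) auto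
    qed (use I L in \<open>auto intro!: sum_nonneg\<close>)
    ultimately show ?thesis by linarith
  qed
  have cont: "continuous_on {A..B} S1" "continuous_on {A..B} S2"
    unfolding S1_def S2_def by (intro continuous_intros)+
  have "integral {A..B} (\<lambda>t. (norm (S1 t + S2 t))\<^sup>2) \<le> integral {A..B} (\<lambda>t. 2 * (M * nonsquare_mass)\<^sup>2 + 2 * (norm (S2 t))\<^sup>2)"
  proof (rule integral_le)
    show "(\<lambda>t. (norm (S1 t + S2 t))\<^sup>2) integrable_on {A..B}"
      by (intro integrable_continuous_real continuous_intros cont)
    show "(\<lambda>t. 2 * (M * nonsquare_mass)\<^sup>2 + 2 * (norm (S2 t))\<^sup>2) integrable_on {A..B}"
      by (intro integrable_continuous_real continuous_intros cont)
    fix t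
    have "(norm (S1 t + S2 t))\<^sup>2 \<le> (M * nonsquare_mass + norm (S2 t))\<^sup>2"
      using norm_triangle_ineq[of "S1 t" "S2 t"] S1[of t] by (intro power_mono) auto
    also have "\<dots> \<le> 2 * (M * nonsquare_mass)\<^sup>2 + 2 * (norm (S2 t))\<^sup>2"
      using sum_squares_bound[of "M * nonsquare_mass" "norm (S2 t)"] by (simp add: power2_sum)
    finally show "(norm (S1 t + S2 t))\<^sup>2 \<le> 2 * (M * nonsquare_mass)\<^sup>2 + 2 * (norm (S2 t))\<^sup>2" .
  qed
  also have "\<dots> = (B - A) * (2 * (M * nonsquare_mass)\<^sup>2) + 2 * integral {A..B} (\<lambda>t. (norm (S2 t))\<^sup>2)"
    using AB by (subst integral_add) (auto intro!: integrable_continuous_real continuous_intros cont)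
  also have "\<dots> \<le> (B - A) * (2 * (M * nonsquare_mass)\<^sup>2) + 2 * ((B - A) * (M\<^sup>2 * square_mass) + 3 * (1 + L) * (M\<^sup>2 * psq_sum L))"
    using i2 by simp
  also have "\<dots> = M\<^sup>2 * (2 * (B - A) * (nonsquare_mass\<^sup>2 + square_mass) + 6 * (1 + L) * psq_sum L)"
    by (simp add: power_mult_distrib algebra_simps)
  finally show ?thesis unfolding S[symmetric] c_def .
qed

text \<open>Multiply the real function by n0^(i t) and integrate. Only the term n0 of the polynomial
  resonates; every other frequency, including all those of the conjugate, is at least the gap ln
  ((n0 + 1) / n0) away from 0 and contributes a bounded integral.\<close>

lemma coefficient_extraction:
  fixes d :: "nat \<Rightarrow> complex"
  assumes n0: "n0 \<in> freqs L" "n0 \<ge> 2" and AB: "A \<le> B"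
  shows "norm (d n0) * (B - A) \<le> integral {A..B} (\<lambda>t. \<bar>2 * Re (\<Sum>n\<in>freqs L. d n * osc n t)\<bar>)
     + 4 / ln (real (n0 + 1) / real n0) * (\<Sum>n\<in>freqs L. norm (d n))"
proof -
  define c where "c = ln (real (n0 + 1) / real n0)"
  have c: "c > 0" unfolding c_def using n0 by (intro ln_gt_zero) (simp add: field_simps)
  define P where "P = (\<lambda>t. 2 * Re (\<Sum>n\<in>freqs L. d n * osc n t))"
  define E where "E = (\<lambda>x t. exp (\<i> * of_real (x * t)) :: complex)"
  have cE: "continuous_on X (E x)" for x X unfolding E_def by (intro continuous_intros)
  have oE: "osc n t * E (ln n0) t = E (ln n0 - ln n) t" "cnj (osc n t) * E (ln n0) t = E (ln n0 + ln n) t" for n t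
    by (simp_all add: osc_def E_def exp_cnj exp_add[symmetric] algebra_simps)
  have PE: "of_real (P t) * E (ln n0) t = (\<Sum>n\<in>freqs L. d n * E (ln n0 - ln n) t + cnj (d n) * E (ln n0 + ln n) t)" for t
  proof -
    have "of_real (P t) = (\<Sum>n\<in>freqs L. d n * osc n t) + cnj (\<Sum>n\<in>freqs L. d n * osc n t)"
      by (simp only: P_def complex_add_cnj)
    also have "\<dots> = (\<Sum>n\<in>freqs L. d n * osc n t + cnj (d n) * cnj (osc n t))"
      by (simp add: sum.distrib)
    finally show ?thesis by (simp add: sum_distrib_right distrib_right mult.assoc oE)
  qed
  define J where "J = (\<lambda>x. integral {A..B} (E x))"
  have Jb: "norm (J x) \<le> 2 / c" if "c \<le> \<bar>x\<bar>" for x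
    unfolding J_def E_def by (rule osc_integral_bound[OF c that AB])
  have "integral {A..B} (\<lambda>t. of_real (P t) * E (ln n0) t) = (\<Sum>n\<in>freqs L. integral {A..B} (\<lambda>t. d n * E (ln n0 - ln n) t + cnj (d n) * E (ln n0 + ln n) t))"
    unfolding PE by (intro integral_sum finite_freqs integrable_continuous_real continuous_intros cE)
  also have "\<dots> = (\<Sum>n\<in>freqs L. d n * J (ln n0 - ln n) + cnj (d n) * J (ln n0 + ln n))"
    unfolding J_def by (intro sum.cong refl, subst integral_add) (auto intro!: integrable_continuous_real continuous_intros cE)
  also have "\<dots> = (\<Sum>n\<in>freqs L. d n * J (ln n0 - ln n)) + (\<Sum>n\<in>freqs L. cnj (d n) * J (ln n0 + ln n))"
    by (rule sum.distrib)
  also have "(\<Sum>n\<in>freqs L. d n * J (ln n0 - ln n)) = d n0 * J (ln n0 - ln n0) + (\<Sum>n\<in>freqs L - {n0}. d n * J (ln n0 - ln n))"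
    using n0 finite_freqs by (intro sum.remove) auto
  also have "J (ln n0 - ln n0) = of_real (B - A)" using AB by (simp add: J_def E_def scaleR_conv_of_real)
  finally have eq: "d n0 * of_real (B - A) = integral {A..B} (\<lambda>t. of_real (P t) * E (ln n0) t)
     - (\<Sum>n\<in>freqs L - {n0}. d n * J (ln n0 - ln n)) - (\<Sum>n\<in>freqs L. cnj (d n) * J (ln n0 + ln n))" by simp
  have "norm (d n0) * (B - A) = norm (d n0 * of_real (B - A))" using AB by (simp only: norm_mult norm_of_real)
  also have "\<dots> \<le> norm (integral {A..B} (\<lambda>t. of_real (P t) * E (ln n0) t))
     + norm (\<Sum>n\<in>freqs L - {n0}. d n * J (ln n0 - ln n)) + norm (\<Sum>n\<in>freqs L. cnj (d n) * J (ln n0 + ln n))"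
    unfolding eq by (meson norm_triangle_ineq4 add_right_mono order_trans)
  also have "\<dots> \<le> integral {A..B} (\<lambda>t. \<bar>P t\<bar>) + 2 / c * (\<Sum>n\<in>freqs L. norm (d n)) + 2 / c * (\<Sum>n\<in>freqs L. norm (d n))"
  proof (intro add_mono)
    have Pc: "continuous_on {A..B} P" unfolding P_def by (intro continuous_intros)
    show "norm (integral {A..B} (\<lambda>t. of_real (P t) * E (ln n0) t)) \<le> integral {A..B} (\<lambda>t. \<bar>P t\<bar>)"
    proof (rule integral_norm_bound_integral)
      show "norm (of_real (P t) * E (ln n0) t) \<le> \<bar>P t\<bar>" for t by (simp add: norm_mult E_def)
    qed (intro integrable_continuous_real continuous_intros Pc cE)+
    have "norm (\<Sum>n\<in>freqs L - {n0}. d n * J (ln n0 - ln n)) \<le> (\<Sum>n\<in>freqs L - {n0}. 2 / c * norm (d n))"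
    proof (rule sum_norm_le)
      fix n assume "n \<in> freqs L - {n0}"
      hence "c \<le> \<bar>ln (real n0) - ln (real n)\<bar>" unfolding c_def using n0 by (intro log_separation) (auto simp: freqs_def)
      from mult_left_mono[OF Jb[OF this], of "norm (d n)"] show "norm (d n * J (ln n0 - ln n)) \<le> 2 / c * norm (d n)"
        by (simp add: norm_mult mult.commute)
    qed
    also have "\<dots> \<le> (\<Sum>n\<in>freqs L. 2 / c * norm (d n))" using c finite_freqs by (intro sum_mono2) auto
    finally show "norm (\<Sum>n\<in>freqs L - {n0}. d n * J (ln n0 - ln n)) \<le> 2 / c * (\<Sum>n\<in>freqs L. norm (d n))"
      by (simp only: sum_distrib_left)
    have "norm (\<Sum>n\<in>freqs L. cnj (d n) * J (ln n0 + ln n)) \<le> (\<Sum>n\<in>freqs L. 2 / c * norm (d n))"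
    proof (rule sum_norm_le)
      fix n assume "n \<in> freqs L"
      hence "c \<le> \<bar>ln (real n0) + ln (real n)\<bar>" unfolding c_def using n0 by (intro log_separation_sum) (auto simp: freqs_def)
      from mult_left_mono[OF Jb[OF this], of "norm (d n)"] show "norm (cnj (d n) * J (ln n0 + ln n)) \<le> 2 / c * norm (d n)"
        by (simp add: norm_mult mult.commute)
    qed
    thus "norm (\<Sum>n\<in>freqs L. cnj (d n) * J (ln n0 + ln n)) \<le> 2 / c * (\<Sum>n\<in>freqs L. norm (d n))"
      by (simp only: sum_distrib_left)
  qed
  also have "\<dots> = integral {A..B} (\<lambda>t. \<bar>P t\<bar>) + 4 / c * (\<Sum>n\<in>freqs L. norm (d n))" by (simp add: field_simps)
  finally show ?thesis by (simp add: P_def c_def)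
qed

end

text \<open>Taking the difference of the explicit formula at \<open>t\<close> and \<open>t + \<pi> / ln n\<^sub>0\<close> removes the contribution of the
  Gamma factors and doubles the coefficient at \<open>n\<^sub>0\<close>.\<close>

lemma frequency_shift: "n0 \<ge> 2 \<Longrightarrow> exp (- \<i> * of_real (pi / ln (real n0) * ln (real n0))) = -1"
  by (simp add: exp_minus)

context selberg_strip
begin

text \<open>Turns the pointwise inequality into an L^1 bound over [2 T, 4 T] and then into a bound
  for one coefficient. Everything is divided by the kernel mass \<open>\<phi>\<close> in the end,
  which is at least 1 / (l m).\<close>

lemma averaged_inequality_if_pointwise:
  assumes n0: "n0 \<in> freqs (l * m)" "n0 \<ge> 2" and h: "h = pi / ln (real n0)" "h \<le> T / 4"
    and T: "T \<ge> 8" and l: "l \<ge> 2" and m: "m \<ge> 4" "even m" and \<sigma>: "\<sigma> > 0"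
    and small: "2 * ln (real n0) / l + 10 * pi * m / 2 ^ m \<le> 1/2"
    and fin: "finite Z" and \<epsilon>: "\<epsilon> \<ge> 0"
    and P: "\<And>t. 2 * T \<le> t \<Longrightarrow> t \<le> 4 * T \<Longrightarrow> \<bar>2 * Re (dpoly l m (T / 2) t - dpoly l m (T / 2) (t + h))\<bar>
       \<le> 2 * pi * (\<Sum>p\<in>Z. real_of_int \<bar>mz p\<bar> * (kerr l m (Im p - t) + kerr l m (Im p - (t + h)))) + \<epsilon>"
  defines "V \<equiv> \<Sum>p\<in>Z. real_of_int \<bar>mz p\<bar>" and "H \<equiv> psq_sum (l * m)"
  shows "norm (e n0) * real n0 powr (- (1/2)) \<le>
      (16 * (nonsquare_mass\<^sup>2 + square_mass) + 24 * ((1 + l * m) * H / T)) / \<sigma>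
      + (5 * pi / 2) * \<sigma> * V / (l * T) + 10 * pi\<^sup>2 * (V * m / (2 ^ m * T)) + l * m * \<epsilon>
      + 8 / ln (real (n0 + 1) / real n0) * (nonsquare_mass + sqrt (H * (1 + l * m))) / T"
proof -
  define c where "c = ln (real (n0 + 1) / real n0)"
  have c: "c > 0" unfolding c_def using n0 by (intro ln_gt_zero) (simp add: field_simps)
  define \<phi> where "\<phi> = kmass l m (T / 2)"
  have lT: "1 \<le> l * (T / 2)" using mult_mono[of 2 l 1 "T / 2"] l T by simp
  have \<phi>ge: "1 / (l * m) \<le> \<phi>" unfolding \<phi>_def using m l lT by (intro kmass_ge) auto
  have lm: "l * m > 0" using l m by simp
  have \<phi>: "\<phi> > 0" using \<phi>ge lm by (meson order_less_le_trans zero_less_divide_1_iff)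
  \<comment> \<open>The polynomial has the size of the kernel mass, so the threshold s is measured
    in units of \<open>\<phi>\<close>.\<close>
  define s where "s = \<sigma> * \<phi>"
  have s: "s > 0" using \<sigma> \<phi> by (simp add: s_def)
  define g where "g = (\<lambda>n. kphi l m (T / 2) (ln (real n)) * (1 - osc n h))"
  define d where "d = (\<lambda>n. e n * of_real (real n powr (- (1/2))) * g n)"
  have g: "norm (g n) \<le> 2 * \<phi>" for n
  proof -
    have "norm (1 - osc n h) \<le> 2" using norm_triangle_ineq4[of 1 "osc n h"] by simp
    hence "norm (kphi l m (T / 2) (ln (real n))) * norm (1 - osc n h) \<le> \<phi> * 2"
      unfolding \<phi>_def using m by (intro mult_mono norm_kphi_le) (use \<phi> \<phi>_def in auto)
    thus ?thesis by (simp add: g_def norm_mult)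
  qed
  \<comment> \<open>The shift gives 1 - osc n0 h = 2, while the assumption \<open>small\<close>
    keeps the transform at ln n0 above half of the mass.\<close>
  have g0: "\<phi> \<le> norm (g n0)"
  proof -
    have "osc n0 h = -1" unfolding osc_def h using frequency_shift[OF n0(2)] by simp
    hence eq: "norm (g n0) = 2 * norm (kphi l m (T / 2) (ln (real n0)))" by (simp add: g_def norm_mult)
    have "\<phi> * (1/2) \<le> \<phi> * (1 - 2 * ln (real n0) / l - 10 * pi * m / 2 ^ m)"
      using small \<phi> by (intro mult_left_mono) auto
    also have "\<dots> \<le> norm (kphi l m (T / 2) (ln (real n0)))"
      unfolding \<phi>_def using m l lT n0 by (intro norm_kphi_ge) auto
    finally show ?thesis using eq by simp
  qed
  define S where "S = (\<lambda>t. \<Sum>n\<in>freqs (l * m). d n * osc n t)"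
  have S: "dpoly l m (T / 2) t - dpoly l m (T / 2) (t + h) = S t" for t
    unfolding S_def dpoly_def sum_subtractf[symmetric]
    by (intro sum.cong refl) (simp add: osc_add d_def g_def algebra_simps)
  define P where "P = (\<lambda>t. 2 * Re (S t))"
  define cf where "cf = 5 * s / 2 + 10 * pi / 2 ^ m"
  have cf: "cf \<ge> 0" using s by (simp add: cf_def)
  define R where "R = (\<lambda>t. \<Sum>p\<in>Z. real_of_int \<bar>mz p\<bar> * (hump l (Im p - t) + hump l (Im p - (t + h))))"
  have pw: "\<bar>P t\<bar> \<le> (P t)\<^sup>2 / (2 * s) + cf * R t + \<epsilon>" if "2 * T \<le> t" "t \<le> 4 * T" for t
    unfolding R_def cf_def using pointwise_bound[OF fin _ _ s P[OF that, unfolded S] \<epsilon>] m by (simp add: P_def)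
  have Sc: "continuous_on X S" for X unfolding S_def by (intro continuous_intros)
  have Pc: "continuous_on X P" for X unfolding P_def by (intro continuous_intros Sc)
  have hc: "continuous_on X (\<lambda>t. hump l (b - (t + h')))" for X b h' by (intro continuous_intros)
  have hc0: "continuous_on X (\<lambda>t. hump l (b - t))" for X b by (intro continuous_intros)
  have Rc: "continuous_on X R" for X unfolding R_def by (intro continuous_intros)
  let ?I = "{2 * T..4 * T}"
  \<comment> \<open>Each zero is counted with its multiplicity difference and twice the mass pi / l,
    once for t and once for t + h.\<close>
  have iR: "integral ?I R \<le> 2 * pi / l * V"
  proof -
    have "integral ?I R = (\<Sum>p\<in>Z. real_of_int \<bar>mz p\<bar> * (integral ?I (\<lambda>t. hump l (Im p - t)) + integral ?I (\<lambda>t. hump l (Im p - (t + h)))))"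
      unfolding R_def
      apply (subst integral_sum[OF fin], intro integrable_continuous_real continuous_intros)
      apply (intro sum.cong refl, subst integral_mult_right, subst integral_add)
      by (auto intro!: integrable_continuous_real hc hc0)
    also have "\<dots> \<le> (\<Sum>p\<in>Z. real_of_int \<bar>mz p\<bar> * (pi / l + pi / l))"
    proof (intro sum_mono mult_left_mono add_mono)
      fix p
      have e1: "(\<lambda>t. hump l (Im p - t)) = (\<lambda>t. hump l (t - Im p))" by (simp add: hump_minus_commute)
      show "integral ?I (\<lambda>t. hump l (Im p - t)) \<le> pi / l"
        unfolding e1 using l T by (intro integral_hump_le) auto
      have e2: "(\<lambda>t. hump l (Im p - (t + h))) = (\<lambda>t. hump l (t - (Im p - h)))"
        by (rule ext, subst hump_minus_commute) (simp add: algebra_simps)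
      show "integral ?I (\<lambda>t. hump l (Im p - (t + h))) \<le> pi / l"
        unfolding e2 using l T by (intro integral_hump_le) auto
    qed auto
    also have "\<dots> = 2 * pi / l * V" unfolding V_def sum_distrib_left by (intro sum.cong) auto
    finally show ?thesis .
  qed
  have iP2: "integral ?I (\<lambda>t. (P t)\<^sup>2) \<le> 16 * \<phi>\<^sup>2 * (4 * T * (nonsquare_mass\<^sup>2 + square_mass) + 6 * (1 + l * m) * H)"
  proof -
    have "integral ?I (\<lambda>t. (P t)\<^sup>2) \<le> integral ?I (\<lambda>t. 4 * (norm (S t))\<^sup>2)"
    proof (rule integral_le)
      fix t
      have "\<bar>P t\<bar> \<le> 2 * norm (S t)" using abs_Re_le_cmod[of "S t"] by (simp add: P_def)
      hence "\<bar>P t\<bar>\<^sup>2 \<le> (2 * norm (S t))\<^sup>2" by (intro power_mono) auto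
      thus "(P t)\<^sup>2 \<le> 4 * (norm (S t))\<^sup>2" by (simp add: power_mult_distrib)
    qed (intro integrable_continuous_real continuous_intros Pc Sc)+
    also have "\<dots> = 4 * integral ?I (\<lambda>t. (norm (S t))\<^sup>2)" by simp
    also have "integral ?I (\<lambda>t. (norm (S t))\<^sup>2) \<le> (2 * \<phi>)\<^sup>2 * (2 * (4 * T - 2 * T) * (nonsquare_mass\<^sup>2 + square_mass) + 6 * (1 + l * m) * psq_sum (l * m))"
      unfolding S_def d_def by (rule mean_square_bound[OF g]) (use lm T in auto)
    finally show ?thesis by (simp add: H_def power_mult_distrib algebra_simps)
  qed
  have iP: "integral ?I (\<lambda>t. \<bar>P t\<bar>) \<le> integral ?I (\<lambda>t. (P t)\<^sup>2) / (2 * s) + cf * (2 * pi / l * V) + 2 * T * \<epsilon>"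
  proof -
    have "integral ?I (\<lambda>t. \<bar>P t\<bar>) \<le> integral ?I (\<lambda>t. ((P t)\<^sup>2 / (2 * s) + cf * R t) + \<epsilon>)"
      by (rule integral_le) (use pw s in \<open>auto intro!: integrable_continuous_real continuous_intros Pc Rc\<close>)
    also have "\<dots> = integral ?I (\<lambda>t. (P t)\<^sup>2 / (2 * s) + cf * R t) + integral ?I (\<lambda>t. \<epsilon>)"
      by (rule integral_add) (use s in \<open>auto intro!: integrable_continuous_real continuous_intros Pc Rc\<close>)
    also have "integral ?I (\<lambda>t. (P t)\<^sup>2 / (2 * s) + cf * R t) = integral ?I (\<lambda>t. (P t)\<^sup>2 / (2 * s)) + integral ?I (\<lambda>t. cf * R t)"
      by (rule integral_add) (use s in \<open>auto intro!: integrable_continuous_real continuous_intros Pc Rc\<close>)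
    also have "integral ?I (\<lambda>t. cf * R t) = cf * integral ?I R" by simp
    also have "integral ?I (\<lambda>t. (P t)\<^sup>2 / (2 * s)) = integral ?I (\<lambda>t. (P t)\<^sup>2) / (2 * s)" by simp
    also have "integral ?I (\<lambda>t. \<epsilon>) = 2 * T * \<epsilon>" using T by simp
    finally show ?thesis using mult_left_mono[OF iR cf] by linarith
  qed
  have dsum: "(\<Sum>n\<in>freqs (l * m). norm (d n)) \<le> 2 * \<phi> * (nonsquare_mass + sqrt (H * (1 + l * m)))"
  proof -
    have "(\<Sum>n\<in>freqs (l * m). norm (d n)) \<le> (\<Sum>n\<in>freqs (l * m). 2 * \<phi> * (norm (e n) * real n powr (- (1/2))))"
    proof (rule sum_mono)
      fix n
      have "norm (d n) = norm (g n) * (norm (e n) * real n powr (- (1/2)))" by (simp add: d_def norm_mult)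
      also have "\<dots> \<le> 2 * \<phi> * (norm (e n) * real n powr (- (1/2)))" by (intro mult_right_mono g) auto
      finally show "norm (d n) \<le> 2 * \<phi> * (norm (e n) * real n powr (- (1/2)))" .
    qed
    also have "\<dots> = 2 * \<phi> * (\<Sum>n\<in>freqs (l * m). norm (e n) * real n powr (- (1/2)))" by (simp only: sum_distrib_left)
    also have "\<dots> \<le> 2 * \<phi> * (nonsquare_mass + sqrt (H * (1 + l * m)))"
      unfolding H_def using lm \<phi> by (intro mult_left_mono sum_coefficients_le) auto
    finally show ?thesis .
  qed
  have "norm (d n0) * (4 * T - 2 * T) \<le> integral ?I (\<lambda>t. \<bar>P t\<bar>) + 4 / c * (\<Sum>n\<in>freqs (l * m). norm (d n))"
    unfolding P_def S_def c_def by (rule coefficient_extraction[OF n0]) (use T in auto)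
  also have "\<dots> \<le> (integral ?I (\<lambda>t. (P t)\<^sup>2) / (2 * s) + cf * (2 * pi / l * V) + 2 * T * \<epsilon>) + 4 / c * (2 * \<phi> * (nonsquare_mass + sqrt (H * (1 + l * m))))"
    using iP mult_left_mono[OF dsum, of "4 / c"] c by simp
  also have "integral ?I (\<lambda>t. (P t)\<^sup>2) / (2 * s) \<le> 16 * \<phi>\<^sup>2 * (4 * T * (nonsquare_mass\<^sup>2 + square_mass) + 6 * (1 + l * m) * H) / (2 * s)"
    using s iP2 by (intro divide_right_mono) auto
  finally have main: "norm (d n0) * (2 * T) \<le> 16 * \<phi>\<^sup>2 * (4 * T * (nonsquare_mass\<^sup>2 + square_mass) + 6 * (1 + l * m) * H) / (2 * s)
     + cf * (2 * pi / l * V) + 2 * T * \<epsilon> + 4 / c * (2 * \<phi> * (nonsquare_mass + sqrt (H * (1 + l * m))))" by simp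
  define X where "X = norm (e n0) * real n0 powr (- (1/2))"
  have "X * \<phi> \<le> norm (d n0)"
    using mult_left_mono[OF g0, of X] by (simp add: X_def d_def norm_mult)
  hence "X * \<phi> * (2 * T) \<le> norm (d n0) * (2 * T)" using T by (intro mult_right_mono) auto
  with main have main2: "X * \<phi> * (2 * T) \<le> 16 * \<phi>\<^sup>2 * (4 * T * (nonsquare_mass\<^sup>2 + square_mass) + 6 * (1 + l * m) * H) / (2 * s)
     + cf * (2 * pi / l * V) + 2 * T * \<epsilon> + 4 / c * (2 * \<phi> * (nonsquare_mass + sqrt (H * (1 + l * m))))" by linarith
  \<comment> \<open>In the mean square and in the main term over zeros \<open>\<phi>\<close>
    cancels; the remaining negative powers of it stand next to factors that are small enough to bear
    l m.\<close>
  have \<phi>inv: "1 / \<phi> \<le> l * m" using \<phi>ge \<phi> lm by (simp add: field_simps)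
  have V: "V \<ge> 0" unfolding V_def by (intro sum_nonneg) auto
  have "X = (X * \<phi> * (2 * T)) / (\<phi> * (2 * T))" using \<phi> T by simp
  also have "\<dots> \<le> (16 * \<phi>\<^sup>2 * (4 * T * (nonsquare_mass\<^sup>2 + square_mass) + 6 * (1 + l * m) * H) / (2 * s)
     + cf * (2 * pi / l * V) + 2 * T * \<epsilon> + 4 / c * (2 * \<phi> * (nonsquare_mass + sqrt (H * (1 + l * m))))) / (\<phi> * (2 * T))"
    using \<phi> T by (intro divide_right_mono main2) auto
  also have "\<dots> = (16 * (nonsquare_mass\<^sup>2 + square_mass) + 24 * ((1 + l * m) * H / T)) / \<sigma>
      + (5 * pi / 2) * \<sigma> * V / (l * T) + 10 * pi\<^sup>2 * (V / (l * 2 ^ m * T)) * (1 / \<phi>) + \<epsilon> * (1 / \<phi>)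
      + 4 / c * (nonsquare_mass + sqrt (H * (1 + l * m))) / T"
    (is "?l = ?r")
  proof -
    have a1: "(16 * \<phi>\<^sup>2 * (4 * T * q + 6 * (1 + l * m) * H) / (2 * s)) / (\<phi> * (2 * T)) = (16 * q + 24 * ((1 + l * m) * H / T)) / \<sigma>" for q
      unfolding s_def using \<phi> T \<sigma> by (simp add: field_simps power2_eq_square)
    have a2: "(cf * (2 * pi / l * V)) / (\<phi> * (2 * T)) = (5 * pi / 2) * \<sigma> * V / (l * T) + 10 * pi\<^sup>2 * (V / (l * 2 ^ m * T)) * (1 / \<phi>)"
      unfolding cf_def s_def using \<phi> T l by (simp add: field_simps power2_eq_square)
    have a3: "(2 * T * \<epsilon>) / (\<phi> * (2 * T)) = \<epsilon> * (1 / \<phi>)" using T by simp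
    have a4: "(4 / c * (2 * \<phi> * q)) / (\<phi> * (2 * T)) = 4 / c * q / T" for q using \<phi> by simp
    show ?thesis unfolding add_divide_distrib[of _ _ "\<phi> * (2 * T)"] a1 a2 a3 a4 by simp
  qed
  also have "\<dots> \<le> (16 * (nonsquare_mass\<^sup>2 + square_mass) + 24 * ((1 + l * m) * H / T)) / \<sigma>
      + (5 * pi / 2) * \<sigma> * V / (l * T) + 10 * pi\<^sup>2 * (V / (l * 2 ^ m * T)) * (l * m) + \<epsilon> * (l * m)
      + 8 / c * (nonsquare_mass + sqrt (H * (1 + l * m))) / T"
  proof (intro add_mono order.refl mult_left_mono \<phi>inv \<epsilon> divide_right_mono mult_right_mono)
    show "0 \<le> 10 * pi\<^sup>2 * (V / (l * 2 ^ m * T))" using V l T by simp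
    show "0 \<le> nonsquare_mass + sqrt (H * (1 + l * m))"
      using nonsquare_mass_nonneg psq_sum_nonneg lm by (simp add: H_def)
  qed (use c T in auto)
  also have "10 * pi\<^sup>2 * (V / (l * 2 ^ m * T)) * (l * m) = 10 * pi\<^sup>2 * (V * m / (2 ^ m * T))" using l by simp
  finally show ?thesis by (simp add: X_def c_def mult.commute)
qed

text \<open>Subtracting the explicit formula at t + h from that at t yields the pointwise inequality
  with an error of order 1 / T. The heights U1 and U2 depend on T but not on t, so they drop out
  once the zeros are counted in the larger window (T, 6 T).\<close>

theorem averaged_inequality:
  assumes n0: "n0 \<ge> 2" and A: "A \<ge> 1"
  shows "\<exists>C2\<ge>0. \<exists>T0\<ge>3. \<forall>T\<ge>T0. \<forall>l m \<sigma>. 2 \<le> l \<longrightarrow> l \<le> A * ln T \<longrightarrow> 4 \<le> m \<longrightarrow> even m \<longrightarrow> \<sigma> > 0 \<longrightarrow>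
     2 * ln (real n0) / l + 10 * pi * m / 2 ^ m \<le> 1/2 \<longrightarrow>
     norm (e n0) * real n0 powr (- (1/2)) \<le>
      (16 * (nonsquare_mass\<^sup>2 + square_mass) + 24 * ((1 + l * m) * psq_sum (l * m) / T)) / \<sigma>
      + 8 * \<sigma> * (\<Sum>p\<in>zset T (6 * T). real_of_int \<bar>mz p\<bar>) / (l * T)
      + 100 * ((\<Sum>p\<in>zset T (6 * T). real_of_int \<bar>mz p\<bar>) * m / (2 ^ m * T))
      + C2 * ((l * m + 1 + sqrt (psq_sum (l * m) * (1 + l * m))) / T)"
proof -
  obtain C1 T1 where C1: "C1 \<ge> 0" and T1: "T1 \<ge> 3" and EF: "\<forall>T\<ge>T1. \<exists>U1\<in>{T..T+1}. \<exists>U2\<in>{5*T..5*T+1}. \<forall>l m t.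
     2 \<le> l \<longrightarrow> l \<le> A * ln T \<longrightarrow> 4 \<le> m \<longrightarrow> even m \<longrightarrow> 2 * T \<le> t \<longrightarrow> t \<le> 17/4 * T \<longrightarrow>
     \<bar>2 * pi * (\<Sum>p\<in>zset U1 U2. real_of_int (mz p) * kerr l m (Im p - t)) + 2 * Re (dpoly l m (T / 2) t)
       - integral {U1..U2} (\<lambda>y. Re (xi (Complex (1/2) y)) * kerr l m (y - t))\<bar> \<le> C1 / T"
    using explicit_formula[OF A] by blast
  define h where "h = pi / ln (real n0)"
  have h: "h > 0" unfolding h_def using n0 by (intro divide_pos_pos) auto
  define c where "c = ln (real (n0 + 1) / real n0)"
  have c: "c > 0" unfolding c_def using n0 by (intro ln_gt_zero) (simp add: field_simps)
  define C2 where "C2 = (2 * C1 + 1000 * C * h) + 8 / c * (nonsquare_mass + 1)"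
  have D0: "0 \<le> 2 * C1 + 1000 * C * h" using C1 C_nonneg h by simp
  have D1: "0 \<le> 8 / c * (nonsquare_mass + 1)" using c nonsquare_mass_nonneg by simp
  have C2: "C2 \<ge> 0" unfolding C2_def using D0 D1 by linarith
  define T0 where "T0 = max T1 (max (2 * Y) (max 8 (4 * h)))"
  have main: "norm (e n0) * real n0 powr (- (1/2)) \<le>
      (16 * (nonsquare_mass\<^sup>2 + square_mass) + 24 * ((1 + l * m) * psq_sum (l * m) / T)) / \<sigma>
      + 8 * \<sigma> * (\<Sum>p\<in>zset T (6 * T). real_of_int \<bar>mz p\<bar>) / (l * T)
      + 100 * ((\<Sum>p\<in>zset T (6 * T). real_of_int \<bar>mz p\<bar>) * m / (2 ^ m * T))
      + C2 * ((l * m + 1 + sqrt (psq_sum (l * m) * (1 + l * m))) / T)"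
    if T: "T \<ge> T0" and l: "2 \<le> l" "l \<le> A * ln T" and m: "4 \<le> m" "even m" and \<sigma>: "\<sigma> > 0"
     and small: "2 * ln (real n0) / l + 10 * pi * m / 2 ^ m \<le> 1/2" for T l m \<sigma>
  proof -
    have Tb: "T \<ge> T1" "T \<ge> 2 * Y" "T \<ge> 8" "h \<le> T / 4" using T by (auto simp: T0_def)
    obtain U1 U2 where U: "U1 \<in> {T..T+1}" "U2 \<in> {5*T..5*T+1}" and ef: "\<And>t. 2 * T \<le> t \<Longrightarrow> t \<le> 17/4 * T \<Longrightarrow>
     \<bar>2 * pi * (\<Sum>p\<in>zset U1 U2. real_of_int (mz p) * kerr l m (Im p - t)) + 2 * Re (dpoly l m (T / 2) t)
       - integral {U1..U2} (\<lambda>y. Re (xi (Complex (1/2) y)) * kerr l m (y - t))\<bar> \<le> C1 / T"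
      using EF Tb(1) l m by blast
    define Z where "Z = zset U1 U2"
    have YT: "Y \<le> T" using Tb(2) Y_ge by linarith
    have ZZ: "Z \<subseteq> zset T (6 * T)" unfolding Z_def zset_def using U Tb by auto
    have finT: "finite (zset T (6 * T))" using YT by (rule finite_zset)
    have finZ: "finite Z" using ZZ finT finite_subset by blast
    define V where "V = (\<Sum>p\<in>zset T (6 * T). real_of_int \<bar>mz p\<bar>)"
    define V' where "V' = (\<Sum>p\<in>Z. real_of_int \<bar>mz p\<bar>)"
    have V: "V' \<le> V" unfolding V_def V'_def by (rule sum_mono2[OF finT ZZ]) auto
    have V0: "0 \<le> V'" unfolding V'_def by (intro sum_nonneg) auto
    define H where "H = psq_sum (l * m)"
    define sq where "sq = sqrt (H * (1 + l * m))"
    have lm: "l * m > 0" using l m by simp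
    have ln0: "ln (real n0) < l * m"
    proof -
      have "0 \<le> 10 * pi * m / 2 ^ m" by simp
      hence "2 * ln (real n0) / l \<le> 1/2" using small by linarith
      hence "ln (real n0) < l" using l by (simp add: field_simps)
      also have "l * 1 \<le> l * m" using l m by (intro mult_left_mono) auto
      finally show ?thesis by simp
    qed
    have sq0: "0 \<le> sq" unfolding sq_def H_def using psq_sum_nonneg lm by simp
    define \<epsilon> where "\<epsilon> = (2 * C1 + 1000 * C * h) / T"
    have "norm (e n0) * real n0 powr (- (1/2)) \<le>
      (16 * (nonsquare_mass\<^sup>2 + square_mass) + 24 * ((1 + l * m) * H / T)) / \<sigma>
      + (5 * pi / 2) * \<sigma> * V' / (l * T) + 10 * pi\<^sup>2 * (V' * m / (2 ^ m * T)) + l * m * \<epsilon>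
      + 8 / c * (nonsquare_mass + sq) / T"
      unfolding V'_def H_def c_def sq_def
    proof (rule averaged_inequality_if_pointwise)
      show "n0 \<in> freqs (l * m)" using ln0 n0 by (simp add: freqs_def)
      show "h = pi / ln (real n0)" by (simp add: h_def)
      show "\<epsilon> \<ge> 0" unfolding \<epsilon>_def using D0 Tb by simp
      fix t assume t: "2 * T \<le> t" "t \<le> 4 * T"
      define K where "K = (\<lambda>t. \<Sum>p\<in>Z. real_of_int (mz p) * kerr l m (Im p - t))"
      define I where "I = (\<lambda>t. integral {U1..U2} (\<lambda>y. Re (xi (Complex (1/2) y)) * kerr l m (y - t)))"
      have a1: "\<bar>2 * pi * K t + 2 * Re (dpoly l m (T / 2) t) - I t\<bar> \<le> C1 / T"
        unfolding K_def I_def Z_def using t Tb by (intro ef) auto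
      have a2: "\<bar>2 * pi * K (t + h) + 2 * Re (dpoly l m (T / 2) (t + h)) - I (t + h)\<bar> \<le> C1 / T"
        unfolding K_def I_def Z_def using t Tb h by (intro ef) auto
      have a3: "\<bar>I t - I (t + h)\<bar> \<le> 1000 * C * h / T"
        unfolding I_def by (rule xi_difference) (use h Tb l m U t in auto)
      have "\<bar>K t - K (t + h)\<bar> \<le> (\<Sum>p\<in>Z. real_of_int \<bar>mz p\<bar> * (kerr l m (Im p - t) + kerr l m (Im p - (t + h))))"
        unfolding K_def sum_subtractf[symmetric]
      proof (rule order.trans[OF sum_abs], rule sum_mono)
        fix p
        have "\<bar>kerr l m (Im p - t) - kerr l m (Im p - (t + h))\<bar> \<le> kerr l m (Im p - t) + kerr l m (Im p - (t + h))"
          using kerr_bounds(1)[OF m(2), of l "Im p - t"] kerr_bounds(1)[OF m(2), of l "Im p - (t + h)"] by linarith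
        from mult_left_mono[OF this, of "\<bar>real_of_int (mz p)\<bar>"]
        show "\<bar>real_of_int (mz p) * kerr l m (Im p - t) - real_of_int (mz p) * kerr l m (Im p - (t + h))\<bar>
            \<le> real_of_int \<bar>mz p\<bar> * (kerr l m (Im p - t) + kerr l m (Im p - (t + h)))"
          by (simp add: right_diff_distrib[symmetric] abs_mult)
      qed
      hence "2 * pi * \<bar>K t - K (t + h)\<bar> \<le> 2 * pi * (\<Sum>p\<in>Z. real_of_int \<bar>mz p\<bar> * (kerr l m (Im p - t) + kerr l m (Im p - (t + h))))"
        by (intro mult_left_mono) auto
      moreover have "2 * pi * \<bar>K t - K (t + h)\<bar> = \<bar>2 * pi * K t - 2 * pi * K (t + h)\<bar>"
        by (simp add: abs_mult right_diff_distrib[symmetric])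
      moreover have "\<epsilon> = C1 / T + C1 / T + 1000 * C * h / T" by (simp add: \<epsilon>_def add_divide_distrib)
      moreover have "2 * Re (dpoly l m (T / 2) t - dpoly l m (T / 2) (t + h)) = 2 * Re (dpoly l m (T / 2) t) - 2 * Re (dpoly l m (T / 2) (t + h))" by simp
      ultimately show "\<bar>2 * Re (dpoly l m (T / 2) t - dpoly l m (T / 2) (t + h))\<bar>
         \<le> 2 * pi * (\<Sum>p\<in>Z. real_of_int \<bar>mz p\<bar> * (kerr l m (Im p - t) + kerr l m (Im p - (t + h)))) + \<epsilon>"
        using a1 a2 a3 by linarith
    qed (use n0 Tb l m \<sigma> small finZ in auto)
    \<comment> \<open>Rounding of constants: 5 pi / 2 < 8, and below 10 pi^2 < 100.\<close>
    moreover have "(5 * pi / 2) * \<sigma> * V' / (l * T) \<le> 8 * \<sigma> * V / (l * T)"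
      using V V0 \<sigma> l Tb pi_less_4 pi_approx by (intro divide_right_mono mult_mono) auto
    moreover have "10 * pi\<^sup>2 * (V' * m / (2 ^ m * T)) \<le> 100 * (V * m / (2 ^ m * T))"
    proof (rule mult_mono)
      have "pi * pi \<le> 3.15 * 3.15" using pi_approx by (intro mult_mono) auto
      thus "10 * pi\<^sup>2 \<le> 100" by (simp add: power2_eq_square)
    qed (use V V0 Tb in \<open>auto intro!: divide_right_mono mult_right_mono\<close>)
    moreover have "l * m * \<epsilon> + 8 / c * (nonsquare_mass + sq) / T \<le> C2 * ((l * m + 1 + sq) / T)"
    proof -
      have "l * m * \<epsilon> \<le> (2 * C1 + 1000 * C * h) * ((l * m + 1 + sq) / T)"
      proof -
        have "l * m * \<epsilon> = (2 * C1 + 1000 * C * h) * (l * m / T)" by (simp add: \<epsilon>_def)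
        also have "\<dots> \<le> (2 * C1 + 1000 * C * h) * ((l * m + 1 + sq) / T)"
          using D0 sq0 Tb by (intro mult_left_mono divide_right_mono) auto
        finally show ?thesis .
      qed
      moreover have "8 / c * (nonsquare_mass + sq) / T \<le> (8 / c * (nonsquare_mass + 1)) * ((l * m + 1 + sq) / T)"
      proof -
        have "0 \<le> nonsquare_mass * sq" using nonsquare_mass_nonneg sq0 by (intro mult_nonneg_nonneg)
        hence "nonsquare_mass + sq \<le> (nonsquare_mass + 1) * (1 + sq)" by (simp add: algebra_simps)
        also have "\<dots> \<le> (nonsquare_mass + 1) * (l * m + 1 + sq)"
          using nonsquare_mass_nonneg lm by (intro mult_left_mono) auto
        finally have "8 / c * (nonsquare_mass + sq) \<le> 8 / c * ((nonsquare_mass + 1) * (l * m + 1 + sq))"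
          using c by (intro mult_left_mono) auto
        hence "8 / c * (nonsquare_mass + sq) / T \<le> 8 / c * ((nonsquare_mass + 1) * (l * m + 1 + sq)) / T"
          using Tb by (intro divide_right_mono) auto
        thus ?thesis by (simp only: mult.assoc times_divide_eq_right)
      qed
      ultimately show ?thesis unfolding C2_def by (simp only: distrib_right)
    qed
    ultimately show ?thesis unfolding V_def[symmetric] H_def[symmetric] sq_def[symmetric] by linarith
  qed
  have "T0 \<ge> 3" using T1 by (simp add: T0_def)
  with C2 main show ?thesis by blast
qed

end

section \<open>Zeros on the critical line and uniqueness\<close>

context selberg
begin

text \<open>Cut the range of ordinates into at most 6 T unit intervals; each piece of the critical
  line lies in one disc of \<open>local_logderiv\<close>. The factor 3 comes from the crude T + j <=
  T^3.\<close>

lemma zero_count_critical_line: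
  "\<exists>K\<ge>1. \<exists>T0\<ge>3. \<forall>T\<ge>T0. \<forall>X. finite X \<longrightarrow> X \<subseteq> {s. Re s = 1/2 \<and> T < Im s \<and> Im s < 6 * T} \<longrightarrow>
     real_of_int (\<Sum>p\<in>X. zorder F p) \<le> K * (T * ln T)"
proof -
  obtain K T0 where K: "K \<ge> 1" "T0 \<ge> 3" and cnt: "\<And>T. T \<ge> T0 \<Longrightarrow> finite {z \<in> cball (Complex 2 (T + 1/2)) 4. F z = 0} \<and>
     real (\<Sum>p\<in>{z \<in> cball (Complex 2 (T + 1/2)) 4. F z = 0}. nat (zorder F p)) \<le> K * ln T \<and>
     (\<forall>z\<in>cball (Complex 2 (T + 1/2)) 2. \<forall>d>0. (\<forall>p\<in>{z \<in> cball (Complex 2 (T + 1/2)) 4. F z = 0}. d \<le> norm (z - p)) \<longrightarrow>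
        norm (deriv F z / F z) \<le> K * ln T / d + K * ln T)"
    using local_logderiv by blast
  have "real_of_int (\<Sum>p\<in>X. zorder F p) \<le> (18 * K) * (T * ln T)"
    if T: "T \<ge> max T0 8" and X: "finite X" "X \<subseteq> {s. Re s = 1/2 \<and> T < Im s \<and> Im s < 6 * T}" for T X
  proof -
    define N where "N = nat \<lceil>5 * T\<rceil>"
    define k where "k = (\<lambda>p. nat \<lfloor>Im p - T\<rfloor>)"
    have T8: "T \<ge> 8" "T \<ge> T0" using T by auto
    have N: "real N \<le> 5 * T + 1" "5 * T \<le> real N" unfolding N_def using T8 by linarith+
    have kb: "real (k p) \<le> Im p - T" "Im p - T < real (k p) + 1" "k p < N" if "p \<in> X" for p
    proof -
      have p: "T < Im p" "Im p < 6 * T" using that X by auto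
      show 1: "real (k p) \<le> Im p - T" "Im p - T < real (k p) + 1" unfolding k_def using p by linarith+
      have "real (k p) < real N" using 1 p N by linarith
      thus "k p < N" by simp
    qed
    have imp: "Im p > 0" if "p \<in> X" for p using that X T8 by fastforce
    have part: "real_of_int (\<Sum>p\<in>{p\<in>X. k p = j}. zorder F p) \<le> K * (3 * ln T)" if j: "j < N" for j
    proof -
      define B where "B = {z \<in> cball (Complex 2 (T + real j + 1/2)) 4. F z = 0}"
      have Tj: "T + real j \<ge> T0" using T8 by simp
      have B: "finite B" "real (\<Sum>p\<in>B. nat (zorder F p)) \<le> K * ln (T + real j)"
        unfolding B_def using cnt[OF Tj] by (blast, blast)
      have "(\<Sum>p\<in>{p\<in>X. k p = j}. zorder F p) = (\<Sum>p\<in>{p\<in>X. k p = j \<and> F p = 0}. int (nat (zorder F p)))"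
        using X zorder_F[OF imp] by (intro sum.mono_neutral_cong_right) auto
      also have "\<dots> \<le> (\<Sum>p\<in>B. int (nat (zorder F p)))"
      proof (rule sum_mono2[OF B(1)])
        show "{p\<in>X. k p = j \<and> F p = 0} \<subseteq> B"
        proof
          fix p assume p: "p \<in> {p\<in>X. k p = j \<and> F p = 0}"
          hence "Re p = 1/2" "\<bar>Im p - (T + real j + 1/2)\<bar> \<le> 1" using X kb[of p] by auto
          hence "norm (Complex 2 (T + real j + 1/2) - p) \<le> 4"
            using cmod_le[of "Complex 2 (T + real j + 1/2) - p"] by simp
          thus "p \<in> B" using p by (simp add: B_def dist_norm)
        qed
      qed auto
      finally have "real_of_int (\<Sum>p\<in>{p\<in>X. k p = j}. zorder F p) \<le> real_of_int (\<Sum>p\<in>B. int (nat (zorder F p)))"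
        by (simp only: of_int_le_iff)
      also have "\<dots> = real (\<Sum>p\<in>B. nat (zorder F p))" by (simp del: int_nat_eq)
      also have "\<dots> \<le> K * ln (T + real j)" by (rule B(2))
      also have "ln (T + real j) \<le> ln (T ^ 3)"
      proof (rule ln_mono)
        have "8 * 8 * T \<le> T * T * T" using T8 by (intro mult_mono) auto
        moreover have "real j \<le> 5 * T + 1" using j N by linarith
        ultimately show "T + real j \<le> T ^ 3" unfolding power3_eq_cube using T8 by linarith
      qed (use T8 in auto)
      also have "ln (T ^ 3) = 3 * ln T" using T8 by (simp add: ln_realpow)
      finally show ?thesis using K by simp
    qed
    have "(\<Sum>p\<in>X. zorder F p) = (\<Sum>j<N. \<Sum>p\<in>{p\<in>X. k p = j}. zorder F p)"
      by (rule sum.group[symmetric]) (use X kb in auto)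
    hence "real_of_int (\<Sum>p\<in>X. zorder F p) = (\<Sum>j<N. real_of_int (\<Sum>p\<in>{p\<in>X. k p = j}. zorder F p))" by simp
    also have "\<dots> \<le> (\<Sum>j<N. K * (3 * ln T))" by (intro sum_mono part) auto
    also have "\<dots> = real N * (K * (3 * ln T))" by simp
    also have "\<dots> \<le> (6 * T) * (K * (3 * ln T))" using N T8 K by (intro mult_right_mono) auto
    finally show ?thesis by (simp add: mult_ac)
  qed
  moreover have "18 * K \<ge> 1" "max T0 8 \<ge> 3" using K by auto
  ultimately show ?thesis by blast
qed

lemma isolated_zero_upper:
  assumes "Im p > 0" "F p = 0" shows "isolated_zero F p"
  unfolding isolated_zero_def
proof
  have "isCont F p" using continuous_on_interior[OF holomorphic_on_imp_continuous_on[OF F_holo_upper]] open_upper assms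
    by (simp add: interior_open)
  thus "F \<midarrow>p\<rightarrow> 0" using assms by (simp add: isCont_def)
  obtain r where r: "r > 0" "\<And>z. z \<in> ball p r - {p} \<Longrightarrow> F z \<noteq> 0" using F_factor[OF assms(1)] by blast
  show "\<forall>\<^sub>F x in at p. F x \<noteq> 0" unfolding eventually_at using r by (intro exI[of _ r]) (auto simp: dist_commute)
qed

text \<open>Above Y the Gamma factor is holomorphic and nonzero, so the zero of F is also one of the
  completed function.\<close>

lemma nontrivial_zero_high:
  assumes g: "gamma_region C Y" and p: "Re p = 1/2" "Im p > Y" "F p = 0"
  shows "nontrivial_zero F p"
  unfolding nontrivial_zero_def
proof (intro conjI exI)
  have Y: "Y \<ge> 3" using g by (simp add: gamma_region_def)
  show iF: "isolated_zero F p" using p Y by (intro isolated_zero_upper) auto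
  show "selberg_functional_eq F Q N lam \<mu> w" by (rule functional_eq)
  have op: "open {s. \<bar>Re s\<bar> < 12 \<and> Y < Im s}"
  proof -
    have "{s. \<bar>Re s\<bar> < 12 \<and> Y < Im s} = {s. Re s < 12} \<inter> {s. - 12 < Re s} \<inter> {s. Y < Im s}" by auto
    thus ?thesis by (simp add: open_Int open_halfspace_Re_gt open_halfspace_Re_lt open_halfspace_Im_gt)
  qed
  have ev: "\<forall>\<^sub>F s in at p. selberg_Phi F Q N lam \<mu> s = gam s * F s \<and> gam s \<noteq> 0"
    by (rule eventually_at_in_open'[OF op, THEN eventually_mono])
       (use p Phi_eq[OF g] gamma_regionD(1)[OF g] in auto)
  have "isCont gam p" using gamma_regionD(2)[OF g, of p] p by (auto intro: DERIV_isCont)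
  hence "(\<lambda>s. gam s * F s) \<midarrow>p\<rightarrow> gam p * 0"
    using iF by (intro tendsto_mult) (auto simp: isCont_def isolated_zero_def)
  hence "(\<lambda>s. gam s * F s) \<midarrow>p\<rightarrow> 0" by simp
  moreover have "\<forall>\<^sub>F s in at p. gam s * F s = selberg_Phi F Q N lam \<mu> s" using ev by eventually_elim simp
  ultimately have "selberg_Phi F Q N lam \<mu> \<midarrow>p\<rightarrow> 0" by (rule Lim_transform_eventually)
  moreover have "\<forall>\<^sub>F s in at p. F s \<noteq> 0" using iF by (simp add: isolated_zero_def)
  with ev have "\<forall>\<^sub>F s in at p. selberg_Phi F Q N lam \<mu> s \<noteq> 0" by eventually_elim simp
  ultimately show "isolated_zero (selberg_Phi F Q N lam \<mu>) p" by (simp add: isolated_zero_def)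
qed

lemma in_selberg_class: "F \<in> selberg_class"
  unfolding selberg_class_def using dirichlet continuation functional_eq log_series by blast

text \<open>Above Y every zero on the critical line is non-trivial, and a point that is no zero has
  order 0, so the formula holds for both kinds of points.\<close>

lemma count_critical_zeros:
  assumes g: "gamma_region C Y" and p: "Re p = 1/2" "Im p > Y" "Im p \<le> T"
  shows "count (critical_zeros F T) (Im p) = nat (zorder F p)"
proof -
  let ?S = "{\<gamma>. \<bar>\<gamma>\<bar> \<le> T \<and> nontrivial_zero F (1/2 + \<i> * of_real \<gamma>)}"
  have Y: "Y \<ge> 3" using g by (simp add: gamma_region_def)
  have pe: "1/2 + \<i> * of_real (Im p) = p" using p by (simp add: complex_eq_iff)
  have "count (critical_zeros F T) (Im p) = (\<Sum>\<gamma>\<in>?S. if \<gamma> = Im p then nat (zorder F (1/2 + \<i> * of_real \<gamma>)) else 0)"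
    unfolding critical_zeros_def count_sum by (intro sum.cong) auto
  also have "\<dots> = (if Im p \<in> ?S then nat (zorder F p) else 0)"
    using sum.delta[OF finite_critical_zeros[OF in_selberg_class, of T], of "Im p" "\<lambda>\<gamma>. nat (zorder F (1/2 + \<i> * of_real \<gamma>))"]
    unfolding pe by simp
  also have "\<dots> = nat (zorder F p)"
  proof (cases "F p = 0")
    case True
    hence "nontrivial_zero F p" by (intro nontrivial_zero_high[OF g] p)
    thus ?thesis using p Y by (simp add: pe)
  next
    case False
    thus ?thesis using zorder_F(3)[of p] p Y by simp
  qed
  finally show ?thesis .
qed

end

lemma sum_count_le_size: "finite X \<Longrightarrow> (\<Sum>x\<in>X. count M x) \<le> size M"
proof -
  assume X: "finite X"
  have "(\<Sum>x\<in>X. count M x) = (\<Sum>x\<in>X \<inter> set_mset M. count M x)"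
    using X by (intro sum.mono_neutral_right) (auto simp: count_eq_zero_iff)
  also have "\<dots> \<le> (\<Sum>x\<in>set_mset M. count M x)" by (intro sum_mono2) auto
  finally show ?thesis by (simp add: size_multiset_overloaded_eq)
qed

section \<open>The total multiplicity difference on the critical line\<close>

context selberg_strip
begin

lemma zset_mass_le:
  "\<exists>K\<ge>1. \<exists>T0\<ge>3. \<forall>T\<ge>T0. (\<Sum>p\<in>zset T (6 * T). real_of_int \<bar>mz p\<bar>) \<le> K * (T * ln T)"
proof -
  obtain K1 T1 where K1: "K1 \<ge> 1" "T1 \<ge> 3" and all1: "\<forall>T\<ge>T1. \<forall>X. finite X \<longrightarrow> X \<subseteq> {s. Re s = 1/2 \<and> T < Im s \<and> Im s < 6 * T} \<longrightarrow>
     real_of_int (\<Sum>p\<in>X. zorder F p) \<le> K1 * (T * ln T)" using A.zero_count_critical_line by (elim exE conjE)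
  note 1 = K1 all1[rule_format]
  obtain K2 T2 where K2: "K2 \<ge> 1" "T2 \<ge> 3" and all2: "\<forall>T\<ge>T2. \<forall>X. finite X \<longrightarrow> X \<subseteq> {s. Re s = 1/2 \<and> T < Im s \<and> Im s < 6 * T} \<longrightarrow>
     real_of_int (\<Sum>p\<in>X. zorder G p) \<le> K2 * (T * ln T)" using B.zero_count_critical_line by (elim exE conjE)
  note 2 = K2 all2[rule_format]
  have "(\<Sum>p\<in>zset T (6 * T). real_of_int \<bar>mz p\<bar>) \<le> (K1 + K2) * (T * ln T)" if T: "T \<ge> max (max T1 T2) Y" for T
  proof -
    have sub: "zset T (6 * T) \<subseteq> {s. Re s = 1/2 \<and> T < Im s \<and> Im s < 6 * T}" by (auto simp: zset_def sing_def)
    have fin: "finite (zset T (6 * T))" using T by (intro finite_zset) auto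
    have "(\<Sum>p\<in>zset T (6 * T). real_of_int \<bar>mz p\<bar>) \<le> (\<Sum>p\<in>zset T (6 * T). real_of_int (zorder F p) + real_of_int (zorder G p))"
    proof (rule sum_mono)
      fix p assume "p \<in> zset T (6 * T)"
      hence "Im p > 0" using T Y_ge by (auto simp: zset_def)
      thus "real_of_int \<bar>mz p\<bar> \<le> real_of_int (zorder F p) + real_of_int (zorder G p)"
        using A.zorder_F(1)[of p] B.zorder_F(1)[of p] by (simp add: mz_def)
    qed
    also have "\<dots> = real_of_int (\<Sum>p\<in>zset T (6 * T). zorder F p) + real_of_int (\<Sum>p\<in>zset T (6 * T). zorder G p)"
      by (simp add: sum.distrib)
    also have "\<dots> \<le> K1 * (T * ln T) + K2 * (T * ln T)"
      using T fin sub by (intro add_mono 1 2) auto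
    finally show ?thesis by (simp add: distrib_right)
  qed
  moreover have "K1 + K2 \<ge> 1" "max (max T1 T2) Y \<ge> 3" using 1 2 by auto
  ultimately show ?thesis by blast
qed

text \<open>Adding the two truncated differences of multiplicities gives the absolute difference.
  The window (T, 6 T) sees only part of the symmetric difference, and Im is injective on the
  critical line.\<close>

lemma zset_mass_le_symdiff:
  assumes T: "T \<ge> Y"
  shows "(\<Sum>p\<in>zset T (6 * T). real_of_int \<bar>mz p\<bar>) \<le> real (size (mset_symdiff (critical_zeros F (6 * T)) (critical_zeros G (6 * T))))"
proof -
  let ?M = "mset_symdiff (critical_zeros F (6 * T)) (critical_zeros G (6 * T))"
  have fin: "finite (zset T (6 * T))" using T by (rule finite_zset)
  have inj: "inj_on Im (zset T (6 * T))" by (auto simp: inj_on_def zset_def sing_def complex_eq_iff)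
  have "(\<Sum>p\<in>zset T (6 * T). real_of_int \<bar>mz p\<bar>) = (\<Sum>p\<in>zset T (6 * T). real (count ?M (Im p)))"
  proof (rule sum.cong[OF refl])
    fix p assume "p \<in> zset T (6 * T)"
    hence p: "Re p = 1/2" "Im p > Y" "Im p \<le> 6 * T" "Im p > 0" using T Y_ge by (auto simp: zset_def sing_def)
    show "real_of_int \<bar>mz p\<bar> = real (count ?M (Im p))"
      using A.count_critical_zeros[OF regF p(1-3)] B.count_critical_zeros[OF regG p(1-3)]
        A.zorder_F(1)[OF p(4)] B.zorder_F(1)[OF p(4)]
      by (simp add: mset_symdiff_def mz_def)
  qed
  also have "\<dots> = real (\<Sum>\<gamma>\<in>Im ` zset T (6 * T). count ?M \<gamma>)"
    by (simp add: sum.reindex[OF inj])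
  also have "\<dots> \<le> real (size ?M)" using fin by (intro of_nat_mono sum_count_le_size) auto
  finally show ?thesis .
qed

end

context selberg_pair
begin

text \<open>The logarithms then agree for Re s > 1, and so do F and G; the identity theorem extends
  this to the plane without 1.\<close>

lemma eq_if_e_vanishes:
  assumes "\<And>n. n \<ge> 2 \<Longrightarrow> e n = 0" shows "F = G"
proof -
  have "A.bl = B.bl"
  proof
    fix n
    show "A.bl n = B.bl n"
    proof (cases "n \<ge> 2")
      case True
      hence "A.bL n = B.bL n" using assms[of n] by (simp add: e_def)
      thus ?thesis unfolding A.bl_def B.bl_def A.bL_def B.bL_def by simp
    next
      case False
      hence "n = 0 \<or> n = 1" by linarith
      thus ?thesis by (auto simp: A.bl_def B.bl_def)
    qed
  qed
  hence right: "F s = G s" if "s \<in> {s. Re s > 1}" for s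
    using that by (simp add: A.F_eq_exp B.F_eq_exp)
  have off: "F s = G s" if "s \<noteq> 1" for s
  proof (rule analytic_continuation_open[of "{s. Re s > 1}" "- {1}" F G])
    show "connected (- {1::complex})" by (intro connected_punctured_universe) simp
    show "{s::complex. 1 < Re s} \<noteq> {}" by (auto intro!: exI[of _ 2])
  qed (use that right in \<open>auto simp: open_halfspace_Re_gt intro!: A.F_holomorphic B.F_holomorphic\<close>)
  have ev: "\<forall>\<^sub>F s in at 1. F s = G s" using off by (simp add: eventually_at_filter)
  \<comment> \<open>At 1 the normalisation decides: both values are 0 at a common pole, and
    otherwise both are the common limit.\<close>
  have niceF: "is_pole F 1 \<and> F 1 = 0 \<or> F \<midarrow>1\<rightarrow> F 1" and niceG: "is_pole G 1 \<and> G 1 = 0 \<or> G \<midarrow>1\<rightarrow> G 1"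
    using A.continuation B.continuation by (auto simp: selberg_continuation_def nicely_meromorphic_on_def)
  have "F 1 = G 1"
  proof (cases "is_pole F 1")
    case True
    hence pG: "is_pole G 1" using is_pole_cong[OF ev refl] by simp
    have "\<not> F \<midarrow>1\<rightarrow> F 1" "\<not> G \<midarrow>1\<rightarrow> G 1"
      using True pG not_tendsto_and_filterlim_at_infinity[of "at (1::complex)"] by (auto simp: is_pole_def)
    thus ?thesis using niceF niceG by simp
  next
    case False
    hence "\<not> is_pole G 1" using is_pole_cong[OF ev refl] by simp
    hence lim: "F \<midarrow>1\<rightarrow> F 1" "G \<midarrow>1\<rightarrow> G 1" using niceF niceG False by auto
    have "F \<midarrow>1\<rightarrow> G 1" by (rule Lim_transform_eventually[OF lim(2)]) (use ev in eventually_elim, simp)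
    thus ?thesis using lim(1) by (metis LIM_unique)
  qed
  hence "F s = G s" for s using off[of s] by (cases "s = 1") auto
  thus "F = G" by blast
qed

end

section \<open>The choice of parameters\<close>

text \<open>The exponent \<open>m\<close> of the kernel has to satisfy \<open>m ln T = o(2\<^sup>m)\<close> and \<open>m = O(ln ln T)\<close>, and to be even.\<close>

definition mexp :: "real \<Rightarrow> nat" where "mexp T = 2 * nat \<lceil>2 * ln (ln T)\<rceil>"

lemma mexp_bounds:
  assumes "ln (ln T) \<ge> 2" and T: "T \<ge> 3"
  shows "4 * ln (ln T) \<le> real (mexp T)" "real (mexp T) \<le> 4 * ln (ln T) + 2" "even (mexp T)" "mexp T \<ge> 4"
    "(ln T)\<^sup>2 \<le> 2 ^ mexp T"
proof -
  have n: "2 * ln (ln T) \<le> real (nat \<lceil>2 * ln (ln T)\<rceil>)" "real (nat \<lceil>2 * ln (ln T)\<rceil>) \<le> 2 * ln (ln T) + 1"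
    using assms by linarith+
  show 1: "4 * ln (ln T) \<le> real (mexp T)" "real (mexp T) \<le> 4 * ln (ln T) + 2" "even (mexp T)"
    using n by (auto simp: mexp_def)
  have "4 \<le> real (mexp T)" using 1(1) assms by linarith
  thus "mexp T \<ge> 4" by linarith
  have pos: "ln T > 0" using T by simp
  have "(ln T)\<^sup>2 = exp (2 * ln (ln T))" using pos by (simp add: exp_double)
  also have "\<dots> \<le> exp (real (mexp T) * ln 2)"
  proof -
    have "2 * ln (ln T) \<le> real (mexp T) / 2" using 1 by simp
    also have "\<dots> = real (mexp T) * (1/2)" by simp
    also have "\<dots> \<le> real (mexp T) * ln 2" using ln2_ge_two_thirds by (intro mult_left_mono) auto
    finally show ?thesis by simp
  qed
  also have "\<dots> = 2 ^ mexp T" by (simp add: exp_of_nat_mult)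
  finally show "(ln T)\<^sup>2 \<le> 2 ^ mexp T" .
qed

context selberg_strip
begin

text \<open>The hypotheses of the main theorem enter only through these requirements on l. For fixed
  A everything vanishes as T grows except a term of order 1 / \<sigma> and one of order \<sigma> C0
  / A; they balance at \<sigma> = sqrt A. Any exponent below 1 in place of 1/2 would do for
  \<open>psq_sum\<close>.\<close>

lemma e_eq_0_if_parameters:
  assumes n0: "n0 \<ge> 2" and C0: "C0 \<ge> 0"
    and par: "\<And>A. A \<ge> 1 \<Longrightarrow> \<exists>l. (\<forall>\<^sub>F T in at_top. l T \<le> A * ln T \<and> l T * mexp T \<le> A * ln T * (4 * ln (ln T) + 2) \<and>
        (\<Sum>p\<in>zset T (6 * T). real_of_int \<bar>mz p\<bar>) / (l T * T) \<le> C0 / A \<and> psq_sum (l T * mexp T) \<le> T powr (1/2))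
      \<and> filterlim l at_top at_top"
  shows "e n0 = 0"
proof -
  define X where "X = norm (e n0) * real n0 powr (- (1/2))"
  define K1 where "K1 = 16 * (nonsquare_mass\<^sup>2 + square_mass) + 24 + 8 * C0 + 101"
  obtain KV TV where KV: "KV \<ge> 1" "TV \<ge> 3" and V: "\<forall>T\<ge>TV. (\<Sum>p\<in>zset T (6 * T). real_of_int \<bar>mz p\<bar>) \<le> KV * (T * ln T)"
    using zset_mass_le by (elim bexE exE conjE)
  have key: "X \<le> K1 / sqrt A" if A: "A \<ge> 1" for A
  proof -
    obtain l where lev: "\<forall>\<^sub>F T in at_top. l T \<le> A * ln T \<and> l T * mexp T \<le> A * ln T * (4 * ln (ln T) + 2) \<and>
        (\<Sum>p\<in>zset T (6 * T). real_of_int \<bar>mz p\<bar>) / (l T * T) \<le> C0 / A \<and> psq_sum (l T * mexp T) \<le> T powr (1/2)"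
      and llim: "filterlim l at_top at_top" using par[OF A] by blast
    obtain C2 T0 where C2: "C2 \<ge> 0" and T0: "T0 \<ge> 3" and avg: "\<forall>T\<ge>T0. \<forall>l m \<sigma>. 2 \<le> l \<longrightarrow> l \<le> A * ln T \<longrightarrow> 4 \<le> m \<longrightarrow> even m \<longrightarrow> \<sigma> > 0 \<longrightarrow>
     2 * ln (real n0) / l + 10 * pi * m / 2 ^ m \<le> 1/2 \<longrightarrow>
     norm (e n0) * real n0 powr (- (1/2)) \<le>
      (16 * (nonsquare_mass\<^sup>2 + square_mass) + 24 * ((1 + l * m) * psq_sum (l * m) / T)) / \<sigma>
      + 8 * \<sigma> * (\<Sum>p\<in>zset T (6 * T). real_of_int \<bar>mz p\<bar>) / (l * T)
      + 100 * ((\<Sum>p\<in>zset T (6 * T). real_of_int \<bar>mz p\<bar>) * m / (2 ^ m * T))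
      + C2 * ((l * m + 1 + sqrt (psq_sum (l * m) * (1 + l * m))) / T)"
      using averaged_inequality[OF n0 A] by (elim exE conjE)
    have ev1: "\<forall>\<^sub>F T in at_top. ln (ln T) \<ge> (2::real)" by real_asymp
    have ev2: "\<forall>\<^sub>F T in at_top. 10 * pi * (4 * ln (ln T) + 2) / (ln T)\<^sup>2 \<le> (1/4::real)" by real_asymp
    have ev3: "\<forall>\<^sub>F T in at_top. (1 + A * ln T * (4 * ln (ln T) + 2)) * T powr (1/2) / T \<le> (1::real)" by real_asymp
    \<comment> \<open>The contribution of distant zeros: their number is at most KV T ln T, and 2^m
      >= (ln T)^2 by the choice of m.\<close>
    have ev4: "\<forall>\<^sub>F T in at_top. KV * (T * ln T) * (4 * ln (ln T) + 2) / ((ln T)\<^sup>2 * T) \<le> 1 / (100 * A)"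
    proof -
      have "1 / (100 * A) > 0" using A by simp
      moreover have "((\<lambda>T. KV * (T * ln T) * (4 * ln (ln T) + 2) / ((ln T)\<^sup>2 * T)) \<longlongrightarrow> 0) at_top" by real_asymp
      ultimately have "\<forall>\<^sub>F T in at_top. KV * (T * ln T) * (4 * ln (ln T) + 2) / ((ln T)\<^sup>2 * T) < 1 / (100 * A)"
        by (simp only: order_tendsto_iff)
      thus ?thesis by eventually_elim simp
    qed
    have ev5: "\<forall>\<^sub>F T in at_top. C2 * ((A * ln T * (4 * ln (ln T) + 2) + 1 + sqrt (T powr (1/2) * (1 + A * ln T * (4 * ln (ln T) + 2)))) / T) \<le> 1 / (100 * A)"
    proof -
      have "1 / (100 * A) > 0" using A by simp
      moreover have "((\<lambda>T. C2 * ((A * ln T * (4 * ln (ln T) + 2) + 1 + sqrt (T powr (1/2) * (1 + A * ln T * (4 * ln (ln T) + 2)))) / T)) \<longlongrightarrow> 0) at_top" by (rule tendsto_mult_right_zero) (use A in real_asymp)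
      ultimately have "\<forall>\<^sub>F T in at_top. C2 * ((A * ln T * (4 * ln (ln T) + 2) + 1 + sqrt (T powr (1/2) * (1 + A * ln T * (4 * ln (ln T) + 2)))) / T) < 1 / (100 * A)"
        by (simp only: order_tendsto_iff)
      thus ?thesis by eventually_elim simp
    qed
    have ev6: "\<forall>\<^sub>F T in at_top. l T \<ge> 2 + 8 * ln (real n0)" using llim by (simp add: filterlim_at_top)
    have ev7: "\<forall>\<^sub>F T in at_top. T \<ge> max T0 TV" by (rule eventually_ge_at_top)
    obtain T where T: "l T \<le> A * ln T" "l T * mexp T \<le> A * ln T * (4 * ln (ln T) + 2)"
        "(\<Sum>p\<in>zset T (6 * T). real_of_int \<bar>mz p\<bar>) / (l T * T) \<le> C0 / A" "psq_sum (l T * mexp T) \<le> T powr (1/2)"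
        "ln (ln T) \<ge> 2" "10 * pi * (4 * ln (ln T) + 2) / (ln T)\<^sup>2 \<le> 1/4"
        "(1 + A * ln T * (4 * ln (ln T) + 2)) * T powr (1/2) / T \<le> 1"
        "KV * (T * ln T) * (4 * ln (ln T) + 2) / ((ln T)\<^sup>2 * T) \<le> 1 / (100 * A)"
        "C2 * ((A * ln T * (4 * ln (ln T) + 2) + 1 + sqrt (T powr (1/2) * (1 + A * ln T * (4 * ln (ln T) + 2)))) / T) \<le> 1 / (100 * A)"
        "l T \<ge> 2 + 8 * ln (real n0)" "T \<ge> max T0 TV"
      using eventually_happens'[OF _ eventually_conj[OF lev eventually_conj[OF ev1 eventually_conj[OF ev2 eventually_conj[OF ev3
          eventually_conj[OF ev4 eventually_conj[OF ev5 eventually_conj[OF ev6 ev7]]]]]]]] by (auto simp del: max.bounded_iff)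
    define m where "m = mexp T"
    define L where "L = l T * m"
    define Lm where "Lm = A * ln T * (4 * ln (ln T) + 2)"
    define H where "H = psq_sum L"
    define W where "W = (\<Sum>p\<in>zset T (6 * T). real_of_int \<bar>mz p\<bar>)"
    have T3: "T \<ge> 3" "T \<ge> T0" "T \<ge> TV" using T(11) T0 by auto
    note m = mexp_bounds[OF T(5) T3(1), folded m_def]
    have lnn0: "ln (real n0) \<ge> 0" using n0 by simp
    have l2: "l T \<ge> 2" using T(10) lnn0 by linarith
    have lnT: "ln T > 0" using T3 by simp
    have L0: "0 \<le> L" "L \<le> Lm" using l2 T(2) by (auto simp: L_def Lm_def m_def)
    have H0: "0 \<le> H" "H \<le> T powr (1/2)" using T(4) psq_sum_nonneg by (auto simp: H_def L_def m_def)
    have W0: "0 \<le> W" "W \<le> KV * (T * ln T)" using V T3 by (auto simp: W_def intro!: sum_nonneg)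
    have sA: "sqrt A > 0" using A by simp
    have small: "2 * ln (real n0) / l T + 10 * pi * m / 2 ^ m \<le> 1/2"
    proof -
      have "2 * ln (real n0) / l T \<le> 1/4" using T(10) l2 by (simp add: field_simps)
      moreover have "10 * pi * m / 2 ^ m \<le> 10 * pi * (4 * ln (ln T) + 2) / (ln T)\<^sup>2"
        using m lnT by (intro frac_le mult_left_mono) auto
      ultimately show ?thesis using T(6) by linarith
    qed
    have "X \<le> (16 * (nonsquare_mass\<^sup>2 + square_mass) + 24 * ((1 + L) * H / T)) / sqrt A
      + 8 * sqrt A * W / (l T * T) + 100 * (W * m / (2 ^ m * T)) + C2 * ((L + 1 + sqrt (H * (1 + L))) / T)"
      unfolding X_def L_def H_def W_def using avg[rule_format, OF T3(2) l2 T(1) m(4,3) sA small] .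
    also have "\<dots> \<le> (16 * (nonsquare_mass\<^sup>2 + square_mass) + 24) / sqrt A + 8 * C0 / sqrt A + 1 / A + 1 / A"
    proof (intro add_mono)
      have "(1 + L) * H / T \<le> (1 + Lm) * T powr (1/2) / T"
        using L0 H0 T3 by (intro divide_right_mono mult_mono) auto
      also have "\<dots> \<le> 1" using T(7) by (simp add: Lm_def)
      finally show "(16 * (nonsquare_mass\<^sup>2 + square_mass) + 24 * ((1 + L) * H / T)) / sqrt A \<le> (16 * (nonsquare_mass\<^sup>2 + square_mass) + 24) / sqrt A"
        using sA by (intro divide_right_mono) auto
      have "8 * sqrt A * W / (l T * T) = 8 * sqrt A * (W / (l T * T))" by simp
      also have "\<dots> \<le> 8 * sqrt A * (C0 / A)" using T(3) sA by (intro mult_left_mono) (auto simp: W_def)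
      also have "\<dots> = 8 * C0 * (sqrt A / A)" by simp
      also have "sqrt A / A = 1 / sqrt A" using A by (simp add: field_simps)
      finally show "8 * sqrt A * W / (l T * T) \<le> 8 * C0 / sqrt A" by simp
      have "W * m / (2 ^ m * T) \<le> KV * (T * ln T) * (4 * ln (ln T) + 2) / ((ln T)\<^sup>2 * T)"
        using W0 m lnT T3 by (intro frac_le mult_mono) auto
      also note T(8)
      finally show "100 * (W * m / (2 ^ m * T)) \<le> 1 / A" by simp
      have "C2 * ((L + 1 + sqrt (H * (1 + L))) / T) \<le> C2 * ((Lm + 1 + sqrt (T powr (1/2) * (1 + Lm))) / T)"
        using C2 L0 H0 T3 by (intro mult_left_mono divide_right_mono add_mono real_sqrt_le_mono mult_mono) auto
      also have "\<dots> \<le> 1 / (100 * A)" using T(9) by (simp add: Lm_def)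
      also have "\<dots> \<le> 1 / A" using A by (intro frac_le) auto
      finally show "C2 * ((L + 1 + sqrt (H * (1 + L))) / T) \<le> 1 / A" .
    qed
    also have "\<dots> \<le> (16 * (nonsquare_mass\<^sup>2 + square_mass) + 24) / sqrt A + 8 * C0 / sqrt A + 1 / sqrt A + 1 / sqrt A"
    proof -
      have "1 * sqrt A \<le> sqrt A * sqrt A" using A by (intro mult_right_mono) auto
      hence "sqrt A \<le> A" using A by simp
      hence "1 / A \<le> 1 / sqrt A" using sA by (intro frac_le) auto
      thus ?thesis by simp
    qed
    also have "\<dots> \<le> K1 / sqrt A"
      unfolding add_divide_distrib[symmetric] using sA by (intro divide_right_mono) (auto simp: K1_def)
    finally show ?thesis .
  qed
  have "((\<lambda>A. K1 / sqrt A) \<longlongrightarrow> 0) at_top" by real_asymp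
  moreover have "\<forall>\<^sub>F A in at_top. X \<le> K1 / sqrt A" using eventually_ge_at_top[of 1] by eventually_elim (rule key)
  ultimately have "X \<le> 0" by (rule tendsto_lowerbound) simp
  hence "norm (e n0) * real n0 powr (- (1/2)) \<le> 0 * real n0 powr (- (1/2))" by (simp add: X_def)
  hence "norm (e n0) \<le> 0" using n0 by (subst (asm) mult_le_cancel_right) auto
  thus ?thesis by simp
qed

section \<open>The prime squares under the two hypotheses\<close>

lemma psq_sum_bound_short:
  assumes A: "A \<ge> 1"
  shows "\<forall>\<^sub>F T in at_top. psq_sum (A * ln T) \<le> T powr (1/2)"
proof -
  \<comment> \<open>Here p^2 stays below T^A, so p^\<epsilon> <= T^(1/8) and the square of e (p^2)
    is O(T^(1/4)); the sum of 1 / p costs only a logarithm.\<close>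
  define \<epsilon> where "\<epsilon> = 1 / (4 * A)"
  have \<epsilon>: "\<epsilon> > 0" using A by (simp add: \<epsilon>_def)
  obtain C where C: "C \<ge> 0" "\<And>p. prime p \<Longrightarrow> norm (e (p\<^sup>2)) \<le> C * real p powr \<epsilon>"
    using e_square_bound[OF \<epsilon>] by blast
  have ev: "\<forall>\<^sub>F T in at_top. C\<^sup>2 * T powr (1/4) * (1 + A * ln T) \<le> T powr (1/2)" by real_asymp
  show ?thesis using ev eventually_ge_at_top[of 1]
  proof eventually_elim
    case (elim T)
    define L where "L = A * ln T"
    have L: "L \<ge> 0" using A elim by (simp add: L_def)
    note I = psq_index[OF L]
    have "psq_sum L \<le> (\<Sum>p | prime p \<and> 2 * ln (real p) < L. C\<^sup>2 * T powr (1/4) * (1 / real p))"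
      unfolding psq_sum_def
    proof (rule sum_mono)
      fix p assume "p \<in> {p. prime p \<and> 2 * ln (real p) < L}"
      hence p: "prime p" "2 * ln (real p) < L" "real p > 0" by (auto simp: prime_gt_0_nat)
      have "real p powr \<epsilon> = exp (\<epsilon> * ln (real p))" using p by (simp add: powr_def)
      also have "\<dots> \<le> exp (\<epsilon> * (L / 2))" using p \<epsilon> by auto
      also have "\<epsilon> * (L / 2) = (1/8) * ln T" using A by (simp add: \<epsilon>_def L_def)
      finally have "norm (e (p\<^sup>2)) \<le> C * exp ((1/8) * ln T)" using C(2)[OF p(1)] C(1) mult_left_mono by fastforce
      hence "(norm (e (p\<^sup>2)))\<^sup>2 \<le> (C * exp ((1/8) * ln T))\<^sup>2" by (intro power_mono) auto
      also have "\<dots> = C\<^sup>2 * exp ((1/4) * ln T)" by (simp add: power_mult_distrib exp_double[symmetric])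
      also have "exp ((1/4) * ln T) = T powr (1/4)" using elim by (simp add: powr_def)
      finally show "(norm (e (p\<^sup>2)))\<^sup>2 / real p \<le> C\<^sup>2 * T powr (1/4) * (1 / real p)"
        using p by (simp add: divide_right_mono)
    qed
    also have "\<dots> = C\<^sup>2 * T powr (1/4) * (\<Sum>p | prime p \<and> 2 * ln (real p) < L. 1 / real p)" by (simp only: sum_distrib_left)
    also have "\<dots> \<le> C\<^sup>2 * T powr (1/4) * (1 + L)"
    proof (rule mult_left_mono)
      have "(\<Sum>p | prime p \<and> 2 * ln (real p) < L. 1 / real p) \<le> (\<Sum>p\<in>{1..nat \<lfloor>exp (L / 2)\<rfloor>}. 1 / real p)"
        using I by (intro sum_mono2) auto
      also have "\<dots> \<le> 1 + L" using sum_inverse_le_ln[OF I(2)] I(3) by linarith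
      finally show "(\<Sum>p | prime p \<and> 2 * ln (real p) < L. 1 / real p) \<le> 1 + L" .
    qed simp
    also have "\<dots> \<le> T powr (1/2)" using elim by (simp add: L_def)
    finally show ?case by (simp add: L_def)
  qed
qed

text \<open>Outside the thin set, |e(p^2)|^2 is 4 (ln p)^2 times the square in the hypothesis; one
  logarithm is kept and the other is bounded by L / 2. On the thin set the general bound p^(1/4) for
  e (p^2) already gives a convergent sum, since p^(-1/2) <= p^(-\<beta>).\<close>

lemma psq_sum_split:
  "\<exists>K\<ge>0. \<forall>L\<ge>0. psq_sum L \<le> 2 * L * (\<Sum>p | prime p \<and> real p \<le> exp (L / 2). (norm (aF (p\<^sup>2) - aG (p\<^sup>2)))\<^sup>2 / real p * ln (real p)) + K"
proof -
  obtain \<beta> where \<beta>: "\<beta> < 1/2" "(\<lambda>p. real p powr (- \<beta>)) summable_on E" using summable_E by blast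
  obtain C where C: "C \<ge> 0" "\<And>p. prime p \<Longrightarrow> norm (e (p\<^sup>2)) \<le> C * real p powr (1/4)"
    using e_square_bound[of "1/4"] by auto
  define K where "K = C\<^sup>2 * (\<Sum>\<^sub>\<infinity>p\<in>E. real p powr (- \<beta>))"
  have "psq_sum L \<le> 2 * L * (\<Sum>p | prime p \<and> real p \<le> exp (L / 2). (norm (aF (p\<^sup>2) - aG (p\<^sup>2)))\<^sup>2 / real p * ln (real p)) + K" if L: "L \<ge> 0" for L
  proof -
    let ?I = "{p. prime p \<and> 2 * ln (real p) < L}"
    let ?J = "{p. prime p \<and> real p \<le> exp (L / 2)}"
    have finI: "finite ?I" by (rule psq_index(4)[OF L])
    have finJ: "finite ?J"
      by (rule finite_subset[of _ "{..nat \<lfloor>exp (L / 2)\<rfloor>}"]) (auto simp: le_nat_floor)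
    have "psq_sum L = (\<Sum>p\<in>?I - E. (norm (e (p\<^sup>2)))\<^sup>2 / real p) + (\<Sum>p\<in>?I \<inter> E. (norm (e (p\<^sup>2)))\<^sup>2 / real p)"
      unfolding psq_sum_def by (subst sum.union_disjoint[symmetric]) (auto simp: finI intro!: sum.cong)
    moreover have "(\<Sum>p\<in>?I - E. (norm (e (p\<^sup>2)))\<^sup>2 / real p) \<le> 2 * L * (\<Sum>p\<in>?J. (norm (aF (p\<^sup>2) - aG (p\<^sup>2)))\<^sup>2 / real p * ln (real p))"
    proof -
      have "(\<Sum>p\<in>?I - E. (norm (e (p\<^sup>2)))\<^sup>2 / real p) \<le> (\<Sum>p\<in>?I - E. 2 * L * ((norm (aF (p\<^sup>2) - aG (p\<^sup>2)))\<^sup>2 / real p * ln (real p)))"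
      proof (rule sum_mono)
        fix p assume "p \<in> ?I - E"
        hence p: "prime p" "p \<notin> E" "2 * ln (real p) \<le> L" by auto
        have lnp: "ln (real p) \<ge> 0" using prime_ge_1_nat[OF p(1)] by simp
        define q where "q = (norm (aF (p\<^sup>2) - aG (p\<^sup>2)))\<^sup>2 / real p"
        have "norm (e (p\<^sup>2)) = 2 * norm (aF (p\<^sup>2) - aG (p\<^sup>2)) * ln (real p)"
          unfolding e_prime_square[OF p(1,2)] norm_mult using lnp by simp
        hence "(norm (e (p\<^sup>2)))\<^sup>2 / real p = 4 * (ln (real p) * ln (real p)) * q"
          unfolding q_def by (simp add: power2_eq_square)
        also have "\<dots> \<le> 4 * (ln (real p) * (L / 2)) * q"
          using p lnp by (intro mult_right_mono mult_left_mono) (auto simp: q_def)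
        also have "\<dots> = 2 * L * (q * ln (real p))" by simp
        finally show "(norm (e (p\<^sup>2)))\<^sup>2 / real p \<le> 2 * L * ((norm (aF (p\<^sup>2) - aG (p\<^sup>2)))\<^sup>2 / real p * ln (real p))" by (simp add: q_def)
      qed
      also have "\<dots> = 2 * L * (\<Sum>p\<in>?I - E. (norm (aF (p\<^sup>2) - aG (p\<^sup>2)))\<^sup>2 / real p * ln (real p))" by (simp only: sum_distrib_left)
      also have "\<dots> \<le> 2 * L * (\<Sum>p\<in>?J. (norm (aF (p\<^sup>2) - aG (p\<^sup>2)))\<^sup>2 / real p * ln (real p))"
      proof (intro mult_left_mono sum_mono2 finJ)
        show "?I - E \<subseteq> ?J"
        proof
          fix p assume "p \<in> ?I - E"
          hence p: "prime p" "ln (real p) < L / 2" "real p > 0" by (auto simp: prime_gt_0_nat)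
          hence "real p < exp (L / 2)" by (metis exp_less_cancel_iff exp_ln)
          thus "p \<in> ?J" using p by simp
        qed
        show "0 \<le> (norm (aF (p\<^sup>2) - aG (p\<^sup>2)))\<^sup>2 / real p * ln (real p)" if "p \<in> ?J - (?I - E)" for p
          using that prime_ge_1_nat[of p] by (intro mult_nonneg_nonneg) auto
      qed (use L in auto)
      finally show ?thesis .
    qed
    moreover have "(\<Sum>p\<in>?I \<inter> E. (norm (e (p\<^sup>2)))\<^sup>2 / real p) \<le> K"
    proof -
      have "(\<Sum>p\<in>?I \<inter> E. (norm (e (p\<^sup>2)))\<^sup>2 / real p) \<le> (\<Sum>p\<in>?I \<inter> E. C\<^sup>2 * real p powr (- \<beta>))"
      proof (rule sum_mono)
        fix p assume "p \<in> ?I \<inter> E"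
        hence p: "prime p" "real p \<ge> 1" using prime_ge_1_nat by auto
        have "(norm (e (p\<^sup>2)))\<^sup>2 \<le> (C * real p powr (1/4))\<^sup>2" by (intro power_mono C p) auto
        also have "\<dots> = C\<^sup>2 * (real p powr (1/4) * real p powr (1/4))" by (simp add: power_mult_distrib power2_eq_square)
        also have "real p powr (1/4) * real p powr (1/4) = real p powr (1/2)" by (simp add: powr_add[symmetric])
        finally have "(norm (e (p\<^sup>2)))\<^sup>2 / real p \<le> C\<^sup>2 * real p powr (1/2) / real p" by (intro divide_right_mono) auto
        also have "\<dots> = C\<^sup>2 * (real p powr (1/2) / real p powr 1)" using p by simp
        also have "\<dots> = C\<^sup>2 * real p powr (1/2 - 1)" by (simp only: powr_diff)
        also have "\<dots> \<le> C\<^sup>2 * real p powr (- \<beta>)" using p \<beta> by (intro mult_left_mono powr_mono) auto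
        finally show "(norm (e (p\<^sup>2)))\<^sup>2 / real p \<le> C\<^sup>2 * real p powr (- \<beta>)" .
      qed
      also have "\<dots> = C\<^sup>2 * (\<Sum>p\<in>?I \<inter> E. real p powr (- \<beta>))" by (simp only: sum_distrib_left)
      also have "\<dots> \<le> K" unfolding K_def
        using finI by (intro mult_left_mono finite_sum_le_infsum \<beta>) auto
      finally show ?thesis .
    qed
    ultimately show ?thesis by linarith
  qed
  moreover have "K \<ge> 0" unfolding K_def by (intro mult_nonneg_nonneg infsum_nonneg) auto
  ultimately show ?thesis by blast
qed

text \<open>The argument of the hypothesis is L / 2 with L of order ln T ln ln T, and its logarithm
  is at least ln ln T. The quotient is O(A ln T), so a small multiple of it exponentiates to a small
  power of T.\<close>

lemma psq_sum_bound_long: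
  assumes A: "A \<ge> 1"
    and ii: "\<And>\<epsilon>. \<epsilon> > 0 \<Longrightarrow> (\<lambda>x::real. \<Sum>p | prime p \<and> real p \<le> exp x.
                        (norm (aF (p\<^sup>2) - aG (p\<^sup>2)))\<^sup>2 / real p * ln (real p)) \<in> O(\<lambda>x. exp (\<epsilon> * x / ln x))"
  shows "\<forall>\<^sub>F T in at_top. psq_sum (A * ln T * mexp T) \<le> T powr (1/2)"
proof -
  define D where "D = (\<lambda>x::real. \<Sum>p | prime p \<and> real p \<le> exp x. (norm (aF (p\<^sup>2) - aG (p\<^sup>2)))\<^sup>2 / real p * ln (real p))"
  obtain K where K: "K \<ge> 0" "\<And>L. L \<ge> 0 \<Longrightarrow> psq_sum L \<le> 2 * L * D (L / 2) + K"
    using psq_sum_split unfolding D_def by blast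
  \<comment> \<open>With y = ln ln T >= 2 the exponent is at most (ln T / 12) (2 y + 1) / y <= ln T
    / 4.\<close>
  define \<epsilon> where "\<epsilon> = 1 / (12 * A)"
  have \<epsilon>: "\<epsilon> > 0" using A by (simp add: \<epsilon>_def)
  obtain c where c: "c > 0" "\<forall>\<^sub>F x in at_top. norm (D x) \<le> c * norm (exp (\<epsilon> * x / ln x))"
    using landau_o.bigE[OF ii[OF \<epsilon>, folded D_def]] by blast
  obtain x0 where "\<forall>x\<ge>x0. norm (D x) \<le> c * norm (exp (\<epsilon> * x / ln x))"
    using c(2) unfolding eventually_at_top_linorder by blast
  hence x0: "D x \<le> c * exp (\<epsilon> * x / ln x)" if "x \<ge> x0" for x
    using that by (auto simp: abs_le_iff)
  have ev0: "\<forall>\<^sub>F T in at_top. ln (ln T) \<ge> (2::real)" by real_asymp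
  have ev1: "\<forall>\<^sub>F T in at_top. ln T \<ge> max x0 1" by real_asymp
  have ev2: "\<forall>\<^sub>F T in at_top. 2 * (A * ln T * (4 * ln (ln T) + 2)) * (c * T powr (1/4)) + K \<le> T powr (1/2)" by real_asymp
  show ?thesis using ev0 ev1 ev2 eventually_ge_at_top[of 3]
  proof eventually_elim
    case (elim T)
    have T3: "T \<ge> 3" using elim by auto
      note m = mexp_bounds[OF elim(1) T3]
    define y where "y = ln (ln T)"
    define L where "L = A * ln T * mexp T"
    have lnT: "ln T \<ge> x0" "ln T \<ge> 1" using elim by auto
    have AT: "A * ln T \<ge> ln T" using A lnT mult_right_mono[of 1 A "ln T"] by simp
    have L2: "L / 2 \<ge> ln T"
    proof -
      have "ln T * 1 \<le> (A * ln T) * (real (mexp T) / 2)" using AT lnT m(4) by (intro mult_mono) auto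
      thus ?thesis by (simp add: L_def)
    qed
    have Lu: "L \<le> A * ln T * (4 * y + 2)" unfolding L_def y_def using m(2) A lnT by (intro mult_left_mono) auto
    have L0: "L \<ge> 0" using L2 lnT by linarith
    have yl: "y \<le> ln (L / 2)" unfolding y_def using L2 lnT by (intro ln_mono) auto
    have y2: "y \<ge> 2" using elim by (simp add: y_def)
    have "\<epsilon> * (L / 2) / ln (L / 2) \<le> \<epsilon> * (A * ln T * (4 * y + 2) / 2) / y"
      using yl y2 \<epsilon> Lu L0 A lnT by (intro frac_le mult_left_mono mult_nonneg_nonneg) auto
    also have "\<dots> = ln T / 12 * ((2 * y + 1) / y)" using A y2 by (simp add: \<epsilon>_def field_simps)
    also have "\<dots> \<le> ln T / 12 * 3" using y2 lnT by (intro mult_left_mono) (auto simp: field_simps)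
    finally have ex: "exp (\<epsilon> * (L / 2) / ln (L / 2)) \<le> exp (1/4 * ln T)" by simp
    have "D (L / 2) \<le> c * exp (\<epsilon> * (L / 2) / ln (L / 2))" using L2 lnT by (intro x0) linarith
    also have "\<dots> \<le> c * T powr (1/4)" using ex c elim by (intro mult_left_mono) (auto simp: powr_def)
    finally have D: "D (L / 2) \<le> c * T powr (1/4)" .
    have "psq_sum L \<le> 2 * L * D (L / 2) + K" by (rule K(2)[OF L0])
    also have "2 * L * D (L / 2) \<le> 2 * L * (c * T powr (1/4))" using D L0 by (intro mult_left_mono) auto
    also have "\<dots> \<le> 2 * (A * ln T * (4 * y + 2)) * (c * T powr (1/4))" using Lu c by (intro mult_right_mono) auto
    finally show ?case using elim(3) by (simp add: L_def y_def)
  qed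
qed

text \<open>With l m = A ln T the short bound for \<open>psq_sum\<close> suffices. The constant 60
  is 6 * 2 * 5: the window reaches 6 T, ln (6 T) <= 2 ln T, and m <= 5 ln ln T.\<close>

theorem e_vanishes_if_close_zeros:
  assumes n0: "n0 \<ge> 2" and i: "(\<lambda>T::real. real (size (mset_symdiff (critical_zeros F T) (critical_zeros G T))))
           \<in> O(\<lambda>T. T * (ln T / ln (ln T)))"
  shows "e n0 = 0"
proof -
  obtain c where c: "c > 0" "\<forall>\<^sub>F T in at_top. norm (real (size (mset_symdiff (critical_zeros F T) (critical_zeros G T)))) \<le> c * norm (T * (ln T / ln (ln T)))"
    using landau_o.bigE[OF i] by blast
  then obtain x0 where x0: "\<And>T. T \<ge> x0 \<Longrightarrow> real (size (mset_symdiff (critical_zeros F T) (critical_zeros G T))) \<le> c * norm (T * (ln T / ln (ln T)))"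
    by (auto simp: eventually_at_top_linorder)
  show ?thesis
  proof (rule e_eq_0_if_parameters[OF n0, of "60 * c"])
    fix A :: real assume A: "A \<ge> 1"
    define l where "l = (\<lambda>T. A * ln T / mexp T)"
    have ev0: "\<forall>\<^sub>F T in at_top. ln (ln T) \<ge> (2::real)" by real_asymp
    have ev1: "\<forall>\<^sub>F T in at_top. T \<ge> max (max x0 Y) (6::real)" by real_asymp
    have ev2: "\<forall>\<^sub>F T in at_top. ln (6 * T) \<le> 2 * ln (T::real)" by real_asymp
    have main: "\<forall>\<^sub>F T in at_top. l T \<le> A * ln T \<and> l T * mexp T \<le> A * ln T * (4 * ln (ln T) + 2) \<and>
        (\<Sum>p\<in>zset T (6 * T). real_of_int \<bar>mz p\<bar>) / (l T * T) \<le> 60 * c / A \<and> psq_sum (l T * mexp T) \<le> T powr (1/2)"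
      using ev0 ev1 ev2 psq_sum_bound_short[OF A]
    proof eventually_elim
      case (elim T)
      have T3: "T \<ge> 3" using elim by auto
      note m = mexp_bounds[OF elim(1) T3]
      have T: "T \<ge> x0" "T \<ge> Y" "T \<ge> 6" using elim by auto
      have lnT: "ln T > 0" using T by simp
      have lm: "l T * mexp T = A * ln T" using m by (simp add: l_def)
      have l1: "l T \<le> A * ln T"
        unfolding l_def using A lnT m(4) divide_left_mono[of 1 "real (mexp T)" "A * ln T"] by simp
      have l2: "l T * mexp T \<le> A * ln T * (4 * ln (ln T) + 2)"
        unfolding lm using A lnT elim(1) mult_left_mono[of 1 "4 * ln (ln T) + 2" "A * ln T"] by simp
      have "0 < ln (ln T)" using elim(1) by linarith
      hence lnT1: "1 < ln T" using lnT by simp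
      have mm: "real (mexp T) \<le> 5 * ln (ln T)" using m(2) elim(1) by linarith
      define W where "W = (\<Sum>p\<in>zset T (6 * T). real_of_int \<bar>mz p\<bar>)"
      have "W \<le> real (size (mset_symdiff (critical_zeros F (6 * T)) (critical_zeros G (6 * T))))"
        unfolding W_def by (rule zset_mass_le_symdiff[OF T(2)])
      also have "\<dots> \<le> c * norm (6 * T * (ln (6 * T) / ln (ln (6 * T))))" using T by (intro x0) auto
      also have "norm (6 * T * (ln (6 * T) / ln (ln (6 * T)))) = 6 * T * (ln (6 * T) / ln (ln (6 * T)))"
      proof -
        have "ln T \<le> ln (6 * T)" using T by simp
        moreover have "ln (ln T) \<le> ln (ln (6 * T))" using T lnT by simp
        ultimately have "0 \<le> 6 * T * (ln (6 * T) / ln (ln (6 * T)))"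
          using T lnT elim(1) by (intro mult_nonneg_nonneg divide_nonneg_nonneg) linarith+
        thus ?thesis by (simp only: real_norm_def abs_of_nonneg)
      qed
      also have "\<dots> \<le> 6 * T * (2 * ln T / ln (ln T))"
        using T lnT lnT1 elim by (intro mult_left_mono frac_le) auto
      finally have W: "W \<le> c * (6 * T * (2 * ln T / ln (ln T)))" using c by simp
      have "W / (l T * T) \<le> c * (6 * T * (2 * ln T / ln (ln T))) / (l T * T)"
        using A lnT T m by (intro divide_right_mono W) (simp add: l_def)
      also have "\<dots> = 12 * c / A * (real (mexp T) / ln (ln T))"
        using A lnT T m elim(1) by (simp add: l_def field_simps)
      also have "\<dots> \<le> 12 * c / A * 5"
        using c A mm elim(1) by (intro mult_left_mono) (auto simp: divide_le_eq)
      finally have "W / (l T * T) \<le> 60 * c / A" by simp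
      thus ?case using l1 l2 elim(4) unfolding lm W_def by blast
    qed
    have lim: "filterlim l at_top at_top"
    proof (rule filterlim_at_top_mono)
      show "filterlim (\<lambda>T. A * ln T / (4 * ln (ln T) + 2)) at_top at_top" using A by real_asymp
      show "\<forall>\<^sub>F T in at_top. A * ln T / (4 * ln (ln T) + 2) \<le> l T"
        using ev0 ev1
      proof eventually_elim
        case (elim T)
        have T3: "T \<ge> 3" using elim by auto
      note m = mexp_bounds[OF elim(1) T3]
        show ?case unfolding l_def using m A elim by (intro divide_left_mono mult_pos_pos) auto
      qed
    qed
    show "\<exists>l. (\<forall>\<^sub>F T in at_top. l T \<le> A * ln T \<and> l T * mexp T \<le> A * ln T * (4 * ln (ln T) + 2) \<and>
        (\<Sum>p\<in>zset T (6 * T). real_of_int \<bar>mz p\<bar>) / (l T * T) \<le> 60 * c / A \<and> psq_sum (l T * mexp T) \<le> T powr (1/2))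
      \<and> filterlim l at_top at_top"
      using main lim by blast
  qed (use c in simp)
qed

text \<open>With l = A ln T the trivial count of O(T ln T) zeros gives V / (l T) = O(1 / A); the
  price is a longer polynomial, paid for by the hypothesis on squares.\<close>

theorem e_vanishes_if_close_squares:
  assumes n0: "n0 \<ge> 2" and ii: "\<And>\<epsilon>. \<epsilon> > 0 \<Longrightarrow> (\<lambda>x::real. \<Sum>p | prime p \<and> real p \<le> exp x.
                        (norm (aF (p\<^sup>2) - aG (p\<^sup>2)))\<^sup>2 / real p * ln (real p)) \<in> O(\<lambda>x. exp (\<epsilon> * x / ln x))"
  shows "e n0 = 0"
proof -
  obtain KV TV where KV: "KV \<ge> 1" "TV \<ge> 3" and V: "\<forall>T\<ge>TV. (\<Sum>p\<in>zset T (6 * T). real_of_int \<bar>mz p\<bar>) \<le> KV * (T * ln T)"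
    using zset_mass_le by (elim bexE exE conjE)
  show ?thesis
  proof (rule e_eq_0_if_parameters[OF n0, of KV])
    fix A :: real assume A: "A \<ge> 1"
    have ev0: "\<forall>\<^sub>F T in at_top. ln (ln T) \<ge> (2::real)" by real_asymp
    have ps: "\<forall>\<^sub>F T in at_top. psq_sum (A * ln T * mexp T) \<le> T powr (1/2)" by (rule psq_sum_bound_long[OF A]) (rule ii)
    have main: "\<forall>\<^sub>F T in at_top. A * ln T \<le> A * ln T \<and> A * ln T * mexp T \<le> A * ln T * (4 * ln (ln T) + 2) \<and>
        (\<Sum>p\<in>zset T (6 * T). real_of_int \<bar>mz p\<bar>) / (A * ln T * T) \<le> KV / A \<and> psq_sum (A * ln T * mexp T) \<le> T powr (1/2)"
      using ev0 eventually_ge_at_top[of TV] ps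
    proof eventually_elim
      case (elim T)
      have T: "T \<ge> 3" "ln T > 0" using elim KV by auto
      note m = mexp_bounds[OF elim(1) T(1)]
      have "(\<Sum>p\<in>zset T (6 * T). real_of_int \<bar>mz p\<bar>) / (A * ln T * T) \<le> KV * (T * ln T) / (A * ln T * T)"
        using V elim A T by (intro divide_right_mono) auto
      also have "\<dots> = KV / A" using T A by simp
      finally show ?case using elim(3) m(2) A T by (auto intro: mult_left_mono)
    qed
    have "filterlim (\<lambda>T. A * ln T) at_top at_top" using A by real_asymp
    note lim = this
    show "\<exists>l. (\<forall>\<^sub>F T in at_top. l T \<le> A * ln T \<and> l T * mexp T \<le> A * ln T * (4 * ln (ln T) + 2) \<and>
        (\<Sum>p\<in>zset T (6 * T). real_of_int \<bar>mz p\<bar>) / (l T * T) \<le> KV / A \<and> psq_sum (l T * mexp T) \<le> T powr (1/2))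
      \<and> filterlim l at_top at_top"
      by (rule exI[of _ "\<lambda>T. A * ln T"], rule conjI[OF main lim])
  qed (use KV in simp)
qed

end

theorem theorem1p1:
  fixes F G :: "complex \<Rightarrow> complex" and aF aG :: "nat \<Rightarrow> complex"
    and E :: "nat set" and \<delta> :: real
  assumes "F \<in> selberg_class" and "G \<in> selberg_class"
    and "selberg_dirichlet F aF" and "selberg_dirichlet G aG"
    and "\<And>p. p \<in> E \<Longrightarrow> prime p"
    and "\<delta> > 0"
    and "(\<lambda>x::real. real (card {p \<in> E. real p \<le> x})) \<in> O(\<lambda>x. x powr (1/2 - \<delta>))"
    and "\<And>p. prime p \<Longrightarrow> p \<notin> E \<Longrightarrow> aF p = aG p"
    and "(\<lambda>T::real. real (size (mset_symdiff (critical_zeros F T) (critical_zeros G T))))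
           \<in> O(\<lambda>T. T * (ln T / ln (ln T)))
         \<or> (\<forall>\<epsilon>>0. (\<lambda>x::real. \<Sum>p | prime p \<and> real p \<le> exp x.
                        (norm (aF (p\<^sup>2) - aG (p\<^sup>2)))\<^sup>2 / real p * ln (real p))
                    \<in> O(\<lambda>x. exp (\<epsilon> * x / ln x)))"
  shows "F = G"
proof -
  obtain QF NF lamF \<mu>F wF bF where F: "selberg_continuation F" "selberg_functional_eq F QF NF lamF \<mu>F wF" "selberg_log_series F bF"
    using assms(1) by (auto simp: selberg_class_def)
  obtain QG NG lamG \<mu>G wG bG where G: "selberg_continuation G" "selberg_functional_eq G QG NG lamG \<mu>G wG" "selberg_log_series G bG"
    using assms(2) by (auto simp: selberg_class_def)
  interpret P: selberg_pair F aF bF QF NF lamF \<mu>F wF G aG bG QG NG lamG \<mu>G wG E \<delta>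
  proof
    show "aF p = aG p" if "prime p" "p \<notin> E" for p using that by (rule assms(8))
  qed (rule assms F G | assumption)+
  obtain C1 Y1 where 1: "P.A.gamma_region C1 Y1" using P.A.gamma_region_exists by blast
  obtain C2 Y2 where 2: "P.B.gamma_region C2 Y2" using P.B.gamma_region_exists by blast
  \<comment> \<open>The constants of the two functions are enlarged to a common pair, as the
    reflection argument treats F and G at the same points.\<close>
  interpret selberg_strip F aF bF QF NF lamF \<mu>F wF G aG bG QG NG lamG \<mu>G wG E \<delta> "max C1 C2" "max Y1 Y2"
    by unfold_locales (rule P.A.gamma_region_mono[OF 1] P.B.gamma_region_mono[OF 2]; simp)+
  show "F = G"
  proof (rule P.eq_if_e_vanishes)
    fix n :: nat assume n: "n \<ge> 2"
    from assms(9) show "P.e n = 0"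
    proof
      assume "(\<lambda>T::real. real (size (mset_symdiff (critical_zeros F T) (critical_zeros G T))))
           \<in> O(\<lambda>T. T * (ln T / ln (ln T)))"
      thus ?thesis by (rule e_vanishes_if_close_zeros[OF n])
    next
      assume "\<forall>\<epsilon>>0. (\<lambda>x::real. \<Sum>p | prime p \<and> real p \<le> exp x.
                        (norm (aF (p\<^sup>2) - aG (p\<^sup>2)))\<^sup>2 / real p * ln (real p))
                    \<in> O(\<lambda>x. exp (\<epsilon> * x / ln x))"
      thus ?thesis by (intro e_vanishes_if_close_squares[OF n]) blast
    qed
  qed
qed

end
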